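(* Let $(C,\Delta_C)$ and $(A,\Delta_A)$ be quantum groups and let $\mathrm W\in\mathcal U\mathcal M(\hat C\otimes C)$ be the reduced bicharacter of $C$. For any right quantum group homomorphism $\Delta_R\colon C\to C\otimes A$, there is a unique unitary $V\in\mathcal U\mathcal M(\hat C\otimes A)$ with $$(\mathrm{id}_{\hat C}\otimes\Delta_R)(\mathrm W)=\mathrm W_{12}V_{13}.$$ This unitary is a bicharacter. Conversely, let $V$ be a bicharacter from $C$ to $A$, and let $\mathbb V\in\mathcal U(\mathcal H_C\otimes\mathcal H_A)$ be the corresponding concrete bicharacter. Then $$\Delta_R(x):=\mathbb V(x\otimes1)\mathbb V^*\qquad\text{for all }x\in C$$ defines a right quantum group homomorphism from $C$ to $A$. These two maps between bicharacters and right quantum group homomorphisms are inverse to each other.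
   Context: Tensor products of $C^*$-algebras are spatial; $\mathcal M(A)$ is the multiplier algebra, $\mathcal U\mathcal M(A)$ its unitary group; leg numbering notation is used. A morphism $A\to B$ of $C^*$-algebras is a nondegenerate $*$-homomorphism $A\to\mathcal M(B)$ (extended to multipliers). A unitary $\mathbb W$ on $\mathcal H\otimes\mathcal H$ is multiplicative if $\mathbb W_{23}\mathbb W_{12}=\mathbb W_{12}\mathbb W_{13}\mathbb W_{23}$. It is modular if there are positive self-adjoint operators $\hat Q,Q$ on $\mathcal H$ with trivial kernels and a unitary $\widetilde{\mathbb W}$ on $\overline{\mathcal H}\otimes\mathcal H$ ($\overline{\mathcal H}$ the complex-conjugate Hilbert space) such that $\mathbb W^*(\hat Q\otimes Q)\mathbb W=\hat Q\otimes Q$ and $(x\otimes y\mid\mathbb W\mid z\otimes u)=(\overline z\otimes Qy\mid\widetilde{\mathbb W}\mid\overline x\otimes Q^{-1}u)$ for all $x,z\in\mathcal H$, $y\in\mathrm{dom}(Q)$, $u\in\mathrm{dom}(Q^{-1})$, where $(x\mid T\mid y):=(x\mid Ty)$. A quantum group is a pair $(C,\Delta_C)$ obtained from some modular multiplicative unitary $\mathbb W^C$ on $\mathcal H_C\otimes\mathcal H_C$: $C\subseteq\mathbb B(\mathcal H_C)$ is the norm closure of $\{(\omega\otimes\mathrm{id})(\mathbb W^C):\omega\in\mathbb B(\mathcal H_C)_*\}$ and $\Delta_C(x)=\mathbb W^C(x\otimes1)(\mathbb W^C)^*$; its dual is $(\hat C,\Delta_{\hat C})$, where $\hat C\subseteq\mathbb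 B(\mathcal H_C)$ is the norm closure of $\{(\mathrm{id}\otimes\omega)((\mathbb W^C)^* )\}$ and $\Delta_{\hat C}(y)=\Sigma(\mathbb W^C)^*(1\otimes y)\mathbb W^C\Sigma$ with $\Sigma$ the flip. It is known that $\mathbb W^C$ is the image of a unitary $\mathrm W\in\mathcal U\mathcal M(\hat C\otimes C)$, the reduced bicharacter. Similarly for $A$ on $\mathcal H_A$. A bicharacter from $C$ to $A$ is a unitary $V\in\mathcal U\mathcal M(\hat C\otimes A)$ with $(\Delta_{\hat C}\otimes\mathrm{id}_A)V=V_{23}V_{13}$ and $(\mathrm{id}_{\hat C}\otimes\Delta_A)V=V_{12}V_{13}$; the corresponding concrete bicharacter $\mathbb V$ is its image in $\mathcal U(\mathcal H_C\otimes\mathcal H_A)$. A right quantum group homomorphism from $C$ to $A$ is a morphism $\Delta_R\colon C\to C\otimes A$ with $(\Delta_C\otimes\mathrm{id}_A)\circ\Delta_R=(\mathrm{id}_C\otimes\Delta_R)\circ\Delta_C$ and $(\mathrm{id}_C\otimes\Delta_A)\circ\Delta_R=(\Delta_R\otimes\mathrm{id}_A)\circ\Delta_R$. *)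

theory Defs
  imports "HOL-Analysis.Analysis"
begin

section \<open>Complex Hilbert spaces\<close>

class complex_vector = real_vector +
  fixes scaleC :: "complex \<Rightarrow> 'a \<Rightarrow> 'a" (infixr "*\<^sub>C" 75)
  assumes scaleC_add_right: "c *\<^sub>C (x + y) = c *\<^sub>C x + c *\<^sub>C y"
    and scaleC_add_left: "(c + d) *\<^sub>C x = c *\<^sub>C x + d *\<^sub>C x"
    and scaleC_scaleC: "c *\<^sub>C d *\<^sub>C x = (c * d) *\<^sub>C x"
    and scaleR_scaleC: "r *\<^sub>R x = of_real r *\<^sub>C x"

lemma scaleC_one [simp]: "1 *\<^sub>C x = (x :: 'a::complex_vector)"
  using scaleR_scaleC[of 1 x] by simp

global_interpretation complex_vector: vector_space "scaleC :: complex \<Rightarrow> 'a \<Rightarrow> 'a::complex_vector"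
  defines csubspace = complex_vector.subspace
    and cspan = complex_vector.span
  by unfold_locales (simp_all add: scaleC_add_right scaleC_add_left scaleC_scaleC)

text \<open>The inner product is linear in the second variable.\<close>

class complex_hilbert = complex_vector + real_inner + complete_space +
  fixes cinner :: "'a \<Rightarrow> 'a \<Rightarrow> complex" (infix "\<bullet>\<^sub>C" 70)
  assumes cinner_commute: "x \<bullet>\<^sub>C y = cnj (y \<bullet>\<^sub>C x)"
    and cinner_add_right: "x \<bullet>\<^sub>C (y + z) = x \<bullet>\<^sub>C y + x \<bullet>\<^sub>C z"
    and cinner_scaleC_right [simp]: "x \<bullet>\<^sub>C (c *\<^sub>C y) = c * (x \<bullet>\<^sub>C y)"
    and inner_cinner: "inner x y = Re (x \<bullet>\<^sub>C y)"
begin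

subclass banach ..

end

lemma cinner_add_left: "(x + y) \<bullet>\<^sub>C z = x \<bullet>\<^sub>C z + y \<bullet>\<^sub>C (z::'a::complex_hilbert)"
  by (metis cinner_add_right cinner_commute complex_cnj_add)

lemma cinner_scaleC_left [simp]: "(c *\<^sub>C x) \<bullet>\<^sub>C y = cnj c * (x \<bullet>\<^sub>C (y::'a::complex_hilbert))"
  by (metis cinner_commute cinner_scaleC_right complex_cnj_mult)

lemma cinner_self: "x \<bullet>\<^sub>C x = of_real ((norm (x::'a::complex_hilbert))\<^sup>2)"
proof (rule complex_eqI)
  show "Re (x \<bullet>\<^sub>C x) = Re (of_real ((norm x)\<^sup>2))"
    by (simp add: power2_norm_eq_inner flip: inner_cinner)
  show "Im (x \<bullet>\<^sub>C x) = Im (of_real ((norm x)\<^sup>2))"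
    using arg_cong[OF cinner_commute[of x x], of Im] by simp
qed

lemma norm_scaleC [simp]: "norm (c *\<^sub>C x) = cmod c * norm (x::'a::complex_hilbert)"
proof -
  have "of_real ((norm (c *\<^sub>C x))\<^sup>2) = (c * cnj c) * (x \<bullet>\<^sub>C x)"
    unfolding cinner_self[symmetric] by simp
  also have "\<dots> = of_real ((cmod c * norm x)\<^sup>2)"
    unfolding cinner_self complex_norm_square[symmetric] by (simp add: power_mult_distrib)
  finally have "(of_real ((norm (c *\<^sub>C x))\<^sup>2) :: complex) = of_real ((cmod c * norm x)\<^sup>2)" .
  then show ?thesis
    by (metis mult_nonneg_nonneg norm_ge_zero of_real_eq_iff power2_eq_imp_eq)
qed

lemma norm_cinner: "cmod (x \<bullet>\<^sub>C y) \<le> norm x * norm (y::'a::complex_hilbert)"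
proof (cases "x \<bullet>\<^sub>C y = 0")
  case False
  define c where "c = cnj (sgn (x \<bullet>\<^sub>C y))"
  have "c * (x \<bullet>\<^sub>C y) = of_real (cmod (x \<bullet>\<^sub>C y))"
    unfolding c_def using False
    by (simp add: sgn_eq divide_simps complex_norm_square power2_eq_square mult.commute)
       (metis complex_norm_square mult.commute of_real_mult power2_eq_square)
  then have "cmod (x \<bullet>\<^sub>C y) = inner x (c *\<^sub>C y)"
    by (simp add: inner_cinner)
  also have "\<dots> \<le> norm x * norm (c *\<^sub>C y)"
    by (rule norm_cauchy_schwarz)
  also have "\<dots> = norm x * norm y"
    using False by (simp add: c_def norm_sgn)
  finally show ?thesis .
qed simp

lemma bounded_linear_scaleC: "bounded_linear (\<lambda>x. c *\<^sub>C (x::'a::complex_hilbert))"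
  by (rule bounded_linear_intro[where K = "cmod c"])
     (auto simp: scaleC_add_right scaleR_scaleC scaleC_scaleC mult.commute)

lemma bounded_bilinear_cinner: "bounded_bilinear ((\<bullet>\<^sub>C) :: 'a::complex_hilbert \<Rightarrow> 'a \<Rightarrow> complex)"
proof
  show "\<exists>K. \<forall>a b. norm ((a::'a) \<bullet>\<^sub>C b) \<le> norm a * norm b * K"
    using norm_cinner by (metis mult.right_neutral)
qed (auto simp: cinner_add_left cinner_add_right scaleR_scaleC scaleR_conv_of_real)

interpretation cinner: bounded_bilinear "(\<bullet>\<^sub>C) :: 'a::complex_hilbert \<Rightarrow> 'a \<Rightarrow> complex"
  by (rule bounded_bilinear_cinner)

lemma cinner_eqI: "(\<And>z. z \<bullet>\<^sub>C x = z \<bullet>\<^sub>C y) \<Longrightarrow> x = (y::'a::complex_hilbert)"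
  by (metis cinner.diff_right cinner_self of_real_eq_0_iff right_minus_eq norm_eq_zero
      power_eq_0_iff)

instantiation prod :: (complex_vector, complex_vector) complex_vector
begin

definition scaleC_prod_def: "c *\<^sub>C p = (c *\<^sub>C fst p, c *\<^sub>C snd p)"

instance
  by standard (simp_all add: scaleC_prod_def scaleC_add_right scaleC_add_left scaleC_scaleC
      scaleR_prod_def scaleR_scaleC)

end

instantiation blinfun :: (real_normed_vector, complex_hilbert) complex_vector
begin

definition scaleC_blinfun_def: "c *\<^sub>C T = Blinfun (\<lambda>x. c *\<^sub>C blinfun_apply T x)"

lemma scaleC_blinfun_apply: "blinfun_apply (c *\<^sub>C T) x = c *\<^sub>C blinfun_apply T x"
  unfolding scaleC_blinfun_def
  by (rule fun_cong[OF bounded_linear_Blinfun_apply])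
     (rule bounded_linear_compose[OF bounded_linear_scaleC blinfun.bounded_linear_right])

instance
  by standard (auto intro!: blinfun_eqI simp: scaleC_blinfun_apply blinfun.bilinear_simps
      scaleC_add_right scaleC_add_left scaleC_scaleC scaleR_scaleC)

end


section \<open>The conjugate Hilbert space\<close>

text \<open>\<open>bar x\<close> is the vector \<open>x\<close> regarded as an element of the conjugate space.\<close>

typedef 'a conj_space = "UNIV :: 'a set"
  morphisms unbar bar ..

setup_lifting type_definition_conj_space

instantiation conj_space :: (complex_hilbert) "{complex_vector, real_inner}"
begin

lift_definition zero_conj_space :: "'a conj_space" is 0 .
lift_definition plus_conj_space :: "'a conj_space \<Rightarrow> 'a conj_space \<Rightarrow> 'a conj_space" is "(+)" .
lift_definition minus_conj_space :: "'a conj_space \<Rightarrow> 'a conj_space \<Rightarrow> 'a conj_space" is "(-)" .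
lift_definition uminus_conj_space :: "'a conj_space \<Rightarrow> 'a conj_space" is uminus .
lift_definition scaleR_conj_space :: "real \<Rightarrow> 'a conj_space \<Rightarrow> 'a conj_space" is scaleR .
lift_definition scaleC_conj_space :: "complex \<Rightarrow> 'a conj_space \<Rightarrow> 'a conj_space"
  is "\<lambda>c. scaleC (cnj c)" .
lift_definition inner_conj_space :: "'a conj_space \<Rightarrow> 'a conj_space \<Rightarrow> real" is inner .
lift_definition norm_conj_space :: "'a conj_space \<Rightarrow> real" is norm .
lift_definition dist_conj_space :: "'a conj_space \<Rightarrow> 'a conj_space \<Rightarrow> real" is dist .
lift_definition sgn_conj_space :: "'a conj_space \<Rightarrow> 'a conj_space" is sgn .
definition uniformity_conj_space :: "('a conj_space \<times> 'a conj_space) filter" where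
  "uniformity_conj_space = (INF e\<in>{0<..}. principal {(x, y). dist x y < e})"
definition open_conj_space :: "'a conj_space set \<Rightarrow> bool" where
  "open_conj_space U \<longleftrightarrow> (\<forall>x\<in>U. \<forall>\<^sub>F (x', y) in uniformity. x' = x \<longrightarrow> y \<in> U)"

instance
proof
  fix x y z :: "'a conj_space" and r s :: real and c d :: complex
  show "x + y + z = x + (y + z)" "x + y = y + x" "0 + x = x" "- x + x = 0" "x - y = x + - y"
    by (transfer, simp)+
  show "r *\<^sub>R (x + y) = r *\<^sub>R x + r *\<^sub>R y" "(r + s) *\<^sub>R x = r *\<^sub>R x + s *\<^sub>R x"
    "r *\<^sub>R s *\<^sub>R x = (r * s) *\<^sub>R x" "1 *\<^sub>R x = x"
    by (transfer, simp add: algebra_simps)+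
  show "c *\<^sub>C (x + y) = c *\<^sub>C x + c *\<^sub>C y" "(c + d) *\<^sub>C x = c *\<^sub>C x + d *\<^sub>C x"
    "c *\<^sub>C d *\<^sub>C x = (c * d) *\<^sub>C x" "r *\<^sub>R x = of_real r *\<^sub>C x"
    by (transfer, simp add: scaleC_add_right scaleC_add_left scaleC_scaleC scaleR_scaleC)+
  show "dist x y = norm (x - y)"
    by transfer (simp add: dist_norm)
  show "inner x y = inner y x"
    by transfer (rule inner_commute)
  show "inner (x + y) z = inner x z + inner y z"
    by transfer (rule inner_add_left)
  show "inner (r *\<^sub>R x) y = r * inner x y" "0 \<le> inner x x" "(inner x x = 0) = (x = 0)"
    by (transfer, simp)+
  show "norm x = sqrt (inner x x)"
    by transfer (rule norm_eq_sqrt_inner)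
  show "sgn x = inverse (norm x) *\<^sub>R x"
    by transfer (rule sgn_div_norm)
qed (simp_all add: uniformity_conj_space_def open_conj_space_def)

end

instance conj_space :: (complex_hilbert) complete_space
proof
  fix X :: "nat \<Rightarrow> 'a conj_space"
  assume X: "Cauchy X"
  have d: "dist (unbar x) (unbar y) = dist x y" for x y :: "'a conj_space"
    by transfer simp
  from X have "Cauchy (\<lambda>n. unbar (X n))"
    unfolding Cauchy_def d .
  then obtain l where "(\<lambda>n. unbar (X n)) \<longlonglongrightarrow> l"
    by (auto simp: Cauchy_convergent_iff convergent_def)
  then have "\<forall>e>0. \<exists>N. \<forall>n\<ge>N. dist (X n) (bar l) < e"
    unfolding lim_sequentially by (simp flip: d add: bar_inverse)
  then show "convergent X"
    unfolding convergent_def lim_sequentially by blast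
qed

instantiation conj_space :: (complex_hilbert) complex_hilbert
begin

lift_definition cinner_conj_space :: "'a conj_space \<Rightarrow> 'a conj_space \<Rightarrow> complex"
  is "\<lambda>x y. y \<bullet>\<^sub>C x" .

instance
proof
  fix x y z :: "'a conj_space" and c :: complex
  show "x \<bullet>\<^sub>C y = cnj (y \<bullet>\<^sub>C x)"
    by transfer (rule cinner_commute)
  show "x \<bullet>\<^sub>C (y + z) = x \<bullet>\<^sub>C y + x \<bullet>\<^sub>C z" "x \<bullet>\<^sub>C (c *\<^sub>C y) = c * (x \<bullet>\<^sub>C y)"
    by (transfer, simp add: cinner_add_left)+
  show "inner x y = Re (x \<bullet>\<^sub>C y)"
    by transfer (simp add: inner_cinner[symmetric] inner_commute)
qed

end


section \<open>Orthonormal bases\<close>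

definition orthonormal :: "'a::complex_hilbert set \<Rightarrow> bool" where
  "orthonormal B \<longleftrightarrow> (\<forall>e\<in>B. \<forall>f\<in>B. e \<bullet>\<^sub>C f = (if e = f then 1 else 0))"

definition is_onb :: "'a::complex_hilbert set \<Rightarrow> bool" where
  "is_onb B \<longleftrightarrow> orthonormal B \<and> (\<forall>x. (\<forall>e\<in>B. e \<bullet>\<^sub>C x = 0) \<longrightarrow> x = 0)"

definition onb :: "'a::complex_hilbert set" where
  "onb = (SOME B. is_onb B)"

lemma ex_onb: "\<exists>B :: 'a::complex_hilbert set. is_onb B"
proof -
  have "\<exists>M\<in>{B :: 'a set. orthonormal B}. \<forall>X\<in>{B. orthonormal B}. M \<subseteq> X \<longrightarrow> X = M"
  proof (rule Zorn_Lemma, rule ballI)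
    fix C :: "'a set set"
    assume C: "C \<in> chains {B. orthonormal B}"
    have "e \<bullet>\<^sub>C f = (if e = f then 1 else 0)" if "X \<in> C" "Y \<in> C" "e \<in> X" "f \<in> Y" for X Y e f
    proof -
      have "X \<subseteq> Y \<or> Y \<subseteq> X"
        using C that by (auto simp: chains_def chain_subset_def)
      then have "\<exists>Z\<in>C. e \<in> Z \<and> f \<in> Z"
        using that by blast
      then obtain Z where "Z \<in> C" "e \<in> Z" "f \<in> Z"
        by blast
      moreover have "orthonormal Z"
        using C \<open>Z \<in> C\<close> by (auto simp: chains_def)
      ultimately show ?thesis
        by (simp add: orthonormal_def)
    qed
    then show "\<Union>C \<in> {B. orthonormal B}"
      unfolding orthonormal_def by blast
  qed
  then obtain M :: "'a set" where M: "orthonormal M"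
    and max: "\<And>X. orthonormal X \<Longrightarrow> M \<subseteq> X \<Longrightarrow> X = M"
    by blast
  have "x = 0" if x: "\<forall>e\<in>M. e \<bullet>\<^sub>C x = 0" for x
  proof (rule ccontr)
    assume "x \<noteq> 0"
    define u where "u = sgn x"
    have "sgn x = of_real (inverse (norm x)) *\<^sub>C x"
      by (simp add: sgn_div_norm scaleR_scaleC)
    then have 1: "e \<bullet>\<^sub>C u = 0" "u \<bullet>\<^sub>C e = 0" if "e \<in> M" for e
      using x that cinner_commute[of x e] by (auto simp: u_def)
    have "u \<bullet>\<^sub>C u = 1"
      unfolding cinner_self u_def using \<open>x \<noteq> 0\<close> by (simp add: norm_sgn)
    then have "orthonormal (insert u M)"
      using M 1 unfolding orthonormal_def by auto
    then have "u \<in> M"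
      using max by blast
    then show False
      using 1[of u] \<open>u \<bullet>\<^sub>C u = 1\<close> by simp
  qed
  with M show ?thesis
    unfolding is_onb_def by blast
qed

lemma is_onb_onb: "is_onb (onb :: 'a::complex_hilbert set)"
  unfolding onb_def using ex_onb by (rule someI_ex)

lemma onb_cinner: "e \<in> onb \<Longrightarrow> f \<in> onb \<Longrightarrow> e \<bullet>\<^sub>C f = (if e = f then 1 else 0)"
  using is_onb_onb unfolding is_onb_def orthonormal_def by blast

lemma norm_onb [simp]: "e \<in> onb \<Longrightarrow> norm e = 1"
proof -
  assume "e \<in> onb"
  then have "complex_of_real ((norm e)\<^sup>2) = of_real 1"
    using onb_cinner[of e e] by (simp add: cinner_self)
  then have "(norm e)\<^sup>2 = 1"
    by (simp only: of_real_eq_iff)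
  then show ?thesis
    using norm_ge_zero[of e] by (simp add: power2_eq_1_iff)
qed

lemma onb_total: "(\<And>e. e \<in> onb \<Longrightarrow> e \<bullet>\<^sub>C x = 0) \<Longrightarrow> x = 0"
  using is_onb_onb unfolding is_onb_def by blast

lemma norm_sum_orthogonal:
  fixes v :: "'i \<Rightarrow> 'a::complex_hilbert"
  assumes "finite F" "\<And>i j. i \<in> F \<Longrightarrow> j \<in> F \<Longrightarrow> i \<noteq> j \<Longrightarrow> v i \<bullet>\<^sub>C v j = 0"
  shows "(norm (sum v F))\<^sup>2 = (\<Sum>i\<in>F. (norm (v i))\<^sup>2)"
proof -
  have "of_real ((norm (sum v F))\<^sup>2) = (\<Sum>i\<in>F. \<Sum>j\<in>F. v i \<bullet>\<^sub>C v j)"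
    unfolding cinner_self[symmetric] unfolding cinner.sum_left cinner.sum_right by (rule sum.swap)
  also have "\<dots> = (\<Sum>i\<in>F. \<Sum>j\<in>F. if j = i then v i \<bullet>\<^sub>C v i else 0)"
    using assms(2) by (intro sum.cong) auto
  also have "\<dots> = (\<Sum>i\<in>F. v i \<bullet>\<^sub>C v i)"
    using assms(1) by simp
  also have "\<dots> = of_real (\<Sum>i\<in>F. (norm (v i))\<^sup>2)"
    by (simp add: cinner_self)
  finally show ?thesis
    by (simp only: of_real_eq_iff)
qed

lemma summable_on_orthogonal:
  fixes v :: "'i \<Rightarrow> 'a::complex_hilbert"
  assumes orth: "\<And>i j. i \<in> A \<Longrightarrow> j \<in> A \<Longrightarrow> i \<noteq> j \<Longrightarrow> v i \<bullet>\<^sub>C v j = 0"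
    and summ: "(\<lambda>i. (norm (v i))\<^sup>2) summable_on A"
  shows "v summable_on A"
proof -
  obtain L where L: "((\<lambda>F. \<Sum>i\<in>F. (norm (v i))\<^sup>2) \<longlongrightarrow> L) (finite_subsets_at_top A)"
    using summ unfolding summable_on_def has_sum_def by blast
  have "\<exists>P. eventually P (finite_subsets_at_top A) \<and>
           (\<forall>F F'. P F \<and> P F' \<longrightarrow> dist (sum v F) (sum v F') < e)" if "e > 0" for e
  proof -
    define d where "d = (e/2)\<^sup>2 / 2"
    have "d > 0" using that by (simp add: d_def)
    from L this have "\<forall>\<^sub>F F in finite_subsets_at_top A. dist (\<Sum>i\<in>F. (norm (v i))\<^sup>2) L < d"
      by (rule tendstoD)
    then obtain F0 where F0: "finite F0" "F0 \<subseteq> A" and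
      cl: "\<And>F. finite F \<Longrightarrow> F0 \<subseteq> F \<Longrightarrow> F \<subseteq> A \<Longrightarrow> dist (\<Sum>i\<in>F. (norm (v i))\<^sup>2) L < d"
      unfolding eventually_finite_subsets_at_top by metis
    define P where "P F \<longleftrightarrow> finite F \<and> F0 \<subseteq> F \<and> F \<subseteq> A" for F
    have 1: "dist (sum v F) (sum v F0) < e/2" if "P F" for F
    proof -
      have "(dist (sum v F) (sum v F0))\<^sup>2 = (norm (sum v (F - F0)))\<^sup>2"
        unfolding dist_norm using that by (subst sum_diff) (auto simp: P_def)
      also have "\<dots> = (\<Sum>i\<in>F - F0. (norm (v i))\<^sup>2)"
        using that orth by (intro norm_sum_orthogonal) (auto simp: P_def)
      also have "\<dots> = (\<Sum>i\<in>F. (norm (v i))\<^sup>2) - (\<Sum>i\<in>F0. (norm (v i))\<^sup>2)"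
        using that by (subst sum_diff) (auto simp: P_def)
      also have "\<dots> < 2 * d"
        using cl[of F] cl[of F0] F0 that unfolding P_def dist_real_def by auto
      also have "2 * d = (e/2)\<^sup>2"
        unfolding d_def by simp
      finally show ?thesis
        by (rule power2_less_imp_less) (use \<open>e > 0\<close> in simp)
    qed
    have "dist (sum v F) (sum v F') < e" if "P F" "P F'" for F F'
      using 1[OF that(1)] 1[OF that(2)] by (rule dist_triangle_half_l)
    moreover have "eventually P (finite_subsets_at_top A)"
      unfolding P_def eventually_finite_subsets_at_top using F0 by blast
    ultimately show ?thesis by blast
  qed
  then have "cauchy_filter (filtermap (sum v) (finite_subsets_at_top A))"
    by (simp add: cauchy_filter_metric_filtermap)
  moreover have "complete (UNIV::'a set)"
    by (meson Cauchy_convergent UNIV_I complete_def convergent_def)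
  ultimately obtain L' where "(sum v \<longlongrightarrow> L') (finite_subsets_at_top A)"
    using complete_uniform[where S=UNIV] by (force simp add: filterlim_def)
  then show ?thesis
    using summable_on_def has_sum_def by blast
qed

lemma summable_on_sq_bound:
  fixes f :: "'i \<Rightarrow> 'a::real_normed_vector"
  assumes "\<And>F. finite F \<Longrightarrow> F \<subseteq> A \<Longrightarrow> (\<Sum>i\<in>F. (norm (f i))\<^sup>2) \<le> M"
  shows "(\<lambda>i. (norm (f i))\<^sup>2) summable_on A"
  by (rule nonneg_bdd_above_summable_on) (auto intro!: bdd_aboveI[where M = M] assms)

lemma bessel:
  fixes x :: "'a::complex_hilbert"
  assumes "finite F" "F \<subseteq> onb"
  shows "(\<Sum>e\<in>F. (cmod (e \<bullet>\<^sub>C x))\<^sup>2) \<le> (norm x)\<^sup>2"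
proof -
  define y where "y = (\<Sum>e\<in>F. (e \<bullet>\<^sub>C x) *\<^sub>C e)"
  have ny: "(norm y)\<^sup>2 = (\<Sum>e\<in>F. (cmod (e \<bullet>\<^sub>C x))\<^sup>2)"
    unfolding y_def
  proof (subst norm_sum_orthogonal[OF assms(1)])
    fix e f assume "e \<in> F" "f \<in> F" "e \<noteq> f"
    then show "(e \<bullet>\<^sub>C x) *\<^sub>C e \<bullet>\<^sub>C (f \<bullet>\<^sub>C x) *\<^sub>C f = 0"
      using assms(2) onb_cinner[of e f] by auto
  next
    have "norm e = 1" if "e \<in> F" for e
      using that assms(2) by auto
    then show "(\<Sum>e\<in>F. (norm ((e \<bullet>\<^sub>C x) *\<^sub>C e))\<^sup>2) = (\<Sum>e\<in>F. (cmod (e \<bullet>\<^sub>C x))\<^sup>2)"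
      by (intro sum.cong refl) simp
  qed
  have "y \<bullet>\<^sub>C x = (\<Sum>e\<in>F. of_real ((cmod (e \<bullet>\<^sub>C x))\<^sup>2))"
    by (simp add: y_def cinner.sum_left complex_norm_square mult.commute del: of_real_power)
  then have "(\<Sum>e\<in>F. (cmod (e \<bullet>\<^sub>C x))\<^sup>2) = cmod (y \<bullet>\<^sub>C x)"
    by (simp flip: of_real_sum of_real_power add: sum_nonneg)
  also have "\<dots> \<le> norm y * norm x"
    by (rule norm_cinner)
  finally have "norm y * norm y \<le> norm y * norm x"
    using ny by (simp add: power2_eq_square)
  then have "norm y \<le> norm x"
    by (cases "norm y = 0") auto
  then show ?thesis
    unfolding ny[symmetric] by (simp add: power_mono)
qed

lemma onb_expansion:
  fixes x :: "'a::complex_hilbert"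
  shows "((\<lambda>e. (e \<bullet>\<^sub>C x) *\<^sub>C e) has_sum x) onb"
proof -
  have "(\<lambda>e. (cmod (e \<bullet>\<^sub>C x))\<^sup>2) summable_on onb"
    using bessel by (rule summable_on_sq_bound)
  then have "(\<lambda>e. (norm ((e \<bullet>\<^sub>C x) *\<^sub>C e))\<^sup>2) summable_on onb"
    by (simp cong: summable_on_cong)
  then have "(\<lambda>e. (e \<bullet>\<^sub>C x) *\<^sub>C e) summable_on onb"
    by (intro summable_on_orthogonal) (auto simp: onb_cinner)
  then obtain s where s: "((\<lambda>e. (e \<bullet>\<^sub>C x) *\<^sub>C e) has_sum s) onb"
    unfolding summable_on_def by blast
  have "f \<bullet>\<^sub>C (x - s) = 0" if "f \<in> onb" for f
  proof -
    have "((\<lambda>e. f \<bullet>\<^sub>C ((e \<bullet>\<^sub>C x) *\<^sub>C e)) has_sum f \<bullet>\<^sub>C s) onb"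
      using cinner.bounded_linear_right s by (rule has_sum_bounded_linear)
    moreover have "((\<lambda>e. f \<bullet>\<^sub>C ((e \<bullet>\<^sub>C x) *\<^sub>C e)) has_sum f \<bullet>\<^sub>C x) {f}"
      using that by (subst has_sum_finite_iff) (auto simp: onb_cinner)
    then have "((\<lambda>e. f \<bullet>\<^sub>C ((e \<bullet>\<^sub>C x) *\<^sub>C e)) has_sum f \<bullet>\<^sub>C x) onb"
      by (rule has_sum_cong_neutral[THEN iffD1, rotated -1]) (use that in \<open>auto simp: onb_cinner\<close>)
    ultimately show ?thesis
      using has_sum_unique by (auto simp: cinner.diff_right)
  qed
  then have "x - s = 0"
    by (rule onb_total)
  with s show ?thesis by simp
qed

lemma parseval:
  fixes x :: "'a::complex_hilbert"
  shows "((\<lambda>e. cnj (e \<bullet>\<^sub>C x) * (e \<bullet>\<^sub>C y)) has_sum x \<bullet>\<^sub>C y) onb"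
proof -
  have "((\<lambda>e. x \<bullet>\<^sub>C ((e \<bullet>\<^sub>C y) *\<^sub>C e)) has_sum x \<bullet>\<^sub>C y) onb"
    using cinner.bounded_linear_right onb_expansion by (rule has_sum_bounded_linear)
  moreover have "(\<lambda>e. x \<bullet>\<^sub>C ((e \<bullet>\<^sub>C y) *\<^sub>C e)) = (\<lambda>e. cnj (e \<bullet>\<^sub>C x) * (e \<bullet>\<^sub>C y))"
    by (rule ext, subst cinner_commute[of _ x]) simp
  ultimately show ?thesis
    by (simp only:)
qed

lemma parseval_norm: "((\<lambda>e. (cmod (e \<bullet>\<^sub>C x))\<^sup>2) has_sum (norm (x::'a::complex_hilbert))\<^sup>2) onb"
proof -
  have "((\<lambda>e. Re (cnj (e \<bullet>\<^sub>C x) * (e \<bullet>\<^sub>C x))) has_sum Re (x \<bullet>\<^sub>C x)) onb"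
    using bounded_linear_Re parseval by (rule has_sum_bounded_linear)
  moreover have "Re (cnj z * z) = (cmod z)\<^sup>2" for z
    unfolding cmod_power2 by (simp add: power2_eq_square)
  ultimately show ?thesis
    unfolding cinner_self by simp
qed


section \<open>The Hilbert space tensor product\<close>

definition sq_summable :: "('i \<Rightarrow> complex) \<Rightarrow> bool" where
  "sq_summable f \<longleftrightarrow> (\<lambda>i. (cmod (f i))\<^sup>2) summable_on UNIV"

lemma sq_summable_prod:
  assumes "sq_summable f" "sq_summable g"
  shows "(\<lambda>i. cnj (f i) * g i) summable_on UNIV"
proof -
  have "(\<lambda>i. (cmod (f i))\<^sup>2 + (cmod (g i))\<^sup>2) summable_on UNIV"
    using assms unfolding sq_summable_def by (rule summable_on_add)
  then have "(\<lambda>i. norm (cnj (f i) * g i)) summable_on UNIV"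
  proof (rule summable_on_comparison_test)
    fix i
    have "0 \<le> (cmod (f i) - cmod (g i))\<^sup>2 + (cmod (f i))\<^sup>2 + (cmod (g i))\<^sup>2"
      by simp
    then show "norm (cnj (f i) * g i) \<le> (cmod (f i))\<^sup>2 + (cmod (g i))\<^sup>2"
      unfolding norm_mult complex_mod_cnj power2_diff by linarith
  qed auto
  then show ?thesis
    by (rule abs_summable_summable)
qed

lemma sq_summable_scale: "sq_summable f \<Longrightarrow> sq_summable (\<lambda>i. c * f i)"
  unfolding sq_summable_def norm_mult power_mult_distrib by (rule summable_on_cmult_right)

lemma sq_summable_add:
  assumes "sq_summable f" "sq_summable g"
  shows "sq_summable (\<lambda>i. f i + g i)"
  unfolding sq_summable_def
proof (rule summable_on_comparison_test)
  show "(\<lambda>i. 2 * ((cmod (f i))\<^sup>2 + (cmod (g i))\<^sup>2)) summable_on UNIV"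
    using assms unfolding sq_summable_def by (intro summable_on_cmult_right summable_on_add)
  fix i
  have "(cmod (f i + g i))\<^sup>2 \<le> (cmod (f i) + cmod (g i))\<^sup>2"
    by (intro power_mono norm_triangle_ineq) simp
  also have "\<dots> \<le> 2 * ((cmod (f i))\<^sup>2 + (cmod (g i))\<^sup>2)"
    using zero_le_power2[of "cmod (f i) - cmod (g i)"] unfolding power2_diff power2_sum
    by (simp add: algebra_simps)
  finally show "(cmod (f i + g i))\<^sup>2 \<le> 2 * ((cmod (f i))\<^sup>2 + (cmod (g i))\<^sup>2)" .
qed simp

lemma sq_summable_uminus: "sq_summable f \<Longrightarrow> sq_summable (\<lambda>i. - f i)"
  unfolding sq_summable_def by simp

lemma sq_summable_diff: "sq_summable f \<Longrightarrow> sq_summable g \<Longrightarrow> sq_summable (\<lambda>i. f i - g i)"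
  using sq_summable_add[of f "\<lambda>i. - g i"] sq_summable_uminus[of g] by simp

lemma sq_summable_zero: "sq_summable (\<lambda>i. 0)"
  unfolding sq_summable_def by simp

text \<open>The completed tensor product is modelled by the square-summable families of coefficients with
  respect to the product of chosen orthonormal bases. By the lemmas \<open>cinner_tens\<close>, \<open>tens_add_left\<close>,
  \<open>tens_scaleC_left\<close> (and their right-hand versions) and \<open>tens_dense\<close> below, it does not depend on
  this choice up to a unitary that preserves elementary tensors.\<close>

typedef (overloaded) ('a::complex_hilbert, 'b::complex_hilbert) htensor =
  "{f :: 'a \<times> 'b \<Rightarrow> complex. sq_summable f \<and> (\<forall>p. p \<notin> onb \<times> onb \<longrightarrow> f p = 0)}"
  morphisms htensor_coeff Abs_htensor
  using sq_summable_zero by blast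

setup_lifting type_definition_htensor

instantiation htensor :: (complex_hilbert, complex_hilbert) "{complex_vector, real_inner}"
begin

lift_definition zero_htensor :: "('a, 'b) htensor" is "\<lambda>_. 0"
  using sq_summable_zero by simp
lift_definition plus_htensor :: "('a, 'b) htensor \<Rightarrow> ('a, 'b) htensor \<Rightarrow> ('a, 'b) htensor"
  is "\<lambda>f g p. f p + g p" by (auto intro: sq_summable_add)
lift_definition minus_htensor :: "('a, 'b) htensor \<Rightarrow> ('a, 'b) htensor \<Rightarrow> ('a, 'b) htensor"
  is "\<lambda>f g p. f p - g p" by (auto intro: sq_summable_diff)
lift_definition uminus_htensor :: "('a, 'b) htensor \<Rightarrow> ('a, 'b) htensor"
  is "\<lambda>f p. - f p" by (auto intro: sq_summable_uminus)
lift_definition scaleR_htensor :: "real \<Rightarrow> ('a, 'b) htensor \<Rightarrow> ('a, 'b) htensor"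
  is "\<lambda>r f p. of_real r * f p" by (auto intro: sq_summable_scale)
lift_definition scaleC_htensor :: "complex \<Rightarrow> ('a, 'b) htensor \<Rightarrow> ('a, 'b) htensor"
  is "\<lambda>c f p. c * f p" by (auto intro: sq_summable_scale)
definition inner_htensor :: "('a, 'b) htensor \<Rightarrow> ('a, 'b) htensor \<Rightarrow> real"
  where "inner_htensor x y = Re (\<Sum>\<^sub>\<infinity>p. cnj (htensor_coeff x p) * htensor_coeff y p)"
definition norm_htensor :: "('a, 'b) htensor \<Rightarrow> real"
  where "norm_htensor x = sqrt (inner x x)"
definition dist_htensor :: "('a, 'b) htensor \<Rightarrow> ('a, 'b) htensor \<Rightarrow> real"
  where "dist_htensor x y = norm (x - y)"
definition sgn_htensor :: "('a, 'b) htensor \<Rightarrow> ('a, 'b) htensor"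
  where "sgn_htensor x = inverse (norm x) *\<^sub>R x"
definition uniformity_htensor :: "(('a, 'b) htensor \<times> ('a, 'b) htensor) filter" where
  "uniformity_htensor = (INF e\<in>{0<..}. principal {(x, y). dist x y < e})"
definition open_htensor :: "('a, 'b) htensor set \<Rightarrow> bool" where
  "open_htensor U \<longleftrightarrow> (\<forall>x\<in>U. \<forall>\<^sub>F (x', y) in uniformity. x' = x \<longrightarrow> y \<in> U)"

lemma htensor_sq_summable: "sq_summable (htensor_coeff x)"
  using htensor_coeff[of x] by simp

lemma htensor_summable: "(\<lambda>p. cnj (htensor_coeff x p) * htensor_coeff y p) summable_on UNIV"
  by (intro sq_summable_prod htensor_sq_summable)

lemma htensor_norm_sq:
  "((\<lambda>p. (cmod (htensor_coeff x p))\<^sup>2) has_sum inner x x) UNIV"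
proof -
  have "((\<lambda>p. Re (cnj (htensor_coeff x p) * htensor_coeff x p)) has_sum inner x x) UNIV"
    unfolding inner_htensor_def
    by (intro has_sum_bounded_linear[OF bounded_linear_Re] has_sum_infsum htensor_summable)
  moreover have "Re (cnj z * z) = (cmod z)\<^sup>2" for z
    unfolding cmod_power2 by (simp add: power2_eq_square)
  ultimately show ?thesis
    by (simp only:)
qed

instance
proof
  fix x y z :: "('a, 'b) htensor" and r s :: real and c d :: complex
  note coeff = htensor_coeff_inject[symmetric] zero_htensor.rep_eq plus_htensor.rep_eq
    minus_htensor.rep_eq uminus_htensor.rep_eq scaleR_htensor.rep_eq scaleC_htensor.rep_eq
  show "x + y + z = x + (y + z)" "x + y = y + x" "0 + x = x" "- x + x = 0" "x - y = x + - y"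
    unfolding coeff by (simp_all add: add_ac)
  show "r *\<^sub>R (x + y) = r *\<^sub>R x + r *\<^sub>R y" "(r + s) *\<^sub>R x = r *\<^sub>R x + s *\<^sub>R x"
    "r *\<^sub>R s *\<^sub>R x = (r * s) *\<^sub>R x" "1 *\<^sub>R x = x"
    unfolding coeff by (simp_all add: distrib_left distrib_right mult.assoc)
  show "c *\<^sub>C (x + y) = c *\<^sub>C x + c *\<^sub>C y" "(c + d) *\<^sub>C x = c *\<^sub>C x + d *\<^sub>C x"
    "c *\<^sub>C d *\<^sub>C x = (c * d) *\<^sub>C x" "r *\<^sub>R x = of_real r *\<^sub>C x"
    unfolding coeff by (simp_all add: distrib_left distrib_right mult.assoc)
  have "inner y x = Re (cnj (\<Sum>\<^sub>\<infinity>p. cnj (htensor_coeff x p) * htensor_coeff y p))"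
    unfolding inner_htensor_def infsum_cnj[symmetric] by (simp add: mult.commute)
  then show "inner x y = inner y x"
    unfolding inner_htensor_def by simp
  show "inner (x + y) z = inner x z + inner y z"
    unfolding inner_htensor_def plus_htensor.rep_eq
    by (simp add: distrib_right infsum_add htensor_summable)
  have "(\<Sum>\<^sub>\<infinity>p. cnj (of_real r * htensor_coeff x p) * htensor_coeff y p)
      = of_real r * (\<Sum>\<^sub>\<infinity>p. cnj (htensor_coeff x p) * htensor_coeff y p)"
    by (simp add: mult.assoc infsum_cmult_right')
  then show "inner (r *\<^sub>R x) y = r * inner x y"
    unfolding inner_htensor_def scaleR_htensor.rep_eq by simp
  show "0 \<le> inner x x"
    by (rule has_sum_nonneg[OF htensor_norm_sq]) simp
  show "inner x x = 0 \<longleftrightarrow> x = 0"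
  proof
    assume "inner x x = 0"
    then have h: "((\<lambda>p. (cmod (htensor_coeff x p))\<^sup>2) has_sum 0) UNIV"
      using htensor_norm_sq[of x] by simp
    have "(cmod (htensor_coeff x p))\<^sup>2 \<le> 0" for p
      using finite_sum_le_has_sum[OF h, of "{p}"] by simp
    then have "htensor_coeff x = (\<lambda>_. 0)"
      by (simp add: fun_eq_iff)
    then show "x = 0"
      by (simp add: zero_htensor.rep_eq flip: htensor_coeff_inject)
  next
    show "x = 0 \<Longrightarrow> inner x x = 0"
      unfolding inner_htensor_def by (simp add: zero_htensor.rep_eq)
  qed
qed (simp_all add: uniformity_htensor_def open_htensor_def dist_htensor_def norm_htensor_def
    sgn_htensor_def)

end

lemma htensor_coeff_norm_bound:
  assumes "finite F"
  shows "(\<Sum>p\<in>F. (cmod (htensor_coeff x p))\<^sup>2) \<le> (norm x)\<^sup>2"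
proof -
  have "(\<Sum>p\<in>F. (cmod (htensor_coeff x p))\<^sup>2) \<le> inner x x"
    using assms by (intro finite_sum_le_has_sum[OF htensor_norm_sq]) auto
  then show ?thesis
    by (simp add: power2_norm_eq_inner)
qed

lemma htensor_coeff_cmod_le: "cmod (htensor_coeff x p) \<le> norm x"
  using htensor_coeff_norm_bound[of "{p}" x] by simp

instance htensor :: (complex_hilbert, complex_hilbert) complete_space
proof
  fix X :: "nat \<Rightarrow> ('a, 'b) htensor"
  assume X: "Cauchy X"
  have "Cauchy (\<lambda>n. htensor_coeff (X n) p)" for p
  proof (rule metric_CauchyI)
    fix e :: real assume "e > 0"
    then obtain M where "\<forall>m\<ge>M. \<forall>n\<ge>M. dist (X m) (X n) < e"
      using X unfolding Cauchy_def by metis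
    moreover have "dist (htensor_coeff x p) (htensor_coeff y p) \<le> dist x y" for x y :: "('a, 'b) htensor"
      using htensor_coeff_cmod_le[of "x - y" p] by (simp add: dist_norm minus_htensor.rep_eq)
    ultimately show "\<exists>M. \<forall>m\<ge>M. \<forall>n\<ge>M. dist (htensor_coeff (X m) p) (htensor_coeff (X n) p) < e"
      by (meson order_le_less_trans)
  qed
  then have "\<exists>l. (\<lambda>n. htensor_coeff (X n) p) \<longlonglongrightarrow> l" for p
    by (simp add: Cauchy_convergent_iff convergent_def)
  then obtain g where g: "\<And>p. (\<lambda>n. htensor_coeff (X n) p) \<longlonglongrightarrow> g p"
    by metis
  have bound: "(\<Sum>p\<in>F. (cmod (htensor_coeff (X n) p - g p))\<^sup>2) \<le> e\<^sup>2"
    if "finite F" and n: "\<forall>m\<ge>M. dist (X n) (X m) < e" for F n M and e :: real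
  proof (rule LIMSEQ_le_const2)
    show "(\<lambda>m. \<Sum>p\<in>F. (cmod (htensor_coeff (X n) p - htensor_coeff (X m) p))\<^sup>2)
        \<longlonglongrightarrow> (\<Sum>p\<in>F. (cmod (htensor_coeff (X n) p - g p))\<^sup>2)"
      by (intro tendsto_intros g)
    have "(\<Sum>p\<in>F. (cmod (htensor_coeff (X n) p - htensor_coeff (X m) p))\<^sup>2) \<le> e\<^sup>2" if "m \<ge> M" for m
    proof -
      have "(\<Sum>p\<in>F. (cmod (htensor_coeff (X n) p - htensor_coeff (X m) p))\<^sup>2) \<le> (norm (X n - X m))\<^sup>2"
        using htensor_coeff_norm_bound[OF \<open>finite F\<close>, of "X n - X m"] by (simp add: minus_htensor.rep_eq)
      also have "\<dots> \<le> e\<^sup>2"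
        using n that by (intro power_mono) (auto simp: dist_norm intro: less_imp_le)
      finally show ?thesis .
    qed
    then show "\<exists>N. \<forall>m\<ge>N. (\<Sum>p\<in>F. (cmod (htensor_coeff (X n) p - htensor_coeff (X m) p))\<^sup>2) \<le> e\<^sup>2"
      by blast
  qed
  obtain M1 where M1: "\<forall>m\<ge>M1. \<forall>n\<ge>M1. dist (X m) (X n) < 1"
    using X unfolding Cauchy_def by (metis zero_less_one)
  have sd: "sq_summable (\<lambda>p. htensor_coeff (X M1) p - g p)"
    unfolding sq_summable_def using bound[of _ M1 M1 1] M1 by (intro summable_on_sq_bound) auto
  have "g = (\<lambda>p. htensor_coeff (X M1) p - (htensor_coeff (X M1) p - g p))"
    by simp
  then have "sq_summable g"
    using sq_summable_diff[OF htensor_sq_summable sd] by metis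
  moreover have "g p = 0" if "p \<notin> onb \<times> onb" for p
  proof -
    have "htensor_coeff (X n) p = 0" for n
      using htensor_coeff[of "X n"] that by blast
    then show ?thesis
      using LIMSEQ_unique[OF g[of p]] by simp
  qed
  ultimately have co: "htensor_coeff (Abs_htensor g) = g"
    by (simp add: Abs_htensor_inverse)
  have "X \<longlonglongrightarrow> Abs_htensor g"
  proof (rule metric_LIMSEQ_I)
    fix e :: real assume "e > 0"
    then have "e / 2 > 0"
      by simp
    then obtain M where M: "\<forall>m\<ge>M. \<forall>n\<ge>M. dist (X m) (X n) < e / 2"
      using X unfolding Cauchy_def by metis
    have "dist (X n) (Abs_htensor g) < e" if "n \<ge> M" for n
    proof -
      have "inner (X n - Abs_htensor g) (X n - Abs_htensor g) \<le> (e / 2)\<^sup>2"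
        using htensor_norm_sq
      proof (rule has_sum_le_finite_sums)
        fix F :: "('a \<times> 'b) set" assume "finite F"
        then show "(\<Sum>p\<in>F. (cmod (htensor_coeff (X n - Abs_htensor g) p))\<^sup>2) \<le> (e / 2)\<^sup>2"
          unfolding minus_htensor.rep_eq co using M that by (intro bound[of F M]) auto
      qed
      then have "norm (X n - Abs_htensor g) \<le> e / 2"
        unfolding norm_eq_sqrt_inner using \<open>e > 0\<close> by (intro real_le_lsqrt) auto
      then show ?thesis
        using \<open>e > 0\<close> by (simp add: dist_norm)
    qed
    then show "\<exists>M. \<forall>n\<ge>M. dist (X n) (Abs_htensor g) < e"
      by blast
  qed
  then show "convergent X"
    unfolding convergent_def by blast
qed

instantiation htensor :: (complex_hilbert, complex_hilbert) complex_hilbert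
begin

definition cinner_htensor :: "('a, 'b) htensor \<Rightarrow> ('a, 'b) htensor \<Rightarrow> complex"
  where "cinner_htensor x y = (\<Sum>\<^sub>\<infinity>p. cnj (htensor_coeff x p) * htensor_coeff y p)"

instance
proof
  fix x y z :: "('a, 'b) htensor" and c :: complex
  show "x \<bullet>\<^sub>C y = cnj (y \<bullet>\<^sub>C x)"
    unfolding cinner_htensor_def infsum_cnj[symmetric] by (simp add: mult.commute)
  show "x \<bullet>\<^sub>C (y + z) = x \<bullet>\<^sub>C y + x \<bullet>\<^sub>C z"
    unfolding cinner_htensor_def plus_htensor.rep_eq
    by (simp add: distrib_left infsum_add htensor_summable)
  show "x \<bullet>\<^sub>C (c *\<^sub>C y) = c * (x \<bullet>\<^sub>C y)"
    unfolding cinner_htensor_def scaleC_htensor.rep_eq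
    by (simp add: mult.left_commute infsum_cmult_right')
  show "inner x y = Re (x \<bullet>\<^sub>C y)"
    unfolding cinner_htensor_def inner_htensor_def ..
qed

end


lift_definition tens :: "'a::complex_hilbert \<Rightarrow> 'b::complex_hilbert \<Rightarrow> ('a, 'b) htensor" (infixr "\<otimes>\<^sub>h" 70)
  is "\<lambda>x y (e, f). if e \<in> onb \<and> f \<in> onb then (e \<bullet>\<^sub>C x) * (f \<bullet>\<^sub>C y) else 0"
proof (intro conjI allI impI)
  fix x :: 'a and y :: 'b
  let ?g = "\<lambda>(e, f). if e \<in> onb \<and> f \<in> onb then (e \<bullet>\<^sub>C x) * (f \<bullet>\<^sub>C y) else 0"
  have "(\<Sum>p\<in>F. (cmod (?g p))\<^sup>2) \<le> (norm x)\<^sup>2 * (norm y)\<^sup>2" if "finite F" for F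
  proof -
    define E where "E = fst ` F \<inter> onb"
    define E' where "E' = snd ` F \<inter> onb"
    have fin: "finite E" "finite E'" "E \<subseteq> onb" "E' \<subseteq> onb"
      using that by (auto simp: E_def E'_def)
    have "(\<Sum>p\<in>F. (cmod (?g p))\<^sup>2) = (\<Sum>p\<in>F \<inter> onb \<times> onb. (cmod (?g p))\<^sup>2)"
      by (rule sum.mono_neutral_right) (use that in \<open>auto split: if_splits\<close>)
    also have "\<dots> \<le> (\<Sum>p\<in>E \<times> E'. (cmod (?g p))\<^sup>2)"
    proof (rule sum_mono2)
      show "F \<inter> onb \<times> onb \<subseteq> E \<times> E'"
        unfolding E_def E'_def by force
    qed (use fin in auto)
    also have "\<dots> = (\<Sum>e\<in>E. \<Sum>f\<in>E'. (cmod (e \<bullet>\<^sub>C x))\<^sup>2 * (cmod (f \<bullet>\<^sub>C y))\<^sup>2)"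
      unfolding sum.cartesian_product
      by (rule sum.cong) (auto simp: E_def E'_def norm_mult power_mult_distrib)
    also have "\<dots> = (\<Sum>e\<in>E. (cmod (e \<bullet>\<^sub>C x))\<^sup>2) * (\<Sum>f\<in>E'. (cmod (f \<bullet>\<^sub>C y))\<^sup>2)"
      by (rule sum_product[symmetric])
    also have "\<dots> \<le> (norm x)\<^sup>2 * (norm y)\<^sup>2"
      by (intro mult_mono bessel fin sum_nonneg) auto
    finally show ?thesis .
  qed
  then show "sq_summable ?g"
    unfolding sq_summable_def by (intro summable_on_sq_bound)
next
  fix x :: 'a and y :: 'b and p :: "'a \<times> 'b"
  assume "p \<notin> onb \<times> onb"
  then show "(case p of (e, f) \<Rightarrow> if e \<in> onb \<and> f \<in> onb then (e \<bullet>\<^sub>C x) * (f \<bullet>\<^sub>C y) else 0) = 0"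
    by (cases p) (simp, blast)
qed

lemma cinner_tens [simp]:
  "(x \<otimes>\<^sub>h y) \<bullet>\<^sub>C (x' \<otimes>\<^sub>h y') = (x \<bullet>\<^sub>C x') * (y \<bullet>\<^sub>C y')"
proof -
  let ?h = "\<lambda>p. cnj (htensor_coeff (x \<otimes>\<^sub>h y) p) * htensor_coeff (x' \<otimes>\<^sub>h y') p"
  let ?k = "\<lambda>(e, f). (cnj (e \<bullet>\<^sub>C x) * (e \<bullet>\<^sub>C x')) * (cnj (f \<bullet>\<^sub>C y) * (f \<bullet>\<^sub>C y'))"
  have "(?h has_sum (x \<otimes>\<^sub>h y) \<bullet>\<^sub>C (x' \<otimes>\<^sub>h y')) UNIV"
    unfolding cinner_htensor_def by (intro has_sum_infsum htensor_summable)
  then have "(?k has_sum (x \<otimes>\<^sub>h y) \<bullet>\<^sub>C (x' \<otimes>\<^sub>h y')) (onb \<times> onb)"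
    by (rule has_sum_cong_neutral[THEN iffD1, rotated -1]) (auto simp: tens.rep_eq split: if_splits)
  then have "((\<lambda>e. (cnj (e \<bullet>\<^sub>C x) * (e \<bullet>\<^sub>C x')) * (y \<bullet>\<^sub>C y')) has_sum
      (x \<otimes>\<^sub>h y) \<bullet>\<^sub>C (x' \<otimes>\<^sub>h y')) onb"
  proof (rule has_sum_SigmaD)
    fix e :: 'a
    show "((\<lambda>f. ?k (e, f)) has_sum (cnj (e \<bullet>\<^sub>C x) * (e \<bullet>\<^sub>C x')) * (y \<bullet>\<^sub>C y')) onb"
      unfolding prod.case by (intro has_sum_cmult_right parseval)
  qed
  moreover have "((\<lambda>e. (cnj (e \<bullet>\<^sub>C x) * (e \<bullet>\<^sub>C x')) * (y \<bullet>\<^sub>C y')) has_sum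
      (x \<bullet>\<^sub>C x') * (y \<bullet>\<^sub>C y')) onb"
    by (intro has_sum_cmult_left parseval)
  ultimately show ?thesis
    by (rule has_sum_unique)
qed

lemma norm_tens [simp]: "norm (x \<otimes>\<^sub>h y) = norm x * norm y"
proof -
  have "complex_of_real ((norm (x \<otimes>\<^sub>h y))\<^sup>2) = of_real ((norm x * norm y)\<^sup>2)"
    unfolding cinner_self[symmetric] cinner_tens by (simp add: cinner_self power_mult_distrib)
  then have "(norm (x \<otimes>\<^sub>h y))\<^sup>2 = (norm x * norm y)\<^sup>2"
    by (simp only: of_real_eq_iff)
  then show ?thesis
    by (rule power2_eq_imp_eq) simp_all
qed

lemma tens_add_left: "(x + x') \<otimes>\<^sub>h y = x \<otimes>\<^sub>h y + x' \<otimes>\<^sub>h y"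
  and tens_add_right: "x \<otimes>\<^sub>h (y + y') = x \<otimes>\<^sub>h y + x \<otimes>\<^sub>h y'"
  and tens_scaleC_left: "(c *\<^sub>C x) \<otimes>\<^sub>h y = c *\<^sub>C (x \<otimes>\<^sub>h y)"
  and tens_scaleC_right: "x \<otimes>\<^sub>h (c *\<^sub>C y) = c *\<^sub>C (x \<otimes>\<^sub>h y)"
  unfolding htensor_coeff_inject[symmetric] plus_htensor.rep_eq scaleC_htensor.rep_eq tens.rep_eq
  by (auto simp: fun_eq_iff cinner_add_right distrib_left distrib_right)

lemma bounded_bilinear_tens: "bounded_bilinear (\<otimes>\<^sub>h)"
proof
  show "\<exists>K. \<forall>(a::'a) (b::'b). norm (a \<otimes>\<^sub>h b) \<le> norm a * norm b * K"
    by (rule exI[where x = 1]) simp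
qed (auto simp: tens_add_left tens_add_right tens_scaleC_left tens_scaleC_right scaleR_scaleC)

lemma htensor_coeff_outside: "p \<notin> onb \<times> onb \<Longrightarrow> htensor_coeff v p = 0"
  using htensor_coeff[of v] by blast

lemma htensor_coeff_onb:
  assumes "e \<in> onb" "f \<in> onb"
  shows "htensor_coeff v (e, f) = (e \<otimes>\<^sub>h f) \<bullet>\<^sub>C v"
proof -
  let ?h = "\<lambda>p. cnj (htensor_coeff (e \<otimes>\<^sub>h f) p) * htensor_coeff v p"
  have ef: "htensor_coeff (e \<otimes>\<^sub>h f) p = (if p = (e, f) then 1 else 0)" for p
    unfolding tens.rep_eq using assms by (cases p) (auto simp: onb_cinner)
  have "(?h has_sum (e \<otimes>\<^sub>h f) \<bullet>\<^sub>C v) UNIV"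
    unfolding cinner_htensor_def by (intro has_sum_infsum htensor_summable)
  moreover have "(?h has_sum htensor_coeff v (e, f)) {(e, f)}"
    by (subst has_sum_finite_iff) (auto simp: ef)
  then have "(?h has_sum htensor_coeff v (e, f)) UNIV"
    by (rule has_sum_cong_neutral[THEN iffD1, rotated -1]) (auto simp: ef)
  ultimately show ?thesis
    using has_sum_unique by blast
qed

lemma tens_total:
  assumes "\<And>x y. (x \<otimes>\<^sub>h y) \<bullet>\<^sub>C v = 0"
  shows "v = 0"
proof -
  have "htensor_coeff v p = 0" for p
  proof (cases "p \<in> onb \<times> onb")
    case True
    then show ?thesis
      using htensor_coeff_onb[of "fst p" "snd p" v] assms by auto
  next
    case False
    then show ?thesis
      by (rule htensor_coeff_outside)
  qed
  then show ?thesis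
    unfolding htensor_coeff_inject[symmetric] zero_htensor.rep_eq by auto
qed

lemma tens_expansion:
  "((\<lambda>p. htensor_coeff v p *\<^sub>C (fst p \<otimes>\<^sub>h snd p)) has_sum v) (onb \<times> onb)"
proof -
  let ?t = "\<lambda>p. htensor_coeff v p *\<^sub>C (fst p \<otimes>\<^sub>h snd p)"
  have "(\<lambda>p. (norm (?t p))\<^sup>2) summable_on onb \<times> onb"
  proof (rule summable_on_sq_bound)
    fix F :: "('a \<times> 'b) set" assume F: "finite F" "F \<subseteq> onb \<times> onb"
    have "norm (?t p) = cmod (htensor_coeff v p)" if "p \<in> F" for p
      using F that by auto
    then have "(\<Sum>p\<in>F. (norm (?t p))\<^sup>2) = (\<Sum>p\<in>F. (cmod (htensor_coeff v p))\<^sup>2)"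
      by (intro sum.cong) auto
    then show "(\<Sum>p\<in>F. (norm (?t p))\<^sup>2) \<le> (norm v)\<^sup>2"
      using htensor_coeff_norm_bound[OF F(1), of v] by simp
  qed
  moreover have orth: "?t p \<bullet>\<^sub>C ?t q = 0" if "p \<in> onb \<times> onb" "q \<in> onb \<times> onb" "p \<noteq> q" for p q
    using that by (auto simp: onb_cinner split: if_splits)
  ultimately have "?t summable_on onb \<times> onb"
    by (intro summable_on_orthogonal)
  then obtain s where s: "(?t has_sum s) (onb \<times> onb)"
    unfolding summable_on_def by blast
  have "htensor_coeff s p = htensor_coeff v p" if p: "p \<in> onb \<times> onb" for p
  proof -
    let ?b = "fst p \<otimes>\<^sub>h snd p"
    have "((\<lambda>q. ?b \<bullet>\<^sub>C ?t q) has_sum ?b \<bullet>\<^sub>C s) (onb \<times> onb)"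
      using cinner.bounded_linear_right s by (rule has_sum_bounded_linear)
    moreover have z: "?b \<bullet>\<^sub>C ?t q = (if q = p then htensor_coeff v p else 0)" if "q \<in> onb \<times> onb" for q
      using p that by (auto simp: onb_cinner split: if_splits)
    have "((\<lambda>q. ?b \<bullet>\<^sub>C ?t q) has_sum htensor_coeff v p) {p}"
      using z[OF p] by (subst has_sum_finite_iff) auto
    then have "((\<lambda>q. ?b \<bullet>\<^sub>C ?t q) has_sum htensor_coeff v p) (onb \<times> onb)"
      by (rule has_sum_cong_neutral[THEN iffD1, rotated -1]) (use z p in auto)
    ultimately have "?b \<bullet>\<^sub>C s = htensor_coeff v p"
      by (rule has_sum_unique)
    then show ?thesis
      using htensor_coeff_onb[of "fst p" "snd p" s] p by auto
  qed
  moreover have "htensor_coeff s p = htensor_coeff v p" if "p \<notin> onb \<times> onb" for p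
    using htensor_coeff_outside[OF that, of s] htensor_coeff_outside[OF that, of v] by simp
  ultimately have "s = v"
    unfolding htensor_coeff_inject[symmetric] by blast
  with s show ?thesis
    by simp
qed

lemma tens_dense: "closure (cspan (range (\<lambda>(x, y). x \<otimes>\<^sub>h y))) = UNIV"
proof -
  have "v \<in> closure (cspan (range (\<lambda>(x, y). x \<otimes>\<^sub>h y)))" for v :: "('a, 'b) htensor"
    unfolding closure_approachable
  proof (intro allI impI)
    fix e :: real assume "e > 0"
    then obtain F where "finite F"
      and F: "dist (\<Sum>p\<in>F. htensor_coeff v p *\<^sub>C (fst p \<otimes>\<^sub>h snd p)) v \<le> e / 2"
      using has_sum_finite_approximation[OF tens_expansion[of v], of "e / 2"] by auto
    have "(\<Sum>p\<in>F. htensor_coeff v p *\<^sub>C (fst p \<otimes>\<^sub>h snd p)) \<in> cspan (range (\<lambda>(x, y). x \<otimes>\<^sub>h y))"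
      by (intro complex_vector.span_sum complex_vector.span_scale complex_vector.span_base)
         (auto simp: image_iff)
    then show "\<exists>y\<in>cspan (range (\<lambda>(x, y). x \<otimes>\<^sub>h y)). dist y v < e"
      using F \<open>e > 0\<close> by (intro bexI) auto
  qed
  then show ?thesis
    by auto
qed


section \<open>Bounded operators\<close>

text \<open>The type of bounded linear maps in the library is real-linear, so that complex linearity
  has to be imposed separately.\<close>

definition bop :: "('a::complex_hilbert \<Rightarrow>\<^sub>L 'b::complex_hilbert) set" where
  "bop = {T. \<forall>c x. blinfun_apply T (c *\<^sub>C x) = c *\<^sub>C blinfun_apply T x}"

definition adj :: "('a::complex_hilbert \<Rightarrow>\<^sub>L 'b::complex_hilbert) \<Rightarrow> ('b \<Rightarrow>\<^sub>L 'a)" where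
  "adj T = (THE S. \<forall>x y. blinfun_apply S y \<bullet>\<^sub>C x = y \<bullet>\<^sub>C T x)"

definition unitary :: "('a::complex_hilbert \<Rightarrow>\<^sub>L 'b::complex_hilbert) \<Rightarrow> bool" where
  "unitary U \<longleftrightarrow> U \<in> bop \<and> adj U o\<^sub>L U = id_blinfun \<and> U o\<^sub>L adj U = id_blinfun"

lemma bop_scaleC: "T \<in> bop \<Longrightarrow> blinfun_apply T (c *\<^sub>C x) = c *\<^sub>C T x"
  by (simp add: bop_def)

lemma bopI: "(\<And>c x. blinfun_apply T (c *\<^sub>C x) = c *\<^sub>C T x) \<Longrightarrow> T \<in> bop"
  by (simp add: bop_def)

lemma bop_compose: "S \<in> bop \<Longrightarrow> T \<in> bop \<Longrightarrow> S o\<^sub>L T \<in> bop"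
  by (simp add: bop_def)

lemma bop_id: "id_blinfun \<in> bop"
  by (simp add: bop_def)

lemma riesz:
  fixes f :: "'a::complex_hilbert \<Rightarrow>\<^sub>L complex"
  assumes lin: "\<And>c x. f (c *\<^sub>C x) = c * f x"
  shows "\<exists>y. \<forall>x. f x = y \<bullet>\<^sub>C x"
proof -
  let ?t = "\<lambda>e. cnj (f e) *\<^sub>C e"
  have "(\<lambda>e. (norm (?t e))\<^sup>2) summable_on onb"
  proof (rule summable_on_sq_bound)
    fix F :: "'a set" assume F: "finite F" "F \<subseteq> onb"
    define s where "s = sum ?t F"
    have "norm (?t e) = cmod (f e)" if "e \<in> F" for e
      using F that by auto
    then have "(\<Sum>e\<in>F. (norm (?t e))\<^sup>2) = (\<Sum>e\<in>F. (cmod (f e))\<^sup>2)"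
      by (intro sum.cong) auto
    moreover have ns: "(norm s)\<^sup>2 = (\<Sum>e\<in>F. (norm (?t e))\<^sup>2)"
      unfolding s_def
    proof (rule norm_sum_orthogonal[OF F(1)])
      fix i j assume "i \<in> F" "j \<in> F" "i \<noteq> j"
      then show "?t i \<bullet>\<^sub>C ?t j = 0"
        using F onb_cinner[of i j] by auto
    qed
    moreover have "f s = of_real (\<Sum>e\<in>F. (cmod (f e))\<^sup>2)"
      unfolding s_def blinfun.sum_right lin of_real_sum complex_norm_square by (simp add: mult.commute)
    ultimately have "(norm s)\<^sup>2 = cmod (f s)"
      by (simp add: sum_nonneg del: of_real_sum)
    also have "\<dots> \<le> norm f * norm s"
      by (rule norm_blinfun)
    finally have "norm s \<le> norm f"
      by (cases "norm s = 0") (auto simp: power2_eq_square)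
    then show "(\<Sum>e\<in>F. (norm (?t e))\<^sup>2) \<le> (norm f)\<^sup>2"
      unfolding ns[symmetric] by (rule power_mono) simp
  qed
  then have "?t summable_on onb"
  proof (rule summable_on_orthogonal[rotated])
    fix i j :: 'a assume "i \<in> onb" "j \<in> onb" "i \<noteq> j"
    then show "?t i \<bullet>\<^sub>C ?t j = 0"
      using onb_cinner[of i j] by auto
  qed
  then obtain y where y: "(?t has_sum y) onb"
    unfolding summable_on_def by blast
  have "f x = y \<bullet>\<^sub>C x" for x
  proof -
    have "((\<lambda>e. ?t e \<bullet>\<^sub>C x) has_sum y \<bullet>\<^sub>C x) onb"
      using cinner.bounded_linear_left y by (rule has_sum_bounded_linear)
    moreover have "((\<lambda>e. f ((e \<bullet>\<^sub>C x) *\<^sub>C e)) has_sum f x) onb"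
      using blinfun.bounded_linear_right onb_expansion by (rule has_sum_bounded_linear)
    then have "((\<lambda>e. ?t e \<bullet>\<^sub>C x) has_sum f x) onb"
      unfolding lin by (simp add: mult.commute)
    ultimately show ?thesis
      using has_sum_unique by blast
  qed
  then show ?thesis by blast
qed

lemma bounded_linear_cinner_blinfun: "bounded_linear (\<lambda>x. y \<bullet>\<^sub>C blinfun_apply T x)"
  by (rule bounded_linear_compose[OF cinner.bounded_linear_right blinfun.bounded_linear_right])

lemma ex_adj:
  fixes T :: "'a::complex_hilbert \<Rightarrow>\<^sub>L 'b::complex_hilbert"
  assumes T: "T \<in> bop"
  shows "\<exists>S :: 'b \<Rightarrow>\<^sub>L 'a. \<forall>x y. S y \<bullet>\<^sub>C x = y \<bullet>\<^sub>C T x"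
proof -
  have "\<exists>z. \<forall>x. y \<bullet>\<^sub>C T x = z \<bullet>\<^sub>C x" for y
    using riesz[of "Blinfun (\<lambda>x. y \<bullet>\<^sub>C T x)"] T
    by (simp add: bounded_linear_Blinfun_apply bounded_linear_cinner_blinfun bop_scaleC)
  then obtain g where g: "\<And>x y. g y \<bullet>\<^sub>C x = y \<bullet>\<^sub>C T x"
    by metis
  have "bounded_linear g"
  proof (rule bounded_linear_intro[where K = "norm T"])
    have eq: "u = v" if "\<And>z. u \<bullet>\<^sub>C z = v \<bullet>\<^sub>C z" for u v :: 'a
      using that by (metis cinner_commute cinner_eqI)
    show "g (x + y) = g x + g y" for x y
      by (rule eq) (simp add: g cinner_add_left)
    show "g (r *\<^sub>R x) = r *\<^sub>R g x" for r x
      by (rule eq) (simp add: g scaleR_scaleC)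
    show "norm (g x) \<le> norm x * norm T" for x
    proof -
      have "complex_of_real ((norm (g x))\<^sup>2) = x \<bullet>\<^sub>C T (g x)"
        unfolding g[symmetric] cinner_self ..
      then have "(norm (g x))\<^sup>2 = cmod (x \<bullet>\<^sub>C T (g x))"
        by (metis abs_power2 norm_of_real)
      also have "\<dots> \<le> norm x * norm (T (g x))"
        by (rule norm_cinner)
      also have "\<dots> \<le> norm x * (norm T * norm (g x))"
        by (intro mult_left_mono norm_blinfun) simp
      finally show ?thesis
        by (cases "norm (g x) = 0") (auto simp: power2_eq_square)
    qed
  qed
  then have "\<forall>x y. Blinfun g y \<bullet>\<^sub>C x = y \<bullet>\<^sub>C T x"
    by (simp add: g bounded_linear_Blinfun_apply)
  then show ?thesis by blast
qed

lemma cinner_eqI2: "(\<And>z. x \<bullet>\<^sub>C z = y \<bullet>\<^sub>C z) \<Longrightarrow> x = (y::'a::complex_hilbert)"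
  by (rule cinner_eqI) (metis cinner_commute)

lemma adj_eqI:
  assumes "\<And>x y. blinfun_apply S y \<bullet>\<^sub>C x = y \<bullet>\<^sub>C blinfun_apply T x"
  shows "adj T = S"
  unfolding adj_def
proof (rule the_equality)
  fix S' assume "\<forall>x y. blinfun_apply S' y \<bullet>\<^sub>C x = y \<bullet>\<^sub>C blinfun_apply T x"
  then show "S' = S"
    using assms by (intro blinfun_eqI cinner_eqI2) simp
qed (use assms in blast)

lemma cinner_adj:
  assumes "T \<in> bop"
  shows "blinfun_apply (adj T) y \<bullet>\<^sub>C x = y \<bullet>\<^sub>C blinfun_apply T x"
proof -
  obtain S where S: "\<And>x y. blinfun_apply S y \<bullet>\<^sub>C x = y \<bullet>\<^sub>C blinfun_apply T x"
    using ex_adj[OF assms] by blast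
  show ?thesis
    unfolding adj_eqI[of S T, OF S] by (rule S)
qed

lemma cinner_adj_right:
  assumes "T \<in> bop"
  shows "x \<bullet>\<^sub>C blinfun_apply (adj T) y = blinfun_apply T x \<bullet>\<^sub>C y"
  by (metis assms cinner_adj cinner_commute)

lemma bop_adj: "T \<in> bop \<Longrightarrow> adj T \<in> bop"
  by (rule bopI, rule cinner_eqI2) (simp add: cinner_adj)

lemma blinfun_eq_tensI:
  assumes "S \<in> bop" "T \<in> bop"
    and "\<And>x y. blinfun_apply S (x \<otimes>\<^sub>h y) = blinfun_apply T (x \<otimes>\<^sub>h y)"
  shows "S = T"
proof (rule blinfun_eqI, rule cinner_eqI)
  fix v w
  have "adj S w - adj T w = 0"
  proof (rule tens_total)
    fix x y
    show "(x \<otimes>\<^sub>h y) \<bullet>\<^sub>C (adj S w - adj T w) = 0"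
      using assms by (simp add: cinner.diff_right cinner_adj_right)
  qed
  then show "w \<bullet>\<^sub>C blinfun_apply S v = w \<bullet>\<^sub>C blinfun_apply T v"
    using assms by (metis cinner_adj right_minus_eq)
qed

text \<open>Operators given as sums of operators with pairwise orthogonal ranges.\<close>

lemma orthogonal_operator_sum:
  fixes L :: "'i \<Rightarrow> 'a::complex_hilbert \<Rightarrow>\<^sub>L 'b::complex_hilbert"
  assumes L: "\<And>i. i \<in> I \<Longrightarrow> L i \<in> bop"
    and orth: "\<And>i j x. i \<in> I \<Longrightarrow> j \<in> I \<Longrightarrow> i \<noteq> j \<Longrightarrow> L i x \<bullet>\<^sub>C L j x = 0"
    and "M \<ge> 0"
    and bound: "\<And>F x. finite F \<Longrightarrow> F \<subseteq> I \<Longrightarrow> (\<Sum>i\<in>F. (norm (L i x))\<^sup>2) \<le> (M * norm x)\<^sup>2"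
  shows "\<exists>T\<in>bop. \<forall>x. ((\<lambda>i. L i x) has_sum blinfun_apply T x) I"
proof -
  have "(\<lambda>i. L i x) summable_on I" for x
    by (rule summable_on_orthogonal[OF orth]) (auto intro: summable_on_sq_bound bound)
  then obtain g where g: "\<And>x. ((\<lambda>i. L i x) has_sum g x) I"
    unfolding summable_on_def by metis
  have scale: "g (c *\<^sub>C x) = c *\<^sub>C g x" for c x
  proof (rule has_sum_unique[OF g])
    have "((\<lambda>i. c *\<^sub>C L i x) has_sum c *\<^sub>C g x) I"
      using bounded_linear_scaleC g by (rule has_sum_bounded_linear)
    then show "((\<lambda>i. L i (c *\<^sub>C x)) has_sum c *\<^sub>C g x) I"
      by (rule has_sum_cong[THEN iffD1, rotated]) (simp add: L bop_scaleC)
  qed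
  have "bounded_linear g"
  proof (rule bounded_linear_intro[where K = M])
    show "g (x + y) = g x + g y" for x y
      by (rule has_sum_unique[OF g]) (unfold blinfun.add_right, intro has_sum_add g)
    show "g (r *\<^sub>R x) = r *\<^sub>R g x" for r x
      unfolding scaleR_scaleC by (rule scale)
    show "norm (g x) \<le> norm x * M" for x
    proof (rule field_le_epsilon)
      fix e :: real assume "e > 0"
      then obtain F where F: "finite F" "F \<subseteq> I" "dist (\<Sum>i\<in>F. L i x) (g x) \<le> e"
        using has_sum_finite_approximation[OF g] by blast
      have "(norm (\<Sum>i\<in>F. L i x))\<^sup>2 \<le> (M * norm x)\<^sup>2"
        using norm_sum_orthogonal[of F "\<lambda>i. L i x"] orth bound[of F x] F by (auto simp: subset_iff)
      then have "norm (\<Sum>i\<in>F. L i x) \<le> M * norm x"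
        by (rule power2_le_imp_le) (simp add: \<open>M \<ge> 0\<close>)
      moreover have "norm (g x) \<le> norm (\<Sum>i\<in>F. L i x) + dist (\<Sum>i\<in>F. L i x) (g x)"
        by (metis dist_norm norm_minus_commute norm_triangle_sub)
      ultimately show "norm (g x) \<le> norm x * M + e"
        using F(3) by (simp add: mult.commute)
    qed
  qed
  then have "Blinfun g \<in> bop \<and> (\<forall>x. ((\<lambda>i. L i x) has_sum Blinfun g x) I)"
    by (simp add: bounded_linear_Blinfun_apply bop_def scale g)
  then show ?thesis by blast
qed

definition right_ket :: "'b::complex_hilbert \<Rightarrow> ('a::complex_hilbert \<Rightarrow>\<^sub>L ('a, 'b) htensor)" where
  "right_ket y = Blinfun (\<lambda>x. x \<otimes>\<^sub>h y)"

definition left_ket :: "'a::complex_hilbert \<Rightarrow> ('b::complex_hilbert \<Rightarrow>\<^sub>L ('a, 'b) htensor)" where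
  "left_ket x = Blinfun (\<lambda>y. x \<otimes>\<^sub>h y)"

lemma right_ket_apply [simp]: "blinfun_apply (right_ket y) x = x \<otimes>\<^sub>h y"
  unfolding right_ket_def
  by (simp add: bounded_linear_Blinfun_apply bounded_bilinear.bounded_linear_left[OF bounded_bilinear_tens])

lemma left_ket_apply [simp]: "blinfun_apply (left_ket x) y = x \<otimes>\<^sub>h y"
  unfolding left_ket_def
  by (simp add: bounded_linear_Blinfun_apply bounded_bilinear.bounded_linear_right[OF bounded_bilinear_tens])

lemma bop_right_ket: "right_ket y \<in> bop"
  and bop_left_ket: "left_ket x \<in> bop"
  by (simp_all add: bop_def tens_scaleC_left tens_scaleC_right)

lemma adj_right_ket_tens [simp]: "blinfun_apply (adj (right_ket y)) (x \<otimes>\<^sub>h y') = (y \<bullet>\<^sub>C y') *\<^sub>C x"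
  by (rule cinner_eqI) (simp add: cinner_adj_right bop_right_ket)

lemma adj_left_ket_tens [simp]: "blinfun_apply (adj (left_ket x)) (x' \<otimes>\<^sub>h y) = (x \<bullet>\<^sub>C x') *\<^sub>C y"
  by (rule cinner_eqI) (simp add: cinner_adj_right bop_left_ket)

lemma sum_adj_right_ket_bound:
  assumes F: "finite F" "F \<subseteq> onb"
  shows "(\<Sum>f\<in>F. (norm (blinfun_apply (adj (right_ket f)) v))\<^sup>2) \<le> (norm v)\<^sup>2"
proof -
  let ?v = "\<lambda>f. blinfun_apply (adj (right_ket f)) v"
  define w where "w = (\<Sum>f\<in>F. ?v f \<otimes>\<^sub>h f)"
  have "(norm w)\<^sup>2 = (\<Sum>f\<in>F. (norm (?v f \<otimes>\<^sub>h f))\<^sup>2)"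
    unfolding w_def
  proof (rule norm_sum_orthogonal[OF F(1)])
    fix i j assume "i \<in> F" "j \<in> F" "i \<noteq> j"
    then show "(?v i \<otimes>\<^sub>h i) \<bullet>\<^sub>C (?v j \<otimes>\<^sub>h j) = 0"
      using F onb_cinner[of i j] by auto
  qed
  also have "\<dots> = (\<Sum>f\<in>F. (norm (?v f))\<^sup>2)"
    by (rule sum.cong) (use F in auto)
  finally have nw: "(norm w)\<^sup>2 = (\<Sum>f\<in>F. (norm (?v f))\<^sup>2)" .
  have "(?v f \<otimes>\<^sub>h f) \<bullet>\<^sub>C v = of_real ((norm (?v f))\<^sup>2)" for f
    using cinner_adj_right[OF bop_right_ket, of "?v f" f v] by (simp add: cinner_self)
  then have "w \<bullet>\<^sub>C v = of_real ((norm w)\<^sup>2)"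
    unfolding w_def cinner.sum_left by (simp add: nw[unfolded w_def])
  then have "(norm w)\<^sup>2 = cmod (w \<bullet>\<^sub>C v)"
    by (metis abs_power2 norm_of_real)
  also have "\<dots> \<le> norm w * norm v"
    by (rule norm_cinner)
  finally have "norm w \<le> norm v"
    by (cases "norm w = 0") (auto simp: power2_eq_square)
  then show ?thesis
    unfolding nw[symmetric] by (rule power_mono) simp
qed

text \<open>Operators on a tensor product assembled from operators \<open>K f\<close> with orthogonal ranges,
  applied to the components of a vector with respect to an orthonormal basis of the right factor.\<close>

lemma ex_operator_slices:
  fixes K :: "'b::complex_hilbert \<Rightarrow> ('a::complex_hilbert \<Rightarrow>\<^sub>L 'c::complex_hilbert)"
  assumes K: "\<And>f. K f \<in> bop"
    and K_add: "\<And>f g. K (f + g) = K f + K g"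
    and K_scale: "\<And>c f x. K (c *\<^sub>C f) x = c *\<^sub>C K f x"
    and K_norm: "\<And>f x. norm (K f x) \<le> M * norm f * norm x"
    and orth: "\<And>f g x y. f \<in> onb \<Longrightarrow> g \<in> onb \<Longrightarrow> f \<noteq> g \<Longrightarrow> K f x \<bullet>\<^sub>C K g y = 0"
    and M: "M \<ge> 0"
  shows "\<exists>T\<in>bop. \<forall>x y. blinfun_apply T (x \<otimes>\<^sub>h y) = K y x"
proof -
  have "\<exists>T\<in>bop. \<forall>v. ((\<lambda>f. (K f o\<^sub>L adj (right_ket f)) v) has_sum blinfun_apply T v) onb"
  proof (rule orthogonal_operator_sum)
    show "K f o\<^sub>L adj (right_ket f) \<in> bop" for f
      by (intro bop_compose K bop_adj bop_right_ket)
    show "(K f o\<^sub>L adj (right_ket f)) v \<bullet>\<^sub>C (K g o\<^sub>L adj (right_ket g)) v = 0"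
      if "f \<in> onb" "g \<in> onb" "f \<noteq> g" for f g v
      using that by (simp add: orth)
    show "M \<ge> 0" by fact
    fix F :: "'b set" and v assume F: "finite F" "F \<subseteq> onb"
    have "(\<Sum>f\<in>F. (norm ((K f o\<^sub>L adj (right_ket f)) v))\<^sup>2)
        \<le> (\<Sum>f\<in>F. M\<^sup>2 * (norm (blinfun_apply (adj (right_ket f)) v))\<^sup>2)"
    proof (rule sum_mono)
      fix f assume "f \<in> F"
      then have "norm f = 1"
        using F by auto
      then have "norm (K f (adj (right_ket f) v)) \<le> M * norm (adj (right_ket f) v)"
        using K_norm[of f "adj (right_ket f) v"] by simp
      then show "(norm ((K f o\<^sub>L adj (right_ket f)) v))\<^sup>2 \<le> M\<^sup>2 * (norm (adj (right_ket f) v))\<^sup>2"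
        unfolding power_mult_distrib[symmetric] by (simp add: power_mono)
    qed
    also have "\<dots> = M\<^sup>2 * (\<Sum>f\<in>F. (norm (blinfun_apply (adj (right_ket f)) v))\<^sup>2)"
      by (rule sum_distrib_left[symmetric])
    also have "\<dots> \<le> M\<^sup>2 * (norm v)\<^sup>2"
      by (intro mult_left_mono sum_adj_right_ket_bound F) simp
    finally show "(\<Sum>f\<in>F. (norm ((K f o\<^sub>L adj (right_ket f)) v))\<^sup>2) \<le> (M * norm v)\<^sup>2"
      by (simp only: power_mult_distrib)
  qed
  then obtain T where T: "T \<in> bop"
    and Ts: "\<And>v. ((\<lambda>f. (K f o\<^sub>L adj (right_ket f)) v) has_sum blinfun_apply T v) onb"
    by blast
  have "blinfun_apply T (x \<otimes>\<^sub>h y) = K y x" for x y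
  proof (rule has_sum_unique[OF Ts])
    have "bounded_linear (\<lambda>f. K f x)"
      by (rule bounded_linear_intro[where K = "M * norm x"])
         (use K_norm[of _ x] in \<open>auto simp: K_add blinfun.add_left scaleR_scaleC K_scale ac_simps\<close>)
    then have "((\<lambda>f. K ((f \<bullet>\<^sub>C y) *\<^sub>C f) x) has_sum K y x) onb"
      using onb_expansion by (rule has_sum_bounded_linear)
    then show "((\<lambda>f. (K f o\<^sub>L adj (right_ket f)) (x \<otimes>\<^sub>h y)) has_sum K y x) onb"
      by (simp add: K_scale bop_scaleC[OF K])
  qed
  with T show ?thesis by blast
qed

definition flip :: "('a::complex_hilbert, 'b::complex_hilbert) htensor \<Rightarrow>\<^sub>L ('b, 'a) htensor" where
  "flip = (THE T. T \<in> bop \<and> (\<forall>x y. blinfun_apply T (x \<otimes>\<^sub>h y) = y \<otimes>\<^sub>h x))"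

lemma ex_flip: "\<exists>T\<in>bop. \<forall>(x::'a::complex_hilbert) (y::'b::complex_hilbert).
    blinfun_apply T (x \<otimes>\<^sub>h y) = y \<otimes>\<^sub>h x"
proof -
  have "\<exists>T\<in>bop. \<forall>(x::'a) (y::'b). blinfun_apply T (x \<otimes>\<^sub>h y) = left_ket y x"
    by (rule ex_operator_slices[where M = 1])
       (auto simp: bop_left_ket tens_add_left tens_scaleC_left onb_cinner blinfun.add_left
         intro!: blinfun_eqI)
  then show ?thesis by simp
qed

lemma the_tens_operator:
  assumes "\<exists>T\<in>bop. \<forall>x y. blinfun_apply T (x \<otimes>\<^sub>h y) = h x y"
  shows "(THE T. T \<in> bop \<and> (\<forall>x y. blinfun_apply T (x \<otimes>\<^sub>h y) = h x y)) \<in> bop \<and>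
    (\<forall>x y. blinfun_apply (THE T. T \<in> bop \<and> (\<forall>x y. blinfun_apply T (x \<otimes>\<^sub>h y) = h x y)) (x \<otimes>\<^sub>h y) = h x y)"
proof (rule theI')
  show "\<exists>!T. T \<in> bop \<and> (\<forall>x y. blinfun_apply T (x \<otimes>\<^sub>h y) = h x y)"
    using assms by (auto intro: blinfun_eq_tensI)
qed

lemma bop_flip: "flip \<in> bop"
  and flip_tens [simp]: "blinfun_apply flip (x \<otimes>\<^sub>h y) = y \<otimes>\<^sub>h x"
  using the_tens_operator[OF ex_flip] unfolding flip_def by auto

definition tensor_op :: "('a::complex_hilbert \<Rightarrow>\<^sub>L 'c::complex_hilbert) \<Rightarrow>
    ('b::complex_hilbert \<Rightarrow>\<^sub>L 'd::complex_hilbert) \<Rightarrow> (('a, 'b) htensor \<Rightarrow>\<^sub>L ('c, 'd) htensor)"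
    (infixr "\<otimes>\<^sub>o" 70) where
  "S \<otimes>\<^sub>o T = (THE R. R \<in> bop \<and> (\<forall>x y. blinfun_apply R (x \<otimes>\<^sub>h y) = S x \<otimes>\<^sub>h T y))"

lemma ex_tensor_op_id:
  fixes S :: "'a::complex_hilbert \<Rightarrow>\<^sub>L 'c::complex_hilbert"
  assumes "S \<in> bop"
  shows "\<exists>R\<in>bop. \<forall>x (y::'b::complex_hilbert). blinfun_apply R (x \<otimes>\<^sub>h y) = S x \<otimes>\<^sub>h y"
proof -
  have "\<exists>R\<in>bop. \<forall>x (y::'b). blinfun_apply R (x \<otimes>\<^sub>h y) = (right_ket y o\<^sub>L S) x"
  proof (rule ex_operator_slices[where M = "norm S"])
    show "right_ket y o\<^sub>L S \<in> bop" for y :: 'b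
      by (intro bop_compose bop_right_ket assms)
    show "right_ket (f + g) o\<^sub>L S = (right_ket f o\<^sub>L S) + (right_ket g o\<^sub>L S)" for f g :: 'b
      by (rule blinfun_eqI) (simp add: tens_add_right blinfun.add_left)
    show "norm ((right_ket f o\<^sub>L S) x) \<le> norm S * norm f * norm x" for f :: 'b and x
      using mult_right_mono[OF norm_blinfun[of S x], of "norm f"] by (simp add: ac_simps)
  qed (auto simp: tens_scaleC_right onb_cinner)
  then show ?thesis by simp
qed

lemma ex_tensor_op:
  fixes S :: "'a::complex_hilbert \<Rightarrow>\<^sub>L 'c::complex_hilbert"
    and T :: "'b::complex_hilbert \<Rightarrow>\<^sub>L 'd::complex_hilbert"
  assumes "S \<in> bop" "T \<in> bop"
  shows "\<exists>R\<in>bop. \<forall>x y. blinfun_apply R (x \<otimes>\<^sub>h y) = S x \<otimes>\<^sub>h T y"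
proof -
  obtain R1 where R1: "R1 \<in> bop" "\<And>x (y::'b). blinfun_apply R1 (x \<otimes>\<^sub>h y) = S x \<otimes>\<^sub>h y"
    using ex_tensor_op_id[OF assms(1)] by blast
  obtain R2 where R2: "R2 \<in> bop" "\<And>y (x::'c). blinfun_apply R2 (y \<otimes>\<^sub>h x) = T y \<otimes>\<^sub>h x"
    using ex_tensor_op_id[OF assms(2)] by blast
  have "flip o\<^sub>L R2 o\<^sub>L flip o\<^sub>L R1 \<in> bop"
    by (intro bop_compose bop_flip R1 R2)
  moreover have "\<forall>x y. blinfun_apply (flip o\<^sub>L R2 o\<^sub>L flip o\<^sub>L R1) (x \<otimes>\<^sub>h y) = S x \<otimes>\<^sub>h T y"
    by (simp add: R1 R2)
  ultimately show ?thesis by blast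
qed

lemma bop_tensor_op: "S \<in> bop \<Longrightarrow> T \<in> bop \<Longrightarrow> S \<otimes>\<^sub>o T \<in> bop"
  and tensor_op_tens: "S \<in> bop \<Longrightarrow> T \<in> bop \<Longrightarrow> blinfun_apply (S \<otimes>\<^sub>o T) (x \<otimes>\<^sub>h y) = S x \<otimes>\<^sub>h T y"
  using the_tens_operator[OF ex_tensor_op[of S T]] unfolding tensor_op_def by auto

definition assoc :: "(('a::complex_hilbert, 'b::complex_hilbert) htensor, 'c::complex_hilbert) htensor
    \<Rightarrow>\<^sub>L ('a, ('b, 'c) htensor) htensor" where
  "assoc = (THE T. T \<in> bop \<and> (\<forall>x y z. blinfun_apply T ((x \<otimes>\<^sub>h y) \<otimes>\<^sub>h z) = x \<otimes>\<^sub>h (y \<otimes>\<^sub>h z)))"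

lemma blinfun_eq_tens3I:
  assumes "S \<in> bop" "T \<in> bop"
    and eq: "\<And>x y z. blinfun_apply S ((x \<otimes>\<^sub>h y) \<otimes>\<^sub>h z) = blinfun_apply T ((x \<otimes>\<^sub>h y) \<otimes>\<^sub>h z)"
  shows "S = T"
proof (rule blinfun_eq_tensI[OF assms(1,2)])
  fix w z
  have "S o\<^sub>L right_ket z = T o\<^sub>L right_ket z"
    by (rule blinfun_eq_tensI) (auto simp: eq intro!: bop_compose bop_right_ket assms)
  then show "blinfun_apply S (w \<otimes>\<^sub>h z) = blinfun_apply T (w \<otimes>\<^sub>h z)"
    by (metis blinfun_apply_blinfun_compose right_ket_apply)
qed

lemma ex_assoc:
  "\<exists>T\<in>bop. \<forall>(w::('a::complex_hilbert, 'b::complex_hilbert) htensor) (z::'c::complex_hilbert).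
    blinfun_apply T (w \<otimes>\<^sub>h z) = (id_blinfun \<otimes>\<^sub>o right_ket z) w"
proof (rule ex_operator_slices[where M = 1])
  note b = bop_id bop_right_ket bop_tensor_op tensor_op_tens
  let ?K = "\<lambda>z. (id_blinfun :: 'a \<Rightarrow>\<^sub>L 'a) \<otimes>\<^sub>o (right_ket z :: 'b \<Rightarrow>\<^sub>L ('b, 'c) htensor)"
  have gram: "adj (?K f) o\<^sub>L ?K g = (f \<bullet>\<^sub>C g) *\<^sub>C id_blinfun" for f g
  proof (rule blinfun_eq_tensI)
    show "adj (?K f) o\<^sub>L ?K g \<in> bop"
      by (intro bop_compose bop_adj b)
    show "(f \<bullet>\<^sub>C g) *\<^sub>C id_blinfun \<in> bop"
      by (simp add: bop_def scaleC_blinfun_apply scaleC_scaleC mult.commute)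
    fix x :: 'a and y :: 'b
    have "adj (?K f) (x \<otimes>\<^sub>h (y \<otimes>\<^sub>h g)) - (f \<bullet>\<^sub>C g) *\<^sub>C (x \<otimes>\<^sub>h y) = 0"
      by (rule tens_total) (simp add: cinner.diff_right cinner_adj_right b)
    then show "blinfun_apply (adj (?K f) o\<^sub>L ?K g) (x \<otimes>\<^sub>h y) = blinfun_apply ((f \<bullet>\<^sub>C g) *\<^sub>C id_blinfun) (x \<otimes>\<^sub>h y)"
      by (simp add: b scaleC_blinfun_apply)
  qed
  have inner: "?K f v \<bullet>\<^sub>C ?K g w = (f \<bullet>\<^sub>C g) * (v \<bullet>\<^sub>C w)" for f g v w
  proof -
    have "?K f v \<bullet>\<^sub>C ?K g w = v \<bullet>\<^sub>C (adj (?K f) o\<^sub>L ?K g) w"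
      by (simp add: cinner_adj_right b)
    then show ?thesis
      by (simp add: gram scaleC_blinfun_apply)
  qed
  show "?K f \<in> bop" for f
    by (intro b)
  show "?K (f + g) = ?K f + ?K g" for f g
    by (rule blinfun_eq_tensI)
       (auto simp: b tens_add_right blinfun.add_left bop_scaleC scaleC_add_right intro!: bopI)
  show "blinfun_apply (?K (c *\<^sub>C f)) w = c *\<^sub>C blinfun_apply (?K f) w" for c f w
  proof -
    have "?K (c *\<^sub>C f) = c *\<^sub>C ?K f"
      by (rule blinfun_eq_tensI)
         (auto simp: b tens_scaleC_right bop_scaleC scaleC_blinfun_apply scaleC_scaleC mult.commute
           intro!: bopI)
    then show ?thesis
      by (simp add: scaleC_blinfun_apply)
  qed
  show "norm (?K f w) \<le> 1 * norm f * norm w" for f w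
  proof -
    have "complex_of_real ((norm (?K f w))\<^sup>2) = of_real ((norm f * norm w)\<^sup>2)"
      unfolding cinner_self[symmetric] inner by (simp add: cinner_self power_mult_distrib)
    then have "(norm (?K f w))\<^sup>2 = (norm f * norm w)\<^sup>2"
      by (simp only: of_real_eq_iff)
    then have "norm (?K f w) = norm f * norm w"
      by (rule power2_eq_imp_eq) simp_all
    then show ?thesis by simp
  qed
  show "?K f v \<bullet>\<^sub>C ?K g w = 0" if "f \<in> onb" "g \<in> onb" "f \<noteq> g" for f g v w
    using that by (simp add: inner onb_cinner)
qed simp

lemma the_assoc:
  "(assoc :: (('a::complex_hilbert, 'b::complex_hilbert) htensor, 'c::complex_hilbert) htensor
      \<Rightarrow>\<^sub>L ('a, ('b, 'c) htensor) htensor) \<in> bop \<and>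
    (\<forall>(x::'a) (y::'b) (z::'c). blinfun_apply assoc ((x \<otimes>\<^sub>h y) \<otimes>\<^sub>h z) = x \<otimes>\<^sub>h (y \<otimes>\<^sub>h z))"
  unfolding assoc_def
proof (rule theI', rule ex_ex1I)
  show "\<exists>T. T \<in> bop \<and> (\<forall>(x::'a) (y::'b) (z::'c). blinfun_apply T ((x \<otimes>\<^sub>h y) \<otimes>\<^sub>h z) = x \<otimes>\<^sub>h (y \<otimes>\<^sub>h z))"
    using ex_assoc by (auto simp: tensor_op_tens bop_id bop_right_ket)
qed (auto intro: blinfun_eq_tens3I)

lemma bop_assoc: "assoc \<in> bop"
  and assoc_tens [simp]: "blinfun_apply assoc ((x \<otimes>\<^sub>h y) \<otimes>\<^sub>h z) = x \<otimes>\<^sub>h (y \<otimes>\<^sub>h z)"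
  using the_assoc by auto

lemma tens3_total:
  assumes "\<And>x y z. (x \<otimes>\<^sub>h (y \<otimes>\<^sub>h z)) \<bullet>\<^sub>C v = 0"
  shows "v = 0"
proof (rule tens_total)
  fix x w
  have "blinfun_apply (adj (left_ket x)) v = 0"
    by (rule tens_total) (simp add: cinner_adj_right bop_left_ket assms)
  then show "(x \<otimes>\<^sub>h w) \<bullet>\<^sub>C v = 0"
    by (metis bop_left_ket cinner.zero_right cinner_adj_right left_ket_apply)
qed

lemma adj_flip_tens: "blinfun_apply (adj flip) (x \<otimes>\<^sub>h y) = y \<otimes>\<^sub>h x"
proof -
  have "adj flip (x \<otimes>\<^sub>h y) - (y \<otimes>\<^sub>h x) = 0"
    by (rule tens_total) (simp add: cinner.diff_right cinner_adj_right bop_flip mult.commute)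
  then show ?thesis by simp
qed

lemma unitary_flip: "unitary flip"
  unfolding unitary_def
  by (auto intro!: blinfun_eq_tensI bop_compose bop_adj bop_flip bop_id simp: adj_flip_tens)

lemma adj_assoc_tens: "blinfun_apply (adj assoc) (x \<otimes>\<^sub>h (y \<otimes>\<^sub>h z)) = (x \<otimes>\<^sub>h y) \<otimes>\<^sub>h z"
proof -
  have "(u \<otimes>\<^sub>h w) \<bullet>\<^sub>C (adj assoc (x \<otimes>\<^sub>h (y \<otimes>\<^sub>h z)) - ((x \<otimes>\<^sub>h y) \<otimes>\<^sub>h z)) = 0" for u w
  proof -
    have "adj (right_ket w) (adj assoc (x \<otimes>\<^sub>h (y \<otimes>\<^sub>h z)) - ((x \<otimes>\<^sub>h y) \<otimes>\<^sub>h z)) = 0"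
      by (rule tens_total)
         (simp add: cinner.diff_right cinner_adj_right bop_right_ket bop_assoc mult.assoc)
    then show ?thesis
      by (metis bop_right_ket cinner.zero_right cinner_adj_right right_ket_apply)
  qed
  then have "adj assoc (x \<otimes>\<^sub>h (y \<otimes>\<^sub>h z)) - ((x \<otimes>\<^sub>h y) \<otimes>\<^sub>h z) = 0"
    by (rule tens_total)
  then show ?thesis by simp
qed

lemma unitary_assoc: "unitary assoc"
  unfolding unitary_def
proof (intro conjI bop_assoc)
  show "adj assoc o\<^sub>L assoc = (id_blinfun :: (('a, 'b) htensor, 'c) htensor \<Rightarrow>\<^sub>L _)"
    by (rule blinfun_eq_tens3I) (auto intro!: bop_compose bop_adj bop_assoc bop_id simp: adj_assoc_tens)
  show "assoc o\<^sub>L adj assoc = (id_blinfun :: ('a, ('b, 'c) htensor) htensor \<Rightarrow>\<^sub>L _)"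
  proof (rule blinfun_eqI)
    fix v :: "('a, ('b, 'c) htensor) htensor"
    have "assoc (adj assoc v) - v = 0"
    proof (rule tens3_total)
      fix x y z
      have "(x \<otimes>\<^sub>h (y \<otimes>\<^sub>h z)) \<bullet>\<^sub>C assoc (adj assoc v) = (x \<otimes>\<^sub>h (y \<otimes>\<^sub>h z)) \<bullet>\<^sub>C v"
        by (simp add: cinner_adj[OF bop_assoc, symmetric] adj_assoc_tens)
           (simp add: cinner_adj_right[OF bop_assoc])
      then show "(x \<otimes>\<^sub>h (y \<otimes>\<^sub>h z)) \<bullet>\<^sub>C (assoc (adj assoc v) - v) = 0"
        by (simp add: cinner.diff_right)
    qed
    then show "blinfun_apply (assoc o\<^sub>L adj assoc) v = blinfun_apply id_blinfun v"
      by simp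
  qed
qed


section \<open>Concrete \<open>C\<close>*-algebras, multipliers and morphisms\<close>

text \<open>All \<open>C\<close>*-algebras are norm-closed *-subalgebras of bounded operators acting nondegenerately
  on a Hilbert space, and the multiplier algebra is realised on the same Hilbert space as the
  idealiser.\<close>

definition multipliers :: "('a::complex_hilbert \<Rightarrow>\<^sub>L 'a) set \<Rightarrow> ('a \<Rightarrow>\<^sub>L 'a) set" where
  "multipliers A = {m \<in> bop. \<forall>a\<in>A. m o\<^sub>L a \<in> A \<and> a o\<^sub>L m \<in> A}"

definition tensor_alg :: "('a::complex_hilbert \<Rightarrow>\<^sub>L 'a) set \<Rightarrow> ('b::complex_hilbert \<Rightarrow>\<^sub>L 'b) set \<Rightarrow>
    (('a, 'b) htensor \<Rightarrow>\<^sub>L ('a, 'b) htensor) set" (infixr "\<otimes>\<^sub>a" 70) where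
  "A \<otimes>\<^sub>a B = closure (cspan {a \<otimes>\<^sub>o b |a b. a \<in> A \<and> b \<in> B})"

text \<open>Morphisms are functions on the set \<open>A\<close>, made total by extensionality.\<close>

definition morphism :: "('a::complex_hilbert \<Rightarrow>\<^sub>L 'a) set \<Rightarrow> ('b::complex_hilbert \<Rightarrow>\<^sub>L 'b) set \<Rightarrow>
    (('a \<Rightarrow>\<^sub>L 'a) \<Rightarrow> ('b \<Rightarrow>\<^sub>L 'b)) \<Rightarrow> bool" where
  "morphism A B \<phi> \<longleftrightarrow> \<phi> \<in> extensional A \<and>
    (\<forall>a\<in>A. \<phi> a \<in> multipliers B) \<and>
    (\<forall>a\<in>A. \<forall>b\<in>A. \<phi> (a + b) = \<phi> a + \<phi> b) \<and>
    (\<forall>c. \<forall>a\<in>A. \<phi> (c *\<^sub>C a) = c *\<^sub>C \<phi> a) \<and>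
    (\<forall>a\<in>A. \<forall>b\<in>A. \<phi> (a o\<^sub>L b) = \<phi> a o\<^sub>L \<phi> b) \<and>
    (\<forall>a\<in>A. \<phi> (adj a) = adj (\<phi> a)) \<and>
    closure (cspan {\<phi> a o\<^sub>L b |a b. a \<in> A \<and> b \<in> B}) = B"

text \<open>The unique extension of a morphism to multipliers: \<open>\<phi>(m) \<phi>(a) b = \<phi>(m a) b\<close> for all
  \<open>a \<in> A\<close> and \<open>b \<in> B\<close>.\<close>

definition extend_morphism :: "('a::complex_hilbert \<Rightarrow>\<^sub>L 'a) set \<Rightarrow> ('b::complex_hilbert \<Rightarrow>\<^sub>L 'b) set \<Rightarrow>
    (('a \<Rightarrow>\<^sub>L 'a) \<Rightarrow> ('b \<Rightarrow>\<^sub>L 'b)) \<Rightarrow> ('a \<Rightarrow>\<^sub>L 'a) \<Rightarrow> ('b \<Rightarrow>\<^sub>L 'b)" where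
  "extend_morphism A B \<phi> m =
    (THE n. n \<in> multipliers B \<and> (\<forall>a\<in>A. \<forall>b\<in>B. n o\<^sub>L \<phi> a o\<^sub>L b = \<phi> (m o\<^sub>L a) o\<^sub>L b))"

definition tensor_morphism :: "('a::complex_hilbert \<Rightarrow>\<^sub>L 'a) set \<Rightarrow> ('b::complex_hilbert \<Rightarrow>\<^sub>L 'b) set \<Rightarrow>
    (('a \<Rightarrow>\<^sub>L 'a) \<Rightarrow> ('b \<Rightarrow>\<^sub>L 'b)) \<Rightarrow>
    ('c::complex_hilbert \<Rightarrow>\<^sub>L 'c) set \<Rightarrow> ('d::complex_hilbert \<Rightarrow>\<^sub>L 'd) set \<Rightarrow>
    (('c \<Rightarrow>\<^sub>L 'c) \<Rightarrow> ('d \<Rightarrow>\<^sub>L 'd)) \<Rightarrow>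
    (('a, 'c) htensor \<Rightarrow>\<^sub>L ('a, 'c) htensor) \<Rightarrow> (('b, 'd) htensor \<Rightarrow>\<^sub>L ('b, 'd) htensor)" where
  "tensor_morphism A B \<phi> C D \<psi> =
    (THE \<Theta>. morphism (A \<otimes>\<^sub>a C) (B \<otimes>\<^sub>a D) \<Theta> \<and> (\<forall>a\<in>A. \<forall>c\<in>C. \<Theta> (a \<otimes>\<^sub>o c) = \<phi> a \<otimes>\<^sub>o \<psi> c))"

text \<open>\<open>id\<^sub>D \<otimes> \<phi>\<close> and \<open>\<phi> \<otimes> id\<^sub>D\<close> for a morphism \<open>\<phi>\<close> from \<open>A\<close> to \<open>B\<close>, extended to multipliers.\<close>

definition id_tensor :: "('d::complex_hilbert \<Rightarrow>\<^sub>L 'd) set \<Rightarrow>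
    ('a::complex_hilbert \<Rightarrow>\<^sub>L 'a) set \<Rightarrow> ('b::complex_hilbert \<Rightarrow>\<^sub>L 'b) set \<Rightarrow>
    (('a \<Rightarrow>\<^sub>L 'a) \<Rightarrow> ('b \<Rightarrow>\<^sub>L 'b)) \<Rightarrow>
    (('d, 'a) htensor \<Rightarrow>\<^sub>L ('d, 'a) htensor) \<Rightarrow> (('d, 'b) htensor \<Rightarrow>\<^sub>L ('d, 'b) htensor)" where
  "id_tensor D A B \<phi> =
    extend_morphism (D \<otimes>\<^sub>a A) (D \<otimes>\<^sub>a B) (tensor_morphism D D (\<lambda>d\<in>D. d) A B \<phi>)"

definition tensor_id :: "('a::complex_hilbert \<Rightarrow>\<^sub>L 'a) set \<Rightarrow> ('b::complex_hilbert \<Rightarrow>\<^sub>L 'b) set \<Rightarrow>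
    (('a \<Rightarrow>\<^sub>L 'a) \<Rightarrow> ('b \<Rightarrow>\<^sub>L 'b)) \<Rightarrow> ('d::complex_hilbert \<Rightarrow>\<^sub>L 'd) set \<Rightarrow>
    (('a, 'd) htensor \<Rightarrow>\<^sub>L ('a, 'd) htensor) \<Rightarrow> (('b, 'd) htensor \<Rightarrow>\<^sub>L ('b, 'd) htensor)" where
  "tensor_id A B \<phi> D =
    extend_morphism (A \<otimes>\<^sub>a D) (B \<otimes>\<^sub>a D) (tensor_morphism A B \<phi> D D (\<lambda>d\<in>D. d))"

text \<open>Threefold tensor products are bracketed to the right, \<open>H \<otimes> (K \<otimes> L)\<close>.\<close>

definition reassoc :: "((('a::complex_hilbert, 'b::complex_hilbert) htensor, 'c::complex_hilbert) htensor
      \<Rightarrow>\<^sub>L (('a, 'b) htensor, 'c) htensor)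
    \<Rightarrow> (('a, ('b, 'c) htensor) htensor \<Rightarrow>\<^sub>L ('a, ('b, 'c) htensor) htensor)" where
  "reassoc X = assoc o\<^sub>L X o\<^sub>L adj assoc"

definition leg12 :: "(('a::complex_hilbert, 'b::complex_hilbert) htensor \<Rightarrow>\<^sub>L ('a, 'b) htensor)
    \<Rightarrow> (('a, ('b, 'c::complex_hilbert) htensor) htensor \<Rightarrow>\<^sub>L ('a, ('b, 'c) htensor) htensor)" where
  "leg12 X = reassoc (X \<otimes>\<^sub>o id_blinfun)"

definition leg23 :: "(('b::complex_hilbert, 'c::complex_hilbert) htensor \<Rightarrow>\<^sub>L ('b, 'c) htensor)
    \<Rightarrow> (('a::complex_hilbert, ('b, 'c) htensor) htensor \<Rightarrow>\<^sub>L ('a, ('b, 'c) htensor) htensor)" where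
  "leg23 X = id_blinfun \<otimes>\<^sub>o X"

definition leg13 :: "(('a::complex_hilbert, 'c::complex_hilbert) htensor \<Rightarrow>\<^sub>L ('a, 'c) htensor)
    \<Rightarrow> (('a, ('b::complex_hilbert, 'c) htensor) htensor \<Rightarrow>\<^sub>L ('a, ('b, 'c) htensor) htensor)" where
  "leg13 X = (id_blinfun \<otimes>\<^sub>o flip) o\<^sub>L leg12 X o\<^sub>L (id_blinfun \<otimes>\<^sub>o flip)"


section \<open>Modular multiplicative unitaries\<close>

definition multiplicative :: "(('a::complex_hilbert, 'a) htensor \<Rightarrow>\<^sub>L ('a, 'a) htensor) \<Rightarrow> bool" where
  "multiplicative W \<longleftrightarrow> leg23 W o\<^sub>L leg12 W = leg12 W o\<^sub>L leg13 W o\<^sub>L leg23 W"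

text \<open>Unbounded operators are represented by their graphs; in particular, the inverse of an
  injective operator is the converse of its graph.\<close>

definition self_adjoint :: "('a::complex_hilbert \<times> 'a) set \<Rightarrow> bool" where
  "self_adjoint Q \<longleftrightarrow> csubspace Q \<and> single_valued Q \<and> closure (Domain Q) = UNIV \<and>
    Q = {(y, z). \<forall>(x, w)\<in>Q. w \<bullet>\<^sub>C y = x \<bullet>\<^sub>C z}"

definition positive_with_trivial_kernel :: "('a::complex_hilbert \<times> 'a) set \<Rightarrow> bool" where
  "positive_with_trivial_kernel Q \<longleftrightarrow> self_adjoint Q \<and>
    (\<forall>(x, w)\<in>Q. x \<bullet>\<^sub>C w \<in> \<real>\<^sub>\<ge>\<^sub>0) \<and> (\<forall>x. (x, 0) \<in> Q \<longrightarrow> x = 0)"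

text \<open>The tensor product of two closed operators is the closure of their algebraic tensor product.\<close>

definition graph_tensor :: "('a::complex_hilbert \<times> 'a) set \<Rightarrow> ('b::complex_hilbert \<times> 'b) set \<Rightarrow>
    (('a, 'b) htensor \<times> ('a, 'b) htensor) set" where
  "graph_tensor P Q = closure (cspan {(x \<otimes>\<^sub>h y, x' \<otimes>\<^sub>h y') |x x' y y'. (x, x') \<in> P \<and> (y, y') \<in> Q})"

text \<open>The pair \<open>(u', u) \<in> Q\<close> below encodes \<open>u' = Q\<^sup>-\<^sup>1 u\<close>, and the set on the left-hand side of the
  invariance condition is the graph of \<open>W\<^sup>* (Q' \<otimes> Q) W\<close>.\<close>

definition modular :: "(('a::complex_hilbert, 'a) htensor \<Rightarrow>\<^sub>L ('a, 'a) htensor) \<Rightarrow> bool" where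
  "modular W \<longleftrightarrow> (\<exists>Q' Q (W' :: ('a conj_space, 'a) htensor \<Rightarrow>\<^sub>L ('a conj_space, 'a) htensor).
    positive_with_trivial_kernel Q' \<and> positive_with_trivial_kernel Q \<and> unitary W' \<and>
    {(v, w). (blinfun_apply W v, blinfun_apply W w) \<in> graph_tensor Q' Q} = graph_tensor Q' Q \<and>
    (\<forall>x z. \<forall>(y, Qy)\<in>Q. \<forall>(u', u)\<in>Q.
      (x \<otimes>\<^sub>h y) \<bullet>\<^sub>C W (z \<otimes>\<^sub>h u) = (bar z \<otimes>\<^sub>h Qy) \<bullet>\<^sub>C W' (bar x \<otimes>\<^sub>h u')))"

definition modular_multiplicative_unitary ::
    "(('a::complex_hilbert, 'a) htensor \<Rightarrow>\<^sub>L ('a, 'a) htensor) \<Rightarrow> bool" where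
  "modular_multiplicative_unitary W \<longleftrightarrow> unitary W \<and> multiplicative W \<and> modular W"


section \<open>Quantum groups\<close>

text \<open>The predual consists of the normal functionals, which are the countable sums of vector
  functionals \<open>T \<mapsto> \<langle>\<xi>\<^sub>n, T \<eta>\<^sub>n\<rangle>\<close> with square-summable \<open>\<parallel>\<xi>\<^sub>n\<parallel>\<close> and \<open>\<parallel>\<eta>\<^sub>n\<parallel>\<close>.\<close>

definition predual :: "(('a::complex_hilbert \<Rightarrow>\<^sub>L 'a) \<Rightarrow> complex) set" where
  "predual = {\<omega>. \<exists>\<xi> \<eta> :: nat \<Rightarrow> 'a. summable (\<lambda>n. (norm (\<xi> n))\<^sup>2) \<and> summable (\<lambda>n. (norm (\<eta> n))\<^sup>2) \<and>
    \<omega> = (\<lambda>T. \<Sum>n. \<xi> n \<bullet>\<^sub>C blinfun_apply T (\<eta> n))}"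

text \<open>\<open>(\<omega> \<otimes> id)(X)\<close> and \<open>(id \<otimes> \<omega>)(X)\<close>, characterised by their matrix coefficients.\<close>

definition slice_left :: "(('a::complex_hilbert \<Rightarrow>\<^sub>L 'a) \<Rightarrow> complex) \<Rightarrow>
    (('a, 'b::complex_hilbert) htensor \<Rightarrow>\<^sub>L ('a, 'b) htensor) \<Rightarrow> ('b \<Rightarrow>\<^sub>L 'b)" where
  "slice_left \<omega> X = (THE S. S \<in> bop \<and>
    (\<forall>y u. y \<bullet>\<^sub>C blinfun_apply S u = \<omega> (adj (right_ket y) o\<^sub>L X o\<^sub>L right_ket u)))"

definition slice_right :: "(('b::complex_hilbert \<Rightarrow>\<^sub>L 'b) \<Rightarrow> complex) \<Rightarrow>
    (('a::complex_hilbert, 'b) htensor \<Rightarrow>\<^sub>L ('a, 'b) htensor) \<Rightarrow> ('a \<Rightarrow>\<^sub>L 'a)" where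
  "slice_right \<omega> X = (THE S. S \<in> bop \<and>
    (\<forall>x z. x \<bullet>\<^sub>C blinfun_apply S z = \<omega> (adj (left_ket x) o\<^sub>L X o\<^sub>L left_ket z)))"

lemma norm_adj_le:
  fixes T :: "'a::complex_hilbert \<Rightarrow>\<^sub>L 'b::complex_hilbert"
  assumes "T \<in> bop"
  shows "norm (adj T) \<le> norm T"
proof (rule norm_blinfun_bound)
  fix y
  have "complex_of_real ((norm (adj T y))\<^sup>2) = y \<bullet>\<^sub>C T (adj T y)"
    unfolding cinner_self[symmetric] by (rule cinner_adj[OF assms])
  then have "(norm (adj T y))\<^sup>2 = cmod (y \<bullet>\<^sub>C T (adj T y))"
    by (metis abs_power2 norm_of_real)
  also have "\<dots> \<le> norm y * norm (T (adj T y))"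
    by (rule norm_cinner)
  also have "\<dots> \<le> norm y * (norm T * norm (adj T y))"
    by (intro mult_left_mono norm_blinfun) simp
  finally show "norm (adj T y) \<le> norm T * norm y"
    by (cases "norm (adj T y) = 0") (auto simp: power2_eq_square ac_simps)
qed simp

lemma ex_operator_series:
  fixes P Q :: "nat \<Rightarrow> 'b::complex_hilbert \<Rightarrow>\<^sub>L 'k::complex_hilbert" and X :: "'k \<Rightarrow>\<^sub>L 'k"
  assumes bop: "\<And>n. P n \<in> bop" "\<And>n. Q n \<in> bop" "X \<in> bop"
    and summ: "summable (\<lambda>n. (norm (P n))\<^sup>2)" "summable (\<lambda>n. (norm (Q n))\<^sup>2)"
  shows "\<exists>!S. S \<in> bop \<and> (\<forall>y u. y \<bullet>\<^sub>C blinfun_apply S u = (\<Sum>n. P n y \<bullet>\<^sub>C X (Q n u)))"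
proof (rule ex_ex1I)
  let ?R = "\<lambda>n. adj (P n) o\<^sub>L X o\<^sub>L Q n"
  have "summable ?R"
  proof (rule summable_comparison_test')
    show "summable (\<lambda>n. norm X * ((norm (P n))\<^sup>2 + (norm (Q n))\<^sup>2))"
      by (intro summable_mult summable_add summ)
    fix n
    have "norm (?R n) \<le> norm (adj (P n)) * norm X * norm (Q n)"
      by (meson norm_blinfun_compose mult_right_mono norm_ge_zero order_trans)
    also have "\<dots> \<le> norm (P n) * norm X * norm (Q n)"
      by (intro mult_right_mono norm_adj_le bop) auto
    also have "\<dots> = norm X * (norm (P n) * norm (Q n))"
      by simp
    also have "\<dots> \<le> norm X * ((norm (P n))\<^sup>2 + (norm (Q n))\<^sup>2)"
    proof (rule mult_left_mono)
      have "0 \<le> (norm (P n) - norm (Q n))\<^sup>2 + (norm (P n))\<^sup>2 + (norm (Q n))\<^sup>2"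
        by simp
      then show "norm (P n) * norm (Q n) \<le> (norm (P n))\<^sup>2 + (norm (Q n))\<^sup>2"
        unfolding power2_diff by linarith
    qed simp
    finally show "norm (?R n) \<le> norm X * ((norm (P n))\<^sup>2 + (norm (Q n))\<^sup>2)" .
  qed
  then have "?R sums suminf ?R"
    by (rule summable_sums)
  then have ap: "(\<lambda>n. ?R n u) sums suminf ?R u" for u
    using bounded_linear.sums[OF blinfun.bounded_linear_left] by blast
  have "suminf ?R \<in> bop"
  proof (rule bopI)
    fix c u
    have "(\<lambda>n. c *\<^sub>C ?R n u) sums (c *\<^sub>C suminf ?R u)"
      using bounded_linear.sums[OF bounded_linear_scaleC ap] .
    moreover have "c *\<^sub>C ?R n u = ?R n (c *\<^sub>C u)" for n
      by (simp add: bop bop_adj bop_scaleC)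
    ultimately have "(\<lambda>n. ?R n (c *\<^sub>C u)) sums (c *\<^sub>C suminf ?R u)"
      by (simp only:)
    with ap show "suminf ?R (c *\<^sub>C u) = c *\<^sub>C suminf ?R u"
      by (rule sums_unique2)
  qed
  moreover have "y \<bullet>\<^sub>C suminf ?R u = (\<Sum>n. P n y \<bullet>\<^sub>C X (Q n u))" for y u
  proof -
    have "(\<lambda>n. y \<bullet>\<^sub>C ?R n u) sums (y \<bullet>\<^sub>C suminf ?R u)"
      using bounded_linear.sums[OF cinner.bounded_linear_right ap] .
    then show ?thesis
      by (simp add: bop cinner_adj_right sums_iff)
  qed
  ultimately show "\<exists>S. S \<in> bop \<and> (\<forall>y u. y \<bullet>\<^sub>C blinfun_apply S u = (\<Sum>n. P n y \<bullet>\<^sub>C X (Q n u)))"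
    by blast
next
  fix S T
  assume "S \<in> bop \<and> (\<forall>y u. y \<bullet>\<^sub>C blinfun_apply S u = (\<Sum>n. P n y \<bullet>\<^sub>C X (Q n u)))"
    and "T \<in> bop \<and> (\<forall>y u. y \<bullet>\<^sub>C blinfun_apply T u = (\<Sum>n. P n y \<bullet>\<^sub>C X (Q n u)))"
  then show "S = T"
    by (intro blinfun_eqI cinner_eqI) simp
qed

lemma norm_left_ket_le: "norm (left_ket x) \<le> norm x"
  and norm_right_ket_le: "norm (right_ket y) \<le> norm y"
  by (rule norm_blinfun_bound; simp add: mult.commute)+

lemma summable_norm_sq_mono:
  assumes "summable (\<lambda>n. (norm (x n))\<^sup>2)" "\<And>n. norm (y n) \<le> norm (x n)"
  shows "summable (\<lambda>n::nat. (norm (y n))\<^sup>2)"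
  by (rule summable_comparison_test'[OF assms(1)]) (simp add: assms(2) power_mono)

lemma slice_left:
  assumes "\<omega> \<in> predual" "X \<in> bop"
  shows "slice_left \<omega> X \<in> bop \<and>
    (\<forall>y u. y \<bullet>\<^sub>C blinfun_apply (slice_left \<omega> X) u = \<omega> (adj (right_ket y) o\<^sub>L X o\<^sub>L right_ket u))"
  unfolding slice_left_def
proof (rule theI')
  obtain \<xi> \<eta> where s: "summable (\<lambda>n. (norm (\<xi> n))\<^sup>2)" "summable (\<lambda>n. (norm (\<eta> n))\<^sup>2)"
    and \<omega>: "\<omega> = (\<lambda>T. \<Sum>n. \<xi> n \<bullet>\<^sub>C blinfun_apply T (\<eta> n))"
    using assms(1) unfolding predual_def by blast
  have "\<omega> (adj (right_ket y) o\<^sub>L X o\<^sub>L right_ket u) = (\<Sum>n. left_ket (\<xi> n) y \<bullet>\<^sub>C X (left_ket (\<eta> n) u))" for y u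
    by (simp add: \<omega> cinner_adj_right bop_right_ket)
  then show "\<exists>!S. S \<in> bop \<and>
      (\<forall>y u. y \<bullet>\<^sub>C blinfun_apply S u = \<omega> (adj (right_ket y) o\<^sub>L X o\<^sub>L right_ket u))"
    by (simp only:)
       (intro ex_operator_series bop_left_ket assms s[THEN summable_norm_sq_mono] norm_left_ket_le)
qed

lemma slice_right:
  assumes "\<omega> \<in> predual" "X \<in> bop"
  shows "slice_right \<omega> X \<in> bop \<and>
    (\<forall>x z. x \<bullet>\<^sub>C blinfun_apply (slice_right \<omega> X) z = \<omega> (adj (left_ket x) o\<^sub>L X o\<^sub>L left_ket z))"
  unfolding slice_right_def
proof (rule theI')
  obtain \<xi> \<eta> where s: "summable (\<lambda>n. (norm (\<xi> n))\<^sup>2)" "summable (\<lambda>n. (norm (\<eta> n))\<^sup>2)"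
    and \<omega>: "\<omega> = (\<lambda>T. \<Sum>n. \<xi> n \<bullet>\<^sub>C blinfun_apply T (\<eta> n))"
    using assms(1) unfolding predual_def by blast
  have "\<omega> (adj (left_ket x) o\<^sub>L X o\<^sub>L left_ket z) = (\<Sum>n. right_ket (\<xi> n) x \<bullet>\<^sub>C X (right_ket (\<eta> n) z))" for x z
    by (simp add: \<omega> cinner_adj_right bop_left_ket)
  then show "\<exists>!S. S \<in> bop \<and>
      (\<forall>x z. x \<bullet>\<^sub>C blinfun_apply S z = \<omega> (adj (left_ket x) o\<^sub>L X o\<^sub>L left_ket z))"
    by (simp only:)
       (intro ex_operator_series bop_right_ket assms s[THEN summable_norm_sq_mono] norm_right_ket_le)
qed

definition quantum_group :: "(('a::complex_hilbert, 'a) htensor \<Rightarrow>\<^sub>L ('a, 'a) htensor) \<Rightarrow>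
    ('a \<Rightarrow>\<^sub>L 'a) set \<Rightarrow> (('a \<Rightarrow>\<^sub>L 'a) \<Rightarrow> (('a, 'a) htensor \<Rightarrow>\<^sub>L ('a, 'a) htensor)) \<Rightarrow> bool" where
  "quantum_group W C \<Delta> \<longleftrightarrow> modular_multiplicative_unitary W \<and>
    C = closure {slice_left \<omega> W |\<omega>. \<omega> \<in> predual} \<and>
    \<Delta> = (\<lambda>x\<in>C. W o\<^sub>L (x \<otimes>\<^sub>o id_blinfun) o\<^sub>L adj W)"

definition dual_algebra :: "(('a::complex_hilbert, 'a) htensor \<Rightarrow>\<^sub>L ('a, 'a) htensor) \<Rightarrow>
    ('a \<Rightarrow>\<^sub>L 'a) set" where
  "dual_algebra W = closure {slice_right \<omega> (adj W) |\<omega>. \<omega> \<in> predual}"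

definition dual_comult :: "(('a::complex_hilbert, 'a) htensor \<Rightarrow>\<^sub>L ('a, 'a) htensor) \<Rightarrow>
    ('a \<Rightarrow>\<^sub>L 'a) \<Rightarrow> (('a, 'a) htensor \<Rightarrow>\<^sub>L ('a, 'a) htensor)" where
  "dual_comult W =
    (\<lambda>y\<in>dual_algebra W. flip o\<^sub>L adj W o\<^sub>L (id_blinfun \<otimes>\<^sub>o y) o\<^sub>L W o\<^sub>L flip)"


section \<open>Bicharacters and right quantum group homomorphisms\<close>

text \<open>Since multipliers are operators, a unitary multiplier of the tensor product of the dual
  of \<open>C\<close> with \<open>A\<close> and the corresponding concrete unitary on \<open>H\<^sub>C \<otimes> H\<^sub>A\<close> are the same object; in particular the reduced bicharacter of a
  quantum group is the multiplicative unitary itself.\<close>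

definition unitary_multipliers :: "('a::complex_hilbert \<Rightarrow>\<^sub>L 'a) set \<Rightarrow> ('a \<Rightarrow>\<^sub>L 'a) set" where
  "unitary_multipliers A = {U \<in> multipliers A. unitary U}"

definition bicharacter ::
    "(('c::complex_hilbert, 'c) htensor \<Rightarrow>\<^sub>L ('c, 'c) htensor) \<Rightarrow>
    ('a::complex_hilbert \<Rightarrow>\<^sub>L 'a) set \<Rightarrow> (('a \<Rightarrow>\<^sub>L 'a) \<Rightarrow> (('a, 'a) htensor \<Rightarrow>\<^sub>L ('a, 'a) htensor)) \<Rightarrow>
    (('c, 'a) htensor \<Rightarrow>\<^sub>L ('c, 'a) htensor) \<Rightarrow> bool" where
  "bicharacter W\<^sub>C A \<Delta>\<^sub>A V \<longleftrightarrow> (let C' = dual_algebra W\<^sub>C; \<Delta>' = dual_comult W\<^sub>C in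
    V \<in> unitary_multipliers (C' \<otimes>\<^sub>a A) \<and>
    reassoc (tensor_id C' (C' \<otimes>\<^sub>a C') \<Delta>' A V) = leg23 V o\<^sub>L leg13 V \<and>
    id_tensor C' A (A \<otimes>\<^sub>a A) \<Delta>\<^sub>A V = leg12 V o\<^sub>L leg13 V)"

definition right_qg_hom ::
    "('c::complex_hilbert \<Rightarrow>\<^sub>L 'c) set \<Rightarrow> (('c \<Rightarrow>\<^sub>L 'c) \<Rightarrow> (('c, 'c) htensor \<Rightarrow>\<^sub>L ('c, 'c) htensor)) \<Rightarrow>
    ('a::complex_hilbert \<Rightarrow>\<^sub>L 'a) set \<Rightarrow> (('a \<Rightarrow>\<^sub>L 'a) \<Rightarrow> (('a, 'a) htensor \<Rightarrow>\<^sub>L ('a, 'a) htensor)) \<Rightarrow>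
    (('c \<Rightarrow>\<^sub>L 'c) \<Rightarrow> (('c, 'a) htensor \<Rightarrow>\<^sub>L ('c, 'a) htensor)) \<Rightarrow> bool" where
  "right_qg_hom C \<Delta>\<^sub>C A \<Delta>\<^sub>A \<Delta>\<^sub>R \<longleftrightarrow> morphism C (C \<otimes>\<^sub>a A) \<Delta>\<^sub>R \<and>
    (\<forall>x\<in>C. reassoc (tensor_id C (C \<otimes>\<^sub>a C) \<Delta>\<^sub>C A (\<Delta>\<^sub>R x)) = id_tensor C C (C \<otimes>\<^sub>a A) \<Delta>\<^sub>R (\<Delta>\<^sub>C x)) \<and>
    (\<forall>x\<in>C. id_tensor C A (A \<otimes>\<^sub>a A) \<Delta>\<^sub>A (\<Delta>\<^sub>R x) = reassoc (tensor_id C (C \<otimes>\<^sub>a A) \<Delta>\<^sub>R A (\<Delta>\<^sub>R x)))"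

definition bichar_of_hom ::
    "(('c::complex_hilbert, 'c) htensor \<Rightarrow>\<^sub>L ('c, 'c) htensor) \<Rightarrow>
    ('c \<Rightarrow>\<^sub>L 'c) set \<Rightarrow> ('a::complex_hilbert \<Rightarrow>\<^sub>L 'a) set \<Rightarrow>
    (('c \<Rightarrow>\<^sub>L 'c) \<Rightarrow> (('c, 'a) htensor \<Rightarrow>\<^sub>L ('c, 'a) htensor)) \<Rightarrow>
    (('c, 'a) htensor \<Rightarrow>\<^sub>L ('c, 'a) htensor)" where
  "bichar_of_hom W\<^sub>C C A \<Delta>\<^sub>R = (THE V. V \<in> unitary_multipliers (dual_algebra W\<^sub>C \<otimes>\<^sub>a A) \<and>
    id_tensor (dual_algebra W\<^sub>C) C (C \<otimes>\<^sub>a A) \<Delta>\<^sub>R W\<^sub>C = leg12 W\<^sub>C o\<^sub>L leg13 V)"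

definition hom_of_bichar ::
    "('c::complex_hilbert \<Rightarrow>\<^sub>L 'c) set \<Rightarrow> (('c, 'a::complex_hilbert) htensor \<Rightarrow>\<^sub>L ('c, 'a) htensor) \<Rightarrow>
    ('c \<Rightarrow>\<^sub>L 'c) \<Rightarrow> (('c, 'a) htensor \<Rightarrow>\<^sub>L ('c, 'a) htensor)" where
  "hom_of_bichar C V = (\<lambda>x\<in>C. V o\<^sub>L (x \<otimes>\<^sub>o id_blinfun) o\<^sub>L adj V)"

end

theory Submission
  imports Defs "HOL-Complex_Analysis.Complex_Analysis"
begin

no_notation inner (infix "\<bullet>" 70)
no_notation matrix_matrix_mult (infixl "**" 70)
no_notation fps_compose (infixl "oo" 55)
notation scaleC (infixr "*c" 75)
notation cinner (infix "\<bullet>" 70)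
notation tens (infixr "\<otimes>" 70)
notation tensor_op (infixr "**" 70)
notation tensor_alg (infixr "><" 70)
notation blinfun_compose (infixl "oo" 55)
notation id_blinfun ("\<one>")

notation LIMSEQ (infixr "---->" 60)
type_notation blinfun (infixr "->" 21)

type_synonym ('a, 'b, 'c) htensor3 = "('a, ('b, 'c) htensor) htensor"
type_synonym ('a, 'b) hop = "('a, 'b) htensor -> ('a, 'b) htensor"

text \<open>For a right quantum group homomorphism \<open>\<Delta>\<^sub>R\<close>, the unitary \<open>X = W\<^sub>1\<^sub>2\<^sup>* (id \<otimes> \<Delta>\<^sub>R)(W)\<close> is trivial in its
  second leg, that is \<open>X = V\<^sub>1\<^sub>3\<close>: by the first condition on \<open>\<Delta>\<^sub>R\<close> its slices \<open>v\<close> in the third leg satisfy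
  \<open>W\<^sub>2\<^sub>3 v\<^sub>1\<^sub>2 = v\<^sub>1\<^sub>3 W\<^sub>2\<^sub>3\<close>, and only scalars \<open>a\<close> satisfy \<open>W (a \<otimes> 1) = (1 \<otimes> b) W\<close> for some \<open>b\<close>.
  The second condition on \<open>\<Delta>\<^sub>R\<close> makes \<open>V\<close> a character in its second leg,
  and multiplicativity of \<open>\<Delta>\<^sub>R\<close> yields \<open>V\<^sub>2\<^sub>3 W\<^sub>1\<^sub>2 = W\<^sub>1\<^sub>2 V\<^sub>1\<^sub>3 V\<^sub>2\<^sub>3\<close>, which is the character condition in the
  first leg and says at the same time that \<open>\<Delta>\<^sub>R\<close> is implemented by \<open>V\<close>. Conversely this pentagon equation and
  its mate for \<open>A\<close> turn \<open>x \<mapsto> V (x \<otimes> 1) V\<^sup>*\<close> into a homomorphism.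

  That the slices of \<open>W\<close> span a \<open>C\<close>*-algebra, and that scalars are the only such intertwiners, rests on
  modularity. The unitary \<open>W\<close> commutes with the flow \<open>Q'\<^bsup>it\<^esup> \<otimes> Q\<^bsup>it\<^esup>\<close>, and the
  defining relation with \<open>W~\<close> expresses a slice of \<open>W\<^sup>*\<close> as the boundary value at \<open>-\<i>\<close> of the orbit of
  a slice of \<open>W\<close> under the flow. Averaging over a narrow Gaussian and shifting the contour recovers the
  boundary value inside the closed invariant space spanned by the orbit.\<close>

section \<open>Closed complex subspaces\<close>

text \<open>For a general multiplicative unitary the slices need not be closed under adjoints. The
  proof hinges on one invariance: the closed column space \<open>hcol (lalg W)\<close>, spanned by
  the operators \<open>left_ket z oo a\<close>, is mapped into itself by \<open>W\<close> and by
  \<open>adj W\<close>. Products, adjoints, nondegeneracy and multipliers are then read off by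
  slicing columns. The pentagon equation alone only relates columns built from \<open>W\<close> to
  columns built from its modular companion, weakly and with the unbounded operators inserted; the
  contour shift turns this relation into membership. Powers of \<open>Q\<close> are functions of the
  bounded operator B = (1 + Q)^-1. The polynomial calculus of B comes with a norm bound that exceeds
  the supremum norm by the factor 2, which is harmless because the bound serves only for continuity
  and convergence. For a morphism \<phi> the map id tensor \<phi> is pinned down by its slices in
  the first leg, where it acts as \<phi>; the relation \<open>slrel\<close> records this and
  replaces arguments with completely positive maps. The type class admits the zero Hilbert space,
  where no unit vector is available for slicing, so several proofs split off that case.\<close>

class complex_normed = complex_vector + real_normed_vector +
  assumes norm_scaleC_eq: "norm (c *c x) = cmod c * norm x"

instance complex_hilbert \<subseteq> complex_normed
  by standard simp

instance blinfun :: (real_normed_vector, complex_hilbert) complex_normed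
proof
  fix c and T :: "'a -> 'b"
  have le: "norm (d *c S) \<le> cmod d * norm S" for d and S :: "'a -> 'b"
    by (rule norm_blinfun_bound)
       (auto simp: scaleC_blinfun_apply mult.assoc intro!: mult_left_mono norm_blinfun)
  show "norm (c *c T) = cmod c * norm T"
  proof (cases "c = 0")
    case True
    then show ?thesis using le[of 0 T] by simp
  next
    case False
    have "cmod c * norm T = cmod c * norm (inverse c *c c *c T)"
      using False by (simp add: scaleC_scaleC)
    also have "\<dots> \<le> cmod c * (cmod (inverse c) * norm (c *c T))"
      by (intro mult_left_mono le) simp
    also have "\<dots> = norm (c *c T)"
      using False by (simp add: norm_inverse)
    finally show ?thesis
      using le[of c T] by simp
  qed
qed

lemma bounded_bilinear_scaleC:
  "bounded_bilinear (scaleC :: complex => 'a => 'a::complex_normed)"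
  by standard (auto simp: scaleC_add_left scaleC_add_right scaleR_scaleC scaleC_scaleC norm_scaleC_eq
      scaleR_conv_of_real mult.commute intro!: exI[of _ 1])

interpretation scaleC: bounded_bilinear "scaleC :: complex => 'a => 'a::complex_normed"
  by (rule bounded_bilinear_scaleC)

lemma csubspaceD:
  assumes "csubspace S"
  shows "0 \<in> S" "x \<in> S ==> y \<in> S ==> x + y \<in> S" "x \<in> S ==> c *c x \<in> S"
    "x \<in> S ==> y \<in> S ==> x - y \<in> S" "x \<in> S ==> r *\<^sub>R x \<in> S" "x \<in> S ==> - x \<in> S"
  using assms
  by (auto simp: complex_vector.subspace_0 complex_vector.subspace_add complex_vector.subspace_scale
      complex_vector.subspace_diff scaleR_scaleC complex_vector.subspace_neg)

lemma csubspaceI: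
  assumes "0 \<in> S" "\<And>x y. x \<in> S ==> y \<in> S ==> x + y \<in> S" "\<And>c x. x \<in> S ==> c *c x \<in> S"
  shows "csubspace S"
  using assms by (auto simp: complex_vector.subspace_def)

lemma csubspace_closure:
  fixes S :: "'a::complex_normed set"
  assumes S: "csubspace S"
  shows "csubspace (closure S)"
proof (rule csubspaceI)
  show "0 \<in> closure S"
    using csubspaceD(1)[OF S] closure_subset by blast
next
  fix x y assume "x \<in> closure S" "y \<in> closure S"
  then obtain f g where "\<And>n. f n \<in> S" "f ----> x" "\<And>n. g n \<in> S" "g ----> y"
    unfolding closure_sequential by blast
  then have "\<And>n. f n + g n \<in> S" "(%n. f n + g n) ----> x + y"
    using csubspaceD[OF S] by (auto intro: tendsto_add)
  then show "x + y \<in> closure S"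
    unfolding closure_sequential by (intro exI[of _ "%n. f n + g n"]) simp
next
  fix c x assume "x \<in> closure S"
  then obtain f where "\<And>n. f n \<in> S" "f ----> x"
    unfolding closure_sequential by blast
  then have "\<And>n. c *c f n \<in> S" "(%n. c *c f n) ----> c *c x"
    using csubspaceD[OF S] by (auto intro: scaleC.tendsto)
  then show "c *c x \<in> closure S"
    unfolding closure_sequential by (intro exI[of _ "%n. c *c f n"]) simp
qed

definition ccl :: "'a::complex_normed set => 'a set" where
  "ccl S = closure (cspan S)"

lemma csubspace_ccl [simp]: "csubspace (ccl S)"
  unfolding ccl_def by (intro csubspace_closure complex_vector.subspace_span)

lemma closed_ccl [simp]: "closed (ccl S)"
  unfolding ccl_def by simp

lemma ccl_base: "x \<in> S ==> x \<in> ccl S"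
  unfolding ccl_def using closure_subset complex_vector.span_base by blast

lemma ccl_minimal: "S \<subseteq> M ==> csubspace M ==> closed M ==> ccl S \<subseteq> M"
  unfolding ccl_def by (intro closure_minimal complex_vector.span_minimal)

lemma ccl_mono: "S \<subseteq> T ==> ccl S \<subseteq> ccl T"
  by (intro ccl_minimal) (auto intro: ccl_base)

lemma ccl_id: "csubspace M ==> closed M ==> ccl M = M"
  by (intro antisym ccl_minimal) (auto intro: ccl_base)

text \<open>Only preservation of complex lines is required, so that the principle also covers antilinear
  maps.\<close>

lemma csubspace_vimage:
  assumes f: "linear f" "\<And>c x. \<exists>c'. f (c *c x) = c' *c f x"
    and M: "csubspace M"
  shows "csubspace {x. f x \<in> M}"
proof (rule csubspaceI)
  show "0 \<in> {x. f x \<in> M}"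
    using csubspaceD(1)[OF M] linear_0[OF f(1)] by simp
  show "x + y \<in> {x. f x \<in> M}" if "x \<in> {x. f x \<in> M}" "y \<in> {x. f x \<in> M}" for x y
    using that csubspaceD(2)[OF M] linear_add[OF f(1)] by simp
  show "c *c x \<in> {x. f x \<in> M}" if "x \<in> {x. f x \<in> M}" for c x
    using that csubspaceD(3)[OF M] f(2)[of c x] by auto
qed

lemma ccl_induct_map:
  assumes x: "x \<in> ccl S"
    and f: "bounded_linear f" "\<And>c x. \<exists>c'. f (c *c x) = c' *c f x"
    and M: "csubspace M" "closed M"
    and S: "\<And>s. s \<in> S ==> f s \<in> M"
  shows "f x \<in> M"
proof -
  have "ccl S \<subseteq> {x. f x \<in> M}"
  proof (rule ccl_minimal)
    show "csubspace {x. f x \<in> M}"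
      using bounded_linear.linear[OF f(1)] f(2) M(1) by (rule csubspace_vimage)
    show "closed {x. f x \<in> M}"
      using closed_vimage[OF M(2)] bounded_linear.continuous_on[OF f(1) continuous_on_id]
      by (auto simp: vimage_def)
  qed (use S in auto)
  then show ?thesis using x by blast
qed

lemma ccl_eq_map:
  fixes f g :: "'a::complex_normed => 'b::complex_normed"
  assumes x: "x \<in> ccl S"
    and f: "bounded_linear f" "\<And>c x. f (c *c x) = c *c f x"
    and g: "bounded_linear g" "\<And>c x. g (c *c x) = c *c g x"
    and S: "\<And>s. s \<in> S ==> f s = g s"
  shows "f x = g x"
proof -
  have "(%x. f x - g x) x \<in> {0}"
  proof (rule ccl_induct_map[OF x])
    show "bounded_linear (%x. f x - g x)"
      using f(1) g(1) by (rule bounded_linear_sub)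
    show "\<exists>c'. f (c *c x) - g (c *c x) = c' *c (f x - g x)" for c x
      by (rule exI[of _ c]) (simp add: f g scaleC.diff_right)
  qed (auto simp: S complex_vector.subspace_single_0)
  then show ?thesis by simp
qed

lemma ccl_eq_map_anti:
  fixes f g :: "'a::complex_normed => 'b::complex_normed"
  assumes x: "x \<in> ccl S"
    and f: "bounded_linear f" "\<And>c x. f (c *c x) = cnj c *c f x"
    and g: "bounded_linear g" "\<And>c x. g (c *c x) = cnj c *c g x"
    and S: "\<And>s. s \<in> S ==> f s = g s"
  shows "f x = g x"
proof -
  have "(%x. f x - g x) x \<in> {0}"
  proof (rule ccl_induct_map[OF x])
    show "bounded_linear (%x. f x - g x)"
      using f(1) g(1) by (rule bounded_linear_sub)
    show "\<exists>c'. f (c *c x) - g (c *c x) = c' *c (f x - g x)" for c x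
      by (rule exI[of _ "cnj c"]) (simp add: f g scaleC.diff_right)
  qed (auto simp: S complex_vector.subspace_single_0)
  then show ?thesis by simp
qed

lemma ccl_image_total:
  assumes S: "ccl S = UNIV" and f: "bounded_linear f" "\<And>c x. \<exists>c'. f (c *c x) = c' *c f x"
    and "surj f"
  shows "ccl (f ` S) = UNIV"
proof -
  have "f x \<in> ccl (f ` S)" for x
    by (rule ccl_induct_map[OF _ f, of x S]) (auto simp: S intro: ccl_base)
  then show ?thesis using \<open>surj f\<close> by (metis UNIV_eq_I surj_def)
qed

lemma ccl_tens: "ccl (range (%(x, y). x \<otimes> y)) = UNIV"
  unfolding ccl_def by (rule tens_dense)

interpretation tens: bounded_bilinear "(\<otimes>)"
  by (rule bounded_bilinear_tens)

lemma ccl_tens_dense: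
  assumes "ccl S = UNIV" "ccl T = UNIV"
  shows "ccl {x \<otimes> y |x y. x \<in> S \<and> y \<in> T} = UNIV"
proof -
  let ?M = "ccl {x \<otimes> y |x y. x \<in> S \<and> y \<in> T}"
  have 1: "x \<otimes> y \<in> ?M" if "x \<in> S" for x y
    by (rule ccl_induct_map[of y T "%y. x \<otimes> y"])
       (use that assms in \<open>auto intro: tens.bounded_linear_right tens_scaleC_right ccl_base\<close>)
  have "x \<otimes> y \<in> ?M" for x y
    by (rule ccl_induct_map[of x S "%x. x \<otimes> y"])
       (use 1 assms in \<open>auto intro: tens.bounded_linear_left tens_scaleC_left\<close>)
  then have "ccl (range (%(x, y). x \<otimes> y)) \<subseteq> ?M"
    by (intro ccl_minimal) auto
  then show ?thesis by (auto simp: ccl_tens)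
qed

lemma ccl_closure_UNIV: "closure S = UNIV ==> ccl S = (UNIV :: 'a::complex_normed set)"
  unfolding ccl_def
  by (metis UNIV_eq_I UNIV_I closure_mono complex_vector.span_superset subsetD)

lemma eq_on_total:
  fixes x y :: "'a::complex_hilbert"
  assumes "ccl S = UNIV" "\<And>s. s \<in> S ==> s \<bullet> x = s \<bullet> y"
  shows "x = y"
proof (rule cinner_eqI)
  fix z
  have "z \<in> {z. z \<bullet> x - z \<bullet> y = 0}"
  proof -
    have "ccl S \<subseteq> {z. z \<bullet> x - z \<bullet> y = 0}"
    proof (rule ccl_minimal)
      show "csubspace {z. z \<bullet> x - z \<bullet> y = 0}"
        by (rule csubspaceI) (auto simp: cinner_add_left cinner.zero_left right_diff_distrib[symmetric])
      show "closed {z. z \<bullet> x - z \<bullet> y = 0}"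
        by (intro closed_Collect_eq continuous_intros cinner.continuous_on)
    qed (use assms in auto)
    then show ?thesis using assms(1) by auto
  qed
  then show "z \<bullet> x = z \<bullet> y" by simp
qed

lemma total_orthogonal_0:
  fixes x :: "'a::complex_hilbert"
  assumes "ccl S = UNIV" "\<And>s. s \<in> S ==> s \<bullet> x = 0"
  shows "x = 0"
  by (rule eq_on_total[OF assms(1)]) (simp add: assms(2) cinner.zero_right)


section \<open>Adjoints and slices\<close>

lemma blinfun_compose_assoc: "(A oo B) oo C = A oo (B oo C)"
  and blinfun_compose_id_left [simp]: "\<one> oo A = A"
  and blinfun_compose_id_right [simp]: "A oo \<one> = A"
  by (auto intro: blinfun_eqI)

lemmas [simp] = cinner.zero_left cinner.zero_right bop_compose bop_id bop_adj bop_left_ket bop_right_ket bop_flip bop_assoc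
  bop_tensor_op tensor_op_tens blinfun_compose_assoc

lemma bop_add [simp]: "S \<in> bop ==> T \<in> bop ==> S + T \<in> bop"
  and bop_diff [simp]: "S \<in> bop ==> T \<in> bop ==> S - T \<in> bop"
  and bop_scale [simp]: "T \<in> bop ==> c *c T \<in> bop"
  and bop_zero [simp]: "0 \<in> bop"
  by (auto simp: bop_def blinfun.bilinear_simps scaleC_add_right scaleC_blinfun_apply
      scaleC_scaleC mult.commute scaleC.diff_right)

lemma csubspace_bop [simp]: "csubspace bop"
  by (rule csubspaceI) auto

lemma closed_bop [simp]: "closed (bop :: ('a::complex_hilbert -> 'b::complex_hilbert) set)"
proof -
  have "bop = (\<Inter>c. \<Inter>x. {T :: 'a -> 'b. T (c *c x) = c *c T x})"
    by (auto simp: bop_def)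
  also have "closed \<dots>"
    by (intro closed_INT ballI closed_Collect_eq continuous_intros scaleC.continuous_on)
  finally show ?thesis .
qed

lemma ccl_bop: "S \<subseteq> bop ==> ccl S \<subseteq> bop"
  by (rule ccl_minimal) auto

lemma adj_adj [simp]: "T \<in> bop ==> adj (adj T) = T"
  by (rule adj_eqI) (simp add: cinner_adj_right)

lemma adj_compose [simp]: "S \<in> bop ==> T \<in> bop ==> adj (S oo T) = adj T oo adj S"
  by (rule adj_eqI) (simp add: cinner_adj)

lemma adj_id [simp]: "adj \<one> = \<one>"
  by (rule adj_eqI) simp

lemma adj_add [simp]: "S \<in> bop ==> T \<in> bop ==> adj (S + T) = adj S + adj T"
  by (rule adj_eqI) (simp add: cinner_adj blinfun.add_left cinner_add_left cinner_add_right)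

lemma adj_diff [simp]: "S \<in> bop ==> T \<in> bop ==> adj (S - T) = adj S - adj T"
  by (rule adj_eqI) (simp add: cinner_adj blinfun.diff_left cinner.diff_left cinner.diff_right)

lemma adj_scale [simp]: "T \<in> bop ==> adj (c *c T) = cnj c *c adj T"
  by (rule adj_eqI) (simp add: cinner_adj scaleC_blinfun_apply)

lemma adj_zero [simp]: "adj 0 = 0"
  by (rule adj_eqI) simp

lemma adj_tensor_op [simp]: "S \<in> bop ==> T \<in> bop ==> adj (S ** T) = adj S ** adj T"
proof -
  assume b: "S \<in> bop" "T \<in> bop"
  show ?thesis
  proof (rule blinfun_eq_tensI)
    fix x y
    show "adj (S ** T) (x \<otimes> y) = (adj S ** adj T) (x \<otimes> y)"
      by (rule eq_on_total[OF ccl_tens]) (auto simp: b cinner_adj_right)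
  qed (use b in auto)
qed

lemma tensor_op_compose: "S \<in> bop ==> T \<in> bop ==> S' \<in> bop ==> T' \<in> bop ==>
    (S ** T) oo (S' ** T') = (S oo S') ** (T oo T')"
  by (rule blinfun_eq_tensI) auto

lemma tensor_op_id [simp]: "\<one> ** \<one> = \<one>"
  by (rule blinfun_eq_tensI) auto

lemma unitaryD:
  assumes "unitary U"
  shows "U \<in> bop" "adj U oo U = \<one>" "U oo adj U = \<one>"
    "adj U (U x) = x" "U (adj U y) = y" "adj U oo (U oo S) = S" "U oo (adj U oo T) = T"
proof -
  show 1: "U \<in> bop" "adj U oo U = \<one>" "U oo adj U = \<one>"
    using assms by (auto simp: unitary_def)
  show "adj U (U x) = x"
    using arg_cong[OF 1(2), of "%T. blinfun_apply T x"] by simp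
  show "U (adj U y) = y"
    using arg_cong[OF 1(3), of "%T. blinfun_apply T y"] by simp
  show "adj U oo (U oo S) = S" "U oo (adj U oo T) = T"
    using 1 by (metis blinfun_compose_assoc blinfun_compose_id_left)+
qed

lemma unitary_adj [simp]: "unitary U ==> unitary (adj U)"
  by (auto simp: unitary_def)

lemma unitary_compose [simp]: "unitary U ==> unitary V ==> unitary (U oo V)"
  unfolding unitary_def[of "U oo V"] by (simp add: unitaryD)

lemma unitary_id [simp]: "unitary \<one>"
  by (simp add: unitary_def)

lemma unitary_tensor [simp]: "unitary U ==> unitary V ==> unitary (U ** V)"
  unfolding unitary_def[of "U ** V"] by (simp add: unitaryD tensor_op_compose)

lemmas [simp] = unitary_flip unitary_assoc

lemma adj_flip [simp]: "adj flip = flip"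
  by (rule blinfun_eq_tensI) (auto simp: adj_flip_tens)

lemma flip_flip [simp]: "flip oo flip = \<one>" "flip (flip v) = v"
  "flip oo (flip oo S) = S"
  using unitaryD[OF unitary_flip] by simp_all

lemma surj_unitary: "unitary U ==> surj (blinfun_apply U)"
  by (metis surjI unitaryD(5))

lemma norm_unitary: "unitary U ==> norm (blinfun_apply U x) = norm x"
proof -
  assume U: "unitary U"
  have "U x \<bullet> U x = x \<bullet> x"
    using U by (metis cinner_adj unitaryD(1,4))
  then have "(norm (U x))\<^sup>2 = (norm x)\<^sup>2"
    unfolding cinner_self by (simp only: of_real_eq_iff)
  then show ?thesis
    by (rule power2_eq_imp_eq) simp_all
qed

lemma cinner_unitary: "unitary U ==> U x \<bullet> U y = x \<bullet> y"
  by (metis cinner_adj unitaryD(1,4))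

lemma bounded_linear_compose_left: "bounded_linear (%T. A oo T)"
  and bounded_linear_compose_right: "bounded_linear (%T. T oo A)"
  using bounded_bilinear.bounded_linear_right[OF bounded_bilinear_blinfun_compose]
    bounded_bilinear.bounded_linear_left[OF bounded_bilinear_blinfun_compose] by auto

lemma compose_add: "A oo (B + C) = (A oo B) + (A oo C)" "(S + T) oo R = (S oo R) + (T oo R)"
  by (auto intro!: blinfun_eqI simp: blinfun.bilinear_simps)

lemma compose_diff: "A oo (B - C) = (A oo B) - (A oo C)" "(S - T) oo R = (S oo R) - (T oo R)"
  by (auto intro!: blinfun_eqI simp: blinfun.bilinear_simps)

lemma compose_zero: "A oo 0 = 0" "0 oo R = 0"
  by (auto intro!: blinfun_eqI)

lemma scaleC_compose_left [simp]: "(c *c S) oo T = c *c (S oo T)"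
  by (rule blinfun_eqI) (simp add: scaleC_blinfun_apply)

lemma scaleC_compose_right [simp]: "S \<in> bop ==> S oo (c *c T) = c *c (S oo T)"
  by (rule blinfun_eqI) (simp add: scaleC_blinfun_apply bop_scaleC)

lemma norm_adj: "T \<in> bop ==> norm (adj T) = norm T"
  using norm_adj_le[of T] norm_adj_le[of "adj T"] by simp

lemma tendsto_adj:
  assumes f: "\<And>n. f n \<in> bop" and x: "x \<in> bop" and lim: "f ----> x"
  shows "(%n. adj (f n)) ----> adj x"
proof -
  have "norm (adj (f n) - adj x) \<le> norm (f n - x)" for n
    using norm_adj_le[OF bop_diff[OF f x]] by (simp only: adj_diff[OF f x])
  then have "(%n. adj (f n) - adj x) ----> 0"
    by (rule Lim_null_comparison[OF always_eventually[OF allI]])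
       (rule tendsto_norm_zero[OF LIM_zero[OF lim]])
  then show ?thesis by (rule LIM_zero_cancel)
qed

lemma csubspace_adj_vimage:
  assumes "csubspace M"
  shows "csubspace {T \<in> bop. adj T \<in> M}"
  by (rule csubspaceI) (auto intro: csubspaceD(1-3)[OF assms])

lemma closed_adj_vimage:
  assumes "closed M"
  shows "closed {T \<in> bop. adj T \<in> M}"
  unfolding closed_sequential_limits
proof (intro allI impI)
  fix f x assume "(\<forall>n. f n \<in> {T \<in> bop. adj T \<in> M}) \<and> f ----> x"
  then have f: "\<forall>n. f n \<in> bop" "\<forall>n. adj (f n) \<in> M" and lim: "f ----> x"
    by auto
  have x: "x \<in> bop"
    by (rule closed_sequentially[OF closed_bop _ lim]) (simp add: f(1))
  have "(%n. adj (f n)) ----> adj x"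
    using f(1) by (intro tendsto_adj x lim) simp
  then have "adj x \<in> M"
    by (rule closed_sequentially[OF assms, rotated]) (simp add: f(2))
  with x show "x \<in> {T \<in> bop. adj T \<in> M}" by simp
qed

text \<open>\<open>adj\<close> is meaningful only on \<open>bop\<close>, so it is not a map to which
  \<open>ccl_induct_map\<close> applies and gets its own induction principle.\<close>

lemma adj_ccl:
  assumes "x \<in> ccl S" "S \<subseteq> bop" "\<And>s. s \<in> S ==> adj s \<in> M" "csubspace M" "closed M"
  shows "adj x \<in> M"
proof -
  have "ccl S \<subseteq> {T \<in> bop. adj T \<in> M}"
    using assms by (intro ccl_minimal csubspace_adj_vimage closed_adj_vimage) auto
  then show ?thesis using assms(1) by blast
qed

lemma op_eqI2:
  assumes "S \<in> bop" "T \<in> bop"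
    and "\<And>x y x' y'. (x \<otimes> y) \<bullet> S (x' \<otimes> y') = (x \<otimes> y) \<bullet> T (x' \<otimes> y')"
  shows "S = T"
  using assms(1,2) by (rule blinfun_eq_tensI) (rule eq_on_total[OF ccl_tens], auto simp: assms(3))

lemma op_eqI:
  assumes "\<And>x z. x \<bullet> blinfun_apply S z = x \<bullet> blinfun_apply T z"
  shows "S = T"
  by (intro blinfun_eqI cinner_eqI assms)

lemma left_ket_add: "left_ket (x + y) = left_ket x + left_ket y"
  and left_ket_scaleC: "left_ket (c *c x) = c *c left_ket x"
  by (auto intro!: blinfun_eqI simp: tens_add_left tens_scaleC_left blinfun.add_left scaleC_blinfun_apply)

lemma bounded_linear_left_ket: "bounded_linear left_ket"
  by (rule bounded_linear_intro[where K = 1])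
    (simp_all add: left_ket_add left_ket_scaleC scaleR_scaleC norm_left_ket_le)

text \<open>The slice of \<open>X\<close> in its first leg by the vector functional of
  \<open>x\<close> and \<open>z\<close>. It is written with kets so that operators on either leg can
  be moved through it; \<open>rsl\<close> is the counterpart in the second leg.\<close>

definition lsl :: "'d::complex_hilbert => (('a::complex_hilbert, 'b::complex_hilbert) htensor
    -> ('d, 'c::complex_hilbert) htensor) => 'a => ('b -> 'c)" where
  "lsl x X z = adj (left_ket x) oo X oo left_ket z"

definition rsl :: "'c::complex_hilbert => (('a::complex_hilbert, 'b::complex_hilbert) htensor
    -> ('d::complex_hilbert, 'c) htensor) => 'b => ('a -> 'd)" where
  "rsl y X u = adj (right_ket y) oo X oo right_ket u"

lemma cinner_lsl: "y \<bullet> blinfun_apply (lsl x X z) u = (x \<otimes> y) \<bullet> X (z \<otimes> u)"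
  by (simp add: lsl_def cinner_adj_right)

lemma cinner_rsl: "x \<bullet> blinfun_apply (rsl y X u) z = (x \<otimes> y) \<bullet> X (z \<otimes> u)"
  by (simp add: rsl_def cinner_adj_right)

lemma bop_lsl [simp]: "X \<in> bop ==> lsl x X z \<in> bop"
  and bop_rsl [simp]: "Y \<in> bop ==> rsl y Y u \<in> bop"
  by (simp_all add: lsl_def rsl_def)

lemma lsl_eqI: "X \<in> bop ==> Y \<in> bop ==> (\<And>x z. lsl x X z = lsl x Y z) ==> X = Y"
  by (rule op_eqI2) (auto simp flip: cinner_lsl)

lemma adj_lsl: "X \<in> bop ==> adj (lsl x X z) = lsl z (adj X) x"
  by (auto simp: lsl_def blinfun_compose_assoc)

lemma lsl_linear:
  "lsl x X (z + z') = lsl x X z + lsl x X z'" "X \<in> bop ==> lsl x X (c *c z) = c *c lsl x X z"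
  "lsl (x + x') X z = lsl x X z + lsl x' X z" "lsl (c *c x) X z = cnj c *c lsl x X z"
  "lsl x (X + Y) z = lsl x X z + lsl x Y z" "lsl x (c *c X) z = c *c lsl x X z"
  by (auto intro!: op_eqI simp: cinner_lsl blinfun.add_left scaleC_blinfun_apply cinner_add_right
      cinner_add_left tens_add_left tens_scaleC_left bop_scaleC blinfun.add_right)

lemma rsl_linear:
  "rsl x X (z + z') = rsl x X z + rsl x X z'" "X \<in> bop ==> rsl x X (c *c z) = c *c rsl x X z"
  "rsl (x + x') X z = rsl x X z + rsl x' X z" "rsl (c *c x) X z = cnj c *c rsl x X z"
  "rsl x (X + Y) z = rsl x X z + rsl x Y z" "rsl x (c *c X) z = c *c rsl x X z"
  by (auto intro!: op_eqI simp: cinner_rsl blinfun.add_left scaleC_blinfun_apply cinner_add_right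
      cinner_add_left tens_add_right tens_scaleC_right bop_scaleC blinfun.add_right)

lemma norm_blinfun_compose3:
  assumes "norm A \<le> a" "norm B \<le> b" "norm C \<le> c"
  shows "norm (A oo B oo C) \<le> a * b * c"
proof -
  have "0 \<le> a" "0 \<le> b" "0 \<le> c"
    using assms norm_ge_zero order_trans by blast+
  have "norm (A oo B oo C) \<le> norm (A oo B) * norm C"
    by (rule norm_blinfun_compose)
  also have "\<dots> \<le> (norm A * norm B) * norm C"
    by (intro mult_right_mono norm_blinfun_compose) simp
  also have "\<dots> \<le> a * b * c"
    using assms \<open>0 \<le> a\<close> \<open>0 \<le> b\<close> \<open>0 \<le> c\<close> by (intro mult_mono) auto
  finally show ?thesis .
qed

lemma norm_lsl_le: "norm (lsl x X z) \<le> norm x * norm X * norm z"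
  unfolding lsl_def
  by (rule norm_blinfun_compose3) (simp_all add: norm_adj norm_left_ket_le)

lemma bounded_linear_lsl:
  "bounded_linear (%x. lsl x X z)" "bounded_linear (%X. lsl x X z)"
  "X \<in> bop ==> bounded_linear (%z. lsl x X z)"
proof -
  show "bounded_linear (%x. lsl x X z)"
    by (rule bounded_linear_intro[where K = "norm X * norm z"])
       (use norm_lsl_le in \<open>auto simp: lsl_linear scaleR_scaleC mult.assoc\<close>)
  show "bounded_linear (%X. lsl x X z)"
    by (rule bounded_linear_intro[where K = "norm x * norm z"])
       (use norm_lsl_le in \<open>auto simp: lsl_linear scaleR_scaleC ac_simps\<close>)
  show "bounded_linear (%z. lsl x X z)" if "X \<in> bop"
    by (rule bounded_linear_intro[where K = "norm x * norm X"])
       (use norm_lsl_le that in \<open>auto simp: lsl_linear scaleR_scaleC ac_simps\<close>)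
qed

lemma tensor_op_left_ket: "A \<in> bop ==> B \<in> bop ==> (A ** B) oo left_ket z = left_ket (A z) oo B"
  and tensor_op_right_ket: "A \<in> bop ==> B \<in> bop ==> (A ** B) oo right_ket y = right_ket (B y) oo A"
  by (auto intro!: blinfun_eqI)

lemma adj_left_ket_tensor_op: "A \<in> bop ==> B \<in> bop ==>
    adj (left_ket x) oo (A ** B) = B oo adj (left_ket (adj A x))"
  by (rule blinfun_eq_tensI) (auto simp: cinner_adj bop_scaleC)

lemma adj_right_ket_tensor_op: "A \<in> bop ==> B \<in> bop ==>
    adj (right_ket x) oo (A ** B) = A oo adj (right_ket (adj B x))"
  by (rule blinfun_eq_tensI) (auto simp: cinner_adj bop_scaleC)

lemma adj_left_ket_left_ket: "adj (left_ket x) oo left_ket z = (x \<bullet> z) *c \<one>"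
  by (auto intro!: blinfun_eqI simp: scaleC_blinfun_apply)

lemma flip_left_ket [simp]: "flip oo left_ket x = right_ket x" "flip oo (left_ket x oo A) = right_ket x oo A"
  and flip_right_ket [simp]: "flip oo right_ket x = left_ket x" "flip oo (right_ket x oo A) = left_ket x oo A"
  by (auto intro!: blinfun_eqI)

lemma flip_tensor_op: "A \<in> bop ==> B \<in> bop ==> flip oo (A ** B) = (B ** A) oo flip"
  by (rule blinfun_eq_tensI) auto

lemma adj_right_ket_flip: "adj (right_ket x) oo flip = adj (left_ket x)"
  by (rule blinfun_eq_tensI; simp)

lemma lsl_tensor_op: "A \<in> bop ==> B \<in> bop ==> lsl x (A ** B) z = (x \<bullet> A z) *c B"
  and rsl_tensor_op: "A \<in> bop ==> B \<in> bop ==> rsl y (A ** B) u = (y \<bullet> B u) *c A"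
  by (auto intro!: op_eqI simp: cinner_lsl cinner_rsl scaleC_blinfun_apply mult.commute)

lemma tensor_op_linear:
  "S \<in> bop ==> S' \<in> bop ==> T \<in> bop ==> (S + S') ** T = S ** T + S' ** T"
  "S \<in> bop ==> T' \<in> bop ==> T \<in> bop ==> S ** (T + T') = S ** T + S ** T'"
  "S \<in> bop ==> T \<in> bop ==> (c *c S) ** T = c *c (S ** T)"
  "S \<in> bop ==> T \<in> bop ==> S ** (c *c T) = c *c (S ** T)"
  by (rule blinfun_eq_tensI; simp add: blinfun.add_left scaleC_blinfun_apply tens_add_left tens_add_right
      tens_scaleC_left tens_scaleC_right)+

text \<open>Slicing along an orthonormal basis of the right factor preserves the norm
  (\<open>sum\<close>), and \<open>S ** \<one>\<close> acts as \<open>S\<close> on every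
  slice.\<close>

lemma norm_tensor_op_id:
  fixes S :: "'a::complex_hilbert -> 'c::complex_hilbert"
  assumes S: "S \<in> bop"
  shows "norm (S ** (\<one> :: 'b::complex_hilbert -> 'b)) \<le> norm S"
proof (rule norm_blinfun_bound)
  fix v :: "('a, 'b) htensor"
  let ?T = "S ** (\<one> :: 'b -> 'b)"
  have T: "?T \<in> bop" using S by simp
  have sum: "((%f. (norm (adj (right_ket f) v))\<^sup>2) has_sum (norm v)\<^sup>2) onb"
    for v :: "('e::complex_hilbert, 'b) htensor"
  proof -
    have c: "htensor_coeff v (e, f) = e \<bullet> adj (right_ket f) v" if "e \<in> onb" "f \<in> onb" for e f
      using that by (simp add: htensor_coeff_onb cinner_adj_right)
    have "((%p. (cmod (htensor_coeff v p))\<^sup>2) has_sum inner v v) (onb \<times> onb)"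
      by (rule has_sum_cong_neutral[THEN iffD1, rotated -1, OF htensor_norm_sq])
         (auto simp: htensor_coeff_outside)
    then have "((%(f, e). (cmod (htensor_coeff v (e, f)))\<^sup>2) has_sum inner v v) (onb \<times> onb)"
      by (subst has_sum_swap) (simp add: case_prod_unfold)
    then show ?thesis
      unfolding power2_norm_eq_inner[symmetric]
      by (rule has_sum_SigmaD)
         (simp add: c parseval_norm cong: has_sum_cong)
  qed
  have "(norm (?T v))\<^sup>2 \<le> (norm S * norm v)\<^sup>2"
  proof (rule has_sum_mono)
    show "((%f. (norm (adj (right_ket f) (?T v)))\<^sup>2) has_sum (norm (?T v))\<^sup>2) onb"
      by (rule sum)
    show "((%f. (norm S)\<^sup>2 * (norm (adj (right_ket f) v))\<^sup>2) has_sum (norm S * norm v)\<^sup>2) onb"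
      unfolding power_mult_distrib by (intro has_sum_cmult_right sum)
    fix f :: 'b
    have "adj (right_ket f) (?T v) = S (adj (right_ket f) v)"
      using arg_cong[OF adj_right_ket_tensor_op[OF S bop_id, of f], of "%T. blinfun_apply T v"] by simp
    then have "norm (adj (right_ket f) (?T v)) \<le> norm S * norm (adj (right_ket f) v)"
      by (simp add: norm_blinfun)
    then show "(norm (adj (right_ket f) (?T v)))\<^sup>2 \<le> (norm S)\<^sup>2 * (norm (adj (right_ket f) v))\<^sup>2"
      unfolding power_mult_distrib[symmetric] by (rule power_mono) simp
  qed
  then show "norm (?T v) \<le> norm S * norm v"
    by (rule power2_le_imp_le) simp
qed simp

lemma norm_tensor_op:
  fixes S :: "'a::complex_hilbert -> 'c::complex_hilbert" and T :: "'b::complex_hilbert -> 'd::complex_hilbert"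
  assumes "S \<in> bop" "T \<in> bop"
  shows "norm (S ** T) \<le> norm S * norm T"
proof -
  have T: "\<one> ** T = flip oo (T ** (\<one> :: 'c -> 'c)) oo flip"
    by (rule blinfun_eq_tensI) (use assms in auto)
  have nT: "norm (\<one> ** T :: ('c, 'b) htensor -> _) \<le> norm T"
  proof (rule norm_blinfun_bound)
    fix v :: "('c, 'b) htensor"
    have "norm ((\<one> ** T) v) = norm ((T ** (\<one> :: 'c -> 'c)) (flip v))"
      unfolding T by (simp add: norm_unitary)
    also have "\<dots> \<le> norm (T ** (\<one> :: 'c -> 'c)) * norm (flip v)"
      by (rule norm_blinfun)
    also have "\<dots> \<le> norm T * norm v"
      unfolding norm_unitary[OF unitary_flip] by (intro mult_right_mono norm_tensor_op_id assms) simp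
    finally show "norm ((\<one> ** T) v) \<le> norm T * norm v" .
  qed simp
  have "S ** T = (\<one> ** T) oo (S ** \<one>)"
    using assms by (simp add: tensor_op_compose)
  then have "norm (S ** T) \<le> norm (\<one> ** T :: ('c, 'b) htensor -> _) * norm (S ** (\<one> :: 'b -> 'b))"
    by (simp add: norm_blinfun_compose)
  also have "\<dots> \<le> norm T * norm S"
    by (intro mult_mono nT norm_tensor_op_id assms) auto
  finally show ?thesis by (simp add: mult.commute)
qed

text \<open>Tensor products of operators are well behaved only on complex linear operators, hence the
  following notion of a bounded linear map on \<open>bop\<close>.\<close>

definition blin :: "(('a::complex_hilbert -> 'b::complex_hilbert) => ('c::complex_hilbert -> 'd::complex_hilbert)) => bool" where
  "blin f \<longleftrightarrow> (\<forall>S\<in>bop. f S \<in> bop) \<and> (\<forall>S\<in>bop. \<forall>T\<in>bop. f (S + T) = f S + f T) \<and>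
    (\<forall>c. \<forall>S\<in>bop. f (c *c S) = c *c f S) \<and> (\<exists>K. \<forall>S\<in>bop. norm (f S) \<le> norm S * K)"

lemma blinI:
  assumes "\<And>S. S \<in> bop ==> f S \<in> bop" "\<And>S T. S \<in> bop ==> T \<in> bop ==> f (S + T) = f S + f T"
    "\<And>c S. S \<in> bop ==> f (c *c S) = c *c f S" "\<And>S. S \<in> bop ==> norm (f S) \<le> norm S * K"
  shows "blin f"
  using assms unfolding blin_def by blast

lemma blinD:
  assumes "blin f"
  shows "S \<in> bop ==> f S \<in> bop" "S \<in> bop ==> T \<in> bop ==> f (S + T) = f S + f T"
    "S \<in> bop ==> f (c *c S) = c *c f S" "f 0 = 0" "S \<in> bop ==> T \<in> bop ==> f (S - T) = f S - f T"
proof -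
  show 1: "S \<in> bop ==> T \<in> bop ==> f (S + T) = f S + f T" "S \<in> bop ==> f (c *c S) = c *c f S"
    "S \<in> bop ==> f S \<in> bop" for S T c
    using assms by (auto simp: blin_def)
  show "f 0 = 0"
    using 1(1)[of 0 0] by simp
  show "f (S - T) = f S - f T" if "S \<in> bop" "T \<in> bop"
    using 1(1)[of "S - T" T] that by simp
qed

lemma blin_bound:
  assumes "blin f"
  obtains K where "K > 0" "\<And>S. S \<in> bop ==> norm (f S) \<le> norm S * K"
proof -
  obtain K where K: "\<And>S. S \<in> bop ==> norm (f S) \<le> norm S * K"
    using assms unfolding blin_def by blast
  show ?thesis
  proof (rule that[of "max K 1"])
    show "norm (f S) \<le> norm S * max K 1" if "S \<in> bop" for S
      using K[OF that] mult_left_mono[of K "max K 1" "norm S"] by simp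
  qed simp
qed

lemma null_comparison:
  fixes a :: "nat => 'a::real_normed_vector"
  assumes "\<And>n. norm (a n) \<le> b n" "b ----> 0"
  shows "a ----> 0"
  using assms by (intro Lim_null_comparison[of a b]) auto

lemma blin_tendsto:
  assumes f: "blin f" and s: "\<And>n. s n \<in> bop" "x \<in> bop" "s ----> x"
  shows "(%n. f (s n)) ----> f x"
proof -
  obtain K where K: "K > 0" "\<And>S. S \<in> bop ==> norm (f S) \<le> norm S * K"
    using blin_bound[OF f] by blast
  have "norm (f (s n) - f x) \<le> norm (s n - x) * K" for n
    using K(2)[of "s n - x"] s by (simp add: blinD(5)[OF f])
  moreover have "(%n. norm (s n - x) * K) ----> 0"
    using s(3) by (intro tendsto_mult_left_zero tendsto_norm_zero LIM_zero)
  ultimately have "(%n. f (s n) - f x) ----> 0"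
    by (rule null_comparison)
  then show ?thesis by (rule LIM_zero_cancel)
qed

lemma blin_vimage:
  assumes f: "blin f" and M: "csubspace M" "closed M"
  shows "csubspace {S \<in> bop. f S \<in> M}" "closed {S \<in> bop. f S \<in> M}"
proof -
  show "csubspace {S \<in> bop. f S \<in> M}"
    by (rule csubspaceI) (auto simp: blinD[OF f] intro: csubspaceD(1-3)[OF M(1)])
  show "closed {S \<in> bop. f S \<in> M}"
    unfolding closed_sequential_limits
  proof (intro allI impI)
    fix s x assume "(\<forall>n. s n \<in> {S \<in> bop. f S \<in> M}) \<and> s ----> x"
    then have s: "\<forall>n. s n \<in> bop" "\<forall>n. f (s n) \<in> M" and lim: "s ----> x"
      by auto
    have x: "x \<in> bop"
      by (rule closed_sequentially[OF closed_bop _ lim]) (simp add: s(1))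
    have "(%n. f (s n)) ----> f x"
      using s(1) by (intro blin_tendsto[OF f] x lim) simp
    then have "f x \<in> M"
      by (rule closed_sequentially[OF M(2), rotated]) (simp add: s(2))
    with x show "x \<in> {S \<in> bop. f S \<in> M}" by simp
  qed
qed

lemma blin_ccl:
  assumes x: "x \<in> ccl S" and f: "blin f" and S: "S \<subseteq> bop" and M: "csubspace M" "closed M"
    and fS: "\<And>s. s \<in> S ==> f s \<in> M"
  shows "f x \<in> M"
proof -
  have "ccl S \<subseteq> {S \<in> bop. f S \<in> M}"
    using S fS by (intro ccl_minimal blin_vimage[OF f M]) auto
  then show ?thesis using x by blast
qed

lemma blin_comp:
  assumes f: "blin f" and g: "blin g"
  shows "blin (%S. g (f S))"
proof -
  obtain K where K: "K > 0" "\<And>S. S \<in> bop ==> norm (f S) \<le> norm S * K"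
    using blin_bound[OF f] by blast
  obtain L where L: "L > 0" "\<And>S. S \<in> bop ==> norm (g S) \<le> norm S * L"
    using blin_bound[OF g] by blast
  show ?thesis
  proof (rule blinI)
    fix S :: "'a -> 'b" assume S: "S \<in> bop"
    then have "norm (g (f S)) \<le> norm (f S) * L"
      using L blinD(1)[OF f] by auto
    also have "\<dots> \<le> norm S * K * L"
      using K(2)[OF S] L(1) by (intro mult_right_mono) auto
    finally show "norm (g (f S)) \<le> norm S * (K * L)" by (simp add: mult.assoc)
  qed (auto simp: blinD[OF f] blinD[OF g])
qed

lemma blin_compose_left: "A \<in> bop ==> blin (%S. A oo S)"
  by (rule blinI[where K = "norm A"])
     (auto simp: norm_blinfun_compose mult.commute compose_add(1))

lemma blin_compose_right: "A \<in> bop ==> blin (%S. S oo A)"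
  by (rule blinI[where K = "norm A"])
     (auto simp: norm_blinfun_compose compose_add(2))

lemma blin_tensor_left: "B \<in> bop ==> blin (%S. S ** B)"
  by (rule blinI[where K = "norm B"]) (auto simp: tensor_op_linear norm_tensor_op)

lemma blin_tensor_right: "A \<in> bop ==> blin (%S. A ** S)"
  by (rule blinI[where K = "norm A"]) (auto simp: tensor_op_linear norm_tensor_op mult.commute)

lemma blin_lsl: "blin (%X. lsl x X z)"
  unfolding lsl_def by (intro blin_comp[OF blin_compose_left blin_compose_right]) auto

section \<open>Leg numbering\<close>

lemma compose_reassoc: "A oo B = C oo D ==> A oo (B oo S) = C oo (D oo S)"
  by (simp flip: blinfun_compose_assoc)

lemma assoc_naturality: "A \<in> bop ==> B \<in> bop ==> C \<in> bop ==>
    assoc oo ((A ** B) ** C) = (A ** (B ** C)) oo assoc"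
  by (rule blinfun_eq_tens3I) auto

lemma adj_assoc_naturality: "A \<in> bop ==> B \<in> bop ==> C \<in> bop ==>
    ((A ** B) ** C) oo adj assoc = adj assoc oo (A ** (B ** C))"
proof -
  assume b: "A \<in> bop" "B \<in> bop" "C \<in> bop"
  have "adj (assoc oo ((adj A ** adj B) ** adj C)) = adj ((adj A ** (adj B ** adj C)) oo assoc)"
    using b by (simp only: assoc_naturality bop_adj)
  then show ?thesis
    using b by simp
qed

lemma bop_legs [simp]: "X \<in> bop ==> leg12 X \<in> bop" "X \<in> bop ==> leg13 X \<in> bop" "X \<in> bop ==> leg23 X \<in> bop"
  by (simp_all add: leg12_def leg13_def leg23_def reassoc_def)

lemma assoc_left_inverse [simp]: "adj assoc oo assoc = \<one>" "adj assoc oo (assoc oo S) = S"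
  "adj assoc (assoc v) = v" "assoc (adj assoc w) = w" "assoc oo adj assoc = \<one>"
  "assoc oo (adj assoc oo T) = T"
  using unitaryD[OF unitary_assoc] by auto

lemma leg_compose:
  assumes "X \<in> bop" "Y \<in> bop"
  shows "leg12 X oo leg12 Y = leg12 (X oo Y)" "leg13 X oo leg13 Y = leg13 (X oo Y)"
    "leg23 X oo leg23 Y = leg23 (X oo Y)"
proof -
  have tt: "(X ** \<one>) oo ((Y ** \<one>) oo S) = ((X oo Y) ** \<one>) oo S"
    for S :: "'x::complex_hilbert -> ((_, _) htensor, 'z::complex_hilbert) htensor"
    using assms by (simp add: tensor_op_compose flip: blinfun_compose_assoc)
  show "leg12 X oo leg12 Y = leg12 (X oo Y)"
    unfolding leg12_def reassoc_def by (simp add: blinfun_compose_assoc tt)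
  have ff: "(\<one> ** flip) oo ((\<one> ** flip) oo S) = S"
    for S :: "'x::complex_hilbert -> ('u::complex_hilbert, 'v::complex_hilbert, 'w::complex_hilbert) htensor3"
    by (simp add: tensor_op_compose flip: blinfun_compose_assoc)
  show "leg13 X oo leg13 Y = leg13 (X oo Y)"
    unfolding leg13_def leg12_def reassoc_def by (simp add: blinfun_compose_assoc tt ff)
  show "leg23 X oo leg23 Y = leg23 (X oo Y)"
    unfolding leg23_def using assms by (simp add: tensor_op_compose)
qed

lemma leg_compose2:
  assumes "X \<in> bop" "Y \<in> bop"
  shows "leg12 X oo (leg12 Y oo S) = leg12 (X oo Y) oo S" "leg13 X oo (leg13 Y oo T) = leg13 (X oo Y) oo T"
    "leg23 X oo (leg23 Y oo U) = leg23 (X oo Y) oo U"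
  using assms by (simp_all add: leg_compose flip: blinfun_compose_assoc)

lemma leg_adj [simp]:
  assumes "X \<in> bop"
  shows "adj (leg12 X) = leg12 (adj X)" "adj (leg13 X) = leg13 (adj X)" "adj (leg23 X) = leg23 (adj X)"
  using assms by (simp_all add: leg12_def leg13_def leg23_def reassoc_def blinfun_compose_assoc)

lemma leg_id [simp]: "leg12 \<one> = \<one>" "leg13 \<one> = \<one>"
  "leg23 \<one> = \<one>"
  by (simp_all add: leg12_def leg13_def leg23_def reassoc_def tensor_op_compose)

lemma unitary_legs [simp]:
  assumes "unitary X"
  shows "unitary (leg12 X)" "unitary (leg13 X)" "unitary (leg23 X)"
  unfolding unitary_def[of "leg12 X"] unitary_def[of "leg13 X"] unitary_def[of "leg23 X"]
  by (auto simp: unitaryD[OF assms] leg_compose)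

lemma op_eqI3:
  assumes "S \<in> bop" "T \<in> bop"
    and "\<And>x y z x' y' z'. (x \<otimes> (y \<otimes> z)) \<bullet> S (x' \<otimes> (y' \<otimes> z')) = (x \<otimes> (y \<otimes> z)) \<bullet> T (x' \<otimes> (y' \<otimes> z'))"
  shows "S = T"
  using assms(1,2)
proof (rule lsl_eqI)
  show "lsl x S z = lsl x T z" for x z
    by (rule op_eqI2) (use assms in \<open>auto simp: cinner_lsl\<close>)
qed

lemma cinner_assoc: "(x \<otimes> (y \<otimes> w)) \<bullet> assoc v = ((x \<otimes> y) \<otimes> w) \<bullet> v"
  by (simp add: cinner_adj[OF bop_assoc, symmetric] adj_assoc_tens)

lemma cinner_id_flip: "(x \<otimes> (y \<otimes> w)) \<bullet> (\<one> ** flip) v = (x \<otimes> (w \<otimes> y)) \<bullet> v"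
  by (simp add: cinner_adj[symmetric])

text \<open>After slicing the first leg, leg numbering disappears and elementary tensors on the
  other two legs remain. Most leg identities below are checked in this way, with
  \<open>lsl_eqI\<close>.\<close>

lemma lsl_legs:
  assumes "X \<in> bop"
  shows "lsl x (leg12 X) z = lsl x X z ** \<one>" "lsl x (leg13 X) z = \<one> ** lsl x X z"
    "lsl x (leg23 X) z = (x \<bullet> z) *c X"
proof -
  have 12: "(x \<otimes> (y \<otimes> w)) \<bullet> leg12 X (z \<otimes> (y' \<otimes> w')) = ((x \<otimes> y) \<bullet> X (z \<otimes> y')) * (w \<bullet> w')"
    if "X \<in> bop" for X :: "('p::complex_hilbert, 'q::complex_hilbert) htensor -> ('p, 'q) htensor"
      and x z y y' and w w' :: "'r::complex_hilbert"
  proof -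
    show ?thesis
      using that unfolding leg12_def reassoc_def by (simp add: adj_assoc_tens cinner_assoc)
  qed
  show "lsl x (leg12 X) z = lsl x X z ** \<one>"
    by (rule op_eqI2) (use assms in \<open>auto simp: cinner_lsl 12\<close>)
  have "(x \<otimes> (y \<otimes> w)) \<bullet> leg13 X (z \<otimes> (y' \<otimes> w')) = (y \<bullet> y') * ((x \<otimes> w) \<bullet> X (z \<otimes> w'))"
    for y y' :: "'m::complex_hilbert" and w w'
  proof -
    show ?thesis
      unfolding leg13_def using assms by (simp add: 12 cinner_id_flip)
  qed
  then show "lsl x (leg13 X) z = \<one> ** lsl x X z"
    by (intro op_eqI2) (use assms in \<open>auto simp: cinner_lsl\<close>)
  show "lsl x (leg23 X) z = (x \<bullet> z) *c X"
    unfolding leg23_def using assms by (simp add: lsl_tensor_op)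
qed

lemma leg23_left_ket: "X \<in> bop ==> leg23 X oo left_ket z = left_ket z oo X"
  and adj_left_ket_leg23: "X \<in> bop ==> adj (left_ket z) oo leg23 X = X oo adj (left_ket z)"
  by (simp_all add: leg23_def tensor_op_left_ket adj_left_ket_tensor_op)

text \<open>An operator in legs 2 and 3 does not touch the sliced leg and moves out of the slice.
  Conjugation by \<open>leg23 V\<close> thus becomes conjugation by \<open>V\<close> on
  slices.\<close>

lemma lsl_leg23_compose:
  assumes "X \<in> bop" "Y \<in> bop"
  shows "lsl x (Y oo leg23 X) z = lsl x Y z oo X" "lsl x (leg23 X oo Y) z = X oo lsl x Y z"
  using adj_left_ket_leg23[OF assms(1), THEN compose_reassoc]
  by (simp_all add: lsl_def blinfun_compose_assoc leg23_left_ket assms)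

lemma leg12_tens: "X \<in> bop ==> leg12 X (x \<otimes> (y \<otimes> z)) = assoc (X (x \<otimes> y) \<otimes> z)"
  by (simp add: leg12_def reassoc_def adj_assoc_tens)

lemma leg23_tens: "X \<in> bop ==> leg23 X (x \<otimes> v) = x \<otimes> X v"
  by (simp add: leg23_def)

lemma leg12_assoc: "X \<in> bop ==> leg12 X (assoc (v \<otimes> z)) = assoc (X v \<otimes> z)"
  by (simp add: leg12_def reassoc_def)

lemma leg12_id_right_ket: "X \<in> bop ==> leg12 X oo (\<one> ** right_ket c) = (\<one> ** right_ket c) oo X"
proof -
  assume X: "X \<in> bop"
  have a: "\<one> ** right_ket c = assoc oo right_ket c"
    by (rule blinfun_eq_tensI) auto
  show ?thesis
    unfolding a leg12_def reassoc_def
    by (simp add: blinfun_compose_assoc) (simp add: X tensor_op_right_ket flip: blinfun_compose_assoc)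
qed

lemma leg13_conj: "leg13 X = (\<one> ** flip) oo leg12 X oo (\<one> ** flip)"
  by (rule leg13_def)

text \<open>A vector inserted in the untouched middle leg commutes with \<open>leg13\<close>; this
  is how a trivial middle leg is stripped off later (\<open>leg13_slice\<close>).\<close>

lemma leg13_id_left_ket:
  assumes X: "X \<in> bop"
  shows "leg13 X oo (\<one> ** left_ket c) = (\<one> ** left_ket c) oo X"
    "(\<one> ** adj (left_ket c)) oo leg13 X = X oo (\<one> ** adj (left_ket c))"
proof -
  have 1: "leg13 X oo (\<one> ** left_ket c) = (\<one> ** left_ket c) oo X"
    if X: "X \<in> bop" for X :: "('a::complex_hilbert, 'b::complex_hilbert) htensor -> ('a, 'b) htensor"
      and c :: "'c::complex_hilbert"
    unfolding leg13_def blinfun_compose_assoc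
    by (simp add: tensor_op_compose leg12_id_right_ket X)
       (simp add: tensor_op_compose flip: blinfun_compose_assoc)
  show "leg13 X oo (\<one> ** left_ket c) = (\<one> ** left_ket c) oo X"
    using X by (rule 1)
  have "adj (leg13 (adj X) oo (\<one> ** left_ket c)) = adj ((\<one> ** left_ket c) oo adj X)"
    using X by (simp only: 1 bop_adj)
  then show "(\<one> ** adj (left_ket c)) oo leg13 X = X oo (\<one> ** adj (left_ket c))"
    using X by simp
qed

section \<open>Functional calculus for positive contractions\<close>

lemma parallelogram: "(norm (x + y))\<^sup>2 + (norm (x - y))\<^sup>2 = 2 * (norm x)\<^sup>2 + 2 * (norm (y::'a::real_inner))\<^sup>2"
  by (simp add: power2_norm_eq_inner inner_add inner_diff inner_commute algebra_simps)

lemma norm_diff_sq: "(norm (x - y))\<^sup>2 = (norm x)\<^sup>2 - 2 * Re (x \<bullet> y) + (norm (y::'a::complex_hilbert))\<^sup>2"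
  unfolding inner_cinner[symmetric] by (simp add: power2_norm_eq_inner inner_diff inner_commute)

text \<open>A nearest point of \<open>M\<close> exists because the near-minimizers form nested
  closed sets of shrinking diameter. The difference to the nearest point is orthogonal to
  \<open>M\<close>, hence 0.\<close>

lemma closed_subspace_eq_UNIV:
  fixes M :: "'a::complex_hilbert set"
  assumes M: "csubspace M" "closed M" and orth: "\<And>y. (\<And>x. x \<in> M ==> x \<bullet> y = 0) ==> y = 0"
  shows "M = UNIV"
proof -
  have "z \<in> M" for z
  proof -
    define d where "d = infdist z M"
    have ne: "M \<noteq> {}" using csubspaceD(1)[OF M(1)] by auto
    have le: "d \<le> norm (z - x)" if "x \<in> M" for x
      using infdist_le[OF that, of z] by (simp add: d_def dist_norm)
    have d0: "d \<ge> 0" unfolding d_def by (rule infdist_nonneg)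
    define S where "S n = M \<inter> cball z (d + inverse (real (Suc n)))" for n
    obtain x where x: "\<And>n. x \<in> S n"
    proof (rule decreasing_closed_nest[of S])
      show "closed (S n)" for n by (simp add: S_def M(2) closed_Int)
      show "S n \<noteq> {}" for n
      proof
        assume "S n = {}"
        then have "d + inverse (real (Suc n)) \<le> infdist z M"
          unfolding infdist_notempty[OF ne] by (intro cINF_greatest[OF ne]) (auto simp: S_def disjoint_iff)
        then show False by (simp add: d_def)
      qed
      show "S n \<subseteq> S m" if "m \<le> n" for m n
      proof -
        have "inverse (real (Suc n)) \<le> inverse (real (Suc m))"
          using that by (intro le_imp_inverse_le) simp_all
        then show ?thesis
          unfolding S_def by (intro Int_mono order_refl subset_cball add_left_mono)
      qed
      show "\<exists>n. \<forall>x\<in>S n. \<forall>y\<in>S n. dist x y < e" if e: "e > 0" for e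
      proof -
        \<comment> \<open>By the parallelogram law two points of \<open>S n\<close> have squared
          distance at most 4 (d + i)^2 - 4 d^2 = 8 d i + 4 i^2, where i = 1/(n + 1). Since i^2 \<le>
          i, this is at most (8 d + 4) i.\<close>
        obtain n where n: "inverse (real (Suc n)) < e\<^sup>2 / (8 * d + 4)"
          using reals_Archimedean[of "e\<^sup>2 / (8 * d + 4)"] e d0 by auto
        let ?i = "inverse (real (Suc n))"
        have "dist x y < e" if xy: "x \<in> S n" "y \<in> S n" for x y
        proof -
          have "(1/2) *\<^sub>R (x + y) \<in> M"
            using xy by (intro csubspaceD(5)[OF M(1)] csubspaceD(2)[OF M(1)]) (auto simp: S_def)
          then have "d \<le> norm (z - (1/2) *\<^sub>R (x + y))" by (rule le)
          moreover have "(z - x) + (z - y) = 2 *\<^sub>R (z - (1/2) *\<^sub>R (x + y))"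
            by (simp add: algebra_simps scaleR_2)
          ultimately have "2 * d \<le> norm ((z - x) + (z - y))" by simp
          then have "(2 * d)\<^sup>2 \<le> (norm ((z - x) + (z - y)))\<^sup>2"
            using d0 by (intro power_mono) auto
          moreover have "(norm (z - x))\<^sup>2 \<le> (d + ?i)\<^sup>2" "(norm (z - y))\<^sup>2 \<le> (d + ?i)\<^sup>2"
            using xy by (auto simp: S_def dist_norm intro!: power_mono)
          moreover have "(norm (x - y))\<^sup>2 = 2 * (norm (z - x))\<^sup>2 + 2 * (norm (z - y))\<^sup>2 - (norm ((z - x) + (z - y)))\<^sup>2"
            using parallelogram[of "z - x" "z - y"] by (simp add: norm_minus_commute algebra_simps)
          moreover have "?i * ?i \<le> 1 * ?i" by (intro mult_right_mono) (auto simp: inverse_le_1_iff)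
          moreover have "(d + ?i)\<^sup>2 = d\<^sup>2 + 2 * (d * ?i) + ?i * ?i" "(2 * d)\<^sup>2 = 4 * d\<^sup>2"
              "(8 * d + 4) * ?i = 8 * (d * ?i) + 4 * ?i"
            by (simp_all add: power2_sum power_mult_distrib ring_distribs power2_eq_square[of ?i] del: of_nat_Suc)
          ultimately have "(norm (x - y))\<^sup>2 \<le> (8 * d + 4) * ?i"
            by linarith
          also have "\<dots> < e\<^sup>2" using n d0 by (simp add: field_simps)
          finally show ?thesis unfolding dist_norm using e power2_less_imp_less by fastforce
        qed
        then show ?thesis by blast
      qed
    qed blast
    then have xM: "x \<in> M" by (simp add: S_def)
    have "norm (z - x) \<le> d"
    proof (rule field_le_epsilon)
      fix e :: real assume "e > 0"
      then obtain n where "inverse (real (Suc n)) < e" using reals_Archimedean by blast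
      then show "norm (z - x) \<le> d + e" using x[of n] by (simp add: S_def dist_norm)
    qed
    then have min: "norm (z - x) \<le> norm (z - x - u)" if "u \<in> M" for u
      using le[of "x + u"] csubspaceD(2)[OF M(1) xM that] by (simp add: diff_diff_eq)
    have "z - x = 0"
    proof (rule orth)
      fix u assume u: "u \<in> M"
      define y where "y = z - x"
      define c where "c = u \<bullet> y"
      show "u \<bullet> (z - x) = 0"
      proof (cases "u = 0")
        case False
        \<comment> \<open>Subtracting t c u is the projection along \<open>u\<close>, the best
          correction in that direction; minimality of the distance then forces c = 0.\<close>
        define t where "t = 1 / (norm u)\<^sup>2"
        have t: "t > 0" "t * (norm u)\<^sup>2 = 1" using False by (auto simp: t_def)
        have "(norm y)\<^sup>2 \<le> (norm (y - (of_real t * c) *c u))\<^sup>2"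
          using min[of "(of_real t * c) *c u"] csubspaceD(3)[OF M(1) u] unfolding y_def
          by (intro power_mono) auto
        also have "\<dots> = (norm y)\<^sup>2 - 2 * Re (y \<bullet> ((of_real t * c) *c u)) + (norm ((of_real t * c) *c u))\<^sup>2"
          by (rule norm_diff_sq)
        also have "y \<bullet> ((of_real t * c) *c u) = of_real (t * (cmod c)\<^sup>2)"
          using cinner_commute[of y u] by (simp add: c_def complex_norm_square[symmetric] del: of_real_power)
        also have "(norm ((of_real t * c) *c u))\<^sup>2 = t * (cmod c)\<^sup>2 * (t * (norm u)\<^sup>2)"
          using t(1) by (simp add: norm_mult power_mult_distrib power2_eq_square)
        finally have "t * (cmod c)\<^sup>2 \<le> 0"
          unfolding t(2) by (simp del: of_real_mult of_real_power)
        then have "c = 0" using t(1) by (simp add: mult_le_0_iff)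
        then show ?thesis by (simp add: c_def y_def)
      qed simp
    qed
    then show ?thesis using xM by simp
  qed
  then show ?thesis by blast
qed

text \<open>Polarization recovers \<open>T\<close> from its quadratic form; the factor 2 is the
  price for operators that are not self-adjoint.\<close>

lemma norm_le_numerical_radius:
  assumes T: "T \<in> bop" and M0: "0 \<le> M"
    and M: "\<And>x. cmod (x \<bullet> blinfun_apply T x) \<le> M * (norm x)\<^sup>2"
  shows "norm T \<le> 2 * M"
proof (rule norm_blinfun_bound)
  show "norm (T x) \<le> 2 * M * norm x" for x
  proof (cases "x = 0 \<or> T x = 0")
    case False
    then have nz: "x \<noteq> 0" "T x \<noteq> 0" by auto
    \<comment> \<open>Scaling \<open>T x\<close> to the length of \<open>x\<close> makes the four
      polarization terms add up, by the parallelogram law, to 8 M times the squared norm of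
      \<open>x\<close>.\<close>
    define r where "r = norm (T x) / norm x"
    have r: "r > 0" using nz by (simp add: r_def)
    define y where "y = (1 / complex_of_real r) *c T x"
    have cr: "cmod (1 / complex_of_real r) = 1 / r" using r by (simp add: norm_divide)
    have ny: "norm y = norm x" using nz unfolding y_def norm_scaleC cr by (simp add: r_def)
    have p: "4 * (y \<bullet> T x) = ((x + y) \<bullet> T (x + y)) - ((x - y) \<bullet> T (x - y))
        + (- \<i>) * ((x + (- \<i>) *c y) \<bullet> T (x + (- \<i>) *c y)) - (- \<i>) * ((x + \<i> *c y) \<bullet> T (x + \<i> *c y))" for y
      by (simp add: blinfun.add_right blinfun.diff_right cinner_add_left cinner_add_right cinner.diff_left
          cinner.diff_right bop_scaleC[OF T] algebra_simps)
    have "cmod (4 * (y \<bullet> T x)) \<le> cmod ((x + y) \<bullet> T (x + y)) + cmod ((x - y) \<bullet> T (x - y))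
        + cmod ((x + (- \<i>) *c y) \<bullet> T (x + (- \<i>) *c y)) + cmod ((x + \<i> *c y) \<bullet> T (x + \<i> *c y))"
      unfolding p by (intro norm_triangle_le norm_triangle_le_diff add_mono) (auto simp: norm_mult)
    also have "\<dots> \<le> M * (norm (x + y))\<^sup>2 + M * (norm (x - y))\<^sup>2 + M * (norm (x + (- \<i>) *c y))\<^sup>2 + M * (norm (x + \<i> *c y))\<^sup>2"
      by (intro add_mono M)
    also have "\<dots> = M * ((norm (x + y))\<^sup>2 + (norm (x - y))\<^sup>2) + M * ((norm (x + \<i> *c y))\<^sup>2 + (norm (x - \<i> *c y))\<^sup>2)"
      by (simp add: algebra_simps scaleC.minus_left)
    also have "\<dots> = 8 * (M * (norm x)\<^sup>2)"
      unfolding parallelogram by (simp add: ny)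
    finally have "4 * cmod (y \<bullet> T x) \<le> 8 * (M * (norm x)\<^sup>2)"
      by (simp add: norm_mult)
    moreover have "cmod (y \<bullet> T x) = norm (T x) * norm x"
    proof -
      have "cmod (y \<bullet> T x) = (1 / r) * (norm (T x))\<^sup>2"
        unfolding y_def cinner_scaleC_left norm_mult complex_mod_cnj cinner_self norm_of_real cr by simp
      then show ?thesis using nz by (simp add: r_def power2_eq_square)
    qed
    ultimately have "norm x * norm (T x) \<le> norm x * (2 * M * norm x)"
      by (simp add: power2_eq_square algebra_simps)
    then show ?thesis using nz by simp
  next
    case True
    then show ?thesis using M0 by auto
  qed
qed (use M0 in simp)

section \<open>Polynomials in a positive contraction\<close>

definition opoly :: "('a::complex_hilbert -> 'a) => complex poly => ('a -> 'a)" where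
  "opoly B p = fold_coeffs (%a T. a *c \<one> + (B oo T)) p 0"

lemma opoly_0 [simp]: "opoly B 0 = 0"
  by (simp add: opoly_def)

lemma opoly_pCons [simp]: "opoly B (pCons a p) = a *c \<one> + (B oo opoly B p)"
  by (cases "p = 0 \<and> a = 0") (auto simp: opoly_def)

lemma bop_opoly [simp]: "B \<in> bop ==> opoly B p \<in> bop"
  by (induction p) auto

lemma opoly_add: "opoly B (p + q) = opoly B p + opoly B q"
  by (induction p q rule: poly_induct2)
     (simp_all add: scaleC_add_left compose_add(1))

lemma opoly_smult: "B \<in> bop ==> opoly B (smult c p) = c *c opoly B p"
  by (induction p) (simp_all add: scaleC_add_right scaleC_scaleC)

lemma opoly_mult: "B \<in> bop ==> opoly B (p * q) = opoly B p oo opoly B q"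
  by (induction p) (simp_all add: opoly_add opoly_smult blinfun_compose_assoc
      compose_add(2))

lemma opoly_1 [simp]: "opoly B 1 = \<one>"
  by (simp add: one_pCons)

lemma opoly_diff: "opoly B (p - q) = opoly B p - opoly B q"
  using opoly_add[of B "p - q" q] by (simp add: algebra_simps)

lemma opoly_sum: "opoly B (\<Sum>i\<in>A. p i) = (\<Sum>i\<in>A. opoly B (p i))"
  by (induction A rule: infinite_finite_induct) (auto simp: opoly_add)

lemma adj_opoly:
  assumes "B \<in> bop" "adj B = B"
  shows "adj (opoly B p) = opoly B (map_poly cnj p)"
proof (induction p)
  case (pCons a p)
  have comm: "B oo opoly B q = opoly B q oo B" for q
    using opoly_mult[OF assms(1), of "[:0, 1:]" q] opoly_mult[OF assms(1), of q "[:0, 1:]"]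
    by (simp add: mult.commute)
  show ?case
    using assms pCons comm[symmetric] by (simp add: map_poly_pCons)
qed simp

text \<open>This is 0 \<le> B \<le> 1, expressed by quadratic forms. Positivity of polynomials in
  \<open>B\<close> is derived algebraically from the Bernstein basis instead of from a
  spectrum.\<close>

locale positive_contraction =
  fixes B :: "'a::complex_hilbert -> 'a"
  assumes B: "B \<in> bop" and sa: "adj B = B"
    and pos: "x \<bullet> B x \<in> \<real>\<^sub>\<ge>\<^sub>0" and contr: "x \<bullet> (x - B x) \<in> \<real>\<^sub>\<ge>\<^sub>0"
begin

abbreviation X :: "complex poly" where "X \<equiv> [:0, 1:]"

lemma sym: "B x \<bullet> y = x \<bullet> B y"
  by (metis B cinner_adj sa)

definition sa_poly :: "complex poly => bool" where "sa_poly p \<longleftrightarrow> adj (opoly B p) = opoly B p"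

lemma sa_poly_mult: "sa_poly p ==> sa_poly q ==> sa_poly (p * q)"
  by (simp add: sa_poly_def opoly_mult B flip: opoly_mult[of B q p, OF B] mult.commute[of p])

lemma sa_poly_X: "sa_poly X" "sa_poly (1 - X)"
  by (simp_all add: sa_poly_def opoly_diff B sa)

lemma sa_poly_power: "sa_poly p ==> sa_poly (p ^ n)"
  by (induction n) (simp_all add: sa_poly_mult, simp add: sa_poly_def)

lemma sa_polyD: "sa_poly p ==> opoly B p x \<bullet> y = x \<bullet> opoly B p y"
  by (metis B bop_opoly cinner_adj sa_poly_def)

definition pos_poly :: "complex poly => bool" where
  "pos_poly p \<longleftrightarrow> (\<forall>x. x \<bullet> opoly B p x \<in> \<real>\<^sub>\<ge>\<^sub>0)"

lemma pos_poly_sandwich: "sa_poly q ==> pos_poly p ==> pos_poly (q * p * q)"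
  by (auto simp: pos_poly_def opoly_mult B sa_polyD[symmetric])

lemma pos_poly_add: "pos_poly p ==> pos_poly q ==> pos_poly (p + q)"
  by (auto simp: pos_poly_def opoly_add blinfun.add_left cinner_add_right)

lemma pos_poly_1: "pos_poly 1"
  by (auto simp: pos_poly_def cinner_self)

lemma pos_poly_X: "pos_poly X" "pos_poly (1 - X)"
  using pos contr by (auto simp: pos_poly_def opoly_diff blinfun.diff_left)

text \<open>Even powers split off symmetrically on both sides, which preserves positivity, so only
  the exponents 0 and 1 remain. The mixed case X (1 - X) is itself the sum of a sandwich of X by 1 -
  X and a sandwich of 1 - X by X.\<close>

lemma pos_poly_basis: "pos_poly (X ^ k * (1 - X) ^ m)"
proof -
  have XX: "pos_poly (X * (1 - X))"
  proof -
    have "X * (1 - X) = (1 - X) * X * (1 - X) + X * (1 - X) * X"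
      by (simp add: algebra_simps)
    then show ?thesis
      using pos_poly_sandwich[OF sa_poly_X(2) pos_poly_X(1)] pos_poly_sandwich[OF sa_poly_X(1) pos_poly_X(2)]
      by (metis pos_poly_add)
  qed
  define i j where "i = k div 2" and "j = m div 2"
  define q where "q = X ^ i * (1 - X) ^ j"
  have q: "sa_poly q"
    unfolding q_def by (intro sa_poly_mult sa_poly_power sa_poly_X)
  have k: "k = i + i + k mod 2" and m: "m = j + j + m mod 2"
    unfolding i_def j_def by presburger+
  have "X ^ k * (1 - X) ^ m = q * (X ^ (k mod 2) * (1 - X) ^ (m mod 2)) * q"
    by (subst k, subst m) (simp only: power_add q_def ac_simps)
  moreover have "pos_poly (X ^ (k mod 2) * (1 - X) ^ (m mod 2))"
    using XX pos_poly_X pos_poly_1 by (cases "even k"; cases "even m") (auto simp: odd_iff_mod_2_eq_one)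
  ultimately show ?thesis
    using pos_poly_sandwich[OF q] by simp
qed

definition bern :: "nat => nat => complex poly" where
  "bern n k = smult (of_nat (n choose k)) (X ^ k * (1 - X) ^ (n - k))"

lemma pos_poly_bern: "pos_poly (bern n k)"
  using pos_poly_basis[of k "n - k"] unfolding pos_poly_def bern_def
  by (auto simp: opoly_smult B scaleC_blinfun_apply intro!: nonneg_Reals_mult_I)

lemma sum_bern: "(\<Sum>k\<le>n. bern n k) = 1"
proof -
  have "1 = (X + (1 - X)) ^ n" by simp
  also have "\<dots> = (\<Sum>k\<le>n. of_nat (n choose k) * X ^ k * (1 - X) ^ (n - k))"
    by (rule binomial_ring)
  finally show ?thesis
    by (simp add: bern_def of_nat_poly mult.assoc)
qed

text \<open>Multiply X^k by the partition of unity of degree n - k; \<open>choose_mult\<close> then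
  rewrites the binomial coefficients.\<close>

lemma monom_bern:
  assumes "k \<le> n"
  shows "X ^ k = (\<Sum>j\<le>n. smult (of_nat (j choose k) / of_nat (n choose k)) (bern n j))"
proof -
  have nz: "(of_nat (n choose k) :: complex) \<noteq> 0" using assms by simp
  have "X ^ k = X ^ k * (\<Sum>j\<le>n - k. bern (n - k) j)"
    by (simp add: sum_bern)
  also have "\<dots> = (\<Sum>j\<le>n - k. smult (of_nat (n - k choose j)) (X ^ (j + k) * (1 - X) ^ (n - (j + k))))"
    unfolding sum_distrib_left bern_def by (intro sum.cong) (auto simp: power_add ac_simps)
  also have "\<dots> = (\<Sum>j\<in>{k..n}. smult (of_nat (n - k choose (j - k))) (X ^ j * (1 - X) ^ (n - j)))"
    by (rule sum.reindex_bij_witness[of _ "%j. j - k" "%j. j + k"]) (use assms in auto)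
  also have "\<dots> = (\<Sum>j\<in>{k..n}. smult (of_nat (j choose k) / of_nat (n choose k)) (bern n j))"
  proof (rule sum.cong)
    fix j assume j: "j \<in> {k..n}"
    then have "(of_nat (n choose j) * of_nat (j choose k) :: complex) = of_nat (n choose k) * of_nat (n - k choose (j - k))"
      using choose_mult[of k j n] by (simp flip: of_nat_mult)
    then have "of_nat (n - k choose (j - k)) = (of_nat (j choose k) / of_nat (n choose k) * of_nat (n choose j) :: complex)"
      using nz by (simp add: field_simps)
    then show "smult (of_nat (n - k choose (j - k))) (X ^ j * (1 - X) ^ (n - j)) = smult (of_nat (j choose k) / of_nat (n choose k)) (bern n j)"
      by (simp add: bern_def)
  qed simp
  also have "\<dots> = (\<Sum>j\<le>n. smult (of_nat (j choose k) / of_nat (n choose k)) (bern n j))"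
    by (rule sum.mono_neutral_left) (auto simp: binomial_eq_0)
  finally show ?thesis .
qed

end

text \<open>Both sides are products of k factors of modulus at most 1, so their difference is
  bounded by the sum of the differences of the factors. Thus the j-th Bernstein coefficient of X^k
  is close to the sample (j/n)^k, uniformly in j.\<close>

lemma choose_ratio_approx:
  assumes k: "2 * k \<le> n" "0 < n" and j: "j \<le> n"
  shows "\<bar>real (j choose k) / real (n choose k) - (real j / real n) ^ k\<bar> \<le> real k * (2 * real k / real n)"
proof -
  have "real (j choose k) / real (n choose k) = (\<Prod>i<k. (real j - real i) / (real n - real i))"
    by (simp add: binomial_gbinomial gbinomial_prod_rev prod_dividef lessThan_atLeast0)
  moreover have "(real j / real n) ^ k = (\<Prod>i<k. real j / real n)"
    by simp
  ultimately have "\<bar>real (j choose k) / real (n choose k) - (real j / real n) ^ k\<bar>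
      = norm ((\<Prod>i<k. (real j - real i) / (real n - real i)) - (\<Prod>i<k. real j / real n))"
    by simp
  also have "\<dots> \<le> (\<Sum>i<k. norm ((real j - real i) / (real n - real i) - real j / real n))"
  proof (rule norm_prod_diff)
    fix i assume i: "i \<in> {..<k}"
    then have "\<bar>real j - real i\<bar> \<le> real n - real i" using k j by (auto simp: abs_le_iff)
    moreover have "real n - real i > 0" using i k by auto
    ultimately show "norm ((real j - real i) / (real n - real i)) \<le> 1" by (simp add: divide_simps)
    show "norm (real j / real n) \<le> 1" using j by (simp add: divide_simps)
  qed
  also have "\<dots> \<le> (\<Sum>i<k. 2 * real k / real n)"
  proof (rule sum_mono)
    fix i assume i: "i \<in> {..<k}"
    have p: "real n - real i > 0" "real n > 0" using i k by auto
    have "(real j - real i) / (real n - real i) - real j / real n = - (real i * (real n - real j) / ((real n - real i) * real n))"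
      using p by (simp add: field_simps)
    then have "norm ((real j - real i) / (real n - real i) - real j / real n) = real i * (real n - real j) / ((real n - real i) * real n)"
      using p j by (simp add: abs_mult)
    also have "\<dots> \<le> real k * real n / ((real n / 2) * real n)"
      using i k j p by (intro frac_le mult_mono mult_right_mono) auto
    also have "\<dots> = 2 * real k / real n" using p by (simp add: field_simps)
    finally show "norm ((real j - real i) / (real n - real i) - real j / real n) \<le> 2 * real k / real n" .
  qed
  finally show ?thesis by simp
qed

lemma smult_sum_right: "smult c (sum f A) = (\<Sum>i\<in>A. smult c (f i))"
  by (induction A rule: infinite_finite_induct) (auto simp: smult_add_right)

context positive_contraction
begin

lemma poly_as_bern:
  assumes "degree p \<le> n"
  shows "p = (\<Sum>j\<le>n. smult (\<Sum>k\<le>degree p. coeff p k * (of_nat (j choose k) / of_nat (n choose k))) (bern n j))"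
proof -
  have "p = (\<Sum>k\<le>degree p. smult (coeff p k) (X ^ k))"
    using poly_as_sum_of_monoms[of p] by (simp add: monom_altdef)
  also have "\<dots> = (\<Sum>k\<le>degree p. \<Sum>j\<le>n. smult (coeff p k * (of_nat (j choose k) / of_nat (n choose k))) (bern n j))"
    using assms by (intro sum.cong refl) (subst monom_bern[of _ n], auto simp: smult_sum_right)
  also have "\<dots> = (\<Sum>j\<le>n. \<Sum>k\<le>degree p. smult (coeff p k * (of_nat (j choose k) / of_nat (n choose k))) (bern n j))"
    by (rule sum.swap)
  finally show ?thesis by (simp add: smult_sum)
qed

text \<open>In the Bernstein basis of large degree n the coefficients of \<open>p\<close> approach
  the values p(j/n), while the basis operators are positive with sum 1. The quadratic form is
  therefore nearly a weighted sum of values of \<open>p\<close>, and the numerical radius bound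
  contributes the factor 2.\<close>

lemma norm_opoly_le:
  assumes M: "\<And>t. 0 \<le> t ==> t \<le> 1 ==> cmod (poly p (of_real t)) \<le> M"
  shows "norm (opoly B p) \<le> 2 * M"
proof (rule norm_le_numerical_radius)
  show "opoly B p \<in> bop" using B by simp
  show "0 \<le> M" using order_trans[OF norm_ge_zero M[of 0]] by simp
  fix x :: 'a
  show "cmod (x \<bullet> opoly B p x) \<le> M * (norm x)\<^sup>2"
  proof (rule field_le_epsilon)
    fix e :: real assume "e > 0"
    define d where "d = degree p"
    \<comment> \<open>S / n bounds the distance between the Bernstein coefficients of
      \<open>p\<close> and its samples; n is taken so large that this is at most
      \<open>e'\<close>.\<close>
    define S where "S = (\<Sum>k\<le>d. cmod (coeff p k)) * (real d * (2 * real d))"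
    have S0: "S \<ge> 0" unfolding S_def by (intro mult_nonneg_nonneg sum_nonneg) auto
    define e' where "e' = e / ((norm x)\<^sup>2 + 1)"
    have e': "e' > 0" "e' * (norm x)\<^sup>2 \<le> e"
    proof -
      have "(norm x)\<^sup>2 + 1 > 0" by (simp add: add_nonneg_pos)
      then show "e' > 0" using \<open>e > 0\<close> by (simp add: e'_def)
      have "e * (norm x)\<^sup>2 \<le> e * ((norm x)\<^sup>2 + 1)" using \<open>e > 0\<close> by simp
      then show "e' * (norm x)\<^sup>2 \<le> e" using \<open>(norm x)\<^sup>2 + 1 > 0\<close> by (simp add: e'_def divide_le_eq)
    qed
    obtain n0 where n0: "S / e' < real n0" using reals_Archimedean2 by blast
    define n where "n = n0 + 2 * d + 1"
    have n: "2 * d \<le> n" "0 < n" "S / real n \<le> e'"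
    proof -
      have "S < e' * real n0" using n0 e' by (simp add: divide_less_eq mult.commute)
      also have "\<dots> \<le> e' * real n" using e' by (intro mult_left_mono) (auto simp: n_def)
      finally show "S / real n \<le> e'" by (simp add: divide_le_eq n_def mult.commute)
    qed (auto simp: n_def)
    define b where "b j = (\<Sum>k\<le>d. coeff p k * (of_nat (j choose k) / of_nat (n choose k)))" for j
    have b: "cmod (b j) \<le> M + e'" if j: "j \<le> n" for j
    proof -
      let ?t = "real j / real n"
      have "cmod (b j - poly p (of_real ?t)) = cmod (\<Sum>k\<le>d. coeff p k * (of_nat (j choose k) / of_nat (n choose k) - of_real ?t ^ k))"
        unfolding b_def poly_altdef d_def by (simp add: sum_subtractf right_diff_distrib)
      also have "\<dots> \<le> (\<Sum>k\<le>d. cmod (coeff p k) * (real d * (2 * real d / real n)))"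
      proof (rule sum_norm_le)
        fix k assume k: "k \<in> {..d}"
        have "cmod (of_nat (j choose k) / of_nat (n choose k) - of_real ?t ^ k) = \<bar>real (j choose k) / real (n choose k) - ?t ^ k\<bar>"
        proof -
          have "(of_nat (j choose k) / of_nat (n choose k) - of_real ?t ^ k :: complex)
              = of_real (real (j choose k) / real (n choose k) - ?t ^ k)" by simp
          then show ?thesis by (simp only: norm_of_real)
        qed
        also have "\<dots> \<le> real k * (2 * real k / real n)"
          using k n j by (intro choose_ratio_approx) auto
        also have "\<dots> \<le> real d * (2 * real d / real n)"
          using k n by (intro mult_mono divide_right_mono) auto
        finally show "norm (coeff p k * (of_nat (j choose k) / of_nat (n choose k) - of_real ?t ^ k)) \<le> cmod (coeff p k) * (real d * (2 * real d / real n))"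
          unfolding norm_mult by (intro mult_left_mono) auto
      qed
      also have "\<dots> = S / real n"
        unfolding S_def by (simp add: sum_distrib_right sum_divide_distrib)
      finally have "cmod (b j - poly p (of_real ?t)) \<le> e'" using n(3) by simp
      moreover have "cmod (poly p (of_real ?t)) \<le> M"
        using j n by (intro M) auto
      ultimately show ?thesis
        using norm_triangle_sub[of "b j" "poly p (of_real ?t)"] by simp
    qed
    define c where "c j = Re (x \<bullet> opoly B (bern n j) x)" for j
    have c: "x \<bullet> opoly B (bern n j) x = of_real (c j)" "c j \<ge> 0" for j
      using pos_poly_bern[of n j] unfolding pos_poly_def c_def
      by (auto simp: complex_nonneg_Reals_iff complex_eq_iff)
    have sc: "(\<Sum>j\<le>n. c j) = (norm x)\<^sup>2"
    proof -
      have "complex_of_real (\<Sum>j\<le>n. c j) = x \<bullet> opoly B (\<Sum>j\<le>n. bern n j) x"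
        by (simp add: opoly_sum blinfun.sum_left cinner.sum_right flip: c)
      also have "\<dots> = of_real ((norm x)\<^sup>2)" by (simp add: sum_bern cinner_self)
      finally show ?thesis by (simp only: of_real_eq_iff)
    qed
    have "opoly B p = (\<Sum>j\<le>n. b j *c opoly B (bern n j))"
      using n(1) by (subst poly_as_bern[of p n]) (auto simp: opoly_sum opoly_smult B b_def d_def)
    then have "x \<bullet> opoly B p x = (\<Sum>j\<le>n. b j * of_real (c j))"
      by (simp add: blinfun.sum_left cinner.sum_right scaleC_blinfun_apply c)
    then have "cmod (x \<bullet> opoly B p x) \<le> (\<Sum>j\<le>n. (M + e') * c j)"
      using b c(2) by (auto intro!: sum_norm_le mult_right_mono simp: norm_mult)
    also have "\<dots> = (M + e') * (norm x)\<^sup>2" by (simp add: sc flip: sum_distrib_left)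
    also have "\<dots> \<le> M * (norm x)\<^sup>2 + e" using e'(2) by (simp add: distrib_right)
    finally show "cmod (x \<bullet> opoly B p x) \<le> M * (norm x)\<^sup>2 + e" .
  qed
qed

end

section \<open>Extension from dense subspaces\<close>

lemma dense_extension:
  fixes E :: "'a::complex_hilbert set" and f :: "'a => 'b::complex_hilbert"
  assumes E: "csubspace E" "closure E = UNIV"
    and add: "\<And>x y. x \<in> E ==> y \<in> E ==> f (x + y) = f x + f y"
    and scale: "\<And>c x. x \<in> E ==> f (c *c x) = c *c f x"
    and bound: "\<And>x. x \<in> E ==> norm (f x) \<le> K * norm x"
  shows "\<exists>T\<in>bop. (\<forall>x\<in>E. blinfun_apply T x = f x) \<and> (\<forall>x. norm (T x) \<le> K * norm x)"
proof -
  have minus: "f (x - y) = f x - f y" if "x \<in> E" "y \<in> E" for x y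
    using add[OF that(1) csubspaceD(3)[OF E(1) that(2), of "-1"]] scale[OF that(2), of "-1"]
    by (simp add: scaleC.minus_left)
  have "\<bar>K\<bar>-lipschitz_on E f"
  proof (rule lipschitz_onI)
    show "dist (f x) (f y) \<le> \<bar>K\<bar> * dist x y" if "x \<in> E" "y \<in> E" for x y
      unfolding dist_norm minus[OF that, symmetric]
      by (rule order_trans[OF bound mult_right_mono]) (simp_all add: csubspaceD(4)[OF E(1) that])
  qed simp
  then obtain g where g: "uniformly_continuous_on (closure E) g" and gE: "\<And>x. x \<in> E ==> f x = g x"
    using uniformly_continuous_on_extension_on_closure[OF lipschitz_on_uniformly_continuous] by metis
  have "continuous_on UNIV g" using uniformly_continuous_imp_continuous[OF g] by (simp add: E(2))
  note ci = continuous_on_compose2[OF this _ subset_UNIV]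
  have cl: "P x" if "closed {x. P x}" "\<And>x. x \<in> E ==> P x" for P and x :: 'a
    using closure_minimal[of E "{x. P x}"] that E(2) by auto
  have ga: "g (x + y) = g x + g y" for x y
  proof (rule cl[of "%x. g (x + y) = g x + g y"])
    show "closed {x. g (x + y) = g x + g y}" by (intro closed_Collect_eq continuous_intros ci)
    show "g (x + y) = g x + g y" if x: "x \<in> E" for x
      by (rule cl[of "%y. g (x + y) = g x + g y"])
         (intro closed_Collect_eq continuous_intros ci, simp add: gE[symmetric] add x csubspaceD(2)[OF E(1)])
  qed
  have gs: "g (c *c x) = c *c g x" for c x
    by (rule cl[of "%x. g (c *c x) = c *c g x"])
       (intro closed_Collect_eq continuous_intros scaleC.continuous_on ci, simp add: gE[symmetric] scale csubspaceD(3)[OF E(1)])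
  have gb: "norm (g x) \<le> K * norm x" for x
    by (rule cl[of "%x. norm (g x) \<le> K * norm x"])
       (intro closed_Collect_le continuous_intros ci, simp add: gE[symmetric] bound)
  have bl: "bounded_linear g"
    by (rule bounded_linear_intro[where K = K]) (use gb in \<open>auto simp: ga scaleR_scaleC gs mult.commute\<close>)
  have ap: "blinfun_apply (Blinfun g) = g" by (rule bounded_linear_Blinfun_apply[OF bl])
  show ?thesis
  proof (intro bexI[of _ "Blinfun g"] conjI ballI allI)
    show "Blinfun g \<in> bop" by (rule bopI) (simp add: ap gs)
  qed (auto simp: ap gE gb)
qed

lemma bop_eq_dense:
  assumes "closure E = UNIV" "\<And>x. x \<in> E ==> blinfun_apply S x = blinfun_apply T x"
  shows "S = T"
proof (rule blinfun_eqI)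
  fix x
  have "closed {x. S x = T x}"
    by (intro closed_Collect_eq continuous_intros)
  then have "closure E \<subseteq> {x. S x = T x}"
    using assms(2) by (intro closure_minimal) auto
  then show "S x = T x" using assms(1) by blast
qed

section \<open>Continuous functions of a positive contraction\<close>

context positive_contraction
begin

definition papprox :: "(real => complex) => (nat => complex poly) => bool" where
  "papprox f p \<longleftrightarrow> uniform_limit {0..1} (%n t. poly (p n) (of_real t)) f sequentially"

text \<open>The Bernstein approximation theorem is about real functions, so real and imaginary parts
  are estimated separately, each to within e/2.\<close>

lemma ex_papprox:
  assumes f: "continuous_on {0..1} f"
  shows "\<exists>p. papprox f p"
proof -
  define p where "p n = (\<Sum>k\<le>n. smult (f (real k / real n)) (bern n k))" for n
  have pb: "poly (p n) (of_real t) = (\<Sum>k\<le>n. f (real k / real n) * of_real (Bernstein n k t))" for n t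
    by (simp add: p_def poly_sum bern_def Bernstein_def mult.assoc)
  have "papprox f p"
    unfolding papprox_def
  proof (rule uniform_limitI)
    fix e :: real assume e: "e > 0"
    have "continuous_on {0..1} (%t. Re (f t))" "continuous_on {0..1} (%t. Im (f t))" "e / 2 > 0"
      using f e by (auto intro!: continuous_intros)
    note BW = Bernstein_Weierstrass[OF this(1,3)] Bernstein_Weierstrass[OF this(2,3)]
    obtain N where N: "\<And>n t. N \<le> n ==> t \<in> {0..1} ==> \<bar>Re (f t) - (\<Sum>k\<le>n. Re (f (real k / real n)) * Bernstein n k t)\<bar> < e / 2"
      using BW(1) by metis
    obtain N' where N': "\<And>n t. N' \<le> n ==> t \<in> {0..1} ==> \<bar>Im (f t) - (\<Sum>k\<le>n. Im (f (real k / real n)) * Bernstein n k t)\<bar> < e / 2"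
      using BW(2) by metis
    have "dist (poly (p n) (of_real t)) (f t) < e" if n: "n \<ge> max N N'" and t: "t \<in> {0..1}" for n t
    proof -
      have "dist (poly (p n) (of_real t)) (f t) \<le> \<bar>Re (f t - poly (p n) (of_real t))\<bar> + \<bar>Im (f t - poly (p n) (of_real t))\<bar>"
        unfolding dist_norm norm_minus_commute[of _ "f t"] by (rule cmod_le)
      also have "\<dots> < e / 2 + e / 2"
        using N[of n t] N'[of n t] n t by (intro add_strict_mono) (auto simp: pb)
      finally show ?thesis by simp
    qed
    then show "\<forall>\<^sub>F n in sequentially. \<forall>x\<in>{0..1}. dist (poly (p n) (of_real x)) (f x) < e"
      unfolding eventually_sequentially by blast
  qed
  then show ?thesis by blast
qed

lemma opoly_dist:
  assumes "\<And>t. t \<in> {0..1} ==> dist (poly p (of_real t)) (poly q (of_real t)) \<le> M"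
  shows "dist (opoly B p) (opoly B q) \<le> 2 * M"
  unfolding dist_norm opoly_diff[symmetric] using assms by (intro norm_opoly_le) (auto simp: dist_norm)

lemma convergent_opoly: "papprox f p ==> convergent (%n. opoly B (p n))"
  unfolding Cauchy_convergent_iff[symmetric]
proof (rule metric_CauchyI)
  fix e :: real assume p: "papprox f p" and e: "e > 0"
  obtain N where N: "\<And>n t. n \<ge> N ==> t \<in> {0..1} ==> dist (poly (p n) (of_real t)) (f t) < e / 8"
    using uniform_limitD[OF p[unfolded papprox_def], OF divide_pos_pos[OF e zero_less_numeral]]
    unfolding eventually_sequentially by metis
  have "dist (opoly B (p m)) (opoly B (p n)) < e" if mn: "m \<ge> N" "n \<ge> N" for m n
  proof -
    have "dist (opoly B (p m)) (opoly B (p n)) \<le> 2 * (e / 4)"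
    proof (rule opoly_dist)
      fix t :: real assume "t \<in> {0..1}"
      from N[OF mn(1) this] N[OF mn(2) this] dist_triangle2[of "poly (p m) (of_real t)" "poly (p n) (of_real t)" "f t"]
      show "dist (poly (p m) (of_real t)) (poly (p n) (of_real t)) \<le> e / 4" by simp
    qed
    then show ?thesis using e by simp
  qed
  then show "\<exists>N. \<forall>m\<ge>N. \<forall>n\<ge>N. dist (opoly B (p m)) (opoly B (p n)) < e" by blast
qed

text \<open>One approximating sequence is chosen; \<open>fc_limit\<close> shows that every other one
  has the same limit, and the algebraic rules follow by picking convenient sequences.\<close>

definition fc :: "(real => complex) => ('a -> 'a)" where
  "fc f = lim (%n. opoly B ((SOME p. papprox f p) n))"

lemma fc_limit:
  assumes p: "papprox f p"
  shows "(%n. opoly B (p n)) ----> fc f"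
proof -
  define q where "q = (SOME p. papprox f p)"
  have q: "papprox f q" unfolding q_def by (rule someI[of "papprox f", OF p])
  have "(%n. opoly B (q n)) ----> fc f"
    using convergent_opoly[OF q] unfolding fc_def q_def convergent_LIMSEQ_iff .
  moreover have "(%n. dist (opoly B (p n)) (opoly B (q n))) ----> 0"
  proof (rule metric_LIMSEQ_I)
    fix e :: real assume e: "e > 0"
    have "\<forall>\<^sub>F n in sequentially. \<forall>t\<in>{0..1}. dist (poly (p n) (of_real t)) (f t) < e / 8"
      "\<forall>\<^sub>F n in sequentially. \<forall>t\<in>{0..1}. dist (poly (q n) (of_real t)) (f t) < e / 8"
      using p[unfolded papprox_def] q[unfolded papprox_def] e by (intro uniform_limitD; simp)+
    then have "\<forall>\<^sub>F n in sequentially. dist (dist (opoly B (p n)) (opoly B (q n))) 0 < e"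
    proof eventually_elim
      case (elim n)
      have "dist (opoly B (p n)) (opoly B (q n)) \<le> 2 * (e / 4)"
      proof (rule opoly_dist)
        fix t :: real assume "t \<in> {0..1}"
        with elim have "dist (poly (p n) (of_real t)) (f t) < e / 8" "dist (poly (q n) (of_real t)) (f t) < e / 8"
          by auto
        with dist_triangle2[of "poly (p n) (of_real t)" "poly (q n) (of_real t)" "f t"]
        show "dist (poly (p n) (of_real t)) (poly (q n) (of_real t)) \<le> e / 4" by simp
      qed
      then show ?case using e by simp
    qed
    then show "\<exists>no. \<forall>n\<ge>no. dist (dist (opoly B (p n)) (opoly B (q n))) 0 < e"
      unfolding eventually_sequentially .
  qed
  ultimately show ?thesis
    unfolding dist_norm tendsto_norm_zero_iff by (rule Lim_transform)
qed

lemma papprox_add: "papprox f p ==> papprox g q ==> papprox (%t. f t + g t) (%n. p n + q n)"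
  unfolding papprox_def poly_add by (rule uniform_limit_add)

lemma papprox_mult:
  assumes "continuous_on {0..1} f" "continuous_on {0..1} g" "papprox f p" "papprox g q"
  shows "papprox (%t. f t * g t) (%n. p n * q n)"
  using assms unfolding papprox_def poly_mult
  by (intro uniform_lim_mult) (auto intro!: compact_imp_bounded compact_continuous_image)

lemma papprox_poly: "papprox (%t. poly p (of_real t)) (%n. p)"
  unfolding papprox_def by (intro uniform_limit_const)

lemma papprox_cong: "papprox f p ==> (\<And>t. t \<in> {0..1} ==> f t = g t) ==> papprox g p"
  unfolding papprox_def by (erule uniform_limit_cong'[THEN iffD1, rotated -1]) auto

lemma poly_cnj_of_real: "poly (map_poly cnj p) (of_real t) = cnj (poly p (of_real t))"
  by (induction p) (auto simp: map_poly_pCons)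

lemma papprox_cnj: "papprox f p ==> papprox (%t. cnj (f t)) (%n. map_poly cnj (p n))"
  unfolding papprox_def poly_cnj_of_real uniform_limit_iff dist_norm complex_cnj_diff[symmetric] complex_mod_cnj .

lemma fc_bop [simp]: "continuous_on {0..1} f ==> fc f \<in> bop"
  using ex_papprox[of f] by (auto intro: closed_sequentially[OF closed_bop bop_opoly[OF B] fc_limit])

lemma fc_add:
  assumes "continuous_on {0..1} f" "continuous_on {0..1} g"
  shows "fc (%t. f t + g t) = fc f + fc g"
proof -
  obtain p q where p: "papprox f p" and q: "papprox g q"
    using ex_papprox assms by meson
  show ?thesis
    by (rule LIMSEQ_unique[OF fc_limit[OF papprox_add[OF p q]]])
       (simp add: opoly_add tendsto_add fc_limit p q)
qed

lemma fc_mult: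
  assumes "continuous_on {0..1} f" "continuous_on {0..1} g"
  shows "fc (%t. f t * g t) = fc f oo fc g"
proof -
  obtain p q where p: "papprox f p" and q: "papprox g q"
    using ex_papprox assms by meson
  show ?thesis
    by (rule LIMSEQ_unique[OF fc_limit[OF papprox_mult[OF assms p q]]])
       (simp add: opoly_mult B bounded_bilinear.tendsto[OF bounded_bilinear_blinfun_compose] fc_limit p q)
qed

lemma fc_cong:
  assumes "continuous_on {0..1} f" "\<And>t. t \<in> {0..1} ==> f t = g t"
  shows "fc f = fc g"
proof -
  obtain p where p: "papprox f p" using ex_papprox assms(1) by meson
  show ?thesis by (rule LIMSEQ_unique[OF fc_limit[OF p] fc_limit[OF papprox_cong[OF p assms(2)]]])
qed

lemma fc_poly: "fc (%t. poly p (of_real t)) = opoly B p"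
  by (rule LIMSEQ_unique[OF fc_limit[OF papprox_poly] tendsto_const])

lemma fc_1: "fc (%t. 1) = \<one>"
  using fc_poly[of 1] by simp

lemma fc_const: "fc (%t. c) = c *c \<one>"
  using fc_poly[of "[:c:]"] by simp

lemma fc_ident: "fc of_real = B"
  using fc_poly[of X] by simp

lemma fc_scale: "continuous_on {0..1} f ==> fc (%t. c * f t) = c *c fc f"
  using fc_mult[of "%_. c" f] by (simp add: fc_const)

lemma fc_diff:
  assumes "continuous_on {0..1} f" "continuous_on {0..1} g"
  shows "fc (%t. f t - g t) = fc f - fc g"
  using fc_add[OF assms(1), of "%t. (-1) * g t"] fc_scale[OF assms(2), of "-1"] assms(2)
  by (auto simp: scaleC.minus_left intro: continuous_on_minus)

lemma fc_adj:
  assumes "continuous_on {0..1} f"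
  shows "adj (fc f) = fc (%t. cnj (f t))"
proof -
  obtain p where p: "papprox f p" using ex_papprox assms by meson
  have "(%n. adj (opoly B (p n))) ----> adj (fc f)"
    by (intro tendsto_adj bop_opoly fc_bop B assms fc_limit p)
  then show ?thesis
    using LIMSEQ_unique[OF fc_limit[OF papprox_cnj[OF p]]] by (simp add: adj_opoly B sa)
qed

lemma norm_fc_le:
  assumes f: "continuous_on {0..1} f" and M: "\<And>t. 0 \<le> t ==> t \<le> 1 ==> cmod (f t) \<le> M"
  shows "norm (fc f) \<le> 2 * M"
proof (rule field_le_epsilon)
  fix e :: real assume e: "e > 0"
  obtain p where p: "papprox f p" using ex_papprox f by meson
  have "\<forall>\<^sub>F n in sequentially. \<forall>t\<in>{0..1}. dist (poly (p n) (of_real t)) (f t) < e / 2"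
    using p e unfolding papprox_def by (intro uniform_limitD) auto
  then have "\<forall>\<^sub>F n in sequentially. norm (opoly B (p n)) \<le> 2 * M + e"
  proof eventually_elim
    case (elim n)
    have "norm (opoly B (p n)) \<le> 2 * (M + e / 2)"
    proof (rule norm_opoly_le)
      fix t :: real assume t: "0 \<le> t" "t \<le> 1"
      then have "dist (poly (p n) (of_real t)) (f t) < e / 2" using elim by simp
      then show "cmod (poly (p n) (of_real t)) \<le> M + e / 2"
        using M[OF t] norm_triangle_sub[of "poly (p n) (of_real t)" "f t"] by (simp add: dist_norm)
    qed
    then show ?case by simp
  qed
  then show "norm (fc f) \<le> 2 * M + e"
    using tendsto_upperbound[OF tendsto_norm[OF fc_limit[OF p]]] by simp
qed

lemma fc_commute:
  assumes "continuous_on {0..1} f" "continuous_on {0..1} g"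
  shows "fc f oo fc g = fc g oo fc f"
  by (simp add: fc_mult[symmetric] assms mult.commute)

end

section \<open>Complex powers of positive operators\<close>

text \<open>The usual epsilon argument for uniformly bounded families. Strong convergence then has
  to be checked only on a total set; this serves the spectral cut-offs, the unitary group and the
  flow on columns.\<close>

lemma closed_strong_limit:
  fixes T :: "'i => 'a::real_normed_vector -> 'b::real_normed_vector" and S :: "'a -> 'b"
  assumes K: "\<And>i. norm (T i) \<le> K"
  shows "closed {x. ((%i. T i x) \<longlongrightarrow> S x) F}"
proof (rule closure_subset_eq[THEN iffD1])
  show "closure {x. ((%i. T i x) \<longlongrightarrow> blinfun_apply S x) F} \<subseteq> {x. ((%i. T i x) \<longlongrightarrow> S x) F}"
  proof
    fix x assume x: "x \<in> closure {x. ((%i. T i x) \<longlongrightarrow> S x) F}"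
    have "((%i. T i x) \<longlongrightarrow> S x) F"
    proof (rule tendstoI)
      fix e :: real assume e: "e > 0"
      define k where "k = \<bar>K\<bar> + norm S + 1"
      define d where "d = e / 2 / k"
      have k: "k > 0" by (simp add: k_def add_nonneg_pos)
      then have d: "d > 0" "k * d = e / 2" using e by (simp_all add: d_def)
      then have d2: "\<bar>K\<bar> * d + norm S * d < e / 2" by (simp add: k_def distrib_right)
      obtain y where y: "((%i. T i y) \<longlongrightarrow> S y) F" and yx: "dist y x < d"
        using x d(1) unfolding closure_approachable by blast
      have "\<forall>\<^sub>F i in F. dist (T i y) (S y) < e / 2"
        using y e by (intro tendstoD) auto
      then show "\<forall>\<^sub>F i in F. dist (T i x) (S x) < e"
      proof eventually_elim
        case (elim i)
        have "T i x - S x = T i (x - y) + ((T i y - S y) + S (y - x))"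
          by (simp add: blinfun.diff_right)
        then have "dist (T i x) (S x) \<le> norm (T i (x - y)) + (norm (T i y - S y) + norm (S (y - x)))"
          unfolding dist_norm by (metis norm_triangle_le add_left_mono norm_triangle_ineq)
        moreover have "norm (T i (x - y)) \<le> \<bar>K\<bar> * d"
          using yx K[of i] by (intro order_trans[OF norm_blinfun] mult_mono) (auto simp: dist_norm norm_minus_commute)
        moreover have "norm (S (y - x)) \<le> norm S * d"
          using yx by (intro order_trans[OF norm_blinfun] mult_left_mono) (auto simp: dist_norm)
        ultimately show ?case using elim d2 by (simp add: dist_norm)
      qed
    qed
    then show "x \<in> {x. ((%i. T i x) \<longlongrightarrow> S x) F}" by simp
  qed
qed

text \<open>Meant for B = (1 + Q)^-1, where the spectral value t of \<open>B\<close> belongs to the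
  value (1 - t)/t of \<open>Q\<close>. \<open>inj\<close> excludes t = 0, where \<open>Q\<close>
  would be infinite, and \<open>inj1\<close> excludes t = 1, the kernel of \<open>Q\<close>.\<close>

locale injective_contraction = positive_contraction +
  assumes inj: "B x = 0 ==> x = 0" and inj1: "B x = x ==> x = 0"
begin

text \<open>\<open>cut n\<close> vanishes unless t (1 - t) > 2^-n and is 1 from 2^(1-n) on.
  \<open>lg n\<close> is ln ((1 - t)/t), truncated so as to be continuous on the whole interval.
  Hence \<open>pw n z\<close> is the function of \<open>B\<close> that gives Q^(iz) on
  \<open>Ev n\<close>, the vectors reproduced by the cut-off.\<close>

definition dl :: "nat => real" where "dl n = (1/2) ^ n"
definition cut :: "nat => real => real" where "cut n t = min 1 (max 0 (2 ^ n * (t * (1 - t)) - 1))"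
definition lg :: "nat => real => real" where "lg n t = ln (max (1 - t) (dl n)) - ln (max t (dl n))"
definition en :: "nat => 'a -> 'a" where "en n = fc (%t. of_real (cut n t))"
definition pw :: "nat => complex => real => complex" where "pw n z t = exp (\<i> * z * of_real (lg n t))"
definition Ev :: "nat => 'a set" where "Ev n = {y. en n y = y}"

lemma dl: "0 < dl n" "dl n \<le> 1" "m \<le> n ==> dl n \<le> dl m" "2 ^ n * dl n = 1"
  by (auto simp: dl_def power_le_one power_decreasing power_mult_distrib[symmetric])

lemma continuous_cut [continuous_intros]: "continuous_on S (cut n)"
  unfolding cut_def by (intro continuous_intros)

lemma continuous_lg [continuous_intros]: "continuous_on S (lg n)"
  unfolding lg_def using dl(1)[of n] by (intro continuous_intros) (auto simp: max_def)

lemma continuous_pw [continuous_intros]: "continuous_on S (pw n z)"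
  unfolding pw_def by (intro continuous_intros)

text \<open>Where \<open>cut n\<close> is nonzero, 2^n t (1 - t) exceeds 1, so the next power of 2
  brings it above 2 and the later cut-off is 1 there. This puts the range of \<open>en n\<close>
  into \<open>Ev (Suc n)\<close>.\<close>

lemma cut_mono: "n < m ==> cut m t * cut n t = cut n t"
proof (cases "cut n t = 0")
  case False
  assume "n < m"
  then have "(2::real) ^ Suc n \<le> 2 ^ m" by (intro power_increasing) auto
  moreover have a: "2 ^ n * (t * (1 - t)) > 1" using False by (auto simp: cut_def max_def min_def split: if_splits)
  then have "0 < 2 ^ n * (t * (1 - t))" by linarith
  then have "t * (1 - t) > 0" by (rule zero_less_mult_pos) simp
  ultimately have "2 ^ Suc n * (t * (1 - t)) \<le> 2 ^ m * (t * (1 - t))" by (intro mult_right_mono) auto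
  then have "cut m t = 1" using a by (simp add: cut_def)
  then show ?thesis by simp
qed simp

lemma cut_nonzero:
  assumes t: "t \<in> {0..1}" and "cut n t \<noteq> 0"
  shows "t > dl n" "1 - t > dl n"
proof -
  have "2 ^ n * (t * (1 - t)) > 2 ^ n * dl n"
    using assms by (auto simp: cut_def max_def min_def dl split: if_splits)
  then have a: "t * (1 - t) > dl n" by simp
  have "t * (1 - t) \<le> t * 1" "t * (1 - t) \<le> 1 * (1 - t)"
    using t by (intro mult_left_mono mult_right_mono; auto)+
  with a show "t > dl n" "1 - t > dl n" by auto
qed

lemma lg_eq:
  assumes "t \<in> {0..1}" "cut n t \<noteq> 0" "n \<le> m"
  shows "lg m t = ln (1 - t) - ln t"
  using cut_nonzero[OF assms(1,2)] dl(3)[OF assms(3)] by (simp add: lg_def max_def)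

definition bd :: "nat => real" where "bd n = - ln (dl n)"

lemma lg_bound: "t \<in> {0..1} ==> \<bar>lg n t\<bar> \<le> bd n"
proof -
  assume t: "t \<in> {0..1}"
  have "ln (dl n) \<le> ln (max s (dl n)) \<and> ln (max s (dl n)) \<le> 0" if "s \<in> {0..1}" for s
    using that dl(1,2)[of n] by (auto simp: max_def)
  from this[of t] this[of "1 - t"] t show ?thesis
    unfolding lg_def bd_def by auto
qed

lemma bd_nonneg: "0 \<le> bd n"
  using lg_bound[of 0 n] by simp

text \<open>A vector in \<open>Ev n\<close> is reproduced by \<open>cut n\<close>, so it sees a
  function only where \<open>cut n\<close> is nonzero. The truncations in \<open>lg\<close> are
  invisible there.\<close>

lemma fc_local:
  assumes y: "y \<in> Ev n" and c: "continuous_on {0..1} f" "continuous_on {0..1} g"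
    and eq: "\<And>t. t \<in> {0..1} ==> cut n t \<noteq> 0 ==> f t = g t"
  shows "fc f y = fc g y"
proof -
  have c': "continuous_on {0..1} (%t. complex_of_real (cut n t))" by (intro continuous_intros)
  have "fc f oo en n = fc (%t. f t * of_real (cut n t))"
    unfolding en_def by (rule fc_mult[symmetric, OF c(1) c'])
  also have "\<dots> = fc (%t. g t * of_real (cut n t))"
    using eq by (intro fc_cong continuous_intros c) auto
  also have "\<dots> = fc g oo en n"
    unfolding en_def by (rule fc_mult[OF c(2) c'])
  finally have "fc f (en n y) = fc g (en n y)"
    by (metis blinfun_apply_blinfun_compose)
  then show ?thesis using y by (simp add: Ev_def)
qed

lemma en_bop [simp]: "en n \<in> bop"
  unfolding en_def by (intro fc_bop continuous_intros)

lemma en_commute: "continuous_on {0..1} f ==> en n (fc f y) = fc f (en n y)"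
  using fc_commute[of "%t. of_real (cut n t)" f] unfolding en_def
  by (metis blinfun_apply_blinfun_compose continuous_cut continuous_on_of_real)

lemma Ev_fc: "y \<in> Ev n ==> continuous_on {0..1} f ==> fc f y \<in> Ev n"
  by (simp add: Ev_def en_commute)

lemma en_Ev: "n < m ==> en n v \<in> Ev m"
proof -
  assume "n < m"
  then have "en m oo en n = en n"
    unfolding en_def by (subst fc_mult[symmetric])
      (auto intro!: fc_cong continuous_intros simp: cut_mono simp flip: of_real_mult)
  then show ?thesis unfolding Ev_def by (metis (mono_tags) blinfun_apply_blinfun_compose mem_Collect_eq)
qed

lemma Ev_mono: "n \<le> m ==> Ev n \<subseteq> Ev m"
proof (cases "n = m")
  case False
  assume "n \<le> m"
  then have "n < m" using False by simp
  then show ?thesis using en_Ev[of n m] by (auto simp: Ev_def) (metis (mono_tags) en_Ev Ev_def mem_Collect_eq)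
qed simp

lemma Ev_subspace: "csubspace (Ev n)"
  by (rule csubspaceI) (auto simp: Ev_def blinfun.add_right bop_scaleC)

definition EE :: "'a set" where "EE = (\<Union>n. Ev n)"
text \<open>The least index only fixes a choice; by \<open>qq_eq\<close> any \<open>n\<close> with
  \<open>y\<close> in \<open>Ev n\<close> gives the same vector.\<close>

definition qq :: "complex => 'a => 'a" where "qq z y = fc (pw (LEAST n. y \<in> Ev n) z) y"

lemma pw_eq:
  assumes "t \<in> {0..1}" "cut n t \<noteq> 0" "n \<le> m" "n \<le> m'"
  shows "pw m z t = pw m' z t"
  unfolding pw_def lg_eq[OF assms(1-3)] lg_eq[OF assms(1,2,4)] ..

lemma qq_eq:
  assumes y: "y \<in> Ev n"
  shows "qq z y = fc (pw n z) y"
proof -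
  let ?m = "LEAST n. y \<in> Ev n"
  have m: "y \<in> Ev ?m" "?m \<le> n" using LeastI[of "%n. y \<in> Ev n", OF y] Least_le[of "%n. y \<in> Ev n", OF y] by auto
  show ?thesis
    unfolding qq_def by (rule fc_local[OF m(1)]) (auto intro!: continuous_intros pw_eq[of _ ?m] m)
qed

lemma EE_common:
  assumes "x \<in> EE" "y \<in> EE"
  obtains n where "x \<in> Ev n" "y \<in> Ev n"
proof -
  obtain m k where "x \<in> Ev m" "y \<in> Ev k" using assms by (auto simp: EE_def)
  then show ?thesis using Ev_mono[of m "max m k"] Ev_mono[of k "max m k"] by (intro that[of "max m k"]) auto
qed

lemma EE_subspace: "csubspace EE"
proof (rule csubspaceI)
  show "0 \<in> EE" using csubspaceD(1)[OF Ev_subspace] by (auto simp: EE_def)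
  show "x + y \<in> EE" if xy: "x \<in> EE" "y \<in> EE" for x y
  proof -
    obtain n where "x \<in> Ev n" "y \<in> Ev n" using xy by (rule EE_common)
    then show ?thesis using csubspaceD(2)[OF Ev_subspace, of x n y] unfolding EE_def by auto
  qed
  show "c *c x \<in> EE" if "x \<in> EE" for c x
    using that unfolding EE_def by (auto intro: csubspaceD(3)[OF Ev_subspace])
qed

lemma norm_en: "norm (en n) \<le> 2"
proof -
  have "norm (fc (%t. complex_of_real (cut n t))) \<le> 2 * 1"
  proof (rule norm_fc_le)
    show "continuous_on {0..1} (%t. complex_of_real (cut n t))" by (intro continuous_intros)
    show "cmod (of_real (cut n t)) \<le> 1" for t by (simp add: cut_def)
  qed
  then show ?thesis by (simp add: en_def)
qed

text \<open>On vectors B (v - B v) convergence is exponentially fast, because the error function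
  (cut - 1) t (1 - t) is at most 2 times 2^-n. Such vectors are total since \<open>B\<close> and 1 -
  B are self-adjoint and injective.\<close>

lemma en_tendsto: "(%n. en n x) ----> x"
proof -
  let ?S = "{x. (%n. en n x) ----> \<one> x}"
  have clS: "closed ?S" by (rule closed_strong_limit[OF norm_en])
  have csS: "csubspace ?S"
    by (rule csubspaceI) (auto simp: blinfun.add_right bop_scaleC intro!: tendsto_add scaleC.tendsto)
  have BS: "B (v - B v) \<in> ?S" for v
  proof -
    have c: "continuous_on {0..1} (%t. complex_of_real (t * (1 - t)))"
      "continuous_on {0..1} (%t. complex_of_real (cut n t))" for n by (intro continuous_intros)+
    have B2: "B (v - B v) = fc (%t. of_real (t * (1 - t))) v"
      using fc_poly[of "X * (1 - X)"] by (simp add: opoly_mult opoly_diff B blinfun.diff_left blinfun.diff_right)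
    have le: "norm (en n (B (v - B v)) - B (v - B v)) \<le> 4 * norm v * (1/2) ^ n" for n
    proof -
      have "en n (B (v - B v)) - B (v - B v) = fc (%t. of_real (cut n t) * of_real (t * (1 - t)) - of_real (t * (1 - t))) v"
        unfolding B2 by (subst fc_diff)
          (use c in \<open>auto intro!: continuous_on_mult simp: fc_mult en_def blinfun.diff_left simp del: of_real_mult\<close>)
      also have "norm \<dots> \<le> (2 * (2 * dl n)) * norm v"
      proof (rule order_trans[OF norm_blinfun mult_right_mono[OF norm_fc_le]])
        show "continuous_on {0..1} (%t. of_real (cut n t) * of_real (t * (1 - t)) - complex_of_real (t * (1 - t)))"
          by (intro continuous_intros)
        fix t :: real assume t: "0 \<le> t" "t \<le> 1"
        have p: "0 \<le> t * (1 - t)" using t by simp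
        have "\<bar>(cut n t - 1) * (t * (1 - t))\<bar> \<le> 2 * dl n"
        proof (cases "2 ^ n * (t * (1 - t)) \<ge> 2")
          case True
          then show ?thesis using dl(1)[of n] by (simp add: cut_def)
        next
          case False
          moreover have "2 ^ n * (2 * dl n) = 2" using dl(4)[of n] by linarith
          ultimately have "2 ^ n * (t * (1 - t)) \<le> 2 ^ n * (2 * dl n)" by linarith
          then have "t * (1 - t) \<le> 2 * dl n" by (rule mult_left_le_imp_le) simp
          moreover have "\<bar>cut n t - 1\<bar> \<le> 1" by (auto simp: cut_def)
          ultimately show ?thesis
            using mult_mono[of "\<bar>cut n t - 1\<bar>" 1 "t * (1 - t)" "2 * dl n"] p by (simp add: abs_mult[of "cut n t - 1"])
        qed
        then show "cmod (of_real (cut n t) * of_real (t * (1 - t)) - of_real (t * (1 - t))) \<le> 2 * dl n"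
          by (simp add: left_diff_distrib flip: of_real_mult of_real_diff)
      qed simp
      finally show ?thesis by (simp add: dl_def ac_simps)
    qed
    have "(%n. 4 * norm v * (1/2) ^ n) ----> 4 * norm v * 0"
      by (intro tendsto_mult tendsto_const LIMSEQ_realpow_zero) auto
    then have "(%n. en n (B (v - B v)) - B (v - B v)) ----> 0"
      by (intro null_comparison[OF le]) simp
    then show ?thesis by (simp add: LIM_zero_cancel)
  qed
  have "?S = UNIV"
  proof (rule closed_subspace_eq_UNIV[OF csS clS])
    fix y assume orth: "\<And>x. x \<in> ?S ==> x \<bullet> y = 0"
    have "B y - B (B y) = 0"
    proof (rule cinner_eqI)
      fix v
      have "v \<bullet> (B y - B (B y)) = B (v - B v) \<bullet> y"
        by (simp add: sym cinner.diff_left cinner.diff_right blinfun.diff_right)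
      then show "v \<bullet> (B y - B (B y)) = v \<bullet> 0" using orth[OF BS] by simp
    qed
    then show "y = 0" using inj inj1 by force
  qed
  then show ?thesis by auto
qed

lemma EE_dense: "closure EE = UNIV"
proof -
  have "x \<in> closure EE" for x
    unfolding closure_sequential using en_tendsto[of x] en_Ev[of _ "Suc _"]
    by (intro exI[of _ "%n. en n x"]) (auto simp: EE_def)
  then show ?thesis by blast
qed

lemma qq_in: "y \<in> EE ==> qq z y \<in> EE"
proof -
  assume "y \<in> EE"
  then obtain n where y: "y \<in> Ev n" by (auto simp: EE_def)
  have "qq z y \<in> Ev n" unfolding qq_eq[OF y] by (intro Ev_fc y continuous_intros)
  then show ?thesis by (auto simp: EE_def)
qed

lemma qq_add: "y \<in> EE ==> qq (z + w) y = qq z (qq w y)"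
proof -
  assume "y \<in> EE"
  then obtain n where y: "y \<in> Ev n" by (auto simp: EE_def)
  have "qq z (qq w y) = (fc (pw n z) oo fc (pw n w)) y"
    using Ev_fc[OF y, of "pw n w"] by (simp add: qq_eq[OF y] qq_eq continuous_pw)
  also have "fc (pw n z) oo fc (pw n w) = fc (%t. pw n z t * pw n w t)"
    by (intro fc_mult[symmetric] continuous_intros)
  also have "(%t. pw n z t * pw n w t) = pw n (z + w)"
    by (auto simp: pw_def exp_add[symmetric] algebra_simps)
  finally show ?thesis by (simp add: qq_eq[OF y])
qed

lemma qq_0: "y \<in> EE ==> qq 0 y = y"
proof -
  assume "y \<in> EE"
  then obtain n where y: "y \<in> Ev n" by (auto simp: EE_def)
  have "pw n 0 = (%t. 1)" by (auto simp: pw_def)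
  then show ?thesis by (simp add: qq_eq[OF y] fc_1)
qed

lemma qq_plus: "x \<in> EE ==> y \<in> EE ==> qq z (x + y) = qq z x + qq z y"
  by (erule (1) EE_common) (simp add: qq_eq[OF csubspaceD(2)[OF Ev_subspace]] qq_eq blinfun.add_right)

lemma qq_scale: "y \<in> EE ==> qq z (c *c y) = c *c qq z y"
proof -
  assume "y \<in> EE"
  then obtain n where y: "y \<in> Ev n" by (auto simp: EE_def)
  show ?thesis by (simp add: qq_eq[OF csubspaceD(3)[OF Ev_subspace y]] qq_eq[OF y] bop_scaleC continuous_pw)
qed

lemma qq_adj: "x \<in> EE ==> y \<in> EE ==> qq z x \<bullet> y = x \<bullet> qq (- cnj z) y"
proof -
  assume "x \<in> EE" "y \<in> EE"
  then obtain n where n: "x \<in> Ev n" "y \<in> Ev n" by (rule EE_common)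
  have b: "fc (pw n z) \<in> bop" by (intro fc_bop continuous_intros)
  have "qq z x \<bullet> y = x \<bullet> adj (fc (pw n z)) y"
    by (simp add: qq_eq[OF n(1)] cinner_adj_right[OF b])
  also have "adj (fc (pw n z)) = fc (pw n (- cnj z))"
    by (subst fc_adj) (auto intro!: continuous_intros fc_cong simp: pw_def exp_cnj)
  finally show ?thesis by (simp add: qq_eq[OF n(2)])
qed

text \<open>On \<open>Ev n\<close> the exponent is bounded through \<open>bd n\<close>, so the
  second-order Taylor estimate of exp is uniform in t and passes to operators by
  \<open>norm_fc_le\<close>.\<close>

lemma qq_deriv:
  assumes "y \<in> EE"
  shows "\<exists>d. ((%z. qq z y) has_derivative (%h. h *c d)) (at z)"
proof -
  obtain n where y: "y \<in> Ev n" using assms by (auto simp: EE_def)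
  define d where "d = fc (%t. (\<i> * of_real (lg n t)) * pw n z t) y"
  define L where "L = bd n"
  define C where "C = 2 * (exp (\<bar>Im z\<bar> * L) * (exp L * L\<^sup>2)) * norm y"
  have L0: "L \<ge> 0" using bd_nonneg by (simp add: L_def)
  have c: "continuous_on {0..1} (%t. (\<i> * of_real (lg n t)) * pw n z t)" by (intro continuous_intros)
  have bound: "norm (qq (z + h) y - qq z y - h *c d) \<le> C * (norm h)\<^sup>2" if h: "norm h \<le> 1" for h
  proof -
    let ?f = "%t. pw n (z + h) t - pw n z t - h * ((\<i> * of_real (lg n t)) * pw n z t)"
    have cf: "continuous_on {0..1} ?f" by (intro continuous_intros)
    have "qq (z + h) y - qq z y - h *c d = fc ?f y"
      by (subst fc_diff, intro continuous_intros, intro continuous_intros, subst fc_diff, intro continuous_intros,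
          intro continuous_intros, subst fc_scale[OF c])
        (simp add: qq_eq[OF y] d_def blinfun.diff_left scaleC_blinfun_apply)
    also have "norm \<dots> \<le> (2 * (exp (\<bar>Im z\<bar> * L) * (exp L * L\<^sup>2 * (norm h)\<^sup>2))) * norm y"
    proof (rule order_trans[OF norm_blinfun mult_right_mono[OF norm_fc_le[OF cf]]])
      fix t :: real assume "0 \<le> t" "t \<le> 1"
      then have l: "\<bar>lg n t\<bar> \<le> L" using lg_bound[of t n] by (simp add: L_def)
      define w where "w = \<i> * h * of_real (lg n t)"
      have nw: "norm w \<le> norm h * L" using l by (simp add: w_def norm_mult mult_left_mono)
      have "?f t = pw n z t * (exp w - 1 - w)"
        by (simp add: pw_def w_def exp_add[symmetric] algebra_simps)
      moreover have "norm (pw n z t) \<le> exp (\<bar>Im z\<bar> * L)"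
      proof -
        have "- Im z * lg n t \<le> \<bar>Im z\<bar> * \<bar>lg n t\<bar>" by (metis abs_ge_self abs_minus_cancel abs_mult)
        also have "\<dots> \<le> \<bar>Im z\<bar> * L" using l by (intro mult_left_mono) auto
        finally show ?thesis by (simp add: pw_def)
      qed
      moreover have "norm (exp w - 1 - w) \<le> exp L * L\<^sup>2 * (norm h)\<^sup>2"
      proof -
        have "norm (exp w - 1 - w) \<le> exp \<bar>Re w\<bar> * (norm w)\<^sup>2"
          using Taylor_exp[of w 1] by (simp add: algebra_simps power2_eq_square)
        also have "\<dots> \<le> exp L * (norm h * L)\<^sup>2"
        proof (intro mult_mono power_mono nw)
          have "\<bar>Re w\<bar> \<le> norm h * L" using abs_Re_le_cmod[of w] nw by simp
          also have "\<dots> \<le> 1 * L" using h L0 by (intro mult_right_mono)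
          finally show "exp \<bar>Re w\<bar> \<le> exp L" by simp
        qed auto
        finally show ?thesis by (simp add: power_mult_distrib ac_simps)
      qed
      ultimately show "cmod (?f t) \<le> exp (\<bar>Im z\<bar> * L) * (exp L * L\<^sup>2 * (norm h)\<^sup>2)"
        by (simp only: norm_mult) (intro mult_mono, auto)
    qed simp
    finally show ?thesis by (simp add: C_def ac_simps)
  qed
  have "((%z. qq z y) has_derivative (%h. h *c d)) (at z)"
    unfolding has_derivative_at
  proof (intro conjI)
    show "bounded_linear (%h. h *c d)" by (rule scaleC.bounded_linear_left)
    show "(%h. norm (qq (z + h) y - qq z y - h *c d) / norm h) \<midarrow>0\<rightarrow> 0"
    proof (rule Lim_null_comparison)
      have "\<forall>\<^sub>F h in at 0. norm h < 1 \<and> h \<noteq> (0::complex)"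
        unfolding eventually_at by (rule exI[of _ 1]) auto
      then show "\<forall>\<^sub>F h in at 0. norm (norm (qq (z + h) y - qq z y - h *c d) / norm h) \<le> C * norm h"
      proof eventually_elim
        case (elim h)
        then have "norm (qq (z + h) y - qq z y - h *c d) \<le> C * norm h * norm h"
          using bound[of h] by (simp add: power2_eq_square mult.assoc)
        then show ?case using elim by (simp add: divide_le_eq)
      qed
      have "((%h::complex. C * norm h) \<longlongrightarrow> C * norm (0::complex)) (at 0)" by (intro tendsto_intros)
      then show "((%h. C * norm h) \<longlongrightarrow> 0) (at (0::complex))" by simp
    qed
  qed
  then show ?thesis by blast
qed

text \<open>On the support of the cut-off \<open>pw n (-\<i>)\<close> is (1 - t)/t = 1/t - 1. So u =
  B^-1 y, formed with a truncated 1/t, parametrizes the graph point (B u, u - B u) of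
  \<open>Q\<close>.\<close>

lemma qq_graph:
  assumes "y \<in> EE"
  shows "\<exists>u. y = B u \<and> qq (-\<i>) y = u - B u"
proof -
  obtain n where y: "y \<in> Ev n" using assms by (auto simp: EE_def)
  have ne: "max t (dl n) \<noteq> 0" for t using dl(1)[of n] by (auto simp: max_def)
  let ?g = "%t. complex_of_real (1 / max t (dl n))"
  have g: "continuous_on {0..1} ?g" by (intro continuous_intros) (auto simp only: ne)
  define u where "u = fc ?g y"
  have "B u = (fc of_real oo fc ?g) y" by (simp add: fc_ident u_def)
  also have "\<dots> = fc (%t. of_real t * ?g t) y"
    by (subst fc_mult[OF _ g]) (auto intro!: continuous_intros)
  also have "\<dots> = fc (%t. 1) y"
  proof (rule fc_local[OF y])
    show "continuous_on {0..1} (%t. of_real t * ?g t)" by (intro continuous_on_mult g continuous_intros)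
    fix t :: real assume "t \<in> {0..1}" "cut n t \<noteq> 0"
    then show "of_real t * ?g t = 1" using cut_nonzero[of t n] dl(1)[of n] by auto
  qed (intro continuous_intros)
  finally have Bu: "B u = y" by (simp add: fc_1)
  have "u - y = fc (%t. ?g t - 1) y"
    by (subst fc_diff[OF g]) (auto intro!: continuous_intros simp: u_def fc_1 blinfun.diff_left)
  also have "\<dots> = fc (pw n (-\<i>)) y"
  proof (rule fc_local[OF y])
    fix t :: real assume t: "t \<in> {0..1}" "cut n t \<noteq> 0"
    have p: "t > dl n" "1 - t > dl n" "t > 0" "1 - t > 0"
      using cut_nonzero[OF t] dl(1)[of n] by auto
    have "pw n (-\<i>) t = of_real (exp (ln (1 - t) - ln t))"
      unfolding pw_def lg_eq[OF t order_refl] by (simp flip: exp_of_real)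
    also have "exp (ln (1 - t) - ln t) = (1 - t) / t" using p by (simp add: exp_diff)
    finally show "?g t - 1 = pw n (-\<i>) t" using p by (simp add: field_simps)
  qed (intro continuous_on_diff g continuous_intros)+
  finally have "u - y = qq (-\<i>) y" by (simp add: qq_eq[OF y])
  then show ?thesis using Bu by metis
qed

text \<open>The cut-offs of B u serve as approximants: (1 - t)/t cancels the factor t coming from
  \<open>B\<close>, which leaves the cut-offs of u - B u.\<close>

lemma qq_core: "\<exists>s. (\<forall>n. s n \<in> EE) \<and> s ----> B u \<and> (%n. qq (-\<i>) (s n)) ----> u - B u"
proof (intro exI[of _ "%n. en n (B u)"] conjI allI)
  show "en n (B u) \<in> EE" for n using en_Ev[of n "Suc n"] by (auto simp: EE_def)
  show "(%n. en n (B u)) ----> B u" by (rule en_tendsto)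
  have "qq (-\<i>) (en n (B u)) = en n (u - B u)" for n
  proof -
    have c: "continuous_on {0..1} (%t. complex_of_real (cut n t) * of_real t)"
      "continuous_on {0..1} (%t. complex_of_real (cut n t))" "continuous_on {0..1} (%t. 1 - complex_of_real t)"
      by (intro continuous_intros)+
    have "qq (-\<i>) (en n (B u)) = (fc (pw (Suc n) (-\<i>)) oo (en n oo fc of_real)) u"
      by (simp add: qq_eq[OF en_Ev[OF lessI]] fc_ident)
    also have "fc (pw (Suc n) (-\<i>)) oo (en n oo fc of_real) = fc (%t. pw (Suc n) (-\<i>) t * (of_real (cut n t) * of_real t))"
      unfolding en_def by (subst fc_mult[OF _ c(1)], intro continuous_intros, subst fc_mult[OF c(2)]) (auto intro: continuous_intros)
    also have "\<dots> = fc (%t. of_real (cut n t) * (1 - of_real t))"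
    proof (rule fc_cong)
      fix t :: real assume t: "t \<in> {0..1}"
      show "pw (Suc n) (-\<i>) t * (of_real (cut n t) * of_real t) = of_real (cut n t) * (1 - of_real t)"
      proof (cases "cut n t = 0")
        case False
        have p: "t > 0" "1 - t > 0"
          using cut_nonzero[OF t False] dl(1)[of n] by auto
        have "pw (Suc n) (-\<i>) t = of_real (exp (ln (1 - t) - ln t))"
          unfolding pw_def lg_eq[OF t False le_SucI[OF order_refl]] by (simp flip: exp_of_real)
        also have "exp (ln (1 - t) - ln t) = (1 - t) / t" using p by (simp add: exp_diff)
        finally have "pw (Suc n) (-\<i>) t * of_real t = 1 - of_real t" using p by simp
        then show ?thesis by (metis mult.left_commute)
      qed simp
    qed (intro continuous_intros)
    also have "\<dots> = en n oo (\<one> - B)"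
      unfolding en_def by (subst fc_mult[OF c(2,3)], subst fc_diff) (auto intro: continuous_intros simp: fc_1 fc_ident)
    finally show ?thesis by (simp add: blinfun.diff_left)
  qed
  then show "(%n. qq (-\<i>) (en n (B u))) ----> u - B u" by (simp add: en_tendsto)
qed

end

text \<open>Here \<open>q z y\<close> stands for \<open>Q\<^bsup>iz\<^esup> y\<close>.\<close>

locale power_flow =
  fixes Q :: "('a::complex_hilbert \<times> 'a) set" and E :: "'a set" and q :: "complex => 'a => 'a"
  assumes subspace: "csubspace E" and dense: "closure E = UNIV"
    and q_in: "y \<in> E ==> q z y \<in> E"
    and q_plus: "x \<in> E ==> y \<in> E ==> q z (x + y) = q z x + q z y"
    and q_scale: "y \<in> E ==> q z (c *c y) = c *c q z y"
    and q_add: "y \<in> E ==> q (z + z') y = q z (q z' y)"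
    and q_0: "y \<in> E ==> q 0 y = y"
    and q_adj: "x \<in> E ==> y \<in> E ==> q z x \<bullet> y = x \<bullet> q (- cnj z) y"
    and q_deriv: "y \<in> E ==> \<exists>d. ((%z. q z y) has_derivative (%h. h *c d)) (at z)"
    and q_graph: "y \<in> E ==> (y, q (-\<i>) y) \<in> Q"
    and q_core: "(x, w) \<in> Q ==> \<exists>s. (\<forall>n. s n \<in> E) \<and> s ----> x \<and> (%n. q (-\<i>) (s n)) ----> w"

section \<open>Self-adjoint graphs and their resolvents\<close>

lemma positive_kernelD:
  assumes "positive_with_trivial_kernel Q"
  shows "csubspace Q" "single_valued Q" "(x, w) \<in> Q ==> (y, v) \<in> Q ==> w \<bullet> y = x \<bullet> v"
    "(\<And>x w. (x, w) \<in> Q ==> w \<bullet> y = x \<bullet> v) ==> (y, v) \<in> Q"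
    "(x, w) \<in> Q ==> x \<bullet> w \<in> \<real>\<^sub>\<ge>\<^sub>0" "(x, 0) \<in> Q ==> x = 0"
proof -
  show "csubspace Q" "single_valued Q" "(x, w) \<in> Q ==> x \<bullet> w \<in> \<real>\<^sub>\<ge>\<^sub>0" "(x, 0) \<in> Q ==> x = 0"
    using assms unfolding positive_with_trivial_kernel_def self_adjoint_def by auto
  have Q: "Q = {(y, z). \<forall>(x, w)\<in>Q. w \<bullet> y = x \<bullet> z}"
    using assms unfolding positive_with_trivial_kernel_def self_adjoint_def by (elim conjE) assumption
  show "w \<bullet> y = x \<bullet> v" if xw: "(x, w) \<in> Q" and yv: "(y, v) \<in> Q"
  proof -
    have "(y, v) \<in> {(y, z). \<forall>(x, w)\<in>Q. w \<bullet> y = x \<bullet> z}" using yv Q by simp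
    then show ?thesis using xw by auto
  qed
  show "(y, v) \<in> Q" if *: "\<And>x w. (x, w) \<in> Q ==> w \<bullet> y = x \<bullet> v"
    by (subst Q) (auto simp: *)
qed

lemma graph_add: "csubspace Q ==> (x, w) \<in> Q ==> (y, v) \<in> Q ==> (x + y, w + v) \<in> Q"
  using csubspaceD(2)[of Q "(x, w)" "(y, v)"] by simp

lemma graph_scale: "csubspace Q ==> (x, w) \<in> Q ==> (c *c x, c *c w) \<in> Q"
  using csubspaceD(3)[of Q "(x, w)" c] by (simp add: scaleC_prod_def)

lemma graph_zero: "csubspace Q ==> (0, 0) \<in> Q"
  using csubspaceD(1)[of Q] by (simp add: zero_prod_def)

lemma csubspace_fst:
  assumes R: "csubspace R"
  shows "csubspace (fst ` R)"
proof (rule csubspaceI)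
  show "0 \<in> fst ` R" using csubspaceD(1)[OF R] by force
  show "x + y \<in> fst ` R" if "x \<in> fst ` R" "y \<in> fst ` R" for x y
    using that csubspaceD(2)[OF R] by force
  show "c *c x \<in> fst ` R" if "x \<in> fst ` R" for c x
    using that csubspaceD(3)[OF R, of _ c] by (force simp: scaleC_prod_def)
qed

text \<open>The bound makes the relation \<open>R\<close> single-valued. Starting from a relation
  avoids proving well-definedness by hand, both for the resolvent and for extensions to
  multipliers.\<close>

lemma dense_extension_graph:
  fixes R :: "('a::complex_hilbert \<times> 'b::complex_hilbert) set"
  assumes R: "csubspace R" and dense: "closure (fst ` R) = UNIV"
    and bound: "\<And>x l. (x, l) \<in> R ==> norm l \<le> K * norm x"
  shows "\<exists>T\<in>bop. \<forall>x l. (x, l) \<in> R --> blinfun_apply T x = l"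
proof -
  have uniq: "l = m" if "(x, l) \<in> R" "(x, m) \<in> R" for x l m
    using bound[of 0 "l - m"] csubspaceD(4)[OF R that] by simp
  define f where "f x = (THE l. (x, l) \<in> R)" for x
  have f: "f x = l" if "(x, l) \<in> R" for x l
    unfolding f_def using that uniq by blast
  have fR: "(x, f x) \<in> R" if "x \<in> fst ` R" for x
    using that f by force
  have "\<exists>T\<in>bop. (\<forall>x\<in>fst ` R. blinfun_apply T x = f x) \<and> (\<forall>x. norm (T x) \<le> K * norm x)"
  proof (rule dense_extension[OF csubspace_fst[OF R] dense])
    show "f (x + y) = f x + f y" if "x \<in> fst ` R" "y \<in> fst ` R" for x y
      by (rule f[OF graph_add[OF R fR[OF that(1)] fR[OF that(2)]]])
    show "f (c *c x) = c *c f x" if "x \<in> fst ` R" for c x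
      by (rule f[OF graph_scale[OF R fR[OF that]]])
    show "norm (f x) \<le> K * norm x" if "x \<in> fst ` R" for x
      by (rule bound[OF fR[OF that]])
  qed
  then show ?thesis using f by force
qed

text \<open>Positivity gives |x|^2 + |w|^2 \<le> |x + w|^2 on the graph, so 1 + Q has a contractive
  inverse on its range. A vector v orthogonal to the range satisfies (v, -v) \<in> Q by
  self-adjointness, and positivity kills it.\<close>

lemma ex_resolvent:
  fixes Q :: "('a::complex_hilbert \<times> 'a) set"
  assumes Q: "positive_with_trivial_kernel Q"
  shows "\<exists>B. injective_contraction B \<and> (\<forall>u. (B u, u - B u) \<in> Q) \<and> (\<forall>x w. (x, w) \<in> Q --> B (x + w) = x)"
proof -
  note pk = positive_kernelD[OF Q]
  have ge: "(norm x)\<^sup>2 + (norm w)\<^sup>2 \<le> (norm (x + w))\<^sup>2" if "(x, w) \<in> Q" for x w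
  proof -
    have "(norm (x + w))\<^sup>2 = (norm x)\<^sup>2 + 2 * Re (x \<bullet> w) + (norm w)\<^sup>2"
      unfolding inner_cinner[symmetric] by (simp add: power2_norm_eq_inner inner_add inner_commute)
    moreover have "Re (x \<bullet> w) \<ge> 0" using pk(5)[OF that] by (simp add: complex_nonneg_Reals_iff)
    ultimately show ?thesis by simp
  qed
  have ge1: "norm x \<le> norm (x + w)" "norm w \<le> norm (x + w)" if "(x, w) \<in> Q" for x w
  proof -
    have "(norm x)\<^sup>2 \<le> (norm (x + w))\<^sup>2" "(norm w)\<^sup>2 \<le> (norm (x + w))\<^sup>2"
      using ge[OF that] zero_le_power2[of "norm x"] zero_le_power2[of "norm w"] by linarith+
    then show "norm x \<le> norm (x + w)" "norm w \<le> norm (x + w)"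
      by (auto elim!: power2_le_imp_le)
  qed
  define R where "R = {(u, x). (x, u - x) \<in> Q}"
  have R: "csubspace R"
  proof (rule csubspaceI)
    show "0 \<in> R" using graph_zero[OF pk(1)] by (simp add: R_def zero_prod_def)
    show "p + q \<in> R" if "p \<in> R" "q \<in> R" for p q
      using that graph_add[OF pk(1), of "snd p" "fst p - snd p" "snd q" "fst q - snd q"] by (auto simp: R_def algebra_simps)
    show "c *c p \<in> R" if "p \<in> R" for c p
      using that graph_scale[OF pk(1), of "snd p" "fst p - snd p" c] by (auto simp: R_def scaleC_prod_def scaleC.diff_right)
  qed
  have M: "x + w \<in> fst ` R" if "(x, w) \<in> Q" for x w
    using that by (intro image_eqI[of _ _ "(x + w, x)"]) (auto simp: R_def)
  have dense: "closure (fst ` R) = UNIV"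
  proof (rule closed_subspace_eq_UNIV)
    fix v assume v: "\<And>a. a \<in> closure (fst ` R) ==> a \<bullet> v = 0"
    have "(v, - v) \<in> Q"
    proof (rule pk(4))
      fix x w assume "(x, w) \<in> Q"
      then have "(x + w) \<bullet> v = 0" using v M closure_subset by blast
      then show "w \<bullet> v = x \<bullet> - v" by (simp add: cinner_add_left cinner.minus_right add_eq_0_iff2)
    qed
    from pk(5)[OF this] have "(norm v)\<^sup>2 \<le> 0"
      by (simp add: cinner.minus_right cinner_self complex_nonneg_Reals_iff del: of_real_power)
    then show "v = 0" by simp
  qed (simp_all add: csubspace_closure csubspace_fst R)
  have "norm l \<le> 1 * norm x" if "(x, l) \<in> R" for x l using that ge1(1)[of l "x - l"] by (simp add: R_def)
  from dense_extension_graph[OF R dense this] obtain B where Bb: "B \<in> bop" and BR: "\<And>x l. (x, l) \<in> R ==> B x = l"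
    by blast
  define b where "b = blinfun_apply B"
  define c where "c u = u - b u" for u
  have ap: "blinfun_apply B = b" and cu: "c u = u - b u" for u by (simp_all add: b_def c_def)
  have b_eq: "b u = x" if "u = x + w" "(x, w) \<in> Q" for u x w
    unfolding b_def by (rule BR) (use that in \<open>simp add: R_def\<close>)
  \<comment> \<open>The graph of \<open>Q\<close> is defined by closed conditions, being its own
    adjoint, so the resolvent identity extends from the dense range of 1 + Q to every u.\<close>
  have bQ: "(b u, c u) \<in> Q" for u
  proof (rule pk(4))
    fix y v assume yv: "(y, v) \<in> Q"
    have "fst ` R \<subseteq> {u. v \<bullet> B u = y \<bullet> (u - B u)}" using BR pk(3)[OF yv] by (force simp: R_def)
    moreover have "closed {u. v \<bullet> B u = y \<bullet> (u - B u)}"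
      by (intro closed_Collect_eq continuous_intros cinner.continuous_on)
    ultimately have "closure (fst ` R) \<subseteq> {u. v \<bullet> B u = y \<bullet> (u - B u)}" by (rule closure_minimal)
    then show "v \<bullet> b u = y \<bullet> c u" by (auto simp: dense b_def c_def)
  qed
  have bc: "u = b u + c u" "(b u, c u) \<in> Q" for u using bQ by (simp_all add: c_def)
  have sy: "b u \<bullet> v = u \<bullet> b v" for u v
  proof -
    have "b u \<bullet> v = b u \<bullet> b v + b u \<bullet> c v" by (subst bc(1)[of v]) (simp add: cinner_add_right)
    also have "b u \<bullet> c v = c u \<bullet> b v" by (rule pk(3)[symmetric, OF bc(2) bc(2)])
    also have "b u \<bullet> b v + c u \<bullet> b v = u \<bullet> b v" by (subst (3) bc(1)[of u]) (simp add: cinner_add_left)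
    finally show ?thesis .
  qed
  have rc: "c u \<bullet> b u = b u \<bullet> c u" for u by (rule pk(3)[OF bc(2) bc(2)])
  have "injective_contraction B"
  proof
    show "B \<in> bop" by fact
    show "adj B = B" by (rule adj_eqI) (simp add: ap sy)
    have self: "v \<bullet> v \<in> \<real>\<^sub>\<ge>\<^sub>0" for v :: 'a by (simp add: cinner_self)
    show "x \<bullet> blinfun_apply B x \<in> \<real>\<^sub>\<ge>\<^sub>0" for x
    proof -
      have "x \<bullet> b x = b x \<bullet> b x + c x \<bullet> b x" by (subst (1) bc(1)[of x]) (simp add: cinner_add_left)
      then show ?thesis using pk(5)[OF bc(2), of x] self[of "b x"] by (simp add: ap rc)
    qed
    show "x \<bullet> (x - blinfun_apply B x) \<in> \<real>\<^sub>\<ge>\<^sub>0" for x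
    proof -
      have "x \<bullet> c x = b x \<bullet> c x + c x \<bullet> c x" by (subst (1) bc(1)[of x]) (simp add: cinner_add_left)
      then show ?thesis using pk(5)[OF bc(2), of x] self[of "c x"] by (simp add: ap cu)
    qed
    show "x = 0" if "blinfun_apply B x = 0" for x
    proof -
      have "(0, x) \<in> Q" using bc(2)[of x] bc(1)[of x] that by (simp add: ap)
      then show ?thesis using pk(2) graph_zero[OF pk(1)] unfolding single_valued_def by blast
    qed
    show "x = 0" if "blinfun_apply B x = x" for x
    proof -
      have "(x, 0) \<in> Q" using bc(2)[of x] bc(1)[of x] that by (simp add: ap)
      then show ?thesis by (rule pk(6))
    qed
  qed
  moreover have "\<forall>u. (B u, u - B u) \<in> Q" using bc(2) by (simp add: ap cu)
  moreover have "\<forall>x w. (x, w) \<in> Q --> B (x + w) = x" using b_eq by (simp add: ap)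
  ultimately show ?thesis by blast
qed

lemma ex_power_flow:
  assumes "positive_with_trivial_kernel Q"
  shows "\<exists>E q. power_flow Q E q"
proof -
  obtain B where B: "injective_contraction B" and gr: "\<And>u. (blinfun_apply B u, u - B u) \<in> Q"
    and res: "\<And>x w. (x, w) \<in> Q ==> B (x + w) = x"
    using ex_resolvent[OF assms] by blast
  interpret injective_contraction B by (rule B)
  have "power_flow Q EE qq"
  proof
    show "(y, qq (-\<i>) y) \<in> Q" if "y \<in> EE" for y
      using qq_graph[OF that] gr by force
    show "\<exists>s. (\<forall>n. s n \<in> EE) \<and> s ----> x \<and> (%n. qq (- \<i>) (s n)) ----> w" if "(x, w) \<in> Q" for x w
      using qq_core[of "x + w"] res[OF that] by simp
  qed (fact EE_subspace EE_dense qq_in qq_plus qq_scale qq_add qq_0 qq_adj qq_deriv)+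
  then show ?thesis by blast
qed

section \<open>The unitary group of real powers\<close>

context power_flow
begin

lemma q_inv: "y \<in> E ==> q (- z) (q z y) = y" "y \<in> E ==> q z (q (- z) y) = y"
  using q_add[of y "- z" z] q_add[of y z "- z"] q_0 by simp_all

lemma norm_q_real: "y \<in> E ==> norm (q (of_real t) y) = norm y"
proof -
  assume y: "y \<in> E"
  have "q (of_real t) y \<bullet> q (of_real t) y = y \<bullet> y"
    using q_adj[OF y q_in[OF y], of "of_real t" "of_real t"] q_inv(1)[OF y] by simp
  then have "(norm (q (of_real t) y))\<^sup>2 = (norm y)\<^sup>2"
    unfolding cinner_self by (simp only: of_real_eq_iff)
  then show ?thesis by (rule power2_eq_imp_eq) simp_all
qed

definition U :: "real => 'a -> 'a" where
  "U t = (SOME T. T \<in> bop \<and> (\<forall>y\<in>E. blinfun_apply T y = q (of_real t) y))"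

lemma U: "U t \<in> bop" "y \<in> E ==> U t y = q (of_real t) y"
proof -
  have "\<exists>T\<in>bop. (\<forall>x\<in>E. blinfun_apply T x = q (of_real t) x) \<and> (\<forall>x. norm (T x) \<le> 1 * norm x)"
    by (rule dense_extension[OF subspace dense]) (auto simp: q_plus q_scale norm_q_real)
  then have "\<exists>T. T \<in> bop \<and> (\<forall>y\<in>E. blinfun_apply T y = q (of_real t) y)" by blast
  then have "U t \<in> bop \<and> (\<forall>y\<in>E. blinfun_apply (U t) y = q (of_real t) y)"
    unfolding U_def by (rule someI_ex)
  then show "U t \<in> bop" "y \<in> E ==> U t y = q (of_real t) y" by auto
qed

lemma adj_U: "adj (U t) = U (- t)"
proof (rule bop_eq_dense[OF dense])
  fix y assume y: "y \<in> E"
  show "adj (U t) y = U (- t) y"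
  proof (rule eq_on_total[OF ccl_closure_UNIV[OF dense]])
    fix x assume x: "x \<in> E"
    show "x \<bullet> adj (U t) y = x \<bullet> U (- t) y"
      using q_adj[OF x y, of "of_real t"] by (simp add: cinner_adj_right U x y)
  qed
qed

lemma U_add: "U (s + t) = U s oo U t"
  by (rule bop_eq_dense[OF dense]) (simp add: U q_in q_add)

lemma U_0: "U 0 = \<one>"
  by (rule bop_eq_dense[OF dense]) (simp add: U q_0)

lemma unitary_U [simp]: "unitary (U t)"
  using U_add[of t "- t"] U_add[of "- t" t] by (simp add: unitary_def U adj_U U_0)

lemma isCont_q: "y \<in> E ==> isCont (%z. q z y) z"
  using q_deriv[of y z] has_derivative_continuous by blast

lemma U_tendsto: "((%s. U s x) \<longlongrightarrow> U t x) (at t)"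
proof -
  have "norm (U s) \<le> 1" for s
    by (rule norm_blinfun_bound) (simp_all add: norm_unitary)
  then have "closed {x. ((%s. U s x) \<longlongrightarrow> U t x) (at t)}"
    by (rule closed_strong_limit)
  moreover have "E \<subseteq> {x. ((%s. U s x) \<longlongrightarrow> U t x) (at t)}"
  proof
    fix y assume y: "y \<in> E"
    have "isCont (%s. q (complex_of_real s) y) t"
      using isCont_o2[of t complex_of_real "%z. q z y"] isCont_q[OF y] by simp
    then show "y \<in> {x. ((%s. U s x) \<longlongrightarrow> U t x) (at t)}"
      by (simp add: U y isCont_def)
  qed
  ultimately have "closure E \<subseteq> {x. ((%s. U s x) \<longlongrightarrow> U t x) (at t)}"
    by (intro closure_minimal)
  then show ?thesis using dense by auto
qed

text \<open>Real powers are isometric, so only the compact segment of imaginary parts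
  matters.\<close>

lemma q_strip_bound:
  assumes y: "y \<in> E"
  shows "\<exists>K. \<forall>z. \<bar>Im z\<bar> \<le> R --> norm (q z y) \<le> K"
proof -
  have "compact ((%s. q (\<i> * complex_of_real s) y) ` {-R..R})"
  proof (intro compact_continuous_image continuous_at_imp_continuous_on ballI)
    fix s :: real
    show "isCont (%s. q (\<i> * complex_of_real s) y) s"
      using isCont_o2[of s "%s. \<i> * complex_of_real s" "%z. q z y"] isCont_q[OF y] by simp
  qed simp
  then have "bounded ((%s. q (\<i> * complex_of_real s) y) ` {-R..R})" by (rule compact_imp_bounded)
  then obtain K where K: "\<And>s. s \<in> {-R..R} ==> norm (q (\<i> * complex_of_real s) y) \<le> K"
    unfolding bounded_iff by (metis imageI)
  have "norm (q z y) \<le> K" if "\<bar>Im z\<bar> \<le> R" for z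
  proof -
    have "q z y = q (of_real (Re z)) (q (\<i> * of_real (Im z)) y)"
      unfolding q_add[OF y, symmetric] by (simp add: complex_eq[symmetric])
    then show ?thesis using K[of "Im z"] that by (simp add: norm_q_real q_in y abs_le_iff)
  qed
  then show ?thesis by blast
qed

end

section \<open>Gaussian averages and shifts of the contour\<close>

text \<open>A limit of integrals over [-m, m] suffices because all integrands have Gaussian decay
  (\<open>gdec\<close>). It commutes with bounded linear maps and stays in closed subspaces, for
  values in any Banach space.\<close>

definition wint :: "(real => 'x::banach) => 'x" where
  "wint f = lim (%m. integral {- real m..real m} f)"

definition gdec :: "(real => 'x::real_normed_vector) => bool" where
  "gdec f \<longleftrightarrow> continuous_on UNIV f \<and> (\<exists>C. \<forall>t. norm (f t) \<le> C * exp (- t\<^sup>2))"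

lemma gdec_integrable:
  fixes f :: "real => 'x::banach"
  shows "gdec f ==> f integrable_on {a..b}"
  unfolding gdec_def by (meson continuous_on_subset integrable_continuous_real subset_UNIV)

text \<open>Consecutive integrals differ by two unit intervals on which the square of t is at least
  m, so the increments are dominated by a geometric series with ratio exp(-1).\<close>

lemma wint_tendsto:
  fixes f :: "real => 'x::banach"
  assumes f: "gdec f"
  shows "(%m. integral {- real m..real m} f) ----> wint f"
proof -
  obtain C where C: "\<And>t. norm (f t) \<le> C * exp (- t\<^sup>2)" and cont: "continuous_on UNIV f"
    using f unfolding gdec_def by blast
  have C0: "C \<ge> 0" using order_trans[OF norm_ge_zero C[of 0]] by simp
  define a where "a m = integral {- real m..real m} f" for m :: nat
  have bd: "norm (integral {u..v} f) \<le> C * exp (- real m)"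
    if "u \<le> v" "v - u = 1" "\<And>t. t \<in> {u..v} ==> real m \<le> \<bar>t\<bar>" for u v m
  proof -
    have "norm (integral {u..v} f) \<le> C * exp (- real m) * (v - u)"
    proof (rule integral_bound)
      fix t assume t: "t \<in> {u..v}"
      have "real m \<le> t\<^sup>2"
      proof (cases "m = 0")
        case False
        then have "real m * 1 \<le> \<bar>t\<bar> * \<bar>t\<bar>" using that(3)[OF t] by (intro mult_mono) auto
        then show ?thesis by (simp add: power2_eq_square)
      qed simp
      then have "exp (- t\<^sup>2) \<le> exp (- real m)" by simp
      then show "norm (f t) \<le> C * exp (- real m)"
        using order_trans[OF C mult_left_mono[OF _ C0]] by blast
    qed (use that in \<open>auto intro: continuous_on_subset[OF cont]\<close>)
    then show ?thesis using that by simp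
  qed
  have step: "norm (a (Suc m) - a m) \<le> 2 * C * exp (-1) ^ m" for m
  proof -
    have "a (Suc m) = integral {- real (Suc m)..- real m} f + (a m + integral {real m..real (Suc m)} f)"
    proof -
      have "integral {- real (Suc m)..- real m} f + integral {- real m..real (Suc m)} f = a (Suc m)"
        unfolding a_def by (intro Henstock_Kurzweil_Integration.integral_combine gdec_integrable f) auto
      moreover have "a m + integral {real m..real (Suc m)} f = integral {- real m..real (Suc m)} f"
        unfolding a_def by (intro Henstock_Kurzweil_Integration.integral_combine gdec_integrable f) auto
      ultimately show ?thesis by simp
    qed
    then have "a (Suc m) - a m = integral {- real (Suc m)..- real m} f + integral {real m..real (Suc m)} f"
      by simp
    then have "norm (a (Suc m) - a m) \<le> norm (integral {- real (Suc m)..- real m} f) + norm (integral {real m..real (Suc m)} f)"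
      by (simp add: norm_triangle_ineq)
    also have "\<dots> \<le> C * exp (- real m) + C * exp (- real m)"
      by (intro add_mono bd) auto
    also have "exp (- real m) = exp (-1) ^ m" by (simp flip: exp_of_nat_mult)
    finally show ?thesis by simp
  qed
  have "summable (%m. a (Suc m) - a m)"
  proof (rule summable_comparison_test'[OF _ step])
    show "summable (%m. 2 * C * exp (-1 :: real) ^ m)" by (intro summable_mult summable_geometric) simp
  qed
  then have "convergent (%n. \<Sum>m<n. a (Suc m) - a m)" by (simp add: summable_iff_convergent)
  then have "convergent a" by (simp add: sum_lessThan_telescope convergent_diff_const_right_iff)
  then show ?thesis unfolding wint_def a_def convergent_LIMSEQ_iff .
qed

lemma wint_linear:
  fixes f :: "real => 'x::banach" and L :: "'x => 'y::banach"
  assumes f: "gdec f" and L: "bounded_linear L"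
  shows "gdec (%t. L (f t))" "wint (%t. L (f t)) = L (wint f)"
proof -
  obtain C where C: "\<And>t. norm (f t) \<le> C * exp (- t\<^sup>2)" and cont: "continuous_on UNIV f"
    using f unfolding gdec_def by blast
  obtain K where K: "K \<ge> 0" "\<And>x. norm (L x) \<le> norm x * K"
    using bounded_linear.nonneg_bounded[OF L] by blast
  have "norm (L (f t)) \<le> (C * K) * exp (- t\<^sup>2)" for t
    using order_trans[OF K(2) mult_right_mono[OF C K(1)]] by (simp add: ac_simps)
  moreover have "continuous_on UNIV (%t. L (f t))"
    using bounded_linear.continuous_on[OF L cont] .
  ultimately show g: "gdec (%t. L (f t))" unfolding gdec_def by blast
  have "integral {- real m..real m} (%t. L (f t)) = L (integral {- real m..real m} f)" for m
    using integral_linear[OF gdec_integrable[OF f] L] by (simp add: o_def)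
  then have "(%m. L (integral {- real m..real m} f)) ----> wint (%t. L (f t))"
    using wint_tendsto[OF g] by simp
  then show "wint (%t. L (f t)) = L (wint f)"
    using LIMSEQ_unique bounded_linear.tendsto[OF L wint_tendsto[OF f]] by blast
qed

lemma gdec_add:
  assumes "gdec f" "gdec g"
  shows "gdec (%t. f t + g t)"
proof -
  obtain C D where "\<And>t. norm (f t) \<le> C * exp (- t\<^sup>2)" "\<And>t. norm (g t) \<le> D * exp (- t\<^sup>2)"
    using assms unfolding gdec_def by blast
  then have "norm (f t + g t) \<le> (C + D) * exp (- t\<^sup>2)" for t
    unfolding distrib_right by (intro norm_triangle_le add_mono)
  then show ?thesis using assms unfolding gdec_def by (auto intro: continuous_on_add)
qed

lemma wint_add:
  fixes f g :: "real => 'x::banach"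
  assumes f: "gdec f" and g: "gdec g"
  shows "wint (%t. f t + g t) = wint f + wint g"
proof -
  have "integral {- real m..real m} (%t. f t + g t) = integral {- real m..real m} f + integral {- real m..real m} g" for m
    by (rule integral_add[OF gdec_integrable[OF f] gdec_integrable[OF g]])
  then show ?thesis
    using LIMSEQ_unique[OF wint_tendsto[OF gdec_add[OF f g]]] tendsto_add[OF wint_tendsto[OF f] wint_tendsto[OF g]] by simp
qed

lemma norm_wint_le:
  fixes f :: "real => 'x::banach"
  assumes f: "gdec f" and g: "gdec g" and le: "\<And>t. norm (f t) \<le> g t"
  shows "norm (wint f) \<le> wint g"
proof (rule LIMSEQ_le[OF tendsto_norm[OF wint_tendsto[OF f]] wint_tendsto[OF g]])
  show "\<exists>N. \<forall>m\<ge>N. norm (integral {- real m..real m} f) \<le> integral {- real m..real m} g"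
    using integral_norm_bound_integral[OF gdec_integrable[OF f] gdec_integrable[OF g] le] by blast
qed

text \<open>The Riemann sums of tagged divisions lie in the subspace and approximate the
  integral.\<close>

lemma integral_in_subspace:
  fixes f :: "real => 'x::{banach,complex_normed}"
  assumes f: "f integrable_on {a..b}" and X: "csubspace X" "closed X" and in_X: "\<And>t. f t \<in> X"
  shows "integral {a..b} f \<in> X"
proof -
  have "integral {a..b} f \<in> closure X"
    unfolding closure_approachable
  proof (intro allI impI)
    fix e :: real assume e: "e > 0"
    obtain \<gamma> where \<gamma>: "gauge \<gamma>" and close: "\<And>\<D>. \<D> tagged_division_of (cbox a b) ==> \<gamma> fine \<D> ==>
        norm ((\<Sum>(x, k)\<in>\<D>. measure lborel k *\<^sub>R f x) - integral {a..b} f) < e"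
      using integrable_integral[OF f] e unfolding box_real[symmetric] has_integral by metis
    obtain \<D> where D: "\<D> tagged_division_of (cbox a b)" "\<gamma> fine \<D>"
      using fine_division_exists[OF \<gamma>] by blast
    have "(\<Sum>(x, k)\<in>\<D>. measure lborel k *\<^sub>R f x) \<in> X"
      by (intro complex_vector.subspace_sum X(1)) (auto intro: csubspaceD(5)[OF X(1)] in_X)
    then show "\<exists>y\<in>X. dist y (integral {a..b} f) < e"
      using close[OF D] by (auto simp: dist_norm)
  qed
  then show ?thesis using X(2) by simp
qed

lemma wint_in_subspace:
  fixes f :: "real => 'x::{banach,complex_normed}"
  assumes f: "gdec f" and X: "csubspace X" "closed X" and in_X: "\<And>t. f t \<in> X"
  shows "wint f \<in> X"
  by (rule closed_sequentially[OF X(2) _ wint_tendsto[OF f]])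
     (simp add: integral_in_subspace[OF gdec_integrable[OF f] X in_X])

lemma Im_shift [simp]: "(of_real t - \<i>) = Complex t (-1)"
  by (simp add: complex_eq_iff)

text \<open>In terms of a primitive \<open>P\<close> both horizontal integrals are endpoint
  differences. They differ by the increments of \<open>P\<close> along two vertical segments of
  length 1, which decay like exp(-m^2).\<close>

lemma contour_shift:
  assumes f: "f holomorphic_on UNIV"
    and bd: "\<And>z. \<bar>Im z\<bar> \<le> 1 ==> cmod (f z) \<le> C * exp (- (Re z)\<^sup>2)"
  shows "gdec (%t. f (of_real t))" "gdec (%t. f (of_real t - \<i>))"
    "wint (%t. f (of_real t)) = wint (%t. f (of_real t - \<i>))"
proof -
  have cf: "continuous_on S f" for S
    using holomorphic_on_imp_continuous_on[OF f] continuous_on_subset by blast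
  have c1: "continuous_on S (%t. f (of_real t))" for S
    by (rule continuous_on_compose2[OF cf[of UNIV]]) (auto intro!: continuous_intros)
  have c2: "continuous_on S (%t. f (of_real t - \<i>))" for S
    by (rule continuous_on_compose2[OF cf[of UNIV]]) (auto intro!: continuous_intros simp del: Im_shift)
  show g1: "gdec (%t. f (of_real t))"
    using bd[of "of_real _"] c1 unfolding gdec_def by auto
  show g2: "gdec (%t. f (of_real t - \<i>))"
    using bd[of "of_real _ - \<i>"] c2 unfolding gdec_def by auto
  obtain P where P: "\<And>z. (P has_field_derivative f z) (at z)"
    using holomorphic_convex_primitive'[OF convex_UNIV open_UNIV f] by auto
  have C0: "C \<ge> 0" using order_trans[OF norm_ge_zero bd[of 0]] by simp
  have int: "integral {- real m..real m} (%t. f (of_real t - w)) = P (of_real (real m) - w) - P (of_real (- real m) - w)" for m w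
  proof (rule integral_unique, rule fundamental_theorem_of_calculus)
    fix t :: real
    have "((%t. P (of_real t - w)) has_vector_derivative (1 * f (of_real t - w))) (at t)"
      by (rule field_vector_diff_chain_at[of "%t. of_real t - w" 1 t P "f (of_real t - w)", unfolded o_def])
         (auto intro!: derivative_eq_intros P)
    then show "((%t. P (of_real t - w)) has_vector_derivative f (of_real t - w)) (at t within {- real m..real m})"
      by (simp add: has_vector_derivative_at_within)
  qed simp
  have vert: "cmod (P (of_real r) - P (of_real r - \<i>)) \<le> C * exp (- r\<^sup>2)" for r
  proof -
    have "cmod (P (of_real r) - P (of_real r - \<i>)) \<le> C * exp (- r\<^sup>2) * cmod (of_real r - (of_real r - \<i>))"
    proof (rule field_differentiable_bound[of "closed_segment (of_real r) (of_real r - \<i>)"])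
      fix z assume "z \<in> closed_segment (complex_of_real r) (of_real r - \<i>)"
      then obtain u where u: "0 \<le> u" "u \<le> 1" "z = (1 - u) *\<^sub>R complex_of_real r + u *\<^sub>R (of_real r - \<i>)"
        unfolding closed_segment_def by blast
      then have "Re z = r" "\<bar>Im z\<bar> \<le> 1" unfolding u(3) by (auto simp: algebra_simps)
      then show "cmod (f z) \<le> C * exp (- r\<^sup>2)" using bd[of z] by simp
    qed (auto intro: has_field_derivative_at_within P)
    moreover have "complex_of_real r - (of_real r - \<i>) = \<i>" by (simp del: Im_shift)
    ultimately show ?thesis by (simp only: norm_ii mult_1_right)
  qed
  have "(%m. integral {- real m..real m} (%t. f (of_real t)) - integral {- real m..real m} (%t. f (of_real t - \<i>))) ----> 0"
  proof (rule null_comparison)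
    fix m
    have "integral {- real m..real m} (%t. f (of_real t)) - integral {- real m..real m} (%t. f (of_real t - \<i>))
        = (P (of_real (real m)) - P (of_real (real m) - \<i>)) - (P (of_real (- real m)) - P (of_real (- real m) - \<i>))"
      unfolding int int[of m 0, simplified] by simp
    then show "norm (integral {- real m..real m} (%t. f (of_real t)) - integral {- real m..real m} (%t. f (of_real t - \<i>)))
        \<le> C * exp (- (real m)\<^sup>2) + C * exp (- (real m)\<^sup>2)"
      using norm_triangle_le_diff[OF add_mono[OF vert[of "real m"] vert[of "- real m"]]] by simp
  next
    have "(%m. exp (- (real m)\<^sup>2)) ----> 0" by real_asymp
    then have "(%m. C * exp (- (real m)\<^sup>2) + C * exp (- (real m)\<^sup>2)) ----> C * 0 + C * 0"
      by (intro tendsto_intros)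
    then show "(%m. C * exp (- (real m)\<^sup>2) + C * exp (- (real m)\<^sup>2)) ----> 0" by simp
  qed
  then have "wint (%t. f (of_real t)) - wint (%t. f (of_real t - \<i>)) = 0"
    using LIMSEQ_unique[OF tendsto_diff[OF wint_tendsto[OF g1] wint_tendsto[OF g2]]] by blast
  then show "wint (%t. f (of_real t)) = wint (%t. f (of_real t - \<i>))" by simp
qed

text \<open>The factor \<open>Suc n\<close> keeps every member below exp(-t^2), so the single bound
  of \<open>gdec\<close> serves the whole sequence.\<close>

definition gauss :: "nat => real => real" where "gauss n t = exp (- (real (Suc n) * t\<^sup>2))"

lemma gauss_le: "gauss n t \<le> exp (- t\<^sup>2)" "0 < gauss n t"
proof -
  have "0 \<le> real n * t\<^sup>2" by simp
  then show "gauss n t \<le> exp (- t\<^sup>2)" by (simp add: gauss_def distrib_right)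
qed (simp add: gauss_def)

lemma continuous_gauss [continuous_intros]: "continuous_on S (gauss n)"
  unfolding gauss_def by (intro continuous_intros)

lemma gdec_gauss_scaleR:
  fixes a :: "real => 'x::real_normed_vector"
  assumes a: "continuous_on UNIV a" and M: "\<And>t. norm (a t) \<le> M"
  shows "gdec (%t. gauss n t *\<^sub>R a t)"
proof -
  have "norm (gauss n t *\<^sub>R a t) \<le> M * exp (- t\<^sup>2)" for t
    using mult_mono[OF gauss_le(1)[of n t] M[of t]] gauss_le(2)[of n t]
    by (simp add: mult.commute less_imp_le)
  then show ?thesis unfolding gdec_def using a by (auto intro!: continuous_intros)
qed

text \<open>Dividing the averages by the mass \<open>c n\<close> of the Gaussian stays in the
  subspace and gives an approximate identity at 0.\<close>

lemma gauss_approx: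
  fixes a :: "real => 'x::{banach,complex_normed}"
  assumes a: "continuous_on UNIV a" and M: "\<And>t. norm (a t) \<le> M"
    and X: "csubspace X" "closed X" and in_X: "\<And>n. wint (%t. gauss n t *\<^sub>R a t) \<in> X"
  shows "a 0 \<in> X"
proof -
  have g1: "gdec (gauss n)" for n using gdec_gauss_scaleR[of "%_. 1::real" 1 n] by simp
  define c where "c n = wint (gauss n)" for n
  have M0: "M \<ge> 0" using order_trans[OF norm_ge_zero M[of 0]] .
  \<comment> \<open>The mass is at least the integral over [-s, s] of the minimum there. Used with s
    = d/2 it dominates the tail beyond d, which carries the factor exp(-n d^2).\<close>
  have low: "2 * s * exp (- (real (Suc n) * s\<^sup>2)) \<le> c n" if s: "0 \<le> s" "s \<le> 1" for s n
  proof (rule LIMSEQ_le_const[OF wint_tendsto[OF g1, of n, folded c_def]], intro exI allI impI)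
    fix m :: nat assume m: "1 \<le> m"
    have "2 * s * exp (- (real (Suc n) * s\<^sup>2)) = integral {-s..s} (%t. exp (- (real (Suc n) * s\<^sup>2)))"
      using s by simp
    also have "\<dots> \<le> integral {-s..s} (gauss n)"
    proof (rule integral_le)
      fix t assume "t \<in> {-s..s}"
      then have "\<bar>t\<bar> \<le> s" by auto
      then have "t\<^sup>2 \<le> s\<^sup>2" using s by (metis abs_le_square_iff abs_of_nonneg)
      then show "exp (- (real (Suc n) * s\<^sup>2)) \<le> gauss n t"
        unfolding gauss_def by (simp del: of_nat_Suc add: mult_left_mono)
    qed (use gdec_integrable[OF g1] in auto)
    also have "\<dots> \<le> integral {- real m..real m} (gauss n)"
      using s m gauss_le(2) by (intro integral_subset_le gdec_integrable g1) (auto intro: less_imp_le)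
    finally show "2 * s * exp (- (real (Suc n) * s\<^sup>2)) \<le> integral {- real m..real m} (gauss n)" .
  qed
  have cpos: "c n > 0" for n
    using low[of 1 n] by (intro order_less_le_trans[OF _ low[of 1 n]]) auto
  have "a 0 \<in> closure X"
    unfolding closure_approachable
  proof (intro allI impI)
    fix e :: real assume e: "e > 0"
    have "isCont a 0" using a by (simp add: continuous_on_eq_continuous_at)
    then obtain d0 where d0: "d0 > 0" "\<And>t. dist t 0 < d0 ==> dist (a t) (a 0) < e / 3"
      using e unfolding continuous_at_eps_delta by (metis divide_pos_pos zero_less_numeral)
    define d where "d = min d0 1"
    have d: "0 < d" "d \<le> 1" using d0(1) by (auto simp: d_def)
    have near: "norm (a t - a 0) \<le> e / 3" if "\<bar>t\<bar> < d" for t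
      using d0(2)[of t] that by (simp add: d_def dist_norm)
    define D where "D = 2 * M * c 0 + 1"
    have D: "D > 0" using M0 cpos[of 0] by (simp add: D_def add_nonneg_pos)
    \<comment> \<open>exp(-n d^2) is split into exp(-(3/4) n d^2) and exp(-n (d/2)^2). The first
      factor can be pushed below \<open>k\<close>; the second, together with the exp(-d^2) inside
      \<open>k\<close>, is absorbed by the lower bound for \<open>c n\<close> at s = d/2.\<close>
    define k where "k = e / 3 * d * exp (- d\<^sup>2) / D"
    have k: "k > 0" using e d D by (simp add: k_def)
    have "(%n. exp (- (3/4 * d\<^sup>2)) ^ n) ----> 0" using d by (intro LIMSEQ_realpow_zero) auto
    then obtain n where n: "exp (- (3/4 * d\<^sup>2)) ^ n < k"
      using k by (metis (no_types, lifting) order_tendstoD(2) eventually_sequentially order_refl)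
    have tail: "2 * M * exp (- (real n * d\<^sup>2)) * c 0 \<le> e / 3 * c n"
    proof -
      have x: "exp (- (real n * d\<^sup>2)) = exp (- (3/4 * d\<^sup>2)) ^ n * exp (- (real n * (d/2)\<^sup>2))"
        by (simp add: exp_of_nat_mult[symmetric] exp_add[symmetric] power2_eq_square algebra_simps)
      have "2 * M * exp (- (real n * d\<^sup>2)) * c 0 \<le> D * exp (- (real n * d\<^sup>2))"
        by (simp add: D_def algebra_simps)
      also have "\<dots> \<le> D * (k * exp (- (real n * (d/2)\<^sup>2)))"
        unfolding x using n D by (intro mult_left_mono mult_right_mono) auto
      also have "\<dots> = e / 3 * d * (exp (- d\<^sup>2) * exp (- (real n * (d/2)\<^sup>2)))"
        using D by (simp add: k_def)
      also have "\<dots> \<le> e / 3 * (2 * (d/2) * exp (- (real (Suc n) * (d/2)\<^sup>2)))"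
      proof -
        have "exp (- d\<^sup>2) \<le> exp (- (d/2)\<^sup>2)" by (simp add: power_divide)
        then have "exp (- d\<^sup>2) * exp (- (real n * (d/2)\<^sup>2)) \<le> exp (- (d/2)\<^sup>2) * exp (- (real n * (d/2)\<^sup>2))"
          by (rule mult_right_mono) simp
        also have "\<dots> = exp (- (real (Suc n) * (d/2)\<^sup>2))"
          by (simp add: exp_add[symmetric] algebra_simps)
        finally show ?thesis using e d by (simp add: mult.assoc del: of_nat_Suc)
      qed
      also have "\<dots> \<le> e / 3 * c n" using e d by (intro mult_left_mono low) auto
      finally show ?thesis .
    qed
    have ca: "continuous_on UNIV (%t. a t - a 0)" by (intro continuous_intros a)
    have Ma: "norm (a t - a 0) \<le> 2 * M" for t
      using norm_triangle_ineq4[of "a t" "a 0"] M[of t] M[of 0] by simp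
    define r where "r = wint (%t. gauss n t *\<^sub>R (a t - a 0))"
    have gm: "gdec (%t. e / 3 * gauss n t)" "gdec (%t. 2 * M * exp (- (real n * d\<^sup>2)) * gauss 0 t)"
      by (intro wint_linear(1)[OF g1] bounded_linear_mult_right)+
    have "norm r \<le> wint (%t. e / 3 * gauss n t + 2 * M * exp (- (real n * d\<^sup>2)) * gauss 0 t)"
      unfolding r_def
    proof (rule norm_wint_le[OF gdec_gauss_scaleR[OF ca Ma] gdec_add[OF gm]])
      fix t
      show "norm (gauss n t *\<^sub>R (a t - a 0)) \<le> e / 3 * gauss n t + 2 * M * exp (- (real n * d\<^sup>2)) * gauss 0 t"
      proof (cases "\<bar>t\<bar> < d")
        case True
        then have "gauss n t * norm (a t - a 0) \<le> gauss n t * (e / 3)"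
          using gauss_le(2)[of n t] by (intro mult_left_mono near) auto
        moreover have "0 \<le> 2 * M * exp (- (real n * d\<^sup>2)) * gauss 0 t"
          using M0 gauss_le(2)[of 0 t] by simp
        ultimately show ?thesis
          unfolding norm_scaleR abs_of_pos[OF gauss_le(2)] mult.commute[of "e / 3"] by linarith
      next
        case False
        then have "d\<^sup>2 \<le> t\<^sup>2" using d by (metis abs_le_square_iff abs_of_pos not_less)
        then have "gauss n t \<le> exp (- (real n * d\<^sup>2)) * gauss 0 t"
          by (simp add: gauss_def exp_add[symmetric] algebra_simps mult_left_mono)
        then have "gauss n t * norm (a t - a 0) \<le> (exp (- (real n * d\<^sup>2)) * gauss 0 t) * (2 * M)"
          using gauss_le(2)[of 0 t] by (intro mult_mono Ma) auto
        moreover have "0 \<le> e / 3 * gauss n t" using e gauss_le(2)[of n t] by simp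
        ultimately show ?thesis using gauss_le(2)[of n t] by (simp add: ac_simps)
      qed
    qed
    also have "\<dots> = e / 3 * c n + 2 * M * exp (- (real n * d\<^sup>2)) * c 0"
      unfolding c_def wint_add[OF gm] by (simp only: wint_linear(2)[OF g1 bounded_linear_mult_right])
    also have "\<dots> \<le> 2 * (e / 3) * c n" using tail by simp
    finally have nr: "norm r \<le> 2 * (e / 3) * c n" .
    define w where "w = wint (%t. gauss n t *\<^sub>R a t)"
    have "w = r + c n *\<^sub>R a 0"
    proof -
      have "gdec (%t. gauss n t *\<^sub>R a 0)" "wint (%t. gauss n t *\<^sub>R a 0) = c n *\<^sub>R a 0"
        unfolding c_def by (intro wint_linear[OF g1] bounded_linear_scaleR_left)+
      then show ?thesis
        unfolding w_def r_def using wint_add[OF gdec_gauss_scaleR[OF ca Ma, of n], of "%t. gauss n t *\<^sub>R a 0"]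
        by (simp add: scaleR_diff_right)
    qed
    then have "(1 / c n) *\<^sub>R w - a 0 = (1 / c n) *\<^sub>R r"
      using cpos[of n] by (simp add: scaleR_add_right)
    then have "dist ((1 / c n) *\<^sub>R w) (a 0) = norm r / c n"
      using cpos[of n] by (simp add: dist_norm)
    also have "\<dots> \<le> 2 * (e / 3)" using nr cpos[of n] by (simp add: divide_le_eq)
    also have "\<dots> < e" using e by simp
    finally have "dist ((1 / c n) *\<^sub>R w) (a 0) < e" .
    moreover have "(1 / c n) *\<^sub>R w \<in> X" unfolding w_def by (intro csubspaceD(5)[OF X(1)] in_X)
    ultimately show "\<exists>y\<in>X. dist y (a 0) < e" by blast
  qed
  then show ?thesis using X(2) by simp
qed

text \<open>If \<open>a\<close> is the boundary value at \<open>-\<i>\<close> of an analytic continuation of \<open>b\<close>, as seen by a separating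
  family of functionals, then Gaussian averages of \<open>a\<close> are complex Gaussian averages of \<open>b\<close>.\<close>

lemma boundary_value_in_subspace:
  fixes a b :: "real => 'x::{banach,complex_normed}"
  assumes a: "continuous_on UNIV a" "\<And>t. norm (a t) \<le> M"
    and b: "continuous_on UNIV b" "\<And>t. norm (b t) \<le> M'"
    and X: "csubspace X" "closed X" and bX: "\<And>t. b t \<in> X"
    and L: "\<And>l. l \<in> L ==> bounded_linear l" "\<And>l c x. l \<in> L ==> l (c *c x) = c * l x"
    and sep: "\<And>x y. (\<And>l. l \<in> L ==> l x = l y) ==> x = y"
    and ext: "\<And>l. l \<in> L ==> \<exists>k K. k holomorphic_on UNIV \<and> (\<forall>z. \<bar>Im z\<bar> \<le> 1 --> cmod (k z) \<le> K) \<and>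
      (\<forall>t. k (of_real t) = l (b t)) \<and> (\<forall>t. k (of_real t - \<i>) = l (a t))"
  shows "a 0 \<in> X"
proof (rule gauss_approx[OF a X])
  fix n
  \<comment> \<open>The Gaussian is centred at -i: on the shifted line it is real and equals
    \<open>gauss n\<close>, the weight of \<open>a\<close>, while on the real line it is the complex
    weight of \<open>b\<close>.\<close>
  define h where "h z = exp (- (of_nat (Suc n) * (z + \<i>)\<^sup>2))" for z :: complex
  have hr: "h (of_real t - \<i>) = of_real (gauss n t)" for t
    unfolding h_def gauss_def by (simp flip: exp_of_real del: Im_shift)
  have hb: "cmod (h z) \<le> exp (4 * real (Suc n)) * exp (- (Re z)\<^sup>2)" if "\<bar>Im z\<bar> \<le> 1" for z
  proof -
    have "(Im z + 1)\<^sup>2 \<le> 2\<^sup>2" using that by (intro power2_le_iff_abs_le[THEN iffD2]) auto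
    then have "real (Suc n) * (Im z + 1)\<^sup>2 \<le> real (Suc n) * 4" by (intro mult_left_mono) auto
    moreover have "0 \<le> real n * (Re z)\<^sup>2" by simp
    moreover have "Re (- (of_nat (Suc n) * (z + \<i>)\<^sup>2)) = real (Suc n) * (Im z + 1)\<^sup>2 - real (Suc n) * (Re z)\<^sup>2"
    proof -
      have "Re (of_nat (Suc n) * (z + \<i>)\<^sup>2) = real (Suc n) * Re ((z + \<i>)\<^sup>2)"
        by (simp only: times_complex.sel complex_Re_of_nat complex_Im_of_nat)
      then show ?thesis by (simp add: Re_power2 right_diff_distrib del: of_nat_Suc)
    qed
    moreover have "real (Suc n) * (Re z)\<^sup>2 = real n * (Re z)\<^sup>2 + (Re z)\<^sup>2" by (simp add: distrib_right)
    ultimately have "Re (- (of_nat (Suc n) * (z + \<i>)\<^sup>2)) \<le> 4 * real (Suc n) + - (Re z)\<^sup>2"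
      by linarith
    then show ?thesis unfolding h_def exp_add[symmetric] by simp
  qed
  have ga: "gdec (%t. gauss n t *\<^sub>R a t)" by (rule gdec_gauss_scaleR[OF a])
  have ch: "continuous_on UNIV (%t. h (complex_of_real t))"
    unfolding h_def by (intro continuous_intros)
  have gb: "gdec (%t. h (of_real t) *c b t)"
  proof -
    have "norm (h (of_real t) *c b t) \<le> (exp (4 * real (Suc n)) * M') * exp (- t\<^sup>2)" for t
      unfolding norm_scaleC_eq using mult_mono[OF hb[of "of_real t"] b(2)[of t]] by (simp add: ac_simps)
    moreover have "continuous_on UNIV (%t. h (of_real t) *c b t)" by (intro scaleC.continuous_on ch b(1))
    ultimately show ?thesis unfolding gdec_def by (intro conjI exI allI)
  qed
  have "wint (%t. gauss n t *\<^sub>R a t) = wint (%t. h (of_real t) *c b t)"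
  proof (rule sep)
    fix l assume l: "l \<in> L"
    obtain k K where k: "k holomorphic_on UNIV" and K: "\<And>z. \<bar>Im z\<bar> \<le> 1 ==> cmod (k z) \<le> K"
      and kb: "\<And>t. k (of_real t) = l (b t)" and ka: "\<And>t. k (of_real t - \<i>) = l (a t)"
      using ext[OF l] by blast
    have hk: "(%z. h z * k z) holomorphic_on UNIV" unfolding h_def by (intro holomorphic_intros k)
    have "cmod (h z * k z) \<le> (exp (4 * real (Suc n)) * K) * exp (- (Re z)\<^sup>2)" if "\<bar>Im z\<bar> \<le> 1" for z
      unfolding norm_mult using mult_mono[OF hb[OF that] K[OF that]] by (simp add: ac_simps)
    from contour_shift(3)[OF hk this]
    have "wint (%t. h (of_real t) * k (of_real t)) = wint (%t. h (of_real t - \<i>) * k (of_real t - \<i>))" by blast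
    moreover have "h (of_real t) * k (of_real t) = l (h (of_real t) *c b t)" for t
      by (simp add: kb L(2)[OF l])
    moreover have "h (of_real t - \<i>) * k (of_real t - \<i>) = l (gauss n t *\<^sub>R a t)" for t
      unfolding hr ka scaleR_scaleC by (simp add: L(2)[OF l])
    ultimately have "wint (%t. l (h (of_real t) *c b t)) = wint (%t. l (gauss n t *\<^sub>R a t))"
      by (simp only:)
    then show "l (wint (%t. gauss n t *\<^sub>R a t)) = l (wint (%t. h (of_real t) *c b t))"
      by (simp add: wint_linear(2)[OF ga L(1)[OF l]] wint_linear(2)[OF gb L(1)[OF l]])
  qed
  then show "wint (%t. gauss n t *\<^sub>R a t) \<in> X"
    using wint_in_subspace[OF gb X] csubspaceD(3)[OF X(1) bX] by simp
qed

section \<open>Modular multiplicative unitaries and the scaling flow\<close>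

text \<open>Products carry the graphs of operators, and the instance for \<open>complex\<close>
  below carries the values of functionals, so that the principles for closed spans apply to
  both.\<close>

instance prod :: (complex_normed, complex_normed) complex_normed
proof
  fix c :: complex and x :: "'a \<times> 'b"
  have "(cmod c * norm (fst x))\<^sup>2 + (cmod c * norm (snd x))\<^sup>2 = (cmod c)\<^sup>2 * ((norm (fst x))\<^sup>2 + (norm (snd x))\<^sup>2)"
    by (simp add: power_mult_distrib distrib_left)
  then show "norm (c *c x) = cmod c * norm x"
    by (simp add: norm_prod_def scaleC_prod_def norm_scaleC_eq real_sqrt_mult)
qed

instantiation complex :: complex_normed
begin

definition scaleC_complex :: "complex => complex => complex" where "scaleC_complex c z = c * z"

instance
  by standard (simp_all add: scaleC_complex_def distrib_left distrib_right scaleR_conv_of_real norm_mult)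

end

text \<open>Complex differentiability for vector values. The conjugate-linear variant
  \<open>aholo\<close> is the one required of the first argument of the inner product, so that
  matrix coefficients become holomorphic (\<open>holomorphic_cinner\<close>).\<close>

definition cholo :: "(complex => 'a::complex_normed) => bool" where
  "cholo f \<longleftrightarrow> (\<forall>z. \<exists>d. (f has_derivative (%h. h *c d)) (at z))"

definition aholo :: "(complex => 'a::complex_normed) => bool" where
  "aholo f \<longleftrightarrow> (\<forall>z. \<exists>d. (f has_derivative (%h. cnj h *c d)) (at z))"

lemma cholo_tens:
  assumes "cholo f" "cholo g"
  shows "cholo (%z. f z \<otimes> g z)"
  unfolding cholo_def
proof
  fix z
  obtain d e where "(f has_derivative (%h. h *c d)) (at z)" "(g has_derivative (%h. h *c e)) (at z)"
    using assms unfolding cholo_def by meson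
  from tens.FDERIV[OF this] have "((%z. f z \<otimes> g z) has_derivative (%h. h *c (f z \<otimes> e + d \<otimes> g z))) (at z)"
    by (simp add: tens_scaleC_left tens_scaleC_right scaleC_add_right)
  then show "\<exists>d. ((%z. f z \<otimes> g z) has_derivative (%h. h *c d)) (at z)" by blast
qed

lemma aholo_tens:
  assumes "aholo f" "aholo g"
  shows "aholo (%z. f z \<otimes> g z)"
  unfolding aholo_def
proof
  fix z
  obtain d e where "(f has_derivative (%h. cnj h *c d)) (at z)" "(g has_derivative (%h. cnj h *c e)) (at z)"
    using assms unfolding aholo_def by meson
  from tens.FDERIV[OF this] have "((%z. f z \<otimes> g z) has_derivative (%h. cnj h *c (f z \<otimes> e + d \<otimes> g z))) (at z)"
    by (simp add: tens_scaleC_left tens_scaleC_right scaleC_add_right)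
  then show "\<exists>d. ((%z. f z \<otimes> g z) has_derivative (%h. cnj h *c d)) (at z)" by blast
qed

lemma cholo_op:
  assumes T: "T \<in> bop" and f: "cholo f"
  shows "cholo (%z. blinfun_apply T (f z))"
  unfolding cholo_def
proof
  fix z
  obtain d where "(f has_derivative (%h. h *c d)) (at z)"
    using f unfolding cholo_def by meson
  from bounded_linear.has_derivative[OF blinfun.bounded_linear_right this, of T]
  have "((%z. T (f z)) has_derivative (%h. h *c T d)) (at z)"
    by (simp add: bop_scaleC[OF T])
  then show "\<exists>d. ((%z. T (f z)) has_derivative (%h. h *c d)) (at z)" by blast
qed

lemma aholo_cnj:
  assumes f: "cholo f"
  shows "aholo (%z. f (cnj z))"
  unfolding aholo_def
proof
  fix z
  obtain d where "(f has_derivative (%h. h *c d)) (at (cnj z))"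
    using f unfolding cholo_def by meson
  from has_derivative_compose[OF bounded_linear_imp_has_derivative[OF bounded_linear_cnj] this]
  show "\<exists>d. ((%z. f (cnj z)) has_derivative (%h. cnj h *c d)) (at z)" by blast
qed

lemma holomorphic_cinner:
  fixes f g :: "complex => 'a::complex_hilbert"
  assumes "aholo f" "cholo g"
  shows "(%z. f z \<bullet> g z) holomorphic_on UNIV"
  unfolding holomorphic_on_def
proof
  fix z :: complex
  obtain d e where "(f has_derivative (%h. cnj h *c d)) (at z)" "(g has_derivative (%h. h *c e)) (at z)"
    using assms unfolding cholo_def aholo_def by meson
  from cinner.FDERIV[OF this] have "((%z. f z \<bullet> g z) has_derivative (%h. (f z \<bullet> e + d \<bullet> g z) * h)) (at z)"
    by (simp add: distrib_left mult.commute)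
  then show "(%z. f z \<bullet> g z) field_differentiable at z within UNIV"
    unfolding field_differentiable_def has_field_derivative_def by blast
qed

lemma (in power_flow) cholo_q: "y \<in> E ==> cholo (%z. q z y)"
  unfolding cholo_def using q_deriv by blast

lemma (in power_flow) aholo_q: "y \<in> E ==> aholo (%z. q (cnj z) y)"
  by (intro aholo_cnj cholo_q)

lemma (in power_flow) total: "ccl E = UNIV"
  by (rule ccl_closure_UNIV[OF dense])

lemma op_eq_total:
  assumes "S \<in> bop" "T \<in> bop" "ccl A = UNIV" "ccl D = UNIV"
    and "\<And>a d. a \<in> A ==> d \<in> D ==> a \<bullet> blinfun_apply S d = a \<bullet> blinfun_apply T d"
  shows "S = T"
proof (rule blinfun_eqI, rule eq_on_total[OF assms(3)])
  fix a v assume a: "a \<in> A"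
  have "adj S a = adj T a"
  proof (rule eq_on_total[OF assms(4)])
    fix d assume "d \<in> D"
    from assms(5)[OF a this] have "cnj (a \<bullet> S d) = cnj (a \<bullet> T d)" by simp
    then show "d \<bullet> adj S a = d \<bullet> adj T a"
      by (simp add: cinner_adj_right assms(1,2) cinner_commute[symmetric])
  qed
  then show "a \<bullet> S v = a \<bullet> T v" by (metis assms(1,2) cinner_adj)
qed

lemma graph_tensor_ccl: "graph_tensor P Q = ccl {(x \<otimes> y, x' \<otimes> y') |x x' y y'. (x, x') \<in> P \<and> (y, y') \<in> Q}"
  unfolding graph_tensor_def ccl_def ..

lemma graph_tensor_tens: "(x, x') \<in> P ==> (y, y') \<in> Q ==> (x \<otimes> y, x' \<otimes> y') \<in> graph_tensor P Q"
  unfolding graph_tensor_ccl by (rule ccl_base) blast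

lemma graph_tensor_induct:
  assumes p: "(v, w) \<in> graph_tensor P Q" and eq: "\<And>x x' y y'. (x, x') \<in> P ==> (y, y') \<in> Q ==> (x' \<otimes> y') \<bullet> a = (x \<otimes> y) \<bullet> b"
  shows "w \<bullet> a = v \<bullet> b"
proof -
  have "(%p. snd p \<bullet> a - fst p \<bullet> b) (v, w) \<in> {0}"
  proof (rule ccl_induct_map[OF p[unfolded graph_tensor_ccl]])
    show "bounded_linear (%p. snd p \<bullet> a - fst p \<bullet> b)"
      by (intro bounded_linear_sub bounded_linear_compose[OF cinner.bounded_linear_left] bounded_linear_fst bounded_linear_snd)
    show "\<exists>c'. snd (c *c p) \<bullet> a - fst (c *c p) \<bullet> b = c' *c (snd p \<bullet> a - fst p \<bullet> b)" for c p
      by (rule exI[of _ "cnj c"]) (simp add: scaleC_prod_def scaleC_complex_def right_diff_distrib)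
  qed (auto simp: eq complex_vector.subspace_single_0)
  then show ?thesis by simp
qed

locale modular_data =
  fixes W :: "('a::complex_hilbert, 'a) htensor -> ('a, 'a) htensor"
    and Q' E' q' Q E q
    and W' :: "('a conj_space, 'a) htensor -> ('a conj_space, 'a) htensor"
  assumes W: "unitary W" and mult: "multiplicative W" and W': "unitary W'"
    and pos': "positive_with_trivial_kernel Q'" and pos: "positive_with_trivial_kernel Q"
    and inv: "(W v, W w) \<in> graph_tensor Q' Q \<longleftrightarrow> (v, w) \<in> graph_tensor Q' Q"
    and rel: "(y, y\<^sub>1) \<in> Q ==> (u, u\<^sub>1) \<in> Q ==> (x \<otimes> y) \<bullet> W (z \<otimes> u\<^sub>1) = (bar z \<otimes> y\<^sub>1) \<bullet> W' (bar x \<otimes> u)"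
    and flow': "power_flow Q' E' q'" and flow: "power_flow Q E q"

lemma ex_modular_data:
  assumes "modular_multiplicative_unitary W"
  shows "\<exists>Q' E' q' Q E q W'. modular_data W Q' E' q' Q E q W'"
proof -
  obtain Q' Q and W' :: "('a conj_space, 'a) htensor -> ('a conj_space, 'a) htensor" where
    pos: "positive_with_trivial_kernel Q'" "positive_with_trivial_kernel Q" and W': "unitary W'"
    and inv: "{(v, w). (blinfun_apply W v, blinfun_apply W w) \<in> graph_tensor Q' Q} = graph_tensor Q' Q"
    and rel: "\<forall>x z. \<forall>(y, Qy)\<in>Q. \<forall>(u', u)\<in>Q. (x \<otimes> y) \<bullet> W (z \<otimes> u) = (bar z \<otimes> Qy) \<bullet> W' (bar x \<otimes> u')"
    using assms unfolding modular_multiplicative_unitary_def modular_def by (elim conjE exE) (rule that)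
  obtain E' q' E q where "power_flow Q' E' q'" "power_flow Q E q"
    using ex_power_flow[OF pos(1)] ex_power_flow[OF pos(2)] by metis
  moreover have "(W v, W w) \<in> graph_tensor Q' Q \<longleftrightarrow> (v, w) \<in> graph_tensor Q' Q" for v w
    using arg_cong[OF inv, of "%S. (v, w) \<in> S"] by simp
  moreover have "(x \<otimes> y) \<bullet> W (z \<otimes> u\<^sub>1) = (bar z \<otimes> y\<^sub>1) \<bullet> W' (bar x \<otimes> u)"
    if "(y, y\<^sub>1) \<in> Q" "(u, u\<^sub>1) \<in> Q" for x y y\<^sub>1 z u u\<^sub>1
    using rel that by fastforce
  ultimately have "modular_data W Q' E' q' Q E q W'"
    using assms pos W' unfolding modular_multiplicative_unitary_def modular_data_def by auto
  then show ?thesis by blast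
qed

section \<open>Commutation of W with the flow\<close>

context modular_data
begin

sublocale h: power_flow Q' E' q' by (rule flow')
sublocale f: power_flow Q E q by (rule flow)

lemmas W_bop [simp] = unitaryD(1)[OF W] unitaryD(1)[OF W']

lemma graph_tensor_sym:
  assumes "(v, w) \<in> graph_tensor Q' Q" "(v', w') \<in> graph_tensor Q' Q"
  shows "w \<bullet> v' = v \<bullet> w'"
proof (rule graph_tensor_induct[OF assms(1)])
  fix x x' y y' assume xy: "(x, x') \<in> Q'" "(y, y') \<in> Q"
  have "w' \<bullet> (x \<otimes> y) = v' \<bullet> (x' \<otimes> y')"
    by (rule graph_tensor_induct[OF assms(2)])
       (simp add: positive_kernelD(3)[OF pos' _ xy(1)] positive_kernelD(3)[OF pos _ xy(2)])
  then show "(x' \<otimes> y') \<bullet> v' = (x \<otimes> y) \<bullet> w'"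
    by (metis cinner_commute)
qed

lemma W_graph: "(v, w) \<in> graph_tensor Q' Q ==> (W v, W w) \<in> graph_tensor Q' Q"
  by (simp add: inv)

text \<open>This is the commutation of \<open>W\<close> with Q' tensor Q in a weak form on
  elementary tensors; complex powers of the tensor product operator are never formed.\<close>

lemma W_sym:
  assumes "(x, x') \<in> Q'" "(y, y') \<in> Q" "(z, z') \<in> Q'" "(u, u') \<in> Q"
  shows "(x' \<otimes> y') \<bullet> W (z \<otimes> u) = (x \<otimes> y) \<bullet> W (z' \<otimes> u')"
  by (intro graph_tensor_sym W_graph graph_tensor_tens assms)

definition UU :: "real => ('a, 'a) htensor -> ('a, 'a) htensor" where "UU t = h.U t ** f.U t"

lemma unitary_UU [simp]: "unitary (UU t)"
  by (simp add: UU_def)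

lemma bop_U [simp]: "h.U t \<in> bop" "f.U t \<in> bop" "UU t \<in> bop"
  by (simp_all add: UU_def h.U f.U)

text \<open>The matrix coefficient along the flow continues to an entire function \<open>F\<close>.
  By \<open>W_sym\<close> it has period i, so boundedness on one strip gives boundedness on the
  plane, and Liouville makes it constant.\<close>

lemma W_flow_const:
  assumes x: "x \<in> E'" and y: "y \<in> E" and z: "z \<in> E'" and u: "u \<in> E"
  shows "(h.U t x \<otimes> f.U t y) \<bullet> W (h.U t z \<otimes> f.U t u) = (x \<otimes> y) \<bullet> W (z \<otimes> u)"
proof -
  define F where "F \<zeta> = (q' (cnj \<zeta>) x \<otimes> q (cnj \<zeta>) y) \<bullet> W (q' \<zeta> z \<otimes> q \<zeta> u)" for \<zeta>
  have hol: "F holomorphic_on UNIV"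
    unfolding F_def
    by (intro holomorphic_cinner aholo_tens cholo_op cholo_tens h.aholo_q f.aholo_q h.cholo_q f.cholo_q assms) simp
  have per: "F (\<zeta> - \<i>) = F \<zeta>" for \<zeta>
  proof -
    have 1: "q' (\<zeta> - \<i>) z = q' (-\<i>) (q' \<zeta> z)" "q (\<zeta> - \<i>) u = q (-\<i>) (q \<zeta> u)"
      using h.q_add[OF z, of "-\<i>" \<zeta>] f.q_add[OF u, of "-\<i>" \<zeta>] by simp_all
    have 2: "q' (cnj \<zeta>) x = q' (-\<i>) (q' (cnj (\<zeta> - \<i>)) x)" "q (cnj \<zeta>) y = q (-\<i>) (q (cnj (\<zeta> - \<i>)) y)"
      using h.q_add[OF x, of "-\<i>" "cnj \<zeta> + \<i>"] f.q_add[OF y, of "-\<i>" "cnj \<zeta> + \<i>"] by simp_all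
    show ?thesis
      unfolding F_def 1 2
      by (rule W_sym[symmetric]) (intro h.q_graph f.q_graph h.q_in f.q_in assms)+
  qed
  have per_int: "F (\<zeta> + \<i> * of_int n) = F \<zeta>" for n \<zeta>
  proof (induction n rule: int_induct[of _ 0])
    case (step1 i)
    have e: "\<zeta> + \<i> * of_int (i + 1) - \<i> = \<zeta> + \<i> * of_int i" by (simp add: algebra_simps)
    show ?case using per[of "\<zeta> + \<i> * of_int (i + 1)"] step1(2) unfolding e by (simp only:)
  next
    case (step2 i)
    have e: "\<zeta> + \<i> * of_int i - \<i> = \<zeta> + \<i> * of_int (i - 1)" by (simp add: algebra_simps)
    show ?case using per[of "\<zeta> + \<i> * of_int i"] step2(2) unfolding e by (simp only:)
  qed simp
  obtain Kx where Kx: "\<And>\<zeta>. \<bar>Im \<zeta>\<bar> \<le> 1 ==> norm (q' \<zeta> x) \<le> Kx" using h.q_strip_bound[OF x] by blast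
  obtain Ky where Ky: "\<And>\<zeta>. \<bar>Im \<zeta>\<bar> \<le> 1 ==> norm (q \<zeta> y) \<le> Ky" using f.q_strip_bound[OF y] by blast
  obtain Kz where Kz: "\<And>\<zeta>. \<bar>Im \<zeta>\<bar> \<le> 1 ==> norm (q' \<zeta> z) \<le> Kz" using h.q_strip_bound[OF z] by blast
  obtain Ku where Ku: "\<And>\<zeta>. \<bar>Im \<zeta>\<bar> \<le> 1 ==> norm (q \<zeta> u) \<le> Ku" using f.q_strip_bound[OF u] by blast
  have bd1: "cmod (F \<zeta>) \<le> (Kx * Ky) * (Kz * Ku)" if "\<bar>Im \<zeta>\<bar> \<le> 1" for \<zeta>
  proof -
    have c: "\<bar>Im (cnj \<zeta>)\<bar> \<le> 1" using that by simp
    have "cmod (F \<zeta>) \<le> norm (q' (cnj \<zeta>) x \<otimes> q (cnj \<zeta>) y) * norm (W (q' \<zeta> z \<otimes> q \<zeta> u))"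
      unfolding F_def by (rule norm_cinner)
    also have "\<dots> = (norm (q' (cnj \<zeta>) x) * norm (q (cnj \<zeta>) y)) * (norm (q' \<zeta> z) * norm (q \<zeta> u))"
      by (simp add: norm_unitary[OF W])
    also have "\<dots> \<le> (Kx * Ky) * (Kz * Ku)"
      using order_trans[OF norm_ge_zero Kx[OF c]] order_trans[OF norm_ge_zero Ky[OF c]]
        order_trans[OF norm_ge_zero Kz[OF that]] order_trans[OF norm_ge_zero Ku[OF that]]
      by (intro mult_mono Kx[OF c] Ky[OF c] Kz[OF that] Ku[OF that]) auto
    finally show ?thesis .
  qed
  have bd: "cmod (F \<zeta>) \<le> (Kx * Ky) * (Kz * Ku)" for \<zeta>
  proof -
    define \<xi> where "\<xi> = \<zeta> - \<i> * of_int \<lfloor>Im \<zeta>\<rfloor>"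
    have "F \<zeta> = F \<xi>" using per_int[of \<xi> "\<lfloor>Im \<zeta>\<rfloor>"] by (simp add: \<xi>_def)
    moreover have "\<bar>Im \<xi>\<bar> \<le> 1" by (simp add: \<xi>_def) linarith
    ultimately show ?thesis using bd1 by simp
  qed
  obtain c where c: "\<And>\<zeta>. F \<zeta> = c"
    using Liouville_theorem[OF hol] bd unfolding bounded_iff constant_on_def by auto
  have "F (of_real t) = F 0" by (simp add: c)
  then show ?thesis
    by (simp add: F_def h.U f.U assms h.q_0 f.q_0)
qed

lemma W_UU: "W oo UU t = UU t oo W"
proof -
  have tens: "UU t (x \<otimes> y) = h.U t x \<otimes> f.U t y" for x y by (simp add: UU_def)
  have "adj (UU t) oo W oo UU t = W"
  proof (rule op_eq_total)
    show "ccl {x \<otimes> y |x y. x \<in> E' \<and> y \<in> E} = UNIV" "ccl {x \<otimes> y |x y. x \<in> E' \<and> y \<in> E} = UNIV"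
      by (rule ccl_tens_dense[OF h.total f.total])+
  qed (auto simp: cinner_adj_right tens W_flow_const)
  then have "UU t oo (adj (UU t) oo W oo UU t) = UU t oo W" by simp
  then show ?thesis by (simp add: unitaryD(7)[OF unitary_UU])
qed

text \<open>\<open>W_sym\<close> trades the powers of \<open>Q\<close> on the second leg for powers
  of \<open>Q'\<close> on the first. The modular relation becomes an identity of bounded operators:
  slices of \<open>W\<close> are slices of its companion, at vectors moved by
  \<open>Q'\<close>.\<close>

lemma conj_relation:
  assumes x: "(x, x') \<in> Q'" and z: "(z, z') \<in> Q'"
  shows "lsl z' W x = lsl (bar x') W' (bar z)"
proof (rule op_eq_total[OF _ _ f.total f.total])
  fix a y assume a: "a \<in> E" and y: "y \<in> E"
  define u where "u = q \<i> a"
  have u: "(u, a) \<in> Q" using f.q_graph[OF f.q_in[OF a, of \<i>]] f.q_inv(1)[OF a, of \<i>] by (simp add: u_def)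
  have y': "(y, q (-\<i>) y) \<in> Q" by (rule f.q_graph[OF y])
  have "(z' \<otimes> a) \<bullet> W (x \<otimes> y) = (z \<otimes> u) \<bullet> W (x' \<otimes> q (-\<i>) y)"
    by (rule W_sym[OF z u x y'])
  also have "\<dots> = (bar x' \<otimes> a) \<bullet> W' (bar z \<otimes> y)"
    by (rule rel[OF u y'])
  finally show "a \<bullet> lsl z' W x y = a \<bullet> lsl (bar x') W' (bar z) y"
    by (simp add: cinner_lsl)
qed simp_all

end

section \<open>Invariance of the column space\<close>

lemma bar_simps: "bar (x + y) = bar x + bar (y::'a::complex_hilbert)" "bar (c *c x) = cnj c *c bar x"
  "bar (r *\<^sub>R x) = r *\<^sub>R bar x" "norm (bar x) = norm x" "bar x \<bullet> bar y = y \<bullet> x"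
  and unbar_simps: "unbar (a + b) = unbar a + unbar (b::'a conj_space)" "unbar (c *c a) = cnj c *c unbar a"
  "unbar (r *\<^sub>R a) = r *\<^sub>R unbar a" "norm (unbar a) = norm a"
proof -
  show u: "unbar (a + b) = unbar a + unbar b" "unbar (c *c a) = cnj c *c unbar a"
    "unbar (r *\<^sub>R a) = r *\<^sub>R unbar a" "norm (unbar a) = norm a" for a b :: "'a conj_space" and c r
    by (transfer, simp)+
  show "bar (x + y) = bar x + bar y" "bar (c *c x) = cnj c *c bar x" "bar (r *\<^sub>R x) = r *\<^sub>R bar x"
    by (rule unbar_inject[THEN iffD1], simp add: bar_inverse u)+
  show "norm (bar x) = norm x" using u(4)[of "bar x"] by (simp add: bar_inverse)
  show "bar x \<bullet> bar y = y \<bullet> x" by (simp add: cinner_conj_space.rep_eq bar_inverse)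
qed

lemma bounded_linear_bar: "bounded_linear (bar :: 'a::complex_hilbert => _)"
  by (rule bounded_linear_intro[where K = 1]) (simp_all add: bar_simps)

lemma bounded_linear_unbar: "bounded_linear (unbar :: _ => 'a::complex_hilbert)"
  by (rule bounded_linear_intro[where K = 1]) (simp_all add: unbar_simps)

lemma bar_unbar [simp]: "bar (unbar a) = a" "unbar (bar x) = x"
  by (simp_all add: unbar_inverse bar_inverse)

lemma total_bar: "ccl S = UNIV ==> ccl (bar ` S) = (UNIV :: 'a::complex_hilbert conj_space set)"
  by (rule ccl_image_total[OF _ bounded_linear_bar]) (auto simp: bar_simps surj_def intro: exI[of _ "unbar _"])

text \<open>The antilinear map is obtained as a linear map into a conjugate space, which
  \<open>ex_operator_slices\<close> can build.\<close>

lemma ex_conj_flip: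
  "\<exists>j :: ('a::complex_hilbert conj_space, 'b::complex_hilbert) htensor => ('a, 'b conj_space) htensor.
    bounded_linear j \<and> (\<forall>c v. j (c *c v) = cnj c *c j v) \<and> (\<forall>x y. j (bar x \<otimes> y) = x \<otimes> bar y)"
proof -
  define K :: "'b => 'a conj_space -> ('a, 'b conj_space) htensor conj_space"
    where "K y = Blinfun (%x. bar (unbar x \<otimes> bar y))" for y
  have K: "K y x = bar (unbar x \<otimes> bar y)" for y x
    unfolding K_def
    by (rule fun_cong[OF bounded_linear_Blinfun_apply])
       (intro bounded_linear_compose[OF bounded_linear_bar] bounded_linear_compose[OF tens.bounded_linear_left] bounded_linear_unbar)
  have "\<exists>T\<in>bop. \<forall>x y. blinfun_apply T (x \<otimes> y) = K y x"
  proof (rule ex_operator_slices[where M = 1])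
    show "K f \<in> bop" for f
      by (rule bopI) (simp add: K unbar_simps bar_simps tens_scaleC_left)
    show "K (f + g) = K f + K g" for f g
      by (rule blinfun_eqI) (simp add: K bar_simps tens_add_right blinfun.add_left)
    show "K (c *c f) x = c *c K f x" for c f x
      by (simp add: K bar_simps tens_scaleC_right)
    show "norm (K f x) \<le> 1 * norm f * norm x" for f x
      by (simp add: K bar_simps unbar_simps mult.commute)
    show "K f x \<bullet> K g y = 0" if "f \<in> onb" "g \<in> onb" "f \<noteq> g" for f g x y
      using that by (simp add: K bar_simps onb_cinner)
  qed simp
  then obtain T :: "('a conj_space, 'b) htensor -> ('a, 'b conj_space) htensor conj_space"
    where T: "T \<in> bop" "\<And>x y. T (x \<otimes> y) = K y x" by blast
  show ?thesis
  proof (intro exI[of _ "%v. unbar (T v)"] conjI allI)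
    show "bounded_linear (%v. unbar (blinfun_apply T v))"
      by (intro bounded_linear_compose[OF bounded_linear_unbar] blinfun.bounded_linear_right)
  qed (simp_all add: bop_scaleC[OF T(1)] unbar_simps T(2) K)
qed

text \<open>Applied to z: let \<open>V\<close> act on legs 2 and 3 of \<eta> tensor z and contract
  leg 2 with \<open>q\<close>. For elementary \<eta> this is a column generator
  (\<open>mid_tens\<close>); being linear in \<eta>, it also covers the entangled vectors that the
  pentagon equation produces.\<close>

definition mid :: "'b::complex_hilbert => (('b, 'c::complex_hilbert) htensor -> ('b, 'c) htensor) =>
    ('a::complex_hilbert, 'b) htensor => ('c -> ('a, 'c) htensor)" where
  "mid q V \<eta> = (\<one> ** (adj (left_ket q) oo V)) oo assoc oo left_ket \<eta>"

lemma bop_mid [simp]: "V \<in> bop ==> mid q V \<eta> \<in> bop"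
  by (simp add: mid_def)

lemma mid_tens: "V \<in> bop ==> mid q V (a \<otimes> b) = left_ket a oo lsl q V b"
  by (rule blinfun_eqI) (simp add: mid_def lsl_def)

lemma bounded_linear_mid: "bounded_linear (%\<eta>. mid q V \<eta>)"
  unfolding mid_def by (intro bounded_linear_compose[OF bounded_linear_compose_left] bounded_linear_left_ket)

lemma mid_scaleC: "V \<in> bop ==> mid q V (c *c \<eta>) = c *c mid q V \<eta>"
  by (simp add: mid_def left_ket_scaleC)

lemma cinner_mid:
  fixes \<eta> :: "('a::complex_hilbert, 'b::complex_hilbert) htensor"
  assumes V: "V \<in> bop"
  shows "\<xi> \<bullet> mid q V \<eta> z = (\<one> ** left_ket q) \<xi> \<bullet> leg23 V (assoc (\<eta> \<otimes> z))"
proof -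
  have "mid q V \<eta> z = adj (\<one> ** left_ket q) (leg23 V (assoc (\<eta> \<otimes> z)))"
  proof -
    have "(\<one> :: 'a -> 'a) ** (adj (left_ket q) oo V) = (\<one> ** adj (left_ket q)) oo (\<one> ** V)"
      by (simp add: tensor_op_compose V)
    then show ?thesis by (simp add: mid_def leg23_def)
  qed
  then show ?thesis by (simp add: cinner_adj_right del: adj_tensor_op)
qed

lemma cinner_mid_tens:
  fixes \<eta> :: "('a::complex_hilbert, 'b::complex_hilbert) htensor"
  assumes V: "V \<in> bop"
  shows "(x \<otimes> y) \<bullet> mid q V \<eta> z = (q \<otimes> y) \<bullet> V (adj (left_ket x) \<eta> \<otimes> z)"
proof (rule ccl_eq_map[of \<eta> "range (%(x, y). x \<otimes> y)"])
  show "\<eta> \<in> ccl (range (%(x, y). x \<otimes> y))" by (simp add: ccl_tens)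
  show "bounded_linear (%\<eta>. (x \<otimes> y) \<bullet> mid q V \<eta> z)"
    by (intro bounded_linear_compose[OF cinner.bounded_linear_right] bounded_linear_compose[OF blinfun.bounded_linear_left] bounded_linear_mid)
  show "bounded_linear (%\<eta>. (q \<otimes> y) \<bullet> V (adj (left_ket x) \<eta> \<otimes> z))"
    by (intro bounded_linear_compose[OF cinner.bounded_linear_right] bounded_linear_compose[OF blinfun.bounded_linear_right]
        bounded_linear_compose[OF tens.bounded_linear_left] blinfun.bounded_linear_right)
  show "(x \<otimes> y) \<bullet> mid q V (c *c \<eta>) z = c *c ((x \<otimes> y) \<bullet> mid q V \<eta> z)" for c \<eta>
    by (simp add: mid_scaleC V scaleC_blinfun_apply scaleC_complex_def)
  show "(q \<otimes> y) \<bullet> V (adj (left_ket x) (c *c \<eta>) \<otimes> z) = c *c ((q \<otimes> y) \<bullet> V (adj (left_ket x) \<eta> \<otimes> z))" for c \<eta>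
    by (simp add: bop_scaleC V tens_scaleC_left scaleC_complex_def)
  fix s :: "('a, 'b) htensor" assume "s \<in> range (%(x, y). x \<otimes> y)"
  then obtain a b where s: "s = a \<otimes> b" by auto
  show "(x \<otimes> y) \<bullet> mid q V s z = (q \<otimes> y) \<bullet> V (adj (left_ket x) s \<otimes> z)"
    by (simp add: s mid_tens V cinner_lsl tens_scaleC_left bop_scaleC)
qed

lemma adj_left_ket_conj_flip:
  assumes j: "bounded_linear j" "\<And>c v. j (c *c v) = cnj c *c j v" "\<And>x y. j (bar x \<otimes> y) = x \<otimes> bar y"
  shows "adj (left_ket x) (j \<omega>) = bar (adj (left_ket (bar x)) \<omega>)"
proof (rule ccl_eq_map_anti[of \<omega> "range (%(x, y). x \<otimes> y)"])
  show "\<omega> \<in> ccl (range (%(x, y). x \<otimes> y))" by (simp add: ccl_tens)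
  show "bounded_linear (%\<omega>. adj (left_ket x) (j \<omega>))"
    by (intro bounded_linear_compose[OF blinfun.bounded_linear_right] j)
  show "bounded_linear (%\<omega>. bar (adj (left_ket (bar x)) \<omega>))"
    by (intro bounded_linear_compose[OF bounded_linear_bar] blinfun.bounded_linear_right)
  fix s :: "('a conj_space, 'b) htensor" assume "s \<in> range (%(x, y). x \<otimes> y)"
  then obtain a b where s: "s = a \<otimes> b" by auto
  show "adj (left_ket x) (j s) = bar (adj (left_ket (bar x)) s)"
    using j(3)[of "unbar a" b] cinner_commute[of x "unbar a"]
    by (simp add: s bar_simps cinner_conj_space.rep_eq bar_inverse)
qed (simp_all add: bop_scaleC bar_simps j(2))

text \<open>The pentagon equation in the form \<open>leg13 W oo leg23 W oo leg12 (adj W) = leg12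
  (adj W) oo leg23 W\<close>, sandwiched between vectors.\<close>

lemma multiplicative_mid:
  assumes W: "unitary W" and mult: "multiplicative W"
  shows "(x \<otimes> y) \<bullet> W (mid p W (adj W (v \<otimes> q)) w) = (lsl v W x p \<otimes> y) \<bullet> W (q \<otimes> w)"
proof -
  note Wb [simp] = unitaryD(1)[OF W]
  have p: "leg13 W oo leg23 W oo leg12 (adj W) = leg12 (adj W) oo leg23 W"
  proof -
    have "leg12 (adj W) oo (leg12 W oo leg13 W oo leg23 W) oo leg12 (adj W) = leg12 (adj W) oo (leg23 W oo leg12 W) oo leg12 (adj W)"
      using mult by (simp only: multiplicative_def)
    then show ?thesis by (simp add: leg_compose leg_compose2 unitaryD(2,3)[OF W])
  qed
  have "(x \<otimes> y) \<bullet> W (mid p W (adj W (v \<otimes> q)) w) = adj W (x \<otimes> y) \<bullet> mid p W (adj W (v \<otimes> q)) w"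
    by (simp add: cinner_adj)
  also have "\<dots> = (\<one> ** left_ket p) (adj W (x \<otimes> y)) \<bullet> leg23 W (leg12 (adj W) (assoc ((v \<otimes> q) \<otimes> w)))"
    by (simp add: cinner_mid leg12_assoc del: assoc_tens)
  also have "(\<one> ** left_ket p) (adj W (x \<otimes> y)) = adj (leg13 W) (x \<otimes> (p \<otimes> y))"
    using arg_cong[OF leg13_id_left_ket(1)[OF bop_adj[OF Wb], of p], of "%T. blinfun_apply T (x \<otimes> y)"] by simp
  also have "adj (leg13 W) (x \<otimes> (p \<otimes> y)) \<bullet> leg23 W (leg12 (adj W) (assoc ((v \<otimes> q) \<otimes> w)))
      = (x \<otimes> (p \<otimes> y)) \<bullet> (leg13 W oo leg23 W oo leg12 (adj W)) (v \<otimes> (q \<otimes> w))"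
    by (subst cinner_adj) simp_all
  also have "\<dots> = leg12 W (x \<otimes> (p \<otimes> y)) \<bullet> leg23 W (v \<otimes> (q \<otimes> w))"
    unfolding p using cinner_adj_right[of "leg12 W" "x \<otimes> (p \<otimes> y)"] by simp
  also have "\<dots> = cnj ((v \<otimes> W (q \<otimes> w)) \<bullet> assoc (W (x \<otimes> p) \<otimes> y))"
    by (simp add: leg12_tens leg23_tens cinner_commute[symmetric])
  also have "(v \<otimes> \<zeta>) \<bullet> assoc (\<omega> \<otimes> y) = \<zeta> \<bullet> (adj (left_ket v) \<omega> \<otimes> y)" for \<zeta> \<omega>
  proof -
    have "adj (left_ket v) oo assoc oo right_ket y = right_ket y oo adj (left_ket v)"
      by (rule blinfun_eq_tensI) (simp_all add: tens_scaleC_left)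
    from arg_cong[OF this, of "%T. blinfun_apply T \<omega>"] have "adj (left_ket v) (assoc (\<omega> \<otimes> y)) = adj (left_ket v) \<omega> \<otimes> y" by simp
    then show ?thesis by (metis bop_left_ket cinner_adj_right left_ket_apply)
  qed
  finally show ?thesis by (simp add: lsl_def cinner_commute[symmetric])
qed

text \<open>The Hilbert module H tensor A, realized by operators into the Hilbert space tensor
  product. Slices of an operator that preserves it multiply \<open>A\<close> into itself from the
  left (\<open>adj_left_ket_hcol\<close>).\<close>

definition hcol :: "('a::complex_hilbert -> 'a) set => ('a -> ('b::complex_hilbert, 'a) htensor) set" where
  "hcol A = ccl {left_ket z oo a |z a. a \<in> A}"

lemma hcol_base: "a \<in> A ==> left_ket z oo a \<in> hcol A"
  unfolding hcol_def by (rule ccl_base) blast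

lemma csubspace_hcol [simp]: "csubspace (hcol A)" and closed_hcol [simp]: "closed (hcol A)"
  unfolding hcol_def by simp_all

lemma bounded_bilinear_lsl: "X \<in> bop ==> bounded_bilinear (%x z. lsl x X z)"
proof
  assume X: "X \<in> bop"
  show "\<exists>K. \<forall>a b. norm (lsl a X b) \<le> norm a * norm b * K"
    using norm_lsl_le[of _ X] by (intro exI[of _ "norm X"]) (simp add: ac_simps)
qed (simp_all add: lsl_linear scaleR_scaleC)

definition lalg :: "(('a::complex_hilbert, 'b::complex_hilbert) htensor -> ('a, 'b) htensor) => ('b -> 'b) set" where
  "lalg W = ccl {lsl x W z |x z. True}"

lemma lsl_in_lalg: "lsl x W z \<in> lalg W"
  unfolding lalg_def by (rule ccl_base) blast

lemma csubspace_lalg [simp]: "csubspace (lalg W)" and closed_lalg [simp]: "closed (lalg W)"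
  unfolding lalg_def by simp_all

lemma lalg_bop: "W \<in> bop ==> lalg W \<subseteq> bop"
  unfolding lalg_def by (rule ccl_bop) auto

lemma lsl_total_induct:
  assumes X: "X \<in> bop" and A: "ccl A = UNIV" and D: "ccl D = UNIV" and M: "csubspace M" "closed M"
    and f: "bounded_linear f" "\<And>c S. \<exists>c'. f (c *c S) = c' *c f S"
    and AD: "\<And>a d. a \<in> A ==> d \<in> D ==> f (lsl a X d) \<in> M"
  shows "f (lsl x X z) \<in> M"
proof -
  have 1: "f (lsl a X z) \<in> M" if "a \<in> A" for a
  proof (rule ccl_induct_map[of z D "%z. f (lsl a X z)"])
    show "bounded_linear (%z. f (lsl a X z))"
      by (rule bounded_linear_compose[OF f(1) bounded_linear_lsl(3)[OF X]])
    show "\<exists>c'. f (lsl a X (c *c x)) = c' *c f (lsl a X x)" for c x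
      unfolding lsl_linear(2)[OF X] by (rule f(2))
  qed (simp_all add: D M AD that)
  show ?thesis
  proof (rule ccl_induct_map[of x A "%x. f (lsl x X z)"])
    show "bounded_linear (%x. f (lsl x X z))"
      by (rule bounded_linear_compose[OF f(1) bounded_linear_lsl(1)])
    show "\<exists>c'. f (lsl (c *c x) X z) = c' *c f (lsl x X z)" for c x
      unfolding lsl_linear(4) by (rule f(2))
  qed (simp_all add: A M 1)
qed

lemma hcol_lalg_induct:
  assumes S: "S \<in> hcol (lalg W)" and M: "csubspace M" "closed M"
    and gen: "\<And>a x z. left_ket a oo lsl x W z \<in> M"
  shows "S \<in> M"
proof -
  have "left_ket a oo c \<in> M" if "c \<in> lalg W" for a c
    by (rule ccl_induct_map[OF that[unfolded lalg_def], of "%c. left_ket a oo c"])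
       (auto intro: bounded_linear_compose_left M gen exI)
  then have "hcol (lalg W) \<subseteq> M" unfolding hcol_def by (intro ccl_minimal M) auto
  then show ?thesis using S by blast
qed

section \<open>The flow on columns\<close>

context modular_data
begin

abbreviation C :: "('a -> 'a) set" where "C \<equiv> lalg W"
abbreviation X :: "('a -> ('a, 'a) htensor) set" where "X \<equiv> hcol C"

lemma range_q: "y \<in> E ==> \<exists>x\<in>E. (x, y) \<in> Q" "y' \<in> E' ==> \<exists>x\<in>E'. (x, y') \<in> Q'"
proof -
  show "\<exists>x\<in>E. (x, y) \<in> Q" if "y \<in> E"
    using f.q_graph[OF f.q_in[OF that, of \<i>]] f.q_inv(1)[OF that, of \<i>] f.q_in[OF that] by auto
  show "\<exists>x\<in>E'. (x, y') \<in> Q'" if "y' \<in> E'"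
    using h.q_graph[OF h.q_in[OF that, of \<i>]] h.q_inv(1)[OF that, of \<i>] h.q_in[OF that] by auto
qed

text \<open>By \<open>conj_relation\<close>, since the vectors of E' lie in the range of
  \<open>Q'\<close> and are total.\<close>

lemma lsl_W'_in: "lsl a W' b \<in> C"
proof (rule lsl_total_induct[where f = "%S. S" and A = "bar ` E'" and D = "bar ` E'"])
  fix a b assume "a \<in> bar ` E'" "b \<in> bar ` E'"
  then obtain x z where xz: "a = bar x" "b = bar z" "x \<in> E'" "z \<in> E'" by auto
  obtain x0 where x0: "(x0, x) \<in> Q'" using range_q(2)[OF xz(3)] by blast
  show "lsl a W' b \<in> C"
    using conj_relation[OF x0 h.q_graph[OF xz(4)]] lsl_in_lalg by (metis xz(1,2))
qed (simp_all add: total_bar h.total)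

lemma mid_W_in: "mid p W \<kappa> \<in> X"
  by (rule ccl_induct_map[of \<kappa> "range (%(x, y). x \<otimes> y)"])
     (auto simp: ccl_tens bounded_linear_mid mid_scaleC mid_tens intro!: hcol_base[OF lsl_in_lalg])

lemma mid_W'_in: "mid p W' \<kappa> \<in> X"
  by (rule ccl_induct_map[of \<kappa> "range (%(x, y). x \<otimes> y)"])
     (auto simp: ccl_tens bounded_linear_mid mid_scaleC mid_tens intro!: hcol_base[OF lsl_W'_in])

text \<open>The flow by conjugation. On a generator it only moves the three vectors by the unitary
  group of \<open>Q'\<close> (\<open>al_gen\<close>), so it preserves \<open>X\<close> and is norm
  continuous there.\<close>

definition al :: "real => ('a -> ('a, 'a) htensor) => ('a -> ('a, 'a) htensor)" where
  "al t S = UU t oo S oo f.U (- t)"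

lemma bounded_linear_al: "bounded_linear (al t)"
  unfolding al_def
  by (intro bounded_linear_compose[OF bounded_linear_compose_right] bounded_linear_compose_left)

lemma al_scaleC: "al t (c *c S) = c *c al t S"
  by (simp add: al_def)

lemma norm_al: "norm (al t S) \<le> norm S"
proof -
  have "norm (UU t) \<le> 1" "norm (f.U (- t)) \<le> 1"
    by (rule norm_blinfun_bound; simp add: norm_unitary)+
  from norm_blinfun_compose3[OF this(1) order_refl this(2), of S] show ?thesis by (simp add: al_def)
qed

lemma al_0: "al 0 S = S"
  by (simp add: al_def UU_def h.U_0 f.U_0)

lemma U_lsl: "f.U t oo lsl x W z oo f.U (- t) = lsl (h.U t x) W (h.U t z)"
proof (rule op_eqI)
  fix y u
  have inv: "f.U (- t) (f.U t v) = v" "f.U t (f.U (- t) v) = v" "h.U (- t) (h.U t w) = w" for v w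
    using f.adj_U[of t] h.adj_U[of t] unitaryD(4,5)[OF f.unitary_U] unitaryD(4)[OF h.unitary_U] by metis+
  have "y \<bullet> (f.U t oo lsl x W z oo f.U (- t)) u = f.U (- t) y \<bullet> lsl x W z (f.U (- t) u)"
    using cinner_adj[of "f.U t" y] by (simp add: f.adj_U)
  also have "\<dots> = (x \<otimes> f.U (- t) y) \<bullet> W (z \<otimes> f.U (- t) u)"
    by (rule cinner_lsl)
  also have "\<dots> = UU t (x \<otimes> f.U (- t) y) \<bullet> UU t (W (z \<otimes> f.U (- t) u))"
    by (simp add: cinner_unitary[OF unitary_UU])
  also have "UU t (W (z \<otimes> f.U (- t) u)) = W (UU t (z \<otimes> f.U (- t) u))"
    using arg_cong[OF W_UU, of "%T. blinfun_apply T (z \<otimes> f.U (- t) u)"] by simp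
  finally show "y \<bullet> (f.U t oo lsl x W z oo f.U (- t)) u = y \<bullet> lsl (h.U t x) W (h.U t z) u"
    by (simp add: UU_def cinner_lsl inv)
qed

lemma al_gen: "al t (left_ket a oo lsl x W z) = left_ket (h.U t a) oo lsl (h.U t x) W (h.U t z)"
proof -
  have "al t (left_ket a oo lsl x W z) = (UU t oo left_ket a) oo (lsl x W z oo f.U (- t))"
    by (simp add: al_def)
  also have "UU t oo left_ket a = left_ket (h.U t a) oo f.U t"
    by (simp add: UU_def tensor_op_left_ket)
  finally show ?thesis by (simp add: U_lsl[symmetric])
qed

lemma al_X: "S \<in> X ==> al t S \<in> X"
proof -
  assume S: "S \<in> X"
  have "S \<in> {S. al t S \<in> X}"
  proof (rule hcol_lalg_induct[OF S])
    show "csubspace {S. al t S \<in> X}"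
      by (rule csubspace_vimage[OF bounded_linear.linear[OF bounded_linear_al]]) (auto simp: al_scaleC)
    show "closed {S. al t S \<in> X}"
      using closed_vimage[OF closed_hcol bounded_linear.continuous_on[OF bounded_linear_al continuous_on_id]]
      by (simp add: vimage_def)
  qed (simp add: al_gen hcol_base lsl_in_lalg)
  then show ?thesis by simp
qed

lemma al_tendsto: "S \<in> X ==> ((%s. al s S) \<longlongrightarrow> al t S) (at t)"
proof -
  assume S: "S \<in> X"
  \<comment> \<open>\<open>al t\<close> is regarded as a bounded operator on a space of operators,
    so that \<open>closed_strong_limit\<close> applies to the norm topology of columns.\<close>
  have ap: "blinfun_apply (Blinfun (al t)) = al t" for t
    by (rule bounded_linear_Blinfun_apply[OF bounded_linear_al])
  have "norm (Blinfun (al s)) \<le> 1" for s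
    by (rule norm_blinfun_bound) (simp_all add: ap norm_al)
  then have cl: "closed {S. ((%s. Blinfun (al s) S) \<longlongrightarrow> Blinfun (al t) S) (at t)}"
    by (rule closed_strong_limit)
  have "S \<in> {S. ((%s. Blinfun (al s) S) \<longlongrightarrow> Blinfun (al t) S) (at t)}"
  proof (rule hcol_lalg_induct[OF S _ cl])
    show "csubspace {S. ((%s. Blinfun (al s) S) \<longlongrightarrow> Blinfun (al t) S) (at t)}"
      by (rule csubspaceI) (auto simp: ap al_scaleC linear_0[OF bounded_linear.linear[OF bounded_linear_al]]
          linear_add[OF bounded_linear.linear[OF bounded_linear_al]] intro!: tendsto_add scaleC.tendsto)
    show "left_ket a oo lsl x W z \<in> {S. ((%s. Blinfun (al s) S) \<longlongrightarrow> Blinfun (al t) S) (at t)}" for a x z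
      by (auto simp: ap al_gen intro!: bounded_bilinear.tendsto[OF bounded_bilinear_blinfun_compose]
          bounded_bilinear.tendsto[OF bounded_bilinear_lsl] bounded_linear.tendsto[OF bounded_linear_left_ket] h.U_tendsto)
  qed
  then show ?thesis by (simp add: ap)
qed

lemma al_comm:
  assumes "V oo UU t = UU t oo V"
  shows "al t (V oo S) = V oo al t S"
  unfolding al_def blinfun_compose_assoc[symmetric] assms by simp

lemma adj_W_UU: "adj W oo UU t = UU t oo adj W"
proof -
  have "adj W oo (W oo UU t) oo adj W = adj W oo (UU t oo W) oo adj W"
    by (simp only: W_UU)
  then show ?thesis by (simp add: unitaryD(2,3,6)[OF W])
qed

lemma continuous_al:
  assumes "V = \<one> \<or> V = W \<or> V = adj W" "S \<in> X"
  shows "continuous_on UNIV (%t. al t (V oo S))"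
proof (intro continuous_at_imp_continuous_on ballI)
  fix t
  have c: "V oo UU s = UU s oo V" for s
    using assms(1) W_UU adj_W_UU by auto
  show "isCont (%t. al t (V oo S)) t"
    unfolding isCont_def al_comm[OF c]
    by (intro bounded_linear.tendsto[OF bounded_linear_compose_left] al_tendsto assms)
qed

text \<open>Formally \<open>r\<close> says G = (Q' tensor Q) T Q^-1, so \<open>T\<close> and
  \<open>G\<close> are values of one analytic orbit of the flow at imaginary distance 1. Hence one
  of them lies in \<open>X\<close> as soon as the real orbit of the other does.\<close>

lemma flow_shift:
  assumes T: "T \<in> bop" and G: "G \<in> bop"
    and r: "\<And>x y z. x \<in> E' ==> y \<in> E ==> z \<in> E ==>
      (q' (-\<i>) x \<otimes> q (-\<i>) y) \<bullet> T z = (x \<otimes> y) \<bullet> G (q (-\<i>) z)"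
    and cT: "continuous_on UNIV (%t. al t T)" and cG: "continuous_on UNIV (%t. al t G)"
  shows "(\<And>t. al t G \<in> X) ==> T \<in> X" "(\<And>t. al t T \<in> X) ==> G \<in> X"
proof -
  \<comment> \<open>Matrix coefficients at vectors of the flow domains: they separate operators and
    continue analytically along the flow.\<close>
  define L where "L = {%S :: 'a -> ('a, 'a) htensor. (x \<otimes> y) \<bullet> S z |x y z. x \<in> E' \<and> y \<in> E \<and> z \<in> E}"
  have L1: "bounded_linear l" if "l \<in> L" for l
    using that unfolding L_def
    by (auto intro!: bounded_linear_compose[OF cinner.bounded_linear_right] blinfun.bounded_linear_left)
  have L2: "l (c *c S) = c * l S" if "l \<in> L" for l c S
    using that unfolding L_def by (auto simp: scaleC_blinfun_apply)
  have sep: "S = S'" if eq: "\<And>l. l \<in> L ==> l S = l S'" for S S'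
  proof (rule bop_eq_dense[OF f.dense])
    fix z assume z: "z \<in> E"
    show "S z = S' z"
    proof (rule eq_on_total[OF ccl_tens_dense[OF h.total f.total]])
      fix s assume "s \<in> {x \<otimes> y |x y. x \<in> E' \<and> y \<in> E}"
      then have "(%S. s \<bullet> blinfun_apply S z) \<in> L" unfolding L_def using z by blast
      from eq[OF this] show "s \<bullet> S z = s \<bullet> S' z" .
    qed
  qed
  \<comment> \<open>The strip has half-width 2 because the second application reflects the parameter
    by z to -z - i, which carries the strip of half-width 1 into this one.\<close>
  have ext: "\<exists>k. k holomorphic_on UNIV \<and> (\<exists>K. \<forall>z. \<bar>Im z\<bar> \<le> 2 --> cmod (k z) \<le> K) \<and>
      (\<forall>t. k (of_real t) = l (al (- t) G)) \<and> (\<forall>t. k (of_real t - \<i>) = l (al (- t) T))" if lL: "l \<in> L" for l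
  proof -
    obtain x y z where l: "l = (%S. (x \<otimes> y) \<bullet> blinfun_apply S z)" and xyz: "x \<in> E'" "y \<in> E" "z \<in> E"
      using lL unfolding L_def by blast
    define k where "k \<zeta> = (q' (cnj \<zeta>) x \<otimes> q (cnj \<zeta>) y) \<bullet> G (q \<zeta> z)" for \<zeta>
    have "k holomorphic_on UNIV"
      unfolding k_def by (intro holomorphic_cinner aholo_tens cholo_op h.aholo_q f.aholo_q f.cholo_q xyz G)
    moreover have "\<exists>K. \<forall>\<zeta>. \<bar>Im \<zeta>\<bar> \<le> 2 --> cmod (k \<zeta>) \<le> K"
    proof -
      obtain Kx where Kx: "\<And>\<zeta>. \<bar>Im \<zeta>\<bar> \<le> 2 ==> norm (q' \<zeta> x) \<le> Kx" using h.q_strip_bound[OF xyz(1), of 2] by blast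
      obtain Ky where Ky: "\<And>\<zeta>. \<bar>Im \<zeta>\<bar> \<le> 2 ==> norm (q \<zeta> y) \<le> Ky" using f.q_strip_bound[OF xyz(2), of 2] by blast
      obtain Kz where Kz: "\<And>\<zeta>. \<bar>Im \<zeta>\<bar> \<le> 2 ==> norm (q \<zeta> z) \<le> Kz" using f.q_strip_bound[OF xyz(3), of 2] by blast
      have "cmod (k \<zeta>) \<le> (Kx * Ky) * (norm G * Kz)" if im: "\<bar>Im \<zeta>\<bar> \<le> 2" for \<zeta>
      proof -
        have c: "\<bar>Im (cnj \<zeta>)\<bar> \<le> 2" using im by simp
        have "cmod (k \<zeta>) \<le> norm (q' (cnj \<zeta>) x \<otimes> q (cnj \<zeta>) y) * norm (G (q \<zeta> z))"
          unfolding k_def by (rule norm_cinner)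
        also have "\<dots> \<le> (norm (q' (cnj \<zeta>) x) * norm (q (cnj \<zeta>) y)) * (norm G * norm (q \<zeta> z))"
          unfolding norm_tens by (intro mult_left_mono norm_blinfun) simp
        also have "\<dots> \<le> (Kx * Ky) * (norm G * Kz)"
          using order_trans[OF norm_ge_zero Kx[OF c]] order_trans[OF norm_ge_zero Ky[OF c]] order_trans[OF norm_ge_zero Kz[OF im]]
          by (intro mult_mono Kx[OF c] Ky[OF c] Kz[OF im]) auto
        finally show ?thesis .
      qed
      then show ?thesis by blast
    qed
    moreover have tr: "(x \<otimes> y) \<bullet> al (- t) S z = (h.U t x \<otimes> f.U t y) \<bullet> S (f.U t z)" for t S
    proof -
      have "adj (UU t) = UU (- t)" by (simp add: UU_def h.adj_U f.adj_U)
      then have "(x \<otimes> y) \<bullet> al (- t) S z = UU t (x \<otimes> y) \<bullet> S (f.U t z)"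
        using cinner_adj_right[of "UU t" "x \<otimes> y"] by (simp add: al_def)
      then show ?thesis by (simp add: UU_def)
    qed
    have "k (of_real t) = l (al (- t) G)" for t
      unfolding l tr k_def by (simp add: h.U f.U xyz)
    moreover have "k (of_real t - \<i>) = l (al (- t) T)" for t
    proof -
      have z: "q (of_real t - \<i>) z = q (-\<i>) (q (of_real t) z)"
        using f.q_add[OF xyz(3), of "-\<i>" "of_real t"] by (simp del: Im_shift)
      have x: "q' (of_real t) x = q' (-\<i>) (q' (of_real t + \<i>) x)" "q (of_real t) y = q (-\<i>) (q (of_real t + \<i>) y)"
        using h.q_add[OF xyz(1), of "-\<i>" "of_real t + \<i>"] f.q_add[OF xyz(2), of "-\<i>" "of_real t + \<i>"] by simp_all
      have c: "cnj (of_real t - \<i>) = of_real t + \<i>" by (simp del: Im_shift)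
      have "k (of_real t - \<i>) = (q' (of_real t + \<i>) x \<otimes> q (of_real t + \<i>) y) \<bullet> G (q (-\<i>) (q (of_real t) z))"
        unfolding k_def c z ..
      also have "\<dots> = (q' (of_real t) x \<otimes> q (of_real t) y) \<bullet> T (q (of_real t) z)"
        unfolding x by (rule r[symmetric]) (intro h.q_in f.q_in xyz)+
      also have "\<dots> = l (al (- t) T)" unfolding l tr by (simp add: h.U f.U xyz)
      finally show ?thesis .
    qed
    ultimately show ?thesis by (intro exI[of _ k] conjI allI)
  qed
  have neg: "continuous_on UNIV (%t. al (- t) S)" if "continuous_on UNIV (%t. al t S)" for S
    by (rule continuous_on_compose2[OF that]) (auto intro: continuous_intros)
  show "T \<in> X" if GX: "\<And>t. al t G \<in> X"
  proof -
    have "al (- 0) T \<in> X"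
    proof (rule boundary_value_in_subspace[of "%t. al (- t) T" _ "%t. al (- t) G" _ X L, OF neg[OF cT] norm_al neg[OF cG] norm_al
          csubspace_hcol closed_hcol GX L1 L2 sep])
      fix l assume "l \<in> L"
      from ext[OF this] obtain k K where k: "k holomorphic_on UNIV" "\<And>z. \<bar>Im z\<bar> \<le> 2 ==> cmod (k z) \<le> K"
        "\<And>t. k (of_real t) = l (al (- t) G)" "\<And>t. k (of_real t - \<i>) = l (al (- t) T)" by meson
      then show "\<exists>k K. k holomorphic_on UNIV \<and> (\<forall>z. \<bar>Im z\<bar> \<le> 1 --> cmod (k z) \<le> K) \<and>
          (\<forall>t. k (of_real t) = l (al (- t) G)) \<and> (\<forall>t. k (of_real t - \<i>) = l (al (- t) T))"
        by (intro exI[of _ k] exI[of _ K]) (auto simp del: Im_shift)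
    qed auto
    then show ?thesis by (simp add: al_0)
  qed
  show "G \<in> X" if TX: "\<And>t. al t T \<in> X"
  proof -
    have "al 0 G \<in> X"
    proof (rule boundary_value_in_subspace[of "%t. al t G" _ "%t. al t T" _ X L, OF cG norm_al cT norm_al
          csubspace_hcol closed_hcol TX L1 L2 sep])
      fix l assume "l \<in> L"
      from ext[OF this] obtain k K where k: "k holomorphic_on UNIV" "\<And>z. \<bar>Im z\<bar> \<le> 2 ==> cmod (k z) \<le> K"
        "\<And>t. k (of_real t) = l (al (- t) G)" "\<And>t. k (of_real t - \<i>) = l (al (- t) T)" by meson
      show "\<exists>k K. k holomorphic_on UNIV \<and> (\<forall>z. \<bar>Im z\<bar> \<le> 1 --> cmod (k z) \<le> K) \<and>
          (\<forall>t. k (of_real t) = l (al t T)) \<and> (\<forall>t. k (of_real t - \<i>) = l (al t G))"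
      proof (intro exI[of _ "%z. k (- z - \<i>)"] exI[of _ K] conjI allI impI)
        have "(k \<circ> (%z. - z - \<i>)) holomorphic_on UNIV"
          by (rule holomorphic_on_compose_gen[OF _ k(1)]) (auto intro!: holomorphic_intros)
        then show "(%z. k (- z - \<i>)) holomorphic_on UNIV" by (simp add: o_def)
        show "cmod (k (- z - \<i>)) \<le> K" if "\<bar>Im z\<bar> \<le> 1" for z
          using that by (intro k(2)) (auto simp: abs_le_iff)
        show "k (- of_real t - \<i>) = l (al t T)" for t
          using k(4)[of "- t"] by (simp del: Im_shift)
        have "- (of_real t - \<i>) - \<i> = of_real (- t)" for t by (simp del: Im_shift)
        then show "k (- (of_real t - \<i>) - \<i>) = l (al t G)" for t
          using k(3)[of "- t"] by (simp only: minus_minus)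
      qed
    qed auto
    then show ?thesis by (simp add: al_0)
  qed
qed

text \<open>Chaining \<open>conj_relation\<close>, the modular relation and the pentagon equation
  yields hypothesis \<open>r\<close> of \<open>flow_shift\<close> for a column of the companion and
  for \<open>W\<close> times a column of \<open>W\<close>.\<close>

lemma weak_relation:
  assumes j: "bounded_linear j" "\<And>c v. j (c *c v) = cnj c *c j v" "\<And>x y. j (bar x \<otimes> y) = x \<otimes> bar y"
    and x: "(x, x\<^sub>1) \<in> Q'" and y: "(y, y\<^sub>1) \<in> Q" and z: "(z, z\<^sub>1) \<in> Q" and v: "(v, v\<^sub>1) \<in> Q'"
  shows "(x\<^sub>1 \<otimes> y\<^sub>1) \<bullet> mid (bar r) W' (j (W' (bar v \<otimes> p))) z
    = (x \<otimes> y) \<bullet> (W oo mid p W (adj W (v\<^sub>1 \<otimes> r))) z\<^sub>1"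
proof -
  have "(x\<^sub>1 \<otimes> y\<^sub>1) \<bullet> mid (bar r) W' (j (W' (bar v \<otimes> p))) z
      = (bar r \<otimes> y\<^sub>1) \<bullet> W' (bar (lsl (bar x\<^sub>1) W' (bar v) p) \<otimes> z)"
    by (simp add: cinner_mid_tens adj_left_ket_conj_flip[OF j] lsl_def)
  also have "lsl (bar x\<^sub>1) W' (bar v) = lsl v\<^sub>1 W x"
    by (rule conj_relation[OF x v, symmetric])
  also have "(bar r \<otimes> y\<^sub>1) \<bullet> W' (bar (lsl v\<^sub>1 W x p) \<otimes> z) = (lsl v\<^sub>1 W x p \<otimes> y) \<bullet> W (r \<otimes> z\<^sub>1)"
    by (rule rel[OF y z, symmetric])
  also have "\<dots> = (x \<otimes> y) \<bullet> W (mid p W (adj W (v\<^sub>1 \<otimes> r)) z\<^sub>1)"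
    by (rule multiplicative_mid[OF W mult, symmetric])
  finally show ?thesis by simp
qed

text \<open>\<open>weak_relation\<close> is used in both directions. The column \<open>N\<close> of
  the companion lies in \<open>X\<close>, hence so does \<open>W oo G\<close>; and \<open>G\<close>
  lies in \<open>X\<close>, hence so does \<open>adj W oo N\<close>, once \<open>W\<close> has been
  moved across Q' tensor Q. It remains to see that columns of these forms are total.\<close>

theorem W_hcol: "S \<in> X ==> W oo S \<in> X" and adj_W_hcol: "S' \<in> X ==> adj W oo S' \<in> X"
proof -
  obtain j :: "('a conj_space, 'a) htensor => ('a, 'a conj_space) htensor" where
    j: "bounded_linear j" "\<And>c v. j (c *c v) = cnj c *c j v" "\<And>x y. j (bar x \<otimes> y) = x \<otimes> bar y"
    using ex_conj_flip by blast
  note wr = weak_relation[OF j]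
  define N where "N v p r = mid (bar r) W' (j (W' (bar v \<otimes> p)))" for v p r
  define G where "G v p r = mid p W (adj W (v \<otimes> r))" for v p r
  have NX: "N v p r \<in> X" and GX: "G v p r \<in> X" for v p r
    unfolding N_def G_def by (rule mid_W'_in mid_W_in)+
  have b: "N v p r \<in> bop" "G v p r \<in> bop" for v p r unfolding N_def G_def by simp_all
  have cV: "continuous_on UNIV (%t. al t S)" "continuous_on UNIV (%t. al t (W oo S))"
    "continuous_on UNIV (%t. al t (adj W oo S))" if "S \<in> X" for S
    using continuous_al[of \<one> S] continuous_al[of W S] continuous_al[of "adj W" S] that by simp_all
  have WG: "W oo G v\<^sub>1 p r \<in> X" and WN: "adj W oo N v p r \<in> X" if v: "(v, v\<^sub>1) \<in> Q'" for v v\<^sub>1 p r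
  proof -
    show "W oo G v\<^sub>1 p r \<in> X"
    proof (rule flow_shift(2)[OF b(1)[of v p r] bop_compose[OF _ b(2)]])
      show "(q' (-\<i>) x \<otimes> q (-\<i>) y) \<bullet> N v p r z = (x \<otimes> y) \<bullet> (W oo G v\<^sub>1 p r) (q (-\<i>) z)"
        if "x \<in> E'" "y \<in> E" "z \<in> E" for x y z
        unfolding N_def G_def by (rule wr) (intro h.q_graph f.q_graph that v)+
    qed (simp_all add: cV NX GX al_X)
    show "adj W oo N v p r \<in> X"
    proof (rule flow_shift(1)[OF bop_compose[OF _ b(1)] b(2)[of v\<^sub>1 p r]])
      fix x y z assume xyz: "x \<in> E'" "y \<in> E" "z \<in> E"
      have "(W (x \<otimes> y), W (q' (-\<i>) x \<otimes> q (-\<i>) y)) \<in> graph_tensor Q' Q"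
        by (intro W_graph graph_tensor_tens h.q_graph f.q_graph xyz)
      then have "W (q' (-\<i>) x \<otimes> q (-\<i>) y) \<bullet> N v p r z = W (x \<otimes> y) \<bullet> (W oo G v\<^sub>1 p r) (q (-\<i>) z)"
        unfolding N_def G_def by (rule graph_tensor_induct) (intro wr f.q_graph xyz v)
      then show "(q' (-\<i>) x \<otimes> q (-\<i>) y) \<bullet> (adj W oo N v p r) z = (x \<otimes> y) \<bullet> G v\<^sub>1 p r (q (-\<i>) z)"
        by (simp add: cinner_adj_right cinner_unitary[OF W])
    qed (simp_all add: cV NX GX al_X)
  qed
  have vim: "csubspace {S. V oo S \<in> X}" "closed {S. V oo S \<in> X}" if "V \<in> bop" for V :: "('a, 'a) htensor -> ('a, 'a) htensor"
  proof -
    show "csubspace {S. V oo S \<in> X}"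
      by (rule csubspace_vimage[OF bounded_linear.linear[OF bounded_linear_compose_left]]) (use that in auto)
    show "closed {S. V oo S \<in> X}"
      using closed_vimage[OF closed_hcol bounded_linear.continuous_on[OF bounded_linear_compose_left continuous_on_id], of V]
      by (simp add: vimage_def)
  qed
  show "W oo S \<in> X" if S: "S \<in> X" for S
  proof -
    have "W oo mid p W \<kappa> \<in> X" for p \<kappa>
    proof -
      have "mid p W \<kappa> \<in> {S. W oo S \<in> X}"
      \<comment> \<open>The vectors v tensor r with v in E' are total, \<open>adj W\<close> is onto,
        and every such v is Q' of some vector, as \<open>WG\<close> requires.\<close>
      proof (rule ccl_induct_map[of \<kappa> "adj W ` {v \<otimes> r |v r. v \<in> E' \<and> r \<in> UNIV}" "mid p W"])
        have "ccl (adj W ` {v \<otimes> r |v r. v \<in> E' \<and> r \<in> UNIV}) = UNIV"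
          by (rule ccl_image_total[OF ccl_tens_dense[OF h.total] blinfun.bounded_linear_right _ surj_unitary[OF unitary_adj[OF W]]])
             (auto simp: bop_scaleC ccl_id)
        then show "\<kappa> \<in> ccl (adj W ` {v \<otimes> r |v r. v \<in> E' \<and> r \<in> UNIV})" by simp
        fix s assume "s \<in> adj W ` {v \<otimes> r |v r. v \<in> E' \<and> r \<in> UNIV}"
        then obtain v r where "s = adj W (v \<otimes> r)" "v \<in> E'" by auto
        then show "mid p W s \<in> {S. W oo S \<in> X}"
          using range_q(2)[of v] WG[unfolded G_def] by auto
      qed (auto simp: bounded_linear_mid mid_scaleC intro!: vim)
      then show ?thesis by simp
    qed
    then have "S \<in> {S. W oo S \<in> X}"
      by (intro hcol_lalg_induct[OF S] vim) (auto simp flip: mid_tens)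
    then show ?thesis by simp
  qed
  show "adj W oo S' \<in> X" if S: "S' \<in> X" for S'
  proof -
    have m: "adj W oo mid (bar r) W' (j \<omega>) \<in> X" for r \<omega>
    proof -
      have "mid (bar r) W' (j \<omega>) \<in> {S. adj W oo S \<in> X}"
      proof (rule ccl_induct_map[of \<omega> "W' ` {v \<otimes> p |v p. v \<in> bar ` E' \<and> p \<in> UNIV}" "%\<omega>. mid (bar r) W' (j \<omega>)"])
        have "ccl (W' ` {v \<otimes> p |v p. v \<in> bar ` E' \<and> p \<in> UNIV}) = UNIV"
          by (rule ccl_image_total[OF ccl_tens_dense[OF total_bar[OF h.total]] blinfun.bounded_linear_right _ surj_unitary[OF W']])
             (auto simp: bop_scaleC ccl_id)
        then show "\<omega> \<in> ccl (W' ` {v \<otimes> p |v p. v \<in> bar ` E' \<and> p \<in> UNIV})" by simp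
        show "bounded_linear (%\<omega>. mid (bar r) W' (j \<omega>))"
          by (rule bounded_linear_compose[OF bounded_linear_mid j(1)])
        fix s assume "s \<in> W' ` {v \<otimes> p |v p. v \<in> bar ` E' \<and> p \<in> UNIV}"
        then obtain v p where "s = W' (bar v \<otimes> p)" "v \<in> E'" by auto
        then show "mid (bar r) W' (j s) \<in> {S. adj W oo S \<in> X}"
          using WN[unfolded N_def, OF h.q_graph] by auto
      qed (auto simp: mid_scaleC j(2) intro!: vim)
      then show ?thesis by simp
    qed
    have m': "left_ket a oo lsl x W z \<in> {S. adj W oo S \<in> X}" if "x \<in> E'" "z \<in> E'" for a x z
    proof -
      obtain z0 where z0: "(z0, x) \<in> Q'" using range_q(2)[OF \<open>x \<in> E'\<close>] by blast
      \<comment> \<open>\<open>conj_relation\<close> rewrites a generator built from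
        \<open>W\<close> as a column of the companion, for which the claim has just been
        shown.\<close>
      have "lsl x W z = lsl (bar (q' (-\<i>) z)) W' (bar z0)"
        by (rule conj_relation[OF h.q_graph[OF \<open>z \<in> E'\<close>] z0])
      then have "left_ket a oo lsl x W z = mid (bar (q' (-\<i>) z)) W' (j (bar a \<otimes> z0))"
        by (simp add: j(3) mid_tens)
      then show ?thesis using m by simp
    qed
    have "S' \<in> {S. adj W oo S \<in> X}"
    proof (intro hcol_lalg_induct[OF S] vim)
      fix a x z
      show "left_ket a oo lsl x W z \<in> {S. adj W oo S \<in> X}"
        by (rule lsl_total_induct[OF _ h.total h.total vim bounded_linear_compose_left]) (use m' in auto)
    qed simp_all
    then show ?thesis by simp
  qed
qed

end

section \<open>The \<open>C\<close>*-algebra of a modular multiplicative unitary\<close>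

text \<open>The last two clauses are nondegeneracy and factorization up to closed span; the latter
  takes the place of approximate units.\<close>

definition cstar :: "('a::complex_hilbert -> 'a) set => bool" where
  "cstar A \<longleftrightarrow> A \<subseteq> bop \<and> csubspace A \<and> closed A \<and> (\<forall>a\<in>A. \<forall>b\<in>A. a oo b \<in> A) \<and> (\<forall>a\<in>A. adj a \<in> A) \<and>
    ccl {blinfun_apply a x |a x. a \<in> A} = UNIV \<and> A \<subseteq> ccl {a oo b |a b. a \<in> A \<and> b \<in> A}"

lemma cstarD:
  assumes "cstar A"
  shows "a \<in> A ==> a \<in> bop" "A \<subseteq> bop" "csubspace A" "closed A" "a \<in> A ==> b \<in> A ==> a oo b \<in> A"
    "a \<in> A ==> adj a \<in> A" "ccl {blinfun_apply a x |a x. a \<in> A} = UNIV" "A \<subseteq> ccl {a oo b |a b. a \<in> A \<and> b \<in> A}"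
  using assms unfolding cstar_def by blast+

lemma adj_left_ket_hcol:
  assumes S: "S \<in> hcol A" and A: "csubspace A" "closed A"
  shows "adj (left_ket x) oo S \<in> A"
  by (rule ccl_induct_map[OF S[unfolded hcol_def], of "%S. adj (left_ket x) oo S"])
     (auto simp: A adj_left_ket_left_ket blinfun_compose_assoc[symmetric] simp del: blinfun_compose_assoc
       intro!: bounded_linear_compose_left csubspaceD(3)[OF A(1)])

text \<open>Invariance of the columns makes slices of \<open>W\<close> and of \<open>adj W\<close>
  left multipliers of \<open>C\<close>. Writing c as a slice of \<open>adj W oo W\<close> applied to
  its own column shows that products of a slice of \<open>adj W\<close> with a slice of
  \<open>W\<close> span a dense subspace; this family of products is closed under adjoints.\<close>

lemma cstar_lalg:
  assumes "modular_multiplicative_unitary (W :: ('a::complex_hilbert, 'a) htensor -> ('a, 'a) htensor)"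
  shows "cstar (lalg W)" "S \<in> hcol (lalg W) ==> W oo S \<in> hcol (lalg W)" "S \<in> hcol (lalg W) ==> adj W oo S \<in> hcol (lalg W)"
proof -
  obtain Q' E' q' Q E q W' where "modular_data W Q' E' q' Q E q W'"
    using ex_modular_data[OF assms] by blast
  then interpret modular_data W Q' E' q' Q E q W' .
  show WX: "W oo S \<in> X" and WX': "adj W oo S \<in> X" if "S \<in> X" for S
    using W_hcol[OF that] adj_W_hcol[OF that] by auto
  have b [simp]: "c \<in> bop" if "c \<in> C" for c using lalg_bop[of W] that by auto
  have 1: "lsl x W z oo c \<in> C" "lsl x (adj W) z oo c \<in> C" if "c \<in> C" for x z c
    using adj_left_ket_hcol[OF WX[OF hcol_base[OF that]] csubspace_lalg closed_lalg, of x z]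
      adj_left_ket_hcol[OF WX'[OF hcol_base[OF that]] csubspace_lalg closed_lalg, of x z]
    by (simp_all add: lsl_def)
  have mult: "a oo c \<in> C" if a: "a \<in> C" and c: "c \<in> C" for a c
    by (rule ccl_induct_map[OF a[unfolded lalg_def], of "%a. a oo c"])
       (auto intro: bounded_linear_compose_right 1 c exI)
  let ?D = "ccl {lsl x (adj W) z oo c |x z c. c \<in> C}"
  have dense: "c \<in> ?D" if c: "c \<in> C" for c
  proof (cases "\<exists>z::'a. z \<noteq> 0")
    case True
    then obtain z :: 'a where z: "z \<noteq> 0" by blast
    have "adj (left_ket z) oo (adj W oo (W oo (left_ket z oo c))) \<in> ?D"
    proof (rule ccl_induct_map[OF WX[OF hcol_base[OF c], unfolded hcol_def], of "%S. adj (left_ket z) oo (adj W oo S)"])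
      show "bounded_linear (%S. adj (left_ket z) oo (adj W oo S))"
        by (intro bounded_linear_compose[OF bounded_linear_compose_left] bounded_linear_compose_left)
      fix s assume "s \<in> {left_ket z oo a |(z::'a) a. a \<in> C}"
      then obtain y a where "s = left_ket y oo a" "a \<in> C" by blast
      then show "adj (left_ket z) oo (adj W oo s) \<in> ?D"
        by (intro ccl_base) (auto simp: lsl_def)
    qed auto
    moreover have "adj (left_ket z) oo (adj W oo (W oo (left_ket z oo c))) = of_real ((norm z)\<^sup>2) *c c"
      unfolding unitaryD(6)[OF W]
      by (simp add: blinfun_compose_assoc[symmetric] adj_left_ket_left_ket cinner_self del: blinfun_compose_assoc of_real_power)
    ultimately have "(1 / of_real ((norm z)\<^sup>2)) *c of_real ((norm z)\<^sup>2) *c c \<in> ?D"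
      by (intro csubspaceD(3)[OF csubspace_ccl, of "of_real ((norm z)\<^sup>2) *c c"]) (simp only:)
    then show ?thesis using z by (simp add: scaleC_scaleC)
  next
    case False
    then have "c = 0" by (intro blinfun_eqI) auto
    then show ?thesis using csubspaceD(1)[OF csubspace_ccl] by simp
  qed
  let ?D' = "ccl {lsl x (adj W) z oo lsl y W u |x z y u. True}"
  have dense': "c \<in> ?D'" if c: "c \<in> C" for c
  proof -
    have "lsl x (adj W) z oo d \<in> ?D'" if d: "d \<in> C" for x z d
    proof (rule ccl_induct_map[OF d[unfolded lalg_def], of "%d. lsl x (adj W) z oo d"])
      fix s assume "s \<in> {lsl x W z |x z. True}"
      then show "lsl x (adj W) z oo s \<in> ?D'" by (intro ccl_base) blast
    qed (auto intro: bounded_linear_compose_left)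
    then have "?D \<subseteq> ?D'" by (intro ccl_minimal) auto
    then show ?thesis using dense[OF c] by blast
  qed
  have adjC: "adj c \<in> C" if c: "c \<in> C" for c
    by (rule adj_ccl[OF dense'[OF c] _ _ csubspace_lalg closed_lalg])
       (auto simp: adj_lsl lsl_in_lalg intro!: 1(2))
  have CC: "C \<subseteq> ccl {a oo b |a b. a \<in> C \<and> b \<in> C}"
  proof
    fix c assume c: "c \<in> C"
    \<comment> \<open>Only at this point do slices of \<open>adj W\<close> belong to
      \<open>C\<close>, as adjoints of slices of \<open>W\<close>.\<close>
    have "lsl x (adj W) z \<in> C" for x z
      using adjC[OF lsl_in_lalg[of z W x]] by (simp add: adj_lsl)
    then have "?D' \<subseteq> ccl {a oo b |a b. a \<in> C \<and> b \<in> C}"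
      using lsl_in_lalg[of _ W] by (intro ccl_mono) blast
    then show "c \<in> ccl {a oo b |a b. a \<in> C \<and> b \<in> C}" using dense'[OF c] by blast
  qed
  \<comment> \<open>If v is orthogonal to the ranges of all slices, then \<open>adj W\<close>, which
    is isometric, kills every x tensor v.\<close>
  have nd: "ccl {blinfun_apply c x |c x. c \<in> C} = UNIV"
  proof (rule closed_subspace_eq_UNIV)
    fix v assume v: "\<And>x. x \<in> ccl {blinfun_apply c x |c x. c \<in> C} ==> x \<bullet> v = 0"
    have "adj W (x \<otimes> v) = 0" for x
    proof (rule tens_total)
      fix z u
      have "lsl x W z u \<bullet> v = 0"
        by (intro v ccl_base) (use lsl_in_lalg[of x W z] in blast)
      then have "v \<bullet> lsl x W z u = 0" by (subst cinner_commute) simp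
      then have "(x \<otimes> v) \<bullet> W (z \<otimes> u) = 0" by (simp add: cinner_lsl)
      then have "W (z \<otimes> u) \<bullet> (x \<otimes> v) = 0" by (subst cinner_commute) simp
      then show "(z \<otimes> u) \<bullet> adj W (x \<otimes> v) = 0" by (simp add: cinner_adj_right)
    qed
    then have "norm (x \<otimes> v) = 0" for x :: 'a
      using norm_unitary[OF unitary_adj[OF W], of "x \<otimes> v"] by simp
    from this[of v] show "v = 0" by simp
  qed simp_all
  show "cstar C" unfolding cstar_def
    by (intro conjI ballI lalg_bop csubspace_lalg closed_lalg mult adjC nd CC) simp_all
qed

section \<open>Duality\<close>

text \<open>The multiplicative unitary of the dual quantum group.\<close>

definition dualu :: "(('a::complex_hilbert, 'b::complex_hilbert) htensor -> ('a, 'b) htensor) => (('b, 'a) htensor -> ('b, 'a) htensor)" where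
  "dualu W = flip oo adj W oo flip"

lemma unitary_dualu [simp]: "unitary W ==> unitary (dualu W)"
  by (simp add: dualu_def)

lemma cinner_legs:
  assumes "X \<in> bop"
  shows "(x \<otimes> (y \<otimes> w)) \<bullet> leg12 X (x' \<otimes> (y' \<otimes> w')) = ((x \<otimes> y) \<bullet> X (x' \<otimes> y')) * (w \<bullet> w')"
    "(x \<otimes> (z \<otimes> u)) \<bullet> leg13 X (x' \<otimes> (z' \<otimes> u')) = ((x \<otimes> u) \<bullet> X (x' \<otimes> u')) * (z \<bullet> z')"
    "(a \<otimes> (b \<otimes> c)) \<bullet> leg23 X (a' \<otimes> (b' \<otimes> c')) = (a \<bullet> a') * ((b \<otimes> c) \<bullet> X (b' \<otimes> c'))"
proof -
  show 1: "(x \<otimes> (y \<otimes> w)) \<bullet> leg12 X (x' \<otimes> (y' \<otimes> w')) = ((x \<otimes> y) \<bullet> X (x' \<otimes> y')) * (w \<bullet> w')" for x y x' y' w w'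
    by (simp add: leg12_tens assms cinner_assoc)
  show "(x \<otimes> (z \<otimes> u)) \<bullet> leg13 X (x' \<otimes> (z' \<otimes> u')) = ((x \<otimes> u) \<bullet> X (x' \<otimes> u')) * (z \<bullet> z')"
    by (simp add: leg13_conj cinner_id_flip 1)
  show "(a \<otimes> (b \<otimes> c)) \<bullet> leg23 X (a' \<otimes> (b' \<otimes> c')) = (a \<bullet> a') * ((b \<otimes> c) \<bullet> X (b' \<otimes> c'))"
    by (simp add: leg23_tens assms)
qed

lemma leg13_flip_tens [simp]: "leg13 flip (x \<otimes> (y \<otimes> w)) = w \<otimes> (y \<otimes> x)"
  by (simp add: leg13_conj leg12_tens)

lemma cinner_leg13_flip: "(x \<otimes> (y \<otimes> w)) \<bullet> leg13 flip v = (w \<otimes> (y \<otimes> x)) \<bullet> v"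
  using cinner_adj[of "leg13 flip" "x \<otimes> (y \<otimes> w)" v] by simp

lemma flip_cinner: "(x \<otimes> y) \<bullet> flip v = (y \<otimes> x) \<bullet> v"
  using cinner_adj[of flip "x \<otimes> y" v] by simp

text \<open>\<open>leg13 flip\<close> reverses the order of the three legs. The pentagon equation
  for the dual is thereby the adjoint of the one for \<open>W\<close>.\<close>

lemma reversed_legs:
  assumes X: "(X :: ('a::complex_hilbert, 'a) htensor -> _) \<in> bop"
  shows "leg12 (flip oo X oo flip) = leg13 flip oo leg23 X oo leg13 flip"
    "leg23 (flip oo X oo flip) = leg13 flip oo leg12 X oo leg13 flip"
    "leg13 (flip oo X oo flip) = leg13 flip oo leg13 X oo leg13 flip"
proof -
  have bb: "flip oo (X oo flip) \<in> bop" using X by simp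
  show "leg12 (flip oo X oo flip) = leg13 flip oo leg23 X oo leg13 flip"
    "leg23 (flip oo X oo flip) = leg13 flip oo leg12 X oo leg13 flip"
    "leg13 (flip oo X oo flip) = leg13 flip oo leg13 X oo leg13 flip"
    by (rule op_eqI3; simp add: X cinner_legs[OF X] cinner_legs[OF bb] cinner_leg13_flip flip_cinner)+
qed

lemma multiplicative_dualu:
  assumes W: "unitary W" and m: "multiplicative W"
  shows "multiplicative (dualu W)"
proof -
  note b [simp] = unitaryD(1)[OF W]
  have u: "unitary (leg13 flip :: ('a, 'a, 'a) htensor3 -> _)" by simp
  have ff: "leg13 flip oo leg13 flip = (\<one> :: ('a, 'a, 'a) htensor3 -> _)"
    "leg13 flip oo (leg13 flip oo S) = (S :: 'z::real_normed_vector -> ('a, 'a, 'a) htensor3)" for S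
    by (simp_all add: leg_compose leg_compose2)
  have m': "leg12 (adj W) oo leg23 (adj W) = leg23 (adj W) oo (leg13 (adj W) oo leg12 (adj W))"
    using arg_cong[OF m[unfolded multiplicative_def], of adj] by simp
  show ?thesis
    unfolding multiplicative_def dualu_def reversed_legs[OF bop_adj[OF b]]
    by (simp add: ff) (simp add: m' blinfun_compose_assoc[symmetric] del: blinfun_compose_assoc)
qed

lemma graph_tensor_flip:
  "(v, w) \<in> graph_tensor P Q \<longleftrightarrow> (flip v, flip w) \<in> graph_tensor Q P"
proof -
  have imp: "(flip v, flip w) \<in> graph_tensor Q P" if "(v, w) \<in> graph_tensor P Q"
    for v w :: "('u::complex_hilbert, 'v::complex_hilbert) htensor" and P Q
  proof -
    have "(%p. (flip (fst p), flip (snd p))) (v, w) \<in> graph_tensor Q P"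
    proof (rule ccl_induct_map[OF that[unfolded graph_tensor_ccl]])
      show "bounded_linear (%p. (flip (fst p :: ('u, 'v) htensor), flip (snd p :: ('u, 'v) htensor)))"
        by (intro bounded_linear_Pair bounded_linear_compose[OF blinfun.bounded_linear_right] bounded_linear_fst bounded_linear_snd)
    qed (auto simp: graph_tensor_ccl scaleC_prod_def bop_scaleC intro: graph_tensor_tens[unfolded graph_tensor_ccl])
    then show ?thesis by simp
  qed
  show ?thesis
    using imp[of v w P Q] imp[of "flip v" "flip w" Q P] by auto
qed

text \<open>\<open>J\<close> is the antiunitary involution that exchanges the two factors and moves
  the conjugation along; it transports the modular companion to the dual.\<close>

lemma conj_swap:
  fixes j :: "('a::complex_hilbert conj_space, 'a) htensor => ('a, 'a conj_space) htensor"
  assumes j: "bounded_linear j" "\<And>c v. j (c *c v) = cnj c *c j v" "\<And>x y. j (bar x \<otimes> y) = x \<otimes> bar y"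
  defines "J \<equiv> %v. flip (j v)"
  shows "bounded_linear J" "J (c *c v) = cnj c *c J v" "J (bar x \<otimes> y) = bar y \<otimes> x"
    "J (J v) = v" "J v \<bullet> w = J w \<bullet> v"
proof -
  show bl: "bounded_linear J" unfolding J_def
    by (rule bounded_linear_compose[OF blinfun.bounded_linear_right j(1)])
  show sc: "J (c *c v) = cnj c *c J v" for c v by (simp add: J_def j(2) bop_scaleC)
  show t: "J (bar x \<otimes> y) = bar y \<otimes> x" for x y by (simp add: J_def j(3))
  have tot: "v \<in> ccl (range (%(x, y). x \<otimes> y))" for v :: "('a conj_space, 'a) htensor" by (simp add: ccl_tens)
  have t': "J (a \<otimes> y) = bar y \<otimes> unbar a" for a y using t[of "unbar a" y] by simp
  show "J (J v) = v"
    by (rule ccl_eq_map[OF tot, of "%v. J (J v)" "%v. v"])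
       (auto simp: sc t' intro: bounded_linear_compose[OF bl bl] bounded_linear_ident)
  have e: "J (a \<otimes> b) \<bullet> w = J w \<bullet> (a \<otimes> b)" for a b w
  proof (rule ccl_eq_map[OF tot, of "%w. J (a \<otimes> b) \<bullet> w" "%w. J w \<bullet> (a \<otimes> b)"])
    show "bounded_linear (%w. J (a \<otimes> b) \<bullet> w)" by (rule cinner.bounded_linear_right)
    show "bounded_linear (%w. J w \<bullet> (a \<otimes> b))" by (rule bounded_linear_compose[OF cinner.bounded_linear_left bl])
    fix s :: "('a conj_space, 'a) htensor" assume "s \<in> range (%(x, y). x \<otimes> y)"
    then show "J (a \<otimes> b) \<bullet> s = J s \<bullet> (a \<otimes> b)"
      by (auto simp: t' cinner_conj_space.rep_eq bar_inverse)
  qed (simp_all add: sc scaleC_complex_def)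
  have "w \<bullet> J v = v \<bullet> J w" for w
  proof (rule ccl_eq_map_anti[OF tot, of "%v. w \<bullet> J v" "%v. v \<bullet> J w"])
    show "bounded_linear (%v. w \<bullet> J v)" by (rule bounded_linear_compose[OF cinner.bounded_linear_right bl])
    show "bounded_linear (%v. v \<bullet> J w)" by (rule cinner.bounded_linear_left)
    fix s :: "('a conj_space, 'a) htensor" assume "s \<in> range (%(x, y). x \<otimes> y)"
    then obtain a b where s: "s = a \<otimes> b" by auto
    show "w \<bullet> J s = s \<bullet> J w"
      using arg_cong[OF e[of a b w], of cnj] by (simp add: s cinner_commute[symmetric])
  qed (simp_all add: sc scaleC_complex_def)
  from arg_cong[OF this[of w], of cnj] show "J v \<bullet> w = J w \<bullet> v"
    by (simp add: cinner_commute[symmetric])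
qed

text \<open>For the dual, \<open>Q\<close> and \<open>Q'\<close> exchange their roles and the
  companion is J W' J. The relation to be checked is \<open>conj_relation\<close>, the form of
  modularity in which only \<open>Q'\<close> occurs.\<close>

lemma modular_multiplicative_unitary_dualu:
  assumes mmu: "modular_multiplicative_unitary (W :: ('a::complex_hilbert, 'a) htensor -> ('a, 'a) htensor)"
  shows "modular_multiplicative_unitary (dualu W)"
proof -
  obtain Q' E' q' Q E q W' where md: "modular_data W Q' E' q' Q E q W'"
    using ex_modular_data[OF mmu] by blast
  interpret modular_data W Q' E' q' Q E q W' by (rule md)
  obtain j :: "('a conj_space, 'a) htensor => ('a, 'a conj_space) htensor" where
    j: "bounded_linear j" "\<And>c v. j (c *c v) = cnj c *c j v" "\<And>x y. j (bar x \<otimes> y) = x \<otimes> bar y"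
    using ex_conj_flip by blast
  define J where "J v = flip (j v)" for v
  note J = conj_swap[OF j, folded J_def]
  have apJ: "blinfun_apply (Blinfun (%v. J (T (J v)))) = (%v. J (T (J v)))" for T :: "('a conj_space, 'a) htensor -> ('a conj_space, 'a) htensor"
    by (intro bounded_linear_Blinfun_apply bounded_linear_compose[OF J(1)] bounded_linear_compose[OF blinfun.bounded_linear_right] J(1))
  define V where "V = Blinfun (%v. J (W' (J v)))"
  have V: "V v = J (W' (J v))" for v unfolding V_def apJ ..
  have adjV: "adj V = Blinfun (%v. J (adj W' (J v)))"
  proof (rule adj_eqI)
    fix x y
    have "J (adj W' (J y)) \<bullet> x = J x \<bullet> adj W' (J y)" by (rule J(5))
    also have "\<dots> = W' (J x) \<bullet> J y" by (simp add: cinner_adj_right)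
    also have "\<dots> = cnj (J y \<bullet> W' (J x))" by (rule cinner_commute)
    also have "J y \<bullet> W' (J x) = J (W' (J x)) \<bullet> y" by (rule J(5))
    finally show "Blinfun (%v. J (adj W' (J v))) y \<bullet> x = y \<bullet> V x"
      unfolding apJ V by (simp add: cinner_commute[symmetric])
  qed
  have uV: "unitary V"
    unfolding unitary_def adjV
    by (auto intro!: bopI blinfun_eqI simp: V apJ J(2) J(4) bop_scaleC unitaryD(4,5)[OF W'])
  have inv': "(adj W v, adj W w) \<in> graph_tensor Q' Q \<longleftrightarrow> (v, w) \<in> graph_tensor Q' Q" for v w
    using inv[of "adj W v" "adj W w"] by (simp add: unitaryD(5)[OF W])
  have "modular (dualu W)"
    unfolding modular_def
  proof (rule exI[of _ Q], rule exI[of _ Q'], rule exI[of _ V], intro conjI pos pos' uV allI)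
    show "{(v, w). (blinfun_apply (dualu W) v, blinfun_apply (dualu W) w) \<in> graph_tensor Q Q'} = graph_tensor Q Q'"
    proof (rule set_eqI)
      fix p :: "('a, 'a) htensor \<times> ('a, 'a) htensor"
      obtain v w where p: "p = (v, w)" by (cases p)
      have "(dualu W v, dualu W w) \<in> graph_tensor Q Q' \<longleftrightarrow> (v, w) \<in> graph_tensor Q Q'"
        using graph_tensor_flip[of "adj W (flip v)" "adj W (flip w)" Q' Q] graph_tensor_flip[of v w Q Q'] inv'
        by (simp add: dualu_def)
      then show "p \<in> {(v, w). (blinfun_apply (dualu W) v, blinfun_apply (dualu W) w) \<in> graph_tensor Q Q'} \<longleftrightarrow> p \<in> graph_tensor Q Q'"
        by (simp add: p)
    qed
    fix x z
    show "\<forall>(y, Qy)\<in>Q'. \<forall>(u', u)\<in>Q'. (x \<otimes> y) \<bullet> blinfun_apply (dualu W) (z \<otimes> u) = (bar z \<otimes> Qy) \<bullet> V (bar x \<otimes> u')"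
    proof (intro ballI, clarify)
      fix y Qy u' u assume yu: "(y, Qy) \<in> Q'" "(u', u) \<in> Q'"
      have "(x \<otimes> y) \<bullet> dualu W (z \<otimes> u) = (y \<otimes> x) \<bullet> adj W (u \<otimes> z)"
        by (simp add: dualu_def flip_cinner)
      also have "\<dots> = cnj (z \<bullet> lsl u W y x)"
        by (simp add: cinner_adj_right cinner_lsl cinner_commute[symmetric])
      also have "\<dots> = cnj ((bar Qy \<otimes> z) \<bullet> W' (bar u' \<otimes> x))"
        by (simp add: conj_relation[OF yu] cinner_lsl)
      also have "\<dots> = cnj (J (bar z \<otimes> Qy) \<bullet> W' (J (bar x \<otimes> u')))"
        by (simp add: J(3))
      also have "J (bar z \<otimes> Qy) \<bullet> W' (J (bar x \<otimes> u')) = V (bar x \<otimes> u') \<bullet> (bar z \<otimes> Qy)"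
        by (simp only: J(5)[of "bar z \<otimes> Qy"] V)
      finally show "(x \<otimes> y) \<bullet> dualu W (z \<otimes> u) = (bar z \<otimes> Qy) \<bullet> V (bar x \<otimes> u')"
        by (simp add: cinner_commute[symmetric])
    qed
  qed
  then show ?thesis
    using mmu unfolding modular_multiplicative_unitary_def by (simp add: multiplicative_dualu)
qed

lemma summable_lsl:
  assumes s: "summable (%n. (norm (\<xi> n))\<^sup>2)" "summable (%n. (norm (\<eta> n))\<^sup>2)"
  shows "summable (%n. lsl (\<xi> n) X (\<eta> n))"
proof (rule summable_comparison_test')
  show "summable (%n. norm X * ((norm (\<xi> n))\<^sup>2 + (norm (\<eta> n))\<^sup>2))"
    by (intro summable_mult summable_add s)
  fix n
  have "norm (lsl (\<xi> n) X (\<eta> n)) \<le> norm X * (norm (\<xi> n) * norm (\<eta> n))"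
    using norm_lsl_le[of "\<xi> n" X "\<eta> n"] by (simp add: ac_simps)
  also have "norm (\<xi> n) * norm (\<eta> n) \<le> (norm (\<xi> n))\<^sup>2 + (norm (\<eta> n))\<^sup>2"
  proof -
    have "0 \<le> (norm (\<xi> n) - norm (\<eta> n))\<^sup>2 + (norm (\<xi> n))\<^sup>2 + (norm (\<eta> n))\<^sup>2" by simp
    then show ?thesis unfolding power2_diff by linarith
  qed
  finally show "norm (lsl (\<xi> n) X (\<eta> n)) \<le> norm X * ((norm (\<xi> n))\<^sup>2 + (norm (\<eta> n))\<^sup>2)"
    by (simp add: mult_left_mono)
qed

lemma slice_left_series:
  assumes s: "summable (%n. (norm (\<xi> n))\<^sup>2)" "summable (%n. (norm (\<eta> n))\<^sup>2)" and X: "X \<in> bop"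
  shows "slice_left (%T. \<Sum>n. \<xi> n \<bullet> blinfun_apply T (\<eta> n)) X = (\<Sum>n. lsl (\<xi> n) X (\<eta> n))" (is "slice_left ?\<omega> X = ?T")
    "(\<Sum>n. lsl (\<xi> n) X (\<eta> n)) \<in> lalg X"
proof -
  have sm: "(%n. lsl (\<xi> n) X (\<eta> n)) sums ?T" by (rule summable_sums[OF summable_lsl[OF s]])
  show T: "?T \<in> lalg X"
    by (rule closed_sequentially[OF closed_lalg _ sm[unfolded sums_def]])
       (auto intro: complex_vector.subspace_sum lsl_in_lalg)
  have \<omega>: "?\<omega> \<in> predual" unfolding predual_def using s by blast
  show "slice_left ?\<omega> X = ?T"
  proof (rule op_eqI)
    fix y u
    have "(%n. y \<bullet> lsl (\<xi> n) X (\<eta> n) u) sums (y \<bullet> ?T u)"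
      by (rule bounded_linear.sums[OF bounded_linear_compose[OF cinner.bounded_linear_right blinfun.bounded_linear_left] sm])
    moreover have "y \<bullet> lsl (\<xi> n) X (\<eta> n) u = \<xi> n \<bullet> (adj (right_ket y) oo X oo right_ket u) (\<eta> n)" for n
      by (simp add: cinner_lsl cinner_adj_right)
    ultimately have "y \<bullet> ?T u = ?\<omega> (adj (right_ket y) oo X oo right_ket u)"
      by (simp add: sums_iff)
    then show "y \<bullet> slice_left ?\<omega> X u = y \<bullet> ?T u"
      using slice_left[OF \<omega> X] by simp
  qed
qed

text \<open>Vector functionals suffice: the series of their slices converge in norm, and a finite
  sum of them becomes a normal functional after padding with zeros.\<close>

lemma closure_slice_left:
  assumes X: "X \<in> bop"
  shows "closure {slice_left \<omega> X |\<omega>. \<omega> \<in> predual} = lalg X"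
proof
  show "closure {slice_left \<omega> X |\<omega>. \<omega> \<in> predual} \<subseteq> lalg X"
  proof (rule closure_minimal[OF _ closed_lalg], rule subsetI)
    fix S assume "S \<in> {slice_left \<omega> X |\<omega>. \<omega> \<in> predual}"
    then obtain \<xi> \<eta> where s: "summable (%n. (norm (\<xi> n))\<^sup>2)" "summable (%n. (norm (\<eta> n))\<^sup>2)"
      and S: "S = slice_left (%T. \<Sum>n. \<xi> n \<bullet> blinfun_apply T (\<eta> n)) X"
      unfolding predual_def by blast
    show "S \<in> lalg X" unfolding S slice_left_series(1)[OF s X] by (rule slice_left_series(2)[OF s X])
  qed
  have "S \<in> {slice_left \<omega> X |\<omega>. \<omega> \<in> predual}" if S: "S \<in> cspan {lsl x X z |x z. True}" for S
  proof -
    have "\<exists>(N::nat) \<xi> \<eta>. S = (\<Sum>n<N. lsl (\<xi> n) X (\<eta> n))"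
      using S
    proof (induction rule: complex_vector.span_induct_alt)
      case base
      then show ?case by (intro exI[of _ "0::nat"]) simp
    next
      case (step c s S)
      obtain x z where s: "s = lsl x X z" using step(1) by blast
      obtain N :: nat and \<xi> \<eta> where "S = (\<Sum>n<N. lsl (\<xi> n) X (\<eta> n))" using step(2) by blast
      then have "c *c s + S = (\<Sum>n<Suc N. lsl ((\<xi>(N := x)) n) X ((\<eta>(N := c *c z)) n))"
        by (simp add: s lsl_linear(2)[OF X] add.commute)
      then show ?case by blast
    qed
    then obtain N and \<xi> \<eta> :: "nat => 'a" where SN: "S = (\<Sum>n<N. lsl (\<xi> n) X (\<eta> n))" by blast
    define \<xi>' \<eta>' where "\<xi>' n = (if n < N then \<xi> n else 0)" and "\<eta>' n = (if n < N then \<eta> n else 0)" for n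
    have s: "summable (%n. (norm (\<xi>' n))\<^sup>2)" "summable (%n. (norm (\<eta>' n))\<^sup>2)"
      by (rule summable_finite[of "{..<N}"]; simp add: \<xi>'_def \<eta>'_def)+
    have "(\<Sum>n. lsl (\<xi>' n) X (\<eta>' n)) = (\<Sum>n<N. lsl (\<xi>' n) X (\<eta>' n))"
      by (rule suminf_finite) (auto simp: \<xi>'_def lsl_linear(4)[of 0, simplified])
    also have "\<dots> = S" by (simp add: SN \<xi>'_def \<eta>'_def)
    finally have "S = slice_left (%T. \<Sum>n. \<xi>' n \<bullet> blinfun_apply T (\<eta>' n)) X"
      using slice_left_series(1)[OF s X] by simp
    moreover have "(%T. \<Sum>n. \<xi>' n \<bullet> blinfun_apply T (\<eta>' n)) \<in> predual" unfolding predual_def using s by blast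
    ultimately show ?thesis by blast
  qed
  then show "lalg X \<subseteq> closure {slice_left \<omega> X |\<omega>. \<omega> \<in> predual}"
    unfolding lalg_def ccl_def by (intro closure_mono) blast
qed

lemma slice_right_flip: "slice_right \<omega> X = slice_left \<omega> (flip oo X oo flip)"
proof -
  have "adj (right_ket y) oo (flip oo X oo flip) oo right_ket u = adj (left_ket y) oo X oo left_ket u" for y u
  proof -
    have "adj (right_ket y) oo (flip oo X oo flip) oo right_ket u = (adj (right_ket y) oo flip) oo X oo (flip oo right_ket u)"
      by simp
    then show ?thesis by (simp only: adj_right_ket_flip flip_right_ket)
  qed
  then show ?thesis unfolding slice_right_def slice_left_def by simp
qed

lemma dual_algebra_eq: "W \<in> bop ==> dual_algebra W = lalg (dualu W)"
  unfolding dual_algebra_def slice_right_flip dualu_def by (rule closure_slice_left) simp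

lemma quantum_groupD:
  assumes "quantum_group W C \<Delta>"
  shows "modular_multiplicative_unitary W" "unitary W" "multiplicative W" "C = lalg W"
    "\<Delta> = (\<lambda>x\<in>C. W oo (x ** \<one>) oo adj W)"
proof -
  show m: "modular_multiplicative_unitary W" and "\<Delta> = (\<lambda>x\<in>C. W oo (x ** \<one>) oo adj W)"
    using assms unfolding quantum_group_def by auto
  then show u: "unitary W" "multiplicative W" unfolding modular_multiplicative_unitary_def by auto
  show "C = lalg W"
    using assms closure_slice_left[OF unitaryD(1)[OF u(1)]] unfolding quantum_group_def by simp
qed

lemma dual_comult_eq:
  fixes W :: "('a::complex_hilbert, 'a) htensor -> ('a, 'a) htensor"
  assumes W: "unitary W" and y: "y \<in> dual_algebra W"
  shows "dual_comult W y = dualu W oo (y ** \<one>) oo adj (dualu W)"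
proof -
  have yb: "y \<in> bop" using y dual_algebra_eq[OF unitaryD(1)[OF W]] lalg_bop[of "dualu W"] unitaryD(1)[OF W]
    by (auto simp: dualu_def)
  have "flip oo (y ** (\<one> :: 'a -> 'a)) oo flip = \<one> ** y"
    unfolding flip_tensor_op[OF yb bop_id] by simp
  then have "flip oo adj W oo (\<one> ** y) oo W oo flip = flip oo adj W oo (flip oo (y ** \<one>) oo flip) oo W oo flip"
    by (simp only:)
  then show ?thesis using y unitaryD(1)[OF W] by (simp add: dual_comult_def dualu_def)
qed

section \<open>Scalar slices\<close>

lemma eigen_scalar:
  fixes T :: "'a::complex_hilbert -> 'a"
  assumes T: "T \<in> bop" and e: "\<And>y. \<exists>c. T y = c *c y"
  shows "\<exists>c. T = c *c \<one>"
proof (cases "\<exists>y::'a. y \<noteq> 0")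
  case True
  then obtain y :: 'a where y: "y \<noteq> 0" by blast
  obtain c where c: "T y = c *c y" using e by blast
  have "T x = c *c x" for x
  proof -
    obtain d where d: "T x = d *c x" using e by blast
    obtain k where k: "T (x + y) = k *c (x + y)" using e by blast
    have lin: "(d - k) *c x = (k - c) *c y"
      using k by (simp add: blinfun.add_right c d scaleC_add_right scaleC.diff_left algebra_simps)
    show ?thesis
    proof (cases "d = k")
      case True
      then have "k = c" using lin y by (auto simp: scaleC.diff_left[symmetric] dest: arg_cong[of _ _ norm])
      then show ?thesis using d True by simp
    next
      case False
      have "x = (1 / (d - k)) *c ((d - k) *c x)" using False by (simp add: scaleC_scaleC)
      then have "x = ((k - c) / (d - k)) *c y" using lin by (simp add: scaleC_scaleC)
      then obtain r where "x = r *c y" by blast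
      then show ?thesis by (simp add: bop_scaleC[OF T] c scaleC_scaleC mult.commute)
    qed
  qed
  then have "T = c *c \<one>" by (intro blinfun_eqI) (simp add: scaleC_blinfun_apply)
  then show ?thesis by blast
next
  case False
  then have "T = 0 *c \<one>" by (intro blinfun_eqI) auto
  then show ?thesis by blast
qed

context modular_data
begin

text \<open>As \<open>W\<close> commutes with the flow, an intertwining relation can be carried
  along the flow and then averaged.\<close>

lemma W_flow_intertwine:
  assumes a: "a \<in> bop" and b: "b \<in> bop" and ab: "W oo (a ** \<one>) = (\<one> ** b) oo W"
  shows "W oo ((h.U t oo a oo h.U (- t)) ** \<one>) = (\<one> ** (f.U t oo b oo f.U (- t))) oo W"
proof -
  have u: "f.U t oo f.U (- t) = \<one>" "h.U t oo h.U (- t) = \<one>"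
    using f.U_add[of t "- t"] h.U_add[of t "- t"] by (simp_all add: f.U_0 h.U_0)
  have 1: "(h.U t oo a oo h.U (- t)) ** \<one> = UU t oo (a ** \<one>) oo UU (- t)"
    using a by (simp add: UU_def tensor_op_compose u)
  have 2: "\<one> ** (f.U t oo b oo f.U (- t)) = UU t oo (\<one> ** b) oo UU (- t)"
    using b by (simp add: UU_def tensor_op_compose u)
  have "W oo (UU t oo (a ** \<one>) oo UU (- t)) = (UU t oo (W oo (a ** \<one>))) oo UU (- t)"
    by (simp add: compose_reassoc[OF W_UU])
  also have "\<dots> = (UU t oo (\<one> ** b) oo UU (- t)) oo W"
    by (simp add: ab W_UU)
  finally show ?thesis unfolding 1 2 .
qed

lemma continuous_U_conj:
  assumes "b \<in> bop"
  shows "continuous_on UNIV (%t. f.U (- t) (blinfun_apply b (f.U t y)))" "continuous_on UNIV (%t. h.U (- t) (blinfun_apply b (h.U t y)))"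
proof -
  have gen: "continuous_on UNIV (%t. V (- t) (blinfun_apply b (V t y)))"
    if V: "\<And>t x. ((%s. V s x) \<longlongrightarrow> V t x) (at t)" "\<And>t. unitary (V t)" for V :: "real => 'a -> 'a"
  proof (intro continuous_at_imp_continuous_on ballI)
    fix t :: real
    have neg: "((%s. V (- s) x) \<longlongrightarrow> V (- t) x) (at t)" for x
    proof -
      have "isCont (%s. V s x) (- t)" using V(1) by (simp add: isCont_def)
      then have "isCont (%s. V (- s) x) t" by (intro isCont_o2[of t uminus "%s. V s x"]) auto
      then show ?thesis by (simp add: isCont_def)
    qed
    have "((%s. V (- s) (b (V s y) - b (V t y)) + V (- s) (b (V t y))) \<longlongrightarrow> 0 + V (- t) (b (V t y))) (at t)"
    proof (intro tendsto_add neg)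
      have "((%s. norm (b (V s y) - b (V t y))) \<longlongrightarrow> 0) (at t)"
        by (intro tendsto_norm_zero LIM_zero bounded_linear.tendsto[OF blinfun.bounded_linear_right] V)
      then show "((%s. V (- s) (b (V s y) - b (V t y))) \<longlongrightarrow> 0) (at t)"
        by (rule Lim_null_comparison[rotated]) (simp add: norm_unitary[OF V(2)])
    qed
    then show "isCont (%t. V (- t) (b (V t y))) t" by (simp add: isCont_def blinfun.diff_right)
  qed
  show "continuous_on UNIV (%t. f.U (- t) (blinfun_apply b (f.U t y)))" "continuous_on UNIV (%t. h.U (- t) (blinfun_apply b (h.U t y)))"
    by (rule gen; simp add: f.U_tendsto h.U_tendsto)+
qed

text \<open>\<open>a z\<close> need not lie in the domain of \<open>Q'\<close>, but its Gaussian
  average along the flow does: a contour shift moves \<open>Q'\<close> from one side of the inner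
  product into the integrand, which becomes \<open>c\<close>.\<close>

lemma mollified_domain:
  assumes a: "a \<in> bop" and z: "z \<in> E'"
  shows "\<exists>s'. (wint (%t. gauss n t *\<^sub>R h.U (- t) (blinfun_apply a (h.U t z))), s') \<in> Q'"
proof -
  define s where "s = wint (%t. gauss n t *\<^sub>R h.U (- t) (blinfun_apply a (h.U t z)))"
  define g where "g z = exp (- (of_nat (Suc n) * z\<^sup>2))" for z :: complex
  \<comment> \<open>z1 = Q' z, so that z is the value at i of the orbit of \<open>z1\<close>; the
    contour shifted down by i meets the bounded orbit of \<open>z1\<close> itself.\<close>
  define z1 where "z1 = q' (-\<i>) z"
  have z1: "z1 \<in> E'" unfolding z1_def by (rule h.q_in[OF z])
  have gr: "g (of_real t) = of_real (gauss n t)" for t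
    unfolding g_def gauss_def by (simp flip: exp_of_real)
  have gb: "cmod (g z) \<le> exp (real (Suc n)) * exp (- (Re z)\<^sup>2)" if "\<bar>Im z\<bar> \<le> 1" for z
  proof -
    have "(Im z)\<^sup>2 \<le> 1" using that by (simp add: abs_square_le_1)
    then have "real (Suc n) * (Im z)\<^sup>2 \<le> real (Suc n)" by (rule mult_left_le) simp
    moreover have "0 \<le> real n * (Re z)\<^sup>2" by simp
    moreover have "Re (- (of_nat (Suc n) * z\<^sup>2)) = real (Suc n) * (Im z)\<^sup>2 - real (Suc n) * (Re z)\<^sup>2"
    proof -
      have "Re (of_nat (Suc n) * z\<^sup>2) = real (Suc n) * Re (z\<^sup>2)"
        by (simp only: times_complex.sel complex_Re_of_nat complex_Im_of_nat)
      then show ?thesis by (simp add: Re_power2 right_diff_distrib del: of_nat_Suc)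
    qed
    moreover have "real (Suc n) * (Re z)\<^sup>2 = real n * (Re z)\<^sup>2 + (Re z)\<^sup>2" by (simp add: distrib_right)
    ultimately have "Re (- (of_nat (Suc n) * z\<^sup>2)) \<le> real (Suc n) + - (Re z)\<^sup>2" by linarith
    then show ?thesis unfolding g_def exp_add[symmetric] by simp
  qed
  have nb: "norm (h.U (- t) (blinfun_apply a (h.U t x))) \<le> norm a * norm x" for t x
    using norm_blinfun[of a "h.U t x"] by (simp add: norm_unitary)
  have gd: "gdec (%t. gauss n t *\<^sub>R h.U (- t) (blinfun_apply a (h.U t z)))"
    by (rule gdec_gauss_scaleR[OF continuous_U_conj(2)[OF a] nb])
  define c where "c t = g (of_real t - \<i>) *c h.U (- t) (blinfun_apply a (h.U t z1))" for t
  have gc: "gdec c"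
  proof -
    have "norm (c t) \<le> (exp (real (Suc n)) * (norm a * norm z1)) * exp (- t\<^sup>2)" for t
      unfolding c_def norm_scaleC_eq using mult_mono[OF gb[of "of_real t - \<i>"] nb[of t z1]] by (simp add: ac_simps)
    moreover have "continuous_on UNIV c" unfolding c_def g_def
      by (intro scaleC.continuous_on continuous_U_conj[OF a] continuous_intros)
    ultimately show ?thesis unfolding gdec_def by (intro conjI exI allI)
  qed
  have "(s, wint c) \<in> Q'"
  proof (rule positive_kernelD(4)[OF pos'])
    fix x w assume xw: "(x, w) \<in> Q'"
    have E': "q' (-\<i>) y \<bullet> s = y \<bullet> wint c" if y: "y \<in> E'" for y
    proof -
      define k where "k \<zeta> = g (\<zeta> - \<i>) * (q' (cnj \<zeta>) y \<bullet> a (q' \<zeta> z1))" for \<zeta>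
      have hol: "(%\<zeta>. g \<zeta> * (q' (cnj (\<zeta> + \<i>)) y \<bullet> a (q' (\<zeta> + \<i>) z1))) holomorphic_on UNIV"
      proof -
        have "(%\<zeta>. q' (cnj \<zeta>) y \<bullet> a (q' \<zeta> z1)) holomorphic_on UNIV"
          by (intro holomorphic_cinner cholo_op h.aholo_q h.cholo_q y z1 a)
        from holomorphic_on_compose_gen[OF _ this, of "%\<zeta>. \<zeta> + \<i>" UNIV]
        have "(%\<zeta>. q' (cnj (\<zeta> + \<i>)) y \<bullet> a (q' (\<zeta> + \<i>) z1)) holomorphic_on UNIV"
          by (simp add: o_def holomorphic_intros)
        then show ?thesis unfolding g_def by (intro holomorphic_intros)
      qed
      obtain Ky where Ky: "\<And>\<zeta>. \<bar>Im \<zeta>\<bar> \<le> 2 ==> norm (q' \<zeta> y) \<le> Ky" using h.q_strip_bound[OF y, of 2] by blast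
      obtain Kz where Kz: "\<And>\<zeta>. \<bar>Im \<zeta>\<bar> \<le> 2 ==> norm (q' \<zeta> z1) \<le> Kz" using h.q_strip_bound[OF z1, of 2] by blast
      have bd: "cmod (g \<zeta> * (q' (cnj (\<zeta> + \<i>)) y \<bullet> a (q' (\<zeta> + \<i>) z1))) \<le> (exp (real (Suc n)) * (Ky * (norm a * Kz))) * exp (- (Re \<zeta>)\<^sup>2)"
        if im: "\<bar>Im \<zeta>\<bar> \<le> 1" for \<zeta>
      proof -
        have i2: "\<bar>Im (cnj (\<zeta> + \<i>))\<bar> \<le> 2" "\<bar>Im (\<zeta> + \<i>)\<bar> \<le> 2" using im by auto
        have "cmod (q' (cnj (\<zeta> + \<i>)) y \<bullet> a (q' (\<zeta> + \<i>) z1)) \<le> norm (q' (cnj (\<zeta> + \<i>)) y) * (norm a * norm (q' (\<zeta> + \<i>) z1))"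
          by (rule order_trans[OF norm_cinner mult_left_mono[OF norm_blinfun]]) simp
        also have "\<dots> \<le> Ky * (norm a * Kz)"
          using order_trans[OF norm_ge_zero Ky[OF i2(1)]] by (intro mult_mono mult_left_mono Ky Kz i2) auto
        finally have "cmod (g \<zeta>) * cmod (q' (cnj (\<zeta> + \<i>)) y \<bullet> a (q' (\<zeta> + \<i>) z1))
            \<le> (exp (real (Suc n)) * exp (- (Re \<zeta>)\<^sup>2)) * (Ky * (norm a * Kz))"
          by (intro mult_mono gb im) auto
        then show ?thesis unfolding norm_mult by (simp only: ac_simps)
      qed
      have t0: "q' (-\<i>) y \<bullet> h.U (- t) (blinfun_apply a (h.U t z)) = q' (cnj (of_real t + \<i>)) y \<bullet> a (q' (of_real t + \<i>) z1)" for t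
      proof -
        have "q' (-\<i>) y \<bullet> h.U (- t) (blinfun_apply a (h.U t z)) = h.U t (q' (-\<i>) y) \<bullet> a (h.U t z)"
          using cinner_adj_right[OF h.U(1), of "q' (-\<i>) y" t] by (simp add: h.adj_U)
        moreover have "h.U t (q' (-\<i>) y) = q' (cnj (of_real t + \<i>)) y"
          using h.q_add[OF y, of "of_real t" "-\<i>"] by (simp add: h.U h.q_in y)
        moreover have "h.U t z = q' (of_real t + \<i>) z1"
          using h.q_add[OF z1, of "of_real t" \<i>] h.q_inv(2)[OF z, of \<i>] by (simp add: h.U z z1_def)
        ultimately show ?thesis by (simp only:)
      qed
      have t1: "y \<bullet> c t = g (of_real t - \<i>) * (q' (cnj (of_real t - \<i> + \<i>)) y \<bullet> a (q' (of_real t - \<i> + \<i>) z1))" for t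
      proof -
        have "y \<bullet> h.U (- t) (blinfun_apply a (h.U t z1)) = h.U t y \<bullet> a (h.U t z1)"
          using cinner_adj_right[OF h.U(1), of y t] by (simp add: h.adj_U)
        then show ?thesis by (simp add: c_def h.U y z1 del: Im_shift)
      qed
      have "q' (-\<i>) y \<bullet> s = wint (%t. q' (-\<i>) y \<bullet> (gauss n t *\<^sub>R h.U (- t) (blinfun_apply a (h.U t z))))"
        unfolding s_def by (rule wint_linear(2)[OF gd cinner.bounded_linear_right, symmetric])
      also have "\<dots> = wint (%t. g (of_real t) * (q' (cnj (of_real t + \<i>)) y \<bullet> a (q' (of_real t + \<i>) z1)))"
        by (simp add: scaleR_scaleC t0 gr)
      also have "\<dots> = wint (%t. g (of_real t - \<i>) * (q' (cnj (of_real t - \<i> + \<i>)) y \<bullet> a (q' (of_real t - \<i> + \<i>) z1)))"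
        by (rule contour_shift(3)[OF hol bd])
      also have "\<dots> = y \<bullet> wint c"
        unfolding t1[symmetric] by (rule wint_linear(2)[OF gc cinner.bounded_linear_right])
      finally show ?thesis .
    qed
    \<comment> \<open>E' is a core, so the identity extends to the whole graph of \<open>Q'\<close>;
      self-adjointness then puts the average into the domain.\<close>
    obtain \<sigma> where \<sigma>: "\<And>n. \<sigma> n \<in> E'" "\<sigma> ----> x" "(%n. q' (-\<i>) (\<sigma> n)) ----> w"
      using h.q_core[OF xw] by blast
    have "(%n. q' (-\<i>) (\<sigma> n) \<bullet> s) ----> w \<bullet> s" "(%n. \<sigma> n \<bullet> wint c) ----> x \<bullet> wint c"
      by (intro cinner.tendsto tendsto_const \<sigma>)+
    then show "w \<bullet> s = x \<bullet> wint c" using E'[OF \<sigma>(1)] LIMSEQ_unique by simp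
  qed
  then show ?thesis unfolding s_def by blast
qed

text \<open>After averaging, the relation matches s, the average of a z, with r, the average of
  \<open>adj b\<close> y, and s lies in the domain of \<open>Q'\<close>.
  \<open>conj_relation\<close> rewrites the match for the companion, which is unitary and cancels:
  bar (Q' s) tensor y = bar (Q' z) tensor r. So r is a multiple of y, and in the limit every y is an
  eigenvector of \<open>adj b\<close>.\<close>

theorem intertwiner_scalar:
  assumes a: "a \<in> bop" and b: "b \<in> bop" and ab: "W oo (a ** \<one>) = (\<one> ** b) oo W"
  shows "\<exists>c. a = c *c \<one>"
proof (cases "\<exists>z\<in>E'. z \<noteq> 0")
  case True
  then obtain z where z: "z \<in> E'" "z \<noteq> 0" by blast
  have z': "(z, q' (-\<i>) z) \<in> Q'" by (rule h.q_graph[OF z(1)])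
  have nz: "q' (-\<i>) z \<noteq> 0" using positive_kernelD(6)[OF pos', of z] z' z(2) by auto
  have "\<exists>c. adj b y = c *c y" for y
  proof -
    let ?r = "%t. f.U (- t) (adj b (f.U t y))"
    have nb: "norm (?r t) \<le> norm (adj b) * norm y" for t
      using norm_blinfun[of "adj b" "f.U t y"] by (simp add: norm_unitary)
    have nbz: "norm (h.U (- t) (a (h.U t z))) \<le> norm a * norm z" for t
      using norm_blinfun[of a "h.U t z"] by (simp add: norm_unitary)
    note cr = continuous_U_conj(1)[OF bop_adj[OF b], of y]
    have "?r 0 \<in> ccl {y}"
    proof (rule gauss_approx[OF cr nb])
      fix n
      note gr = gdec_gauss_scaleR[OF cr nb, of n] and gs = gdec_gauss_scaleR[OF continuous_U_conj(2)[OF a] nbz, of n]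
      define r where "r = wint (%t. gauss n t *\<^sub>R ?r t)"
      define s where "s = wint (%t. gauss n t *\<^sub>R h.U (- t) (a (h.U t z)))"
      obtain s' where s': "(s, s') \<in> Q'" using mollified_domain[OF a z(1), of n] unfolding s_def by blast
      have point: "(x \<otimes> y) \<bullet> W (h.U (- t) (a (h.U t z)) \<otimes> u) = ?r t \<bullet> lsl x W z u" for x u t
      proof -
        have eq: "W oo ((h.U (- t) oo a oo h.U t) ** \<one>) = (\<one> ** (f.U (- t) oo b oo f.U t)) oo W"
          using W_flow_intertwine[OF a b ab, of "- t"] by simp
        have "(x \<otimes> y) \<bullet> W (h.U (- t) (a (h.U t z)) \<otimes> u) = (x \<otimes> y) \<bullet> (\<one> ** (f.U (- t) oo b oo f.U t)) (W (z \<otimes> u))"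
          using arg_cong[OF eq, of "%T. blinfun_apply T (z \<otimes> u)"] a by simp
        also have "\<dots> = adj (\<one> ** (f.U (- t) oo b oo f.U t)) (x \<otimes> y) \<bullet> W (z \<otimes> u)"
          using b by (subst cinner_adj) simp_all
        also have "adj (\<one> ** (f.U (- t) oo b oo f.U t)) (x \<otimes> y) = x \<otimes> ?r t"
          using b by (simp add: f.adj_U)
        finally show ?thesis by (simp add: cinner_lsl)
      qed
      have "(x \<otimes> y) \<bullet> W (s \<otimes> u) = (x \<otimes> r) \<bullet> W (z \<otimes> u)" for x u
      proof -
        have "(x \<otimes> y) \<bullet> W (s \<otimes> u) = wint (%t. (x \<otimes> y) \<bullet> W ((gauss n t *\<^sub>R h.U (- t) (a (h.U t z))) \<otimes> u))"
          unfolding s_def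
          by (rule wint_linear(2)[OF gs, symmetric])
             (intro bounded_linear_compose[OF cinner.bounded_linear_right] bounded_linear_compose[OF blinfun.bounded_linear_right] tens.bounded_linear_left)
        also have "\<dots> = wint (%t. (gauss n t *\<^sub>R ?r t) \<bullet> lsl x W z u)"
          by (simp add: tens.scaleR_left blinfun.scaleR_right cinner.scaleR_right cinner.scaleR_left point)
        also have "\<dots> = r \<bullet> lsl x W z u"
          unfolding r_def by (rule wint_linear(2)[OF gr cinner.bounded_linear_left])
        finally show ?thesis by (simp add: cinner_lsl)
      qed
      then have "lsl x W s u \<bullet> y = lsl x W z u \<bullet> r" for x u
        by (metis cinner_commute cinner_lsl)
      then have eq: "y \<bullet> lsl x W s u = r \<bullet> lsl x W z u" for x u
        by (metis cinner_commute)
      have "adj W' (bar s' \<otimes> y) = adj W' (bar (q' (-\<i>) z) \<otimes> r)"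
      proof (rule eq_on_total[OF ccl_tens_dense[OF total_bar[OF h.total] ccl_id[OF complex_vector.subspace_UNIV closed_UNIV]]])
        fix v assume "v \<in> {x \<otimes> (u::'a) |x u. x \<in> bar ` E' \<and> u \<in> UNIV}"
        then obtain x u where v: "v = bar x \<otimes> u" "x \<in> E'" by auto
        have x': "(x, q' (-\<i>) x) \<in> Q'" by (rule h.q_graph[OF v(2)])
        have "(bar s' \<otimes> y) \<bullet> W' v = (bar (q' (-\<i>) z) \<otimes> r) \<bullet> W' v"
          using eq[of "q' (-\<i>) x" u] by (simp add: v cinner_lsl[symmetric] conj_relation[OF s' x', symmetric] conj_relation[OF z' x', symmetric])
        then have "cnj ((bar s' \<otimes> y) \<bullet> W' v) = cnj ((bar (q' (-\<i>) z) \<otimes> r) \<bullet> W' v)" by simp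
        then show "v \<bullet> adj W' (bar s' \<otimes> y) = v \<bullet> adj W' (bar (q' (-\<i>) z) \<otimes> r)"
          by (simp add: cinner_adj_right cinner_commute[symmetric])
      qed
      then have "bar s' \<otimes> y = bar (q' (-\<i>) z) \<otimes> r"
        by (metis unitaryD(5)[OF W'])
      then have "adj (left_ket (bar (q' (-\<i>) z))) (bar s' \<otimes> y) = adj (left_ket (bar (q' (-\<i>) z))) (bar (q' (-\<i>) z) \<otimes> r)"
        by simp
      then have m: "(bar (q' (-\<i>) z) \<bullet> bar s') *c y = (bar (q' (-\<i>) z) \<bullet> bar (q' (-\<i>) z)) *c r" by simp
      define \<mu> where "\<mu> = bar (q' (-\<i>) z) \<bullet> bar (q' (-\<i>) z)"
      have "\<mu> \<noteq> 0" using nz by (simp add: \<mu>_def cinner_self bar_simps)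
      then have "r = (1 / \<mu>) *c (\<mu> *c r)" by (simp add: scaleC_scaleC)
      also have "\<dots> = (1 / \<mu>) *c (bar (q' (-\<i>) z) \<bullet> bar s') *c y" unfolding m[folded \<mu>_def] ..
      also have "\<dots> \<in> ccl {y}" by (intro csubspaceD(3)[OF csubspace_ccl] ccl_base) simp
      finally show "wint (%t. gauss n t *\<^sub>R ?r t) \<in> ccl {y}" unfolding r_def .
    qed simp_all
    then have "adj b y \<in> ccl {y}" by (simp add: f.U_0)
    \<comment> \<open>The projection formula describes the line through y by a closed condition,
      with y = 0 treated apart.\<close>
    also have "ccl {y} \<subseteq> {v. v = (if y = 0 then 0 else ((y \<bullet> v) / (y \<bullet> y)) *c y)}"
    proof (rule ccl_minimal)
      show "csubspace {v. v = (if y = 0 then 0 else ((y \<bullet> v) / (y \<bullet> y)) *c y)}"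
        by (rule csubspaceI) (auto simp: cinner_add_right add_divide_distrib scaleC_add_left scaleC_scaleC
            simp flip: times_divide_eq_right split: if_splits, metis scaleC_scaleC)
      show "closed {v. v = (if y = 0 then 0 else ((y \<bullet> v) / (y \<bullet> y)) *c y)}"
        by (cases "y = 0") (auto intro!: closed_Collect_eq continuous_intros scaleC.continuous_on cinner.continuous_on simp: cinner_self)
    qed (auto simp: cinner_self)
    finally show ?thesis by (auto split: if_splits intro: exI[of _ 0])
  qed
  then obtain c where c: "adj b = c *c \<one>" using eigen_scalar[OF bop_adj[OF b]] by blast
  have "b = cnj c *c \<one>" using arg_cong[OF c, of adj] b by simp
  then have "W oo (a ** \<one>) = cnj c *c W" using ab by (simp add: tensor_op_linear)
  then have "adj W oo (W oo (a ** \<one>)) = adj W oo (cnj c *c W)" by simp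
  then have "a ** \<one> = cnj c *c (\<one> :: ('a, 'a) htensor -> _)" by (simp add: unitaryD(2,6)[OF W])
  then have "rsl z (a ** \<one>) z = rsl z (cnj c *c (\<one> ** \<one>)) z" by simp
  then have e: "(z \<bullet> z) *c a = (z \<bullet> z) *c cnj c *c \<one>"
    using a rsl_tensor_op[of "\<one> :: 'a -> 'a" "\<one> :: 'a -> 'a" z z]
    by (simp add: rsl_tensor_op rsl_linear scaleC_scaleC mult.commute)
  have "z \<bullet> z \<noteq> 0" using z(2) by (simp add: cinner_self)
  then have "a = cnj c *c \<one>"
    using arg_cong[OF e, of "%T. (1 / (z \<bullet> z)) *c T"] by (simp add: scaleC_scaleC)
  then show ?thesis by blast
next
  case False
  then have "x = (0::'a)" for x
    using total_orthogonal_0[OF h.total, of x] by (metis cinner.zero_left)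
  then have "a = 0 *c \<one>" by (intro blinfun_eqI) metis
  then show ?thesis by blast
qed

end

section \<open>Homomorphisms of operator algebras\<close>

text \<open>\<open>cstar\<close> without nondegeneracy and factorization, as needed for multiplier
  algebras and for the matrix algebras in \<open>slrel_norm\<close>.\<close>

definition staralg :: "('a::complex_hilbert -> 'a) set => bool" where
  "staralg A \<longleftrightarrow> A \<subseteq> bop \<and> csubspace A \<and> closed A \<and> (\<forall>a\<in>A. \<forall>b\<in>A. a oo b \<in> A) \<and> (\<forall>a\<in>A. adj a \<in> A)"

definition starhom :: "('a::complex_hilbert -> 'a) set => (('a -> 'a) => ('b::complex_hilbert -> 'b)) => bool" where
  "starhom A \<phi> \<longleftrightarrow> (\<forall>a\<in>A. \<phi> a \<in> bop) \<and> (\<forall>a\<in>A. \<forall>b\<in>A. \<phi> (a + b) = \<phi> a + \<phi> b) \<and>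
    (\<forall>c. \<forall>a\<in>A. \<phi> (c *c a) = c *c \<phi> a) \<and> (\<forall>a\<in>A. \<forall>b\<in>A. \<phi> (a oo b) = \<phi> a oo \<phi> b) \<and>
    (\<forall>a\<in>A. \<phi> (adj a) = adj (\<phi> a))"

lemma staralgD:
  assumes "staralg A"
  shows "a \<in> A ==> a \<in> bop" "A \<subseteq> bop" "csubspace A" "closed A" "a \<in> A ==> b \<in> A ==> a oo b \<in> A" "a \<in> A ==> adj a \<in> A"
  using assms unfolding staralg_def by blast+

lemma starhomD:
  assumes "starhom A \<phi>"
  shows "a \<in> A ==> \<phi> a \<in> bop" "a \<in> A ==> b \<in> A ==> \<phi> (a + b) = \<phi> a + \<phi> b" "a \<in> A ==> \<phi> (c *c a) = c *c \<phi> a"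
    "a \<in> A ==> b \<in> A ==> \<phi> (a oo b) = \<phi> a oo \<phi> b" "a \<in> A ==> \<phi> (adj a) = adj (\<phi> a)"
  using assms unfolding starhom_def by blast+

lemma starhom_diff:
  assumes A: "staralg A" and \<phi>: "starhom A \<phi>" and ab: "a \<in> A" "b \<in> A"
  shows "\<phi> (a - b) = \<phi> a - \<phi> b"
proof -
  have "(-1) *c b \<in> A" by (rule csubspaceD(3)[OF staralgD(3)[OF A] ab(2)])
  from starhomD(2)[OF \<phi> ab(1) this] starhomD(3)[OF \<phi> ab(2), of "-1"] show ?thesis
    by (simp add: scaleC.minus_left)
qed

lemma starhom_0: "staralg A ==> starhom A \<phi> ==> \<phi> 0 = 0"
  using starhom_diff[of A \<phi> 0 0] csubspaceD(1)[OF staralgD(3)] by auto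

lemma starhom_sum:
  assumes A: "staralg A" and \<phi>: "starhom A \<phi>" and a: "\<And>i. i \<in> F ==> a i \<in> A"
  shows "\<phi> (\<Sum>i\<in>F. a i) = (\<Sum>i\<in>F. \<phi> (a i))"
  using a
proof (induction F rule: infinite_finite_induct)
  case (insert x F)
  then have "(\<Sum>i\<in>F. a i) \<in> A" by (intro complex_vector.subspace_sum staralgD(3)[OF A]) auto
  then show ?case using insert by (simp add: starhomD(2)[OF \<phi>])
qed (simp_all add: starhom_0[OF A \<phi>])

lemma closed_selfadjoint: "closed {b \<in> bop. adj b = (b :: 'a::complex_hilbert -> 'a)}"
  unfolding closed_sequential_limits
proof (intro allI impI)
  fix f and l :: "'a -> 'a"
  assume f: "(\<forall>n. f n \<in> {b \<in> bop. adj b = b}) \<and> f ----> l"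
  then have fb: "\<And>n. f n \<in> bop" and fa: "\<And>n. adj (f n) = f n" and lim: "f ----> l" by auto
  have l: "l \<in> bop" by (rule closed_sequentially[OF closed_bop _ lim]) (simp add: fb)
  have "adj l = l"
    by (rule LIMSEQ_unique[OF tendsto_adj[OF fb l lim, unfolded fa] lim])
  with l show "l \<in> {b \<in> bop. adj b = b}" by simp
qed

text \<open>The fixed point satisfies \<open>(1 - b)\<^sup>2 = 1 - h\<close>, so that \<open>1 - b\<close> replaces the square root of \<open>1 - h\<close>.\<close>

lemma ex_square_root:
  assumes A: "staralg A" and h: "h \<in> A" "adj h = h" "norm h < 1"
  shows "\<exists>b\<in>A. adj b = b \<and> b + b = h + (b oo b)"
proof -
  define r where "r = norm h"
  have r: "0 \<le> r" "r < 1" using h by (simp_all add: r_def)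
  define s where "s = A \<inter> {b \<in> bop. adj b = b} \<inter> cball 0 r"
  \<comment> \<open>2 b = h + b^2 is solved as a fixed point equation. On the ball of radius r = |h|
    < 1 the map is a contraction with constant r, and it preserves both \<open>A\<close> and
    self-adjointness.\<close>
  define f where "f b = (1/2) *\<^sub>R (h + (b oo b))" for b
  have nb: "norm (b oo b) \<le> r" if "norm b \<le> r" for b :: "'a -> 'a"
  proof -
    have "norm (b oo b) \<le> norm b * norm b" by (rule norm_blinfun_compose)
    also have "\<dots> \<le> r * 1" using that r by (intro mult_mono) auto
    finally show ?thesis by simp
  qed
  have "\<exists>!b\<in>s. f b = b"
  proof (rule Banach_fix)
    show "complete s"
      unfolding complete_eq_closed s_def by (intro closed_Int closed_cball closed_selfadjoint staralgD(4)[OF A])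
    have "0 \<in> s" using csubspaceD(1)[OF staralgD(3)[OF A]] r by (simp add: s_def)
    then show "s \<noteq> {}" by blast
    show "f ` s \<subseteq> s"
    proof
      fix y assume "y \<in> f ` s"
      then obtain b where y: "y = f b" and b: "b \<in> A" "b \<in> bop" "adj b = b" "norm b \<le> r"
        by (auto simp: s_def)
      have "f b \<in> A" unfolding f_def
        by (intro csubspaceD(5)[OF staralgD(3)[OF A]] csubspaceD(2)[OF staralgD(3)[OF A]] h staralgD(5)[OF A] b)
      moreover have "adj (f b) = f b"
        using staralgD(1)[OF A h(1)] b by (simp add: f_def scaleR_scaleC h(2))
      moreover have "norm (f b) \<le> r"
        using norm_triangle_ineq[of h "b oo b"] nb[OF b(4)] by (simp add: f_def r_def[symmetric])
      ultimately show "y \<in> s" using staralgD(1)[OF A] by (simp add: s_def y)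
    qed
    show "dist (f x) (f y) \<le> r * dist x y" if "x \<in> s" "y \<in> s" for x y
    proof -
      have n: "norm x \<le> r" "norm y \<le> r" using that by (auto simp: s_def)
      have "f x - f y = (1/2) *\<^sub>R ((x oo (x - y)) + ((x - y) oo y))"
        by (simp add: f_def compose_diff scaleR_diff_right[symmetric] del: scaleR_diff_right)
      then have "norm (f x - f y) \<le> (1/2) * (norm x * norm (x - y) + norm (x - y) * norm y)"
        by (simp add: norm_triangle_le[OF add_mono[OF norm_blinfun_compose norm_blinfun_compose]])
      also have "\<dots> \<le> (1/2) * (r * norm (x - y) + norm (x - y) * r)"
        using n by (intro mult_left_mono add_mono mult_right_mono) auto
      finally show ?thesis by (simp add: dist_norm)
    qed
  qed (use r in auto)
  then obtain b where b: "b \<in> s" "f b = b" by blast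
  have "b + b = 2 *\<^sub>R f b" by (simp add: b(2) scaleR_2)
  also have "\<dots> = h + (b oo b)" by (simp add: f_def)
  finally show ?thesis using b(1) by (auto simp: s_def)
qed

text \<open>For |a| < 1 the element b of \<open>ex_square_root\<close> with h =
  \<open>adj a oo a\<close> satisfies |x - \<phi>(b) x|^2 = |x|^2 - |\<phi>(a) x|^2, which bounds
  \<phi>(a). Rescaling gives the general case.\<close>

lemma starhom_contractive:
  assumes A: "staralg A" and \<phi>: "starhom A \<phi>" and a: "a \<in> A"
  shows "norm (\<phi> a) \<le> norm a"
proof -
  have c1: "norm (\<phi> a) \<le> 1" if a: "a \<in> A" "norm a < 1" for a
  proof (rule norm_blinfun_bound)
    have ab: "a \<in> bop" by (rule staralgD(1)[OF A a(1)])
    have "norm (adj a oo a) \<le> norm a * norm a"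
      using norm_blinfun_compose[of "adj a" a] by (simp add: norm_adj ab)
    also have "\<dots> < 1" using mult_strict_mono'[OF a(2) a(2)] by simp
    finally obtain b where b: "b \<in> A" "adj b = b" "b + b = (adj a oo a) + (b oo b)"
      using ex_square_root[OF A staralgD(5)[OF A staralgD(6)[OF A a(1)] a(1)]] ab by auto
    have pb: "\<phi> b \<in> bop" "\<phi> a \<in> bop" "adj (\<phi> b) = \<phi> b"
      using starhomD(1,5)[OF \<phi>] a b(1,2) by (auto simp: b(2))
       (metis b(1,2) \<phi> starhomD(5))
    have "\<phi> (b + b) = \<phi> ((adj a oo a) + (b oo b))" by (simp only: b(3))
    then have eq: "\<phi> b + \<phi> b = (adj (\<phi> a) oo \<phi> a) + (\<phi> b oo \<phi> b)"
      by (simp add: starhomD[OF \<phi>] staralgD(5,6)[OF A] a b(1))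
    fix x
    have "\<phi> b x + \<phi> b x = adj (\<phi> a) (\<phi> a x) + \<phi> b (\<phi> b x)"
      using arg_cong[OF eq, of "%T. blinfun_apply T x"] by (simp add: blinfun.add_left)
    then have "x \<bullet> \<phi> b x + x \<bullet> \<phi> b x = \<phi> a x \<bullet> \<phi> a x + x \<bullet> \<phi> b (\<phi> b x)"
      using arg_cong[of _ _ "%v. x \<bullet> v"] by (metis cinner_add_right cinner_adj_right pb(2))
    moreover have sb: "\<phi> b x \<bullet> v = x \<bullet> \<phi> b v" for v
      using cinner_adj[OF pb(1), of x v] by (simp add: pb(3))
    ultimately have "(x - \<phi> b x) \<bullet> (x - \<phi> b x) = x \<bullet> x - \<phi> a x \<bullet> \<phi> a x"
      by (simp add: cinner.diff_left cinner.diff_right algebra_simps)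
    then have "(norm (x - \<phi> b x))\<^sup>2 = (norm x)\<^sup>2 - (norm (\<phi> a x))\<^sup>2"
      unfolding cinner_self of_real_diff[symmetric] by (simp only: of_real_eq_iff)
    then have "(norm (\<phi> a x))\<^sup>2 \<le> (norm x)\<^sup>2" using zero_le_power2[of "norm (x - \<phi> b x)"] by linarith
    from power2_le_imp_le[OF this norm_ge_zero] show "norm (\<phi> a x) \<le> 1 * norm x" by simp
  qed simp
  show ?thesis
  proof (rule field_le_epsilon)
    fix e :: real assume e: "e > 0"
    define k where "k = norm a + e"
    have k: "k > 0" "norm a < k" using e by (simp_all add: k_def add_nonneg_pos)
    have "norm ((1 / complex_of_real k) *c a) < 1"
      using k by (simp add: norm_scaleC_eq norm_divide)
    then have "norm (\<phi> ((1 / complex_of_real k) *c a)) \<le> 1"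
      by (intro c1 csubspaceD(3)[OF staralgD(3)[OF A] a])
    then have "norm (\<phi> a) / k \<le> 1"
      using k by (simp add: starhomD(3)[OF \<phi> a] norm_scaleC_eq norm_divide)
    then show "norm (\<phi> a) \<le> norm a + e" using k by (simp add: k_def[symmetric])
  qed
qed

lemma starhom_tendsto:
  assumes A: "staralg A" and \<phi>: "starhom A \<phi>" and s: "\<And>n. s n \<in> A" "a \<in> A" "s ----> a"
  shows "(%n. \<phi> (s n)) ----> \<phi> a"
proof -
  have 1: "norm (\<phi> (s n) - \<phi> a) \<le> norm (s n - a)" for n
    using starhom_contractive[OF A \<phi> csubspaceD(4)[OF staralgD(3)[OF A] s(1) s(2)]]
    by (simp add: starhom_diff[OF A \<phi> s(1) s(2)])
  have 2: "(%n. norm (s n - a)) ----> 0" by (intro tendsto_norm_zero LIM_zero s)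
  show ?thesis by (rule LIM_zero_cancel[OF null_comparison[OF 1 2]])
qed

lemma subspace_vimage:
  fixes f :: "'a::complex_normed => 'b::complex_normed"
  assumes T: "csubspace T" "closed T"
    and add: "\<And>s t. s \<in> T ==> t \<in> T ==> f (s + t) = f s + f t"
    and scale: "\<And>c t. t \<in> T ==> f (c *c t) = c *c f t"
    and bound: "\<And>t. t \<in> T ==> norm (f t) \<le> K * norm t"
    and M: "csubspace M" "closed M"
  shows "csubspace {t \<in> T. f t \<in> M}" "closed {t \<in> T. f t \<in> M}"
proof -
  have f0: "f 0 = 0" using scale[OF csubspaceD(1)[OF T(1)], of 0] by simp
  show "csubspace {t \<in> T. f t \<in> M}"
    by (rule csubspaceI) (auto simp: f0 add scale intro: csubspaceD(1-3)[OF T(1)] csubspaceD(1-3)[OF M(1)])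
  show "closed {t \<in> T. f t \<in> M}"
    unfolding closed_sequential_limits
  proof (intro allI impI)
    fix s l assume s: "(\<forall>n. s n \<in> {t \<in> T. f t \<in> M}) \<and> s ----> l"
    then have sT: "\<And>n. s n \<in> T" and fM: "\<And>n. f (s n) \<in> M" and lim: "s ----> l" by auto
    have l: "l \<in> T" by (rule closed_sequentially[OF T(2) _ lim]) (simp add: sT)
    have 1: "norm (f (s n) - f l) \<le> K * norm (s n - l)" for n
    proof -
      have "s n - l \<in> T" by (rule csubspaceD(4)[OF T(1) sT l])
      from bound[OF this] add[OF this l] show ?thesis by simp
    qed
    have "(%n. K * norm (s n - l)) ----> K * 0"
      by (intro tendsto_mult tendsto_const tendsto_norm_zero LIM_zero lim)
    then have 2: "(%n. K * norm (s n - l)) ----> 0" by simp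
    have "f l \<in> M"
      by (rule closed_sequentially[OF M(2) _ LIM_zero_cancel[OF null_comparison[OF 1 2]]]) (simp add: fM)
    with l show "l \<in> {t \<in> T. f t \<in> M}" by simp
  qed
qed

lemma cstar_staralg: "cstar A ==> staralg A"
  unfolding cstar_def staralg_def by blast

lemma staralg_multipliers:
  assumes A: "staralg A"
  shows "staralg (multipliers A)"
  unfolding staralg_def
proof (intro conjI ballI)
  note a = staralgD[OF A]
  show "multipliers A \<subseteq> bop" by (auto simp: multipliers_def)
  show "csubspace (multipliers A)"
    by (rule csubspaceI)
       (auto simp: multipliers_def compose_add compose_zero a(1) intro: csubspaceD(1-3)[OF a(3)])
  have "multipliers A = bop \<inter> (\<Inter>x\<in>A. {m. m oo x \<in> A} \<inter> {m. x oo m \<in> A})"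
    by (auto simp: multipliers_def)
  moreover have "closed {m. m oo x \<in> A}" "closed {m. x oo m \<in> A}" for x
    using closed_vimage[OF a(4) bounded_linear.continuous_on[OF bounded_linear_compose_right continuous_on_id], of x]
      closed_vimage[OF a(4) bounded_linear.continuous_on[OF bounded_linear_compose_left continuous_on_id], of x]
    by (simp_all add: vimage_def)
  ultimately show "closed (multipliers A)" by (auto intro!: closed_Int closed_INT)
  show "x oo y \<in> multipliers A" if "x \<in> multipliers A" "y \<in> multipliers A" for x y
    using that by (auto simp: multipliers_def) (simp flip: blinfun_compose_assoc)
  show "adj m \<in> multipliers A" if m: "m \<in> multipliers A" for m
  proof -
    have mb: "m \<in> bop" using m by (simp add: multipliers_def)
    have "adj m oo x \<in> A \<and> x oo adj m \<in> A" if x: "x \<in> A" for x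
    proof -
      have "adj x oo m \<in> A" "m oo adj x \<in> A" using m a(6)[OF x] by (auto simp: multipliers_def)
      then have "adj (adj x oo m) \<in> A" "adj (m oo adj x) \<in> A" by (auto intro: a(6))
      then show ?thesis using mb a(1)[OF x] by simp
    qed
    then show ?thesis using mb by (simp add: multipliers_def)
  qed
qed

text \<open>Sending \<phi>(a) x to \<phi>(m a) x has to be well defined on sums. For |m| < 1 the
  element 1 - b, a square root of 1 - \<open>adj m oo m\<close> among the multipliers, supplies a
  remainder vector such that |input|^2 = |image|^2 + |remainder|^2; so the map is a
  contraction.\<close>

lemma ex_extension:
  fixes \<phi> :: "('a::complex_hilbert -> 'a) => ('b::complex_hilbert -> 'b)"
  assumes A: "staralg A" and \<phi>: "starhom A \<phi>" and nd: "ccl {blinfun_apply (\<phi> a) x |a x. a \<in> A} = UNIV"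
    and m: "m \<in> multipliers A"
  shows "\<exists>n\<in>bop. \<forall>a\<in>A. n oo \<phi> a = \<phi> (m oo a)"
proof -
  have M: "staralg (multipliers A)" by (rule staralg_multipliers[OF A])
  have small: "\<exists>n\<in>bop. \<forall>a\<in>A. n oo \<phi> a = \<phi> (m oo a)" if m: "m \<in> multipliers A" "norm m < 1" for m
  proof -
    have mb: "m \<in> bop" by (rule staralgD(1)[OF M m(1)])
    have "norm (adj m oo m) \<le> norm m * norm m"
      using norm_blinfun_compose[of "adj m" m] by (simp add: norm_adj mb)
    also have "\<dots> < 1" using mult_strict_mono'[OF m(2) m(2)] by simp
    finally obtain b where b: "b \<in> multipliers A" "adj b = b" "b + b = (adj m oo m) + (b oo b)"
      using ex_square_root[OF M staralgD(5)[OF M staralgD(6)[OF M m(1)] m(1)]] mb by auto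
    have bb: "b \<in> bop" by (rule staralgD(1)[OF M b(1)])
    have ma: "m oo a \<in> A" and ba: "b oo a \<in> A" and ka: "a - (b oo a) \<in> A" if "a \<in> A" for a
      using m(1) b(1) that csubspaceD(4)[OF staralgD(3)[OF A]] by (auto simp: multipliers_def)
    \<comment> \<open>Triples of a vector, its intended image and the remainder under 1 - b. The
      sesquilinear identity \<open>eq\<close> extends from these generators to their span, where it
      is the theorem of Pythagoras.\<close>
    define S where "S = {(\<phi> a x, \<phi> (m oo a) x, \<phi> (a - (b oo a)) x) |a x. a \<in> A}"
    define eq where "eq p p' \<longleftrightarrow> fst p \<bullet> fst p' = fst (snd p) \<bullet> fst (snd p') + snd (snd p) \<bullet> snd (snd p')"
      for p p' :: "'b \<times> 'b \<times> 'b"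
    have gen: "eq p p'" if "p \<in> S" "p' \<in> S" for p p'
    proof -
      obtain a x a' x' where p: "p = (\<phi> a x, \<phi> (m oo a) x, \<phi> (a - (b oo a)) x)" "a \<in> A"
        "p' = (\<phi> a' x', \<phi> (m oo a') x', \<phi> (a' - (b oo a')) x')" "a' \<in> A"
        using \<open>p \<in> S\<close> \<open>p' \<in> S\<close> unfolding S_def by blast
      note [simp] = staralgD(1)[OF A p(2)] staralgD(1)[OF A p(4)] mb bb
      have pr: "\<phi> c x \<bullet> \<phi> c' x' = x \<bullet> \<phi> (adj c oo c') x'" if "c \<in> A" "c' \<in> A" for c c'
        using that by (simp add: starhomD(4,5)[OF \<phi>] staralgD(6)[OF A] cinner_adj_right starhomD(1)[OF \<phi>])
      have "adj a oo (b + b) oo a' = adj a oo ((adj m oo m) + (b oo b)) oo a'" by (simp only: b(3))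
      then have "adj a oo a' = (adj (m oo a) oo (m oo a')) + (adj (a - (b oo a)) oo (a' - (b oo a')))"
        by (simp add: compose_add
            compose_diff b(2) algebra_simps)
      then have "\<phi> (adj a oo a') = \<phi> (adj (m oo a) oo (m oo a')) + \<phi> (adj (a - (b oo a)) oo (a' - (b oo a')))"
        using p(2,4) by (simp only: starhomD(2)[OF \<phi>] staralgD(5,6)[OF A] ma ka)
      then show ?thesis
        unfolding eq_def p by (simp add: pr p(2,4) ma ka blinfun.add_left cinner_add_right del: adj_compose adj_diff)
    qed
    have sub: "csubspace {p. eq p p'}" "csubspace {p'. eq p p'}" for p p'
      by (rule csubspaceI; auto simp: eq_def cinner_add_left cinner_add_right scaleC_prod_def distrib_left)+
    have eqR: "eq p p'" if "p \<in> cspan S" "p' \<in> cspan S" for p p'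
    proof -
      have 1: "eq p s" if "s \<in> S" for s
        using complex_vector.span_minimal[OF _ sub(1)[of s], of S] gen that \<open>p \<in> cspan S\<close> by blast
      show ?thesis
        using complex_vector.span_minimal[OF _ sub(2)[of p], of S] 1 \<open>p' \<in> cspan S\<close> by blast
    qed
    define R where "R = (%p. (fst p, fst (snd p))) ` cspan S"
    have "\<exists>n\<in>bop. \<forall>x l. (x, l) \<in> R --> blinfun_apply n x = l"
    proof (rule dense_extension_graph)
      show "csubspace R"
      proof (rule csubspaceI)
        show "0 \<in> R" unfolding R_def
          by (rule image_eqI[OF _ complex_vector.span_zero]) (simp add: zero_prod_def)
        fix p p' assume "p \<in> R" "p' \<in> R"
        then obtain s s' where "s \<in> cspan S" "p = (fst s, fst (snd s))" "s' \<in> cspan S" "p' = (fst s', fst (snd s'))"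
          unfolding R_def by blast
        then show "p + p' \<in> R" unfolding R_def by (intro image_eqI[of _ _ "s + s'"]) (simp_all add: complex_vector.span_add)
      next
        fix c p assume "p \<in> R"
        then obtain s where "s \<in> cspan S" "p = (fst s, fst (snd s))" unfolding R_def by blast
        then show "c *c p \<in> R" unfolding R_def
          by (intro image_eqI[of _ _ "c *c s"], simp add: scaleC_prod_def, intro complex_vector.span_scale)
      qed
      have "cspan {blinfun_apply (\<phi> a) x |a x. a \<in> A} \<subseteq> fst ` R"
      proof (rule complex_vector.span_minimal)
        show "{blinfun_apply (\<phi> a) x |a x. a \<in> A} \<subseteq> fst ` R"
        proof
          fix v assume "v \<in> {blinfun_apply (\<phi> a) x |a x. a \<in> A}"
          then obtain a x where v: "v = \<phi> a x" "a \<in> A" by blast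
          then have "(\<phi> a x, \<phi> (m oo a) x, \<phi> (a - (b oo a)) x) \<in> cspan S" unfolding S_def by (intro complex_vector.span_base) blast
          then have "(\<phi> a x, \<phi> (m oo a) x) \<in> R" unfolding R_def by force
          then show "v \<in> fst ` R" using v(1) by force
        qed
        have "fst ` R = fst ` cspan S" unfolding R_def by force
        moreover have "csubspace (fst ` cspan S)"
        proof (rule csubspaceI)
          show "0 \<in> fst ` cspan S" by (rule image_eqI[of _ _ 0]) (simp_all add: complex_vector.span_zero)
          fix p p' assume "p \<in> fst ` cspan S" "p' \<in> fst ` cspan S"
          then obtain s s' where "s \<in> cspan S" "p = fst s" "s' \<in> cspan S" "p' = fst s'" by blast
          then show "p + p' \<in> fst ` cspan S" by (intro image_eqI[of _ _ "s + s'"]) (simp_all add: complex_vector.span_add)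
        next
          fix c p assume "p \<in> fst ` cspan S"
          then obtain s where "s \<in> cspan S" "p = fst s" by blast
          then show "c *c p \<in> fst ` cspan S"
            by (intro image_eqI[of _ _ "c *c s"], simp add: scaleC_prod_def, intro complex_vector.span_scale)
        qed
        ultimately show "csubspace (fst ` R)" by simp
      qed
      then have "closure (cspan {blinfun_apply (\<phi> a) x |a x. a \<in> A}) \<subseteq> closure (fst ` R)" by (rule closure_mono)
      then show "closure (fst ` R) = UNIV" using nd unfolding ccl_def by blast
      show "norm l \<le> 1 * norm x" if xl: "(x, l) \<in> R" for x l
      proof -
        obtain u where "(x, l, u) \<in> cspan S" using xl unfolding R_def by force
        from eqR[OF this this] have "complex_of_real ((norm x)\<^sup>2) = of_real ((norm l)\<^sup>2 + (norm u)\<^sup>2)"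
          by (simp add: eq_def cinner_self)
        then have "(norm x)\<^sup>2 = (norm l)\<^sup>2 + (norm u)\<^sup>2" by (simp only: of_real_eq_iff)
        then have "(norm l)\<^sup>2 \<le> (norm x)\<^sup>2" by simp
        from power2_le_imp_le[OF this norm_ge_zero] show ?thesis by simp
      qed
    qed
    then obtain n where n: "n \<in> bop" "\<And>x l. (x, l) \<in> R ==> n x = l" by blast
    have "n oo \<phi> a = \<phi> (m oo a)" if a: "a \<in> A" for a
    proof (rule blinfun_eqI)
      fix x
      have "(\<phi> a x, \<phi> (m oo a) x, \<phi> (a - (b oo a)) x) \<in> cspan S" unfolding S_def using a by (intro complex_vector.span_base) blast
      then have "(\<phi> a x, \<phi> (m oo a) x) \<in> R" unfolding R_def by force
      from n(2)[OF this] show "(n oo \<phi> a) x = \<phi> (m oo a) x" by simp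
    qed
    then show ?thesis using n(1) by blast
  qed
  define k where "k = norm m + 1"
  have k: "k > 0" "norm m < k" by (simp_all add: k_def add_nonneg_pos)
  have "norm ((1 / complex_of_real k) *c m) < 1" using k by (simp add: norm_scaleC_eq norm_divide)
  then obtain n where n: "n \<in> bop" "\<And>a. a \<in> A ==> n oo \<phi> a = \<phi> (((1 / complex_of_real k) *c m) oo a)"
    using small[OF csubspaceD(3)[OF staralgD(3)[OF M] m]] by blast
  have "(of_real k *c n) oo \<phi> a = \<phi> (m oo a)" if a: "a \<in> A" for a
  proof -
    have ma: "m oo a \<in> A" using m a by (simp add: multipliers_def)
    show ?thesis using k by (simp add: n(2)[OF a] starhomD(3)[OF \<phi> ma] scaleC_scaleC)
  qed
  then show ?thesis using n(1) by (intro bexI[of _ "of_real k *c n"]) auto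
qed

section \<open>Tensor products of homomorphisms\<close>

text \<open>For a finite orthonormal set \<open>F\<close> this is the projection of the first leg
  onto its span, and \<open>pr\<close> is its action on vectors. Compression by it turns operators
  into finite matrices.\<close>

definition PF :: "'d::complex_hilbert set => (('d, 'a::complex_hilbert) htensor -> ('d, 'a) htensor)" where
  "PF F = (\<Sum>e\<in>F. left_ket e oo adj (left_ket e))"

definition pr :: "'d::complex_hilbert set => 'd => 'd" where
  "pr F p = (\<Sum>e\<in>F. (e \<bullet> p) *c e)"

lemma left_ket_sum: "left_ket (\<Sum>i\<in>F. x i) = (\<Sum>i\<in>F. left_ket (x i))"
  by (rule linear_sum[OF bounded_linear.linear[OF bounded_linear_left_ket]])

lemma compose_sum_left: "(\<Sum>i\<in>F. S i) oo T = (\<Sum>i\<in>F. S i oo T)"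
  by (rule linear_sum[OF bounded_linear.linear[OF bounded_linear_compose_right]])

lemma compose_sum_right: "T oo (\<Sum>i\<in>F. S i) = (\<Sum>i\<in>F. T oo S i)"
  by (rule linear_sum[OF bounded_linear.linear[OF bounded_linear_compose_left]])

lemma bop_PF [simp]: "PF F \<in> bop"
  unfolding PF_def by (intro complex_vector.subspace_sum csubspace_bop) simp

lemma adj_sum: "(\<And>i. i \<in> F ==> S i \<in> bop) ==> adj (\<Sum>i\<in>F. S i) = (\<Sum>i\<in>F. adj (S i))"
proof (induction F rule: infinite_finite_induct)
  case (insert x F)
  then have "(\<Sum>i\<in>F. S i) \<in> bop" by (intro complex_vector.subspace_sum csubspace_bop) auto
  then show ?case using insert by simp
qed simp_all

lemma adj_PF [simp]: "adj (PF F) = PF F"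
  unfolding PF_def by (subst adj_sum) simp_all

lemma PF_left_ket: "PF F oo left_ket q = left_ket (pr F q)"
  by (simp add: PF_def pr_def compose_sum_left left_ket_sum adj_left_ket_left_ket left_ket_scaleC)

lemma adj_left_ket_PF: "adj (left_ket p) oo PF F = adj (left_ket (pr F p))"
  using arg_cong[OF PF_left_ket[of F p], of adj] by simp

lemma pr_onb: "finite F ==> F \<subseteq> onb ==> e \<in> F ==> pr F e = e"
proof -
  assume F: "finite F" "F \<subseteq> onb" "e \<in> F"
  have "pr F e = (\<Sum>f\<in>F. if f = e then e else 0)"
    unfolding pr_def using F by (intro sum.cong) (auto simp: onb_cinner subset_iff)
  then show ?thesis using F by simp
qed

lemma PF_PF: "finite F ==> F \<subseteq> onb ==> PF F oo PF F = PF F"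
proof -
  assume F: "finite F" "F \<subseteq> onb"
  have "PF F oo PF F = (\<Sum>e\<in>F. (PF F oo left_ket e) oo adj (left_ket e))"
    by (subst (2) PF_def) (simp add: compose_sum_right)
  also have "\<dots> = PF F"
    unfolding PF_left_ket by (subst PF_def) (rule sum.cong[OF refl], simp only: pr_onb[OF F])
  finally show ?thesis .
qed

lemma norm_PF: "finite F ==> F \<subseteq> onb ==> norm (PF F :: ('d::complex_hilbert, 'a::complex_hilbert) htensor -> _) \<le> 1"
proof (rule norm_blinfun_bound)
  assume F: "finite F" "F \<subseteq> onb"
  fix x :: "('d, 'a) htensor"
  have "complex_of_real ((norm (PF F x))\<^sup>2) = x \<bullet> PF F (PF F x)"
    unfolding cinner_self[symmetric] using cinner_adj[of "PF F" x "PF F x"] by simp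
  also have "PF F (PF F x) = PF F x" using arg_cong[OF PF_PF[OF F], of "%T. blinfun_apply T x"] by simp
  finally have "(norm (PF F x))\<^sup>2 = cmod (x \<bullet> PF F x)" by (metis abs_power2 norm_of_real)
  also have "\<dots> \<le> norm x * norm (PF F x)" by (rule norm_cinner)
  finally show "norm (PF F x) \<le> 1 * norm x"
    by (cases "norm (PF F x) = 0") (auto simp: power2_eq_square)
qed simp

lemma lsl_PF: "lsl p (PF F oo t oo PF F) q = lsl (pr F p) t (pr F q)"
proof -
  have "lsl p (PF F oo t oo PF F) q = (adj (left_ket p) oo PF F) oo t oo (PF F oo left_ket q)"
    by (simp add: lsl_def)
  then show ?thesis by (simp only: adj_left_ket_PF PF_left_ket lsl_def)
qed

lemma lsl_insert_PF: "lsl p (t oo PF F oo s) q = (\<Sum>e\<in>F. lsl p t e oo lsl e s q)"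
  by (simp add: lsl_def PF_def compose_sum_left compose_sum_right)

text \<open>The graph of id tensor \<phi>, with the first leg left arbitrary: \<open>S\<close>
  results from \<open>t\<close> by applying \<phi> to every slice, and is determined by
  that.\<close>

definition slrel :: "('a::complex_hilbert -> 'a) set => (('a -> 'a) => ('b::complex_hilbert -> 'b)) =>
    (('d::complex_hilbert, 'a) htensor -> ('d, 'a) htensor) => (('d, 'b) htensor -> ('d, 'b) htensor) => bool" where
  "slrel A \<phi> t S \<longleftrightarrow> t \<in> bop \<and> S \<in> bop \<and> (\<forall>p q. lsl p t q \<in> A \<and> lsl p S q = \<phi> (lsl p t q))"

lemma slrelD:
  assumes "slrel A \<phi> t S"
  shows "t \<in> bop" "S \<in> bop" "lsl p t q \<in> A" "lsl p S q = \<phi> (lsl p t q)"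
  using assms unfolding slrel_def by auto

lemma slrel_unique: "slrel A \<phi> t S ==> slrel A \<phi> t S' ==> S = S'"
  by (rule lsl_eqI) (auto simp: slrelD)

locale star_hom =
  fixes A :: "('a::complex_hilbert -> 'a) set" and \<phi> :: "('a -> 'a) => ('b::complex_hilbert -> 'b)"
  assumes A: "staralg A" and \<phi>: "starhom A \<phi>"
begin

lemma slrel_add: "slrel A \<phi> t S ==> slrel A \<phi> t' S' ==> slrel A \<phi> (t + t') (S + S')"
  unfolding slrel_def by (auto simp: lsl_linear starhomD(2)[OF \<phi>] intro: csubspaceD(2)[OF staralgD(3)[OF A]])

lemma slrel_scale: "slrel A \<phi> t S ==> slrel A \<phi> (c *c t) (c *c S)"
  unfolding slrel_def by (auto simp: lsl_linear starhomD(3)[OF \<phi>] intro: csubspaceD(3)[OF staralgD(3)[OF A]])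

lemma slrel_diff: "slrel A \<phi> t S ==> slrel A \<phi> t' S' ==> slrel A \<phi> (t - t') (S - S')"
  using slrel_add[of t S "(-1) *c t'" "(-1) *c S'"] slrel_scale[of t' S' "-1"] by (simp add: scaleC.minus_left)

lemma slrel_adj: "slrel A \<phi> t S ==> slrel A \<phi> (adj t) (adj S)"
proof -
  assume r: "slrel A \<phi> t S"
  note [simp] = slrelD(1,2)[OF r]
  have "lsl p (adj t) q = adj (lsl q t p)" "lsl p (adj S) q = adj (lsl q S p)" for p q
    by (simp_all add: adj_lsl)
  then show ?thesis
    unfolding slrel_def by (simp add: slrelD[OF r] staralgD(6)[OF A] starhomD(5)[OF \<phi>] del: adj_lsl)
qed

text \<open>This stands in for complete contractivity. Operators supported on the span of a finite
  \<open>F\<close> form a star algebra of matrices over \<open>A\<close>, on which \<phi> taken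
  entrywise is a star homomorphism, hence contractive. Vectors with finitely many components are
  dense.\<close>

lemma slrel_norm:
  fixes t :: "('d::complex_hilbert, 'a) htensor -> ('d, 'a) htensor"
  assumes r: "slrel A \<phi> t S"
  shows "norm S \<le> norm t"
proof -
  note tb [simp] = slrelD(1,2)[OF r]
  have comp: "norm (PF F oo S oo PF F) \<le> norm t" if F: "finite F" "F \<subseteq> onb" for F
  proof -
    define AF where "AF = {t :: ('d, 'a) htensor -> ('d, 'a) htensor. t \<in> bop \<and> (\<forall>p q. lsl p t q \<in> A) \<and> PF F oo t oo PF F = t}"
    define \<Phi> where "\<Phi> t = (\<Sum>e\<in>F. \<Sum>f\<in>F. left_ket e oo \<phi> (lsl e t f) oo adj (left_ket f))"
      for t :: "('d, 'a) htensor -> ('d, 'a) htensor"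
    have sl: "lsl p t q \<in> A" if "t \<in> AF" for t p q using that by (simp add: AF_def)
    have AFb: "t \<in> bop" if "t \<in> AF" for t using that by (simp add: AF_def)
    have lsl_\<Phi>: "lsl p (\<Phi> t) q = \<phi> (lsl p t q)" if t: "t \<in> AF" for t p q
    proof -
      have "lsl p t q = lsl (pr F p) t (pr F q)"
        using that lsl_PF[of p F t q] by (simp add: AF_def)
      also have "\<dots> = (\<Sum>e\<in>F. \<Sum>f\<in>F. (cnj (e \<bullet> p) * (f \<bullet> q)) *c lsl e t f)"
      proof -
        have s1: "lsl (\<Sum>e\<in>F. x e) t z = (\<Sum>e\<in>F. lsl (x e) t z)" for x z
          by (rule linear_sum[OF bounded_linear.linear[OF bounded_linear_lsl(1)]])
        have s2: "lsl y t (\<Sum>e\<in>F. x e) = (\<Sum>e\<in>F. lsl y t (x e))" for x y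
          by (rule linear_sum[OF bounded_linear.linear[OF bounded_linear_lsl(3)]]) (rule AFb[OF t])
        show ?thesis unfolding pr_def s1 s2 by (subst sum.swap) (simp add: lsl_linear(2,4) AFb[OF t] scaleC_scaleC)
      qed
      finally have "\<phi> (lsl p t q) = (\<Sum>e\<in>F. \<Sum>f\<in>F. (cnj (e \<bullet> p) * (f \<bullet> q)) *c \<phi> (lsl e t f))"
        by (simp add: starhom_sum[OF A \<phi>] starhomD(3)[OF \<phi>] sl t csubspaceD(3)[OF staralgD(3)[OF A]]
            complex_vector.subspace_sum[OF staralgD(3)[OF A]])
      moreover have "lsl p (left_ket e oo \<phi> (lsl e t f) oo adj (left_ket f)) q = (cnj (e \<bullet> p) * (f \<bullet> q)) *c \<phi> (lsl e t f)" for e f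
      proof -
        have "lsl p (left_ket e oo \<phi> (lsl e t f) oo adj (left_ket f)) q
            = (adj (left_ket p) oo left_ket e) oo \<phi> (lsl e t f) oo (adj (left_ket f) oo left_ket q)"
          by (simp add: lsl_def)
        then show ?thesis
          using starhomD(1)[OF \<phi> sl[OF t, of e f]]
          by (simp add: adj_left_ket_left_ket scaleC_scaleC cinner_commute[of p e] mult.commute)
      qed
      then have "lsl p (\<Phi> t) q = (\<Sum>e\<in>F. \<Sum>f\<in>F. (cnj (e \<bullet> p) * (f \<bullet> q)) *c \<phi> (lsl e t f))"
        by (simp add: \<Phi>_def linear_sum[OF bounded_linear.linear[OF bounded_linear_lsl(2)]])
      ultimately show ?thesis by simp
    qed
    have rel: "slrel A \<phi> t (\<Phi> t)" if t: "t \<in> AF" for t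
    proof -
      have "\<Phi> t \<in> bop"
        unfolding \<Phi>_def by (intro complex_vector.subspace_sum csubspace_bop bop_compose bop_adj bop_left_ket starhomD(1)[OF \<phi>] sl t)
      then show ?thesis using t by (simp add: slrel_def lsl_\<Phi> AFb sl)
    qed
    \<comment> \<open>Uniqueness of \<open>slrel\<close> reduces each algebraic property of \<Phi>
      to the corresponding rule for \<open>slrel\<close>.\<close>
    have mem: "t \<in> AF \<and> \<Phi> t = S" if "slrel A \<phi> t S" "PF F oo t oo PF F = t" for t S
    proof -
      have "t \<in> AF" using that by (auto simp: AF_def slrelD)
      then show ?thesis using slrel_unique[OF rel that(1)] by simp
    qed
    have cut: "slrel A \<phi> (PF F oo t oo PF F) (PF F oo S oo PF F)" if "slrel A \<phi> t S" for t S
      unfolding slrel_def lsl_PF using slrelD[OF that] by simp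
    have pfix: "PF F oo t = t" "t oo PF F = t" if "t \<in> AF" for t
      using that PF_PF[OF F] unfolding AF_def by (metis (mono_tags, lifting) blinfun_compose_assoc mem_Collect_eq)+
    have fix\<Phi>: "\<Phi> t oo PF F = \<Phi> t" if t: "t \<in> AF" for t
    proof -
      have "PF F oo \<Phi> t oo PF F = \<Phi> t" using cut[OF rel[OF t]] mem t by (metis pfix)
      then show ?thesis using PF_PF[OF F] by (metis blinfun_compose_assoc)
    qed
    have scale: "c *c t \<in> AF \<and> \<Phi> (c *c t) = c *c \<Phi> t" if t: "t \<in> AF" for c t
      by (rule mem[OF slrel_scale[OF rel[OF t]]]) (simp add: pfix[OF t])
    have add: "t + s \<in> AF \<and> \<Phi> (t + s) = \<Phi> t + \<Phi> s" if "t \<in> AF" "s \<in> AF" for t s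
      by (rule mem[OF slrel_add[OF that[THEN rel]]]) (simp add: compose_add pfix that)
    have comp: "t oo s \<in> AF \<and> \<Phi> (t oo s) = \<Phi> t oo \<Phi> s" if ts: "t \<in> AF" "s \<in> AF" for t s
    proof (rule mem)
      \<comment> \<open>Inserting \<open>PF F\<close>, which the factors absorb, splits a slice of
        the product into a finite sum of products of slices, on which \<phi> is
        multiplicative.\<close>
      have "slrel A \<phi> (t oo PF F oo s) (\<Phi> t oo PF F oo \<Phi> s)"
        unfolding slrel_def lsl_insert_PF using slrelD[OF rel[OF ts(1)]] slrelD[OF rel[OF ts(2)]]
        by (auto simp: starhom_sum[OF A \<phi>] starhomD(4)[OF \<phi>] staralgD(5)[OF A]
            intro!: complex_vector.subspace_sum[OF staralgD(3)[OF A]])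
      then show "slrel A \<phi> (t oo s) (\<Phi> t oo \<Phi> s)" by (simp only: pfix(2)[OF ts(1)] fix\<Phi>[OF ts(1)])
      show "PF F oo (t oo s) oo PF F = t oo s" using pfix ts by (metis blinfun_compose_assoc)
    qed
    have adj: "adj t \<in> AF \<and> \<Phi> (adj t) = adj (\<Phi> t)" if t: "t \<in> AF" for t
      using arg_cong[OF pfix(1)[OF t], of adj] arg_cong[OF pfix(2)[OF t], of adj] t
      by (intro mem[OF slrel_adj[OF rel[OF t]]]) (simp add: AFb)
    have "closed AF"
    proof -
      have "AF = bop \<inter> (\<Inter>p. \<Inter>q. {t. lsl p t q \<in> A}) \<inter> {t. PF F oo t oo PF F = t}"
        by (auto simp: AF_def)
      moreover have "closed {t :: ('d, 'a) htensor -> ('d, 'a) htensor. lsl p t q \<in> A}" for p q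
        using closed_vimage[OF staralgD(4)[OF A] bounded_linear.continuous_on[OF bounded_linear_lsl(2) continuous_on_id], of p q]
        by (simp add: vimage_def)
      moreover have "closed {t :: ('d, 'a) htensor -> ('d, 'a) htensor. PF F oo t oo PF F = t}"
        by (intro closed_Collect_eq bounded_linear.continuous_on[OF bounded_linear_compose[OF bounded_linear_compose_right bounded_linear_compose_left]] continuous_on_id)
      ultimately show ?thesis by (auto intro!: closed_Int closed_INT)
    qed
    define tF where "tF = PF F oo t oo PF F"
    have "PF F oo tF oo PF F = (PF F oo PF F) oo t oo (PF F oo PF F)" by (simp add: tF_def)
    then have "PF F oo tF oo PF F = tF" by (simp only: PF_PF[OF F] tF_def)
    then have tF: "tF \<in> AF" "\<Phi> tF = PF F oo S oo PF F"
      using mem[OF cut[OF r], folded tF_def] by blast+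
    have "0 \<in> AF" using scale[OF tF(1), of 0, THEN conjunct1] by (simp only: complex_vector.scale_zero_left)
    then have AF: "staralg AF"
      unfolding staralg_def using \<open>closed AF\<close> by (intro conjI ballI csubspaceI subsetI) (simp_all add: AFb add scale comp adj)
    have hom: "starhom AF \<Phi>"
      unfolding starhom_def by (intro conjI ballI allI) (simp_all add: add scale comp adj slrelD(2)[OF rel])
    have "norm (PF F oo S oo PF F) \<le> norm tF" using starhom_contractive[OF AF hom tF(1)] by (simp only: tF(2))
    also have "\<dots> \<le> 1 * norm t * 1"
      unfolding tF_def by (rule norm_blinfun_compose3[OF norm_PF[OF F] order_refl norm_PF[OF F]])
    finally show ?thesis by simp
  qed
  define D0 where "D0 = {\<xi> :: ('d, 'b) htensor. \<exists>F. finite F \<and> F \<subseteq> onb \<and> PF F \<xi> = \<xi>}"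
  have mono: "PF F' \<xi> = \<xi>" if "finite F'" "F \<subseteq> F'" "F' \<subseteq> onb" "PF F \<xi> = \<xi>" for F F' and \<xi> :: "('d, 'b) htensor"
  proof -
    have "PF F' oo PF F = (PF F :: ('d, 'b) htensor -> _)"
    proof -
      have "PF F' oo PF F = (\<Sum>e\<in>F. (PF F' oo left_ket e) oo adj (left_ket e :: 'b -> ('d, 'b) htensor))"
        by (subst (2) PF_def) (simp add: compose_sum_right)
      also have "\<dots> = PF F"
        unfolding PF_left_ket by (subst PF_def) (rule sum.cong[OF refl], use pr_onb[OF that(1,3)] that(2) in \<open>simp only: subset_eq\<close>)
      finally show ?thesis .
    qed
    from arg_cong[OF this, of "%T. blinfun_apply T \<xi>"] that(4) show ?thesis by simp
  qed
  have D0_dense: "closure D0 = UNIV"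
  proof -
    have sub: "csubspace D0"
    proof (rule csubspaceI)
      show "0 \<in> D0" unfolding D0_def by (auto intro: exI[of _ "{}"])
      show "x + y \<in> D0" if xy: "x \<in> D0" "y \<in> D0" for x y
      proof -
        obtain F G where "finite F" "F \<subseteq> onb" "PF F x = x" "finite G" "G \<subseteq> onb" "PF G y = y"
          using xy unfolding D0_def by blast
        then have "PF (F \<union> G) (x + y) = x + y" "finite (F \<union> G)" "F \<union> G \<subseteq> onb"
          using mono[of "F \<union> G" F x] mono[of "F \<union> G" G y] by (auto simp: blinfun.add_right)
        then show ?thesis unfolding D0_def by blast
      qed
      show "c *c x \<in> D0" if "x \<in> D0" for c x
        using that unfolding D0_def by (auto simp: bop_scaleC)
    qed
    have "ccl (onb :: 'd set) = UNIV"
    proof (rule closed_subspace_eq_UNIV)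
      fix y :: 'd assume "\<And>x. x \<in> ccl onb ==> x \<bullet> y = 0"
      then show "y = 0" by (intro onb_total) (auto intro: ccl_base)
    qed simp_all
    then have "ccl {x \<otimes> (y::'b) |x y. x \<in> (onb :: 'd set) \<and> y \<in> UNIV} = UNIV"
      by (intro ccl_tens_dense) (auto simp: ccl_id)
    moreover have "{x \<otimes> (y::'b) |x y. x \<in> (onb :: 'd set) \<and> y \<in> UNIV} \<subseteq> D0"
    proof
      fix v assume "v \<in> {x \<otimes> (y::'b) |x y. x \<in> (onb :: 'd set) \<and> y \<in> UNIV}"
      then obtain x y where v: "v = x \<otimes> y" "x \<in> onb" by blast
      have "PF {x} v = v" using v(2) by (simp add: v(1) PF_def onb_cinner)
      then show "v \<in> D0" unfolding D0_def using v(2) by blast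
    qed
    then have "cspan {x \<otimes> (y::'b) |x y. x \<in> (onb :: 'd set) \<and> y \<in> UNIV} \<subseteq> D0"
      by (rule complex_vector.span_minimal[OF _ sub])
    then have "ccl {x \<otimes> (y::'b) |x y. x \<in> (onb :: 'd set) \<and> y \<in> UNIV} \<subseteq> closure D0"
      unfolding ccl_def by (rule closure_mono)
    ultimately show ?thesis by (simp only:) (rule top.extremum_uniqueI)
  qed
  have weak: "cmod (\<eta> \<bullet> S \<xi>) \<le> norm t * norm \<eta> * norm \<xi>" if xy: "\<eta> \<in> D0" "\<xi> \<in> D0" for \<eta> \<xi>
  proof -
    obtain F G where FG: "finite F" "F \<subseteq> onb" "PF F \<eta> = \<eta>" "finite G" "G \<subseteq> onb" "PF G \<xi> = \<xi>"
      using xy unfolding D0_def by blast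
    let ?F = "F \<union> G"
    have F: "finite ?F" "?F \<subseteq> onb" "PF ?F \<eta> = \<eta>" "PF ?F \<xi> = \<xi>"
      using FG mono[of ?F F \<eta>] mono[of ?F G \<xi>] by auto
    have "\<eta> \<bullet> S \<xi> = PF ?F \<eta> \<bullet> S (PF ?F \<xi>)" by (simp only: F)
    also have "\<dots> = \<eta> \<bullet> (PF ?F oo S oo PF ?F) \<xi>"
      using cinner_adj[of "PF ?F" \<eta>] by simp
    finally have "cmod (\<eta> \<bullet> S \<xi>) \<le> norm \<eta> * (norm (PF ?F oo S oo PF ?F) * norm \<xi>)"
      by (simp only:) (rule order_trans[OF norm_cinner mult_left_mono[OF norm_blinfun norm_ge_zero]])
    also have "\<dots> \<le> norm \<eta> * (norm t * norm \<xi>)"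
      by (intro mult_left_mono mult_right_mono comp F) auto
    finally show ?thesis by (simp add: ac_simps)
  qed
  have w2: "norm (S \<xi>) \<le> norm t * norm \<xi>" if xi: "\<xi> \<in> D0" for \<xi>
  proof -
    have "closure D0 \<subseteq> {\<eta>. cmod (\<eta> \<bullet> S \<xi>) \<le> norm t * norm \<eta> * norm \<xi>}"
      by (rule closure_minimal) (auto intro!: weak xi closed_Collect_le continuous_intros cinner.continuous_on)
    then have "cmod (S \<xi> \<bullet> S \<xi>) \<le> norm t * norm (S \<xi>) * norm \<xi>" using D0_dense by blast
    then have "norm (S \<xi>) * norm (S \<xi>) \<le> norm (S \<xi>) * (norm t * norm \<xi>)"
      by (simp add: cinner_self norm_power power2_eq_square norm_mult ac_simps)
    then show ?thesis by (cases "norm (S \<xi>) = 0") auto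
  qed
  show ?thesis
  proof (rule norm_blinfun_bound)
    fix \<xi>
    have "closure D0 \<subseteq> {\<xi>. norm (S \<xi>) \<le> norm t * norm \<xi>}"
      by (rule closure_minimal) (auto intro!: w2 closed_Collect_le continuous_intros)
    then show "norm (S \<xi>) \<le> norm t * norm \<xi>" using D0_dense by blast
  qed simp
qed

end

section \<open>Spatial tensor products and their multipliers\<close>

lemma tensor_alg_ccl: "A >< B = ccl {a ** b |a b. a \<in> A \<and> b \<in> B}"
  by (simp add: tensor_alg_def ccl_def)

lemma tens_in_alg: "a \<in> A ==> b \<in> B ==> a ** b \<in> A >< B"
  unfolding tensor_alg_ccl by (intro ccl_base) blast

lemma ccl_compose:
  assumes x: "x \<in> ccl S" and y: "y \<in> ccl T" and S: "S \<subseteq> bop" and T: "T \<subseteq> bop"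
    and M: "csubspace M" "closed M" and ST: "\<And>s t. s \<in> S ==> t \<in> T ==> s oo t \<in> M"
  shows "x oo y \<in> M"
proof (rule blin_ccl[OF x _ S M, of "%x. x oo y"])
  show "blin (%x. x oo y)" using ccl_bop[OF T] y by (intro blin_compose_right) blast
  show "s oo y \<in> M" if s: "s \<in> S" for s
    by (rule blin_ccl[OF y _ T M, of "%y. s oo y"]) (use s S in \<open>auto intro: blin_compose_left ST\<close>)
qed

lemma multipliersD:
  assumes "m \<in> multipliers A"
  shows "m \<in> bop" "a \<in> A ==> m oo a \<in> A" "a \<in> A ==> a oo m \<in> A"
  using assms by (auto simp: multipliers_def)

lemma multipliersI_ccl:
  assumes S: "S \<subseteq> bop" and m: "m \<in> bop" and 1: "\<And>s. s \<in> S ==> m oo s \<in> ccl S" and 2: "\<And>s. s \<in> S ==> s oo m \<in> ccl S"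
  shows "m \<in> multipliers (ccl S)"
  unfolding multipliers_def
proof (intro CollectI conjI ballI m)
  fix a assume a: "a \<in> ccl S"
  show "m oo a \<in> ccl S" by (rule blin_ccl[OF a blin_compose_left[OF m] S]) (auto intro: 1)
  show "a oo m \<in> ccl S" by (rule blin_ccl[OF a blin_compose_right[OF m] S]) (auto intro: 2)
qed

lemma tensor_multipliers:
  assumes A: "A \<subseteq> bop" and B: "B \<subseteq> bop" and m: "m \<in> multipliers A" and n: "n \<in> multipliers B"
  shows "m ** n \<in> multipliers (A >< B)"
  unfolding tensor_alg_ccl
proof (rule multipliersI_ccl)
  note m = multipliersD[OF m] and n = multipliersD[OF n]
  show "{a ** b |a b. a \<in> A \<and> b \<in> B} \<subseteq> bop" using A B by (auto intro!: bop_tensor_op)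
  show "m ** n \<in> bop" using m n by simp
  fix s assume "s \<in> {a ** b |a b. a \<in> A \<and> b \<in> B}"
  then obtain a b where s: "s = a ** b" "a \<in> A" "b \<in> B" by blast
  have b: "a \<in> bop" "b \<in> bop" using A B s by auto
  show "(m ** n) oo s \<in> ccl {a ** b |a b. a \<in> A \<and> b \<in> B}" "s oo (m ** n) \<in> ccl {a ** b |a b. a \<in> A \<and> b \<in> B}"
    unfolding s(1) tensor_op_compose[OF m(1) n(1) b] tensor_op_compose[OF b m(1) n(1)] tensor_alg_ccl[symmetric]
    by (intro tens_in_alg m n s)+
qed

lemma cstar_self_multipliers: "cstar A ==> A \<subseteq> multipliers A" "\<one> \<in> multipliers A"
  by (auto simp: multipliers_def cstarD)

lemma tensor_dense:
  assumes a: "a \<in> ccl S" and b: "b \<in> ccl T" and S: "S \<subseteq> bop" and T: "T \<subseteq> bop" and M: "csubspace M" "closed M"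
    and ST: "\<And>s t. s \<in> S ==> t \<in> T ==> s ** t \<in> M"
  shows "a ** b \<in> M"
proof (rule blin_ccl[OF a _ S M, of "%a. a ** b"])
  show "blin (%a. a ** b)" using ccl_bop[OF T] b by (intro blin_tensor_left) blast
  show "s ** b \<in> M" if s: "s \<in> S" for s
    by (rule blin_ccl[OF b _ T M, of "%b. s ** b"]) (use s S in \<open>auto intro: blin_tensor_right ST\<close>)
qed

lemma cstar_tensor:
  assumes A: "cstar A" and B: "cstar B"
  shows "cstar (A >< B)"
proof -
  let ?S = "{a ** b |a b. a \<in> A \<and> b \<in> B}"
  note [simp] = cstarD(1)[OF A] cstarD(1)[OF B]
  have Sb: "?S \<subseteq> bop" by auto
  have c: "csubspace (A >< B)" "closed (A >< B)" by (simp_all add: tensor_alg_ccl)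
  have comp: "x oo y \<in> A >< B" if "x \<in> A >< B" "y \<in> A >< B" for x y
    by (rule ccl_compose[OF that[unfolded tensor_alg_ccl] Sb Sb c])
       (auto simp: tensor_op_compose intro!: tens_in_alg cstarD(5)[OF A] cstarD(5)[OF B])
  have adj: "adj x \<in> A >< B" if "x \<in> A >< B" for x
    by (rule adj_ccl[OF that[unfolded tensor_alg_ccl] Sb _ c])
       (auto intro!: tens_in_alg cstarD(6)[OF A] cstarD(6)[OF B])
  have nd: "ccl {blinfun_apply t x |t x. t \<in> A >< B} = UNIV"
  proof -
    have "{x \<otimes> y |x y. x \<in> {blinfun_apply a x |a x. a \<in> A} \<and> y \<in> {blinfun_apply b y |b y. b \<in> B}}
        \<subseteq> {blinfun_apply t x |t x. t \<in> A >< B}"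
    proof
      fix v assume "v \<in> {x \<otimes> y |x y. x \<in> {blinfun_apply a x |a x. a \<in> A} \<and> y \<in> {blinfun_apply b y |b y. b \<in> B}}"
      then obtain a b x y where "v = blinfun_apply a x \<otimes> blinfun_apply b y" "a \<in> A" "b \<in> B" by blast
      then have "v = blinfun_apply (a ** b) (x \<otimes> y)" "a ** b \<in> A >< B" by (simp_all add: tens_in_alg)
      then show "v \<in> {blinfun_apply t x |t x. t \<in> A >< B}" by blast
    qed
    from ccl_mono[OF this] show ?thesis
      unfolding ccl_tens_dense[OF cstarD(7)[OF A] cstarD(7)[OF B]] by blast
  qed
  have "a ** b \<in> ccl {s oo t |s t. s \<in> A >< B \<and> t \<in> A >< B}" if "a \<in> A" "b \<in> B" for a b
  proof (rule tensor_dense[of a "{a oo b |a b. a \<in> A \<and> b \<in> A}" b "{a oo b |a b. a \<in> B \<and> b \<in> B}"])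
    show "a \<in> ccl {a oo b |a b. a \<in> A \<and> b \<in> A}" "b \<in> ccl {a oo b |a b. a \<in> B \<and> b \<in> B}"
      using cstarD(8)[OF A] cstarD(8)[OF B] that by blast+
    fix s t assume "s \<in> {a oo b |a b. a \<in> A \<and> b \<in> A}" "t \<in> {a oo b |a b. a \<in> B \<and> b \<in> B}"
    then obtain a b c d where st: "s = a oo b" "t = c oo d" "a \<in> A" "b \<in> A" "c \<in> B" "d \<in> B" by blast
    have "s ** t = (a ** c) oo (b ** d)" using st by (simp add: tensor_op_compose)
    moreover have "a ** c \<in> A >< B" "b ** d \<in> A >< B" using st by (simp_all add: tens_in_alg)
    ultimately show "s ** t \<in> ccl {s oo t |s t. s \<in> A >< B \<and> t \<in> A >< B}" by (intro ccl_base) blast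
  qed auto
  then have fac: "A >< B \<subseteq> ccl {s oo t |s t. s \<in> A >< B \<and> t \<in> A >< B}"
    by (subst tensor_alg_ccl) (rule ccl_minimal[OF _ csubspace_ccl closed_ccl], blast)
  have "A >< B \<subseteq> bop" unfolding tensor_alg_ccl by (rule ccl_bop[OF Sb])
  then show ?thesis unfolding cstar_def using c comp adj nd fac by blast
qed

section \<open>Morphisms and their extension to multipliers\<close>

lemma morphismD:
  assumes A: "cstar A" and B: "cstar B" and \<phi>: "morphism A B \<phi>"
  shows "starhom A \<phi>" "\<phi> \<in> extensional A" "a \<in> A ==> \<phi> a \<in> multipliers B" "ccl {\<phi> a oo b |a b. a \<in> A \<and> b \<in> B} = B"
    "ccl {blinfun_apply (\<phi> a) x |a x. a \<in> A} = UNIV"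
proof -
  note m = \<phi>[unfolded morphism_def]
  show mul: "a \<in> A ==> \<phi> a \<in> multipliers B" for a using m by blast
  then show "starhom A \<phi>" using m unfolding starhom_def by (auto simp: multipliers_def)
  show "\<phi> \<in> extensional A" using m by blast
  show eq: "ccl {\<phi> a oo b |a b. a \<in> A \<and> b \<in> B} = B" unfolding ccl_def using m by blast
  show "ccl {blinfun_apply (\<phi> a) x |a x. a \<in> A} = UNIV"
  proof -
    have "blinfun_apply b x \<in> ccl {blinfun_apply (\<phi> a) x |a x. a \<in> A}" if b: "b \<in> B" for b x
    proof (rule ccl_induct_map[of b "{\<phi> a oo b |a b. a \<in> A \<and> b \<in> B}" "%b. blinfun_apply b x"])
      show "b \<in> ccl {\<phi> a oo b |a b. a \<in> A \<and> b \<in> B}" unfolding eq by (rule b)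
      fix s assume "s \<in> {\<phi> a oo b |a b. a \<in> A \<and> b \<in> B}"
      then obtain a b where "s = \<phi> a oo b" "a \<in> A" by blast
      then show "blinfun_apply s x \<in> ccl {blinfun_apply (\<phi> a) x |a x. a \<in> A}" by (intro ccl_base) auto
    qed (auto simp: scaleC_blinfun_apply intro!: blinfun.bounded_linear_left)
    then have "ccl {blinfun_apply b x |b x. b \<in> B} \<subseteq> ccl {blinfun_apply (\<phi> a) x |a x. a \<in> A}"
      by (intro ccl_minimal) auto
    then show ?thesis unfolding cstarD(7)[OF B] by blast
  qed
qed

lemma morphismI:
  assumes B: "cstar B" and \<phi>: "starhom A \<phi>" "\<phi> \<in> extensional A" "\<And>a. a \<in> A ==> \<phi> a \<in> multipliers B"
    and nd: "B \<subseteq> ccl {\<phi> a oo b |a b. a \<in> A \<and> b \<in> B}"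
  shows "morphism A B \<phi>"
proof -
  have "ccl {\<phi> a oo b |a b. a \<in> A \<and> b \<in> B} \<subseteq> B"
    by (rule ccl_minimal) (use \<phi>(3) in \<open>auto simp: cstarD[OF B] dest: multipliersD(2)\<close>)
  with nd have "closure (cspan {\<phi> a oo b |a b. a \<in> A \<and> b \<in> B}) = B" unfolding ccl_def by blast
  then show ?thesis unfolding morphism_def using \<phi> starhomD[OF \<phi>(1)] by blast
qed

lemma morphism_id:
  assumes D: "cstar D"
  shows "morphism D D (\<lambda>d\<in>D. d)"
proof (rule morphismI[OF D])
  show "starhom D (\<lambda>d\<in>D. d)"
    unfolding starhom_def using cstarD(1,5,6)[OF D] csubspaceD(2,3)[OF cstarD(3)[OF D]] by auto
  show "D \<subseteq> ccl {(\<lambda>d\<in>D. d) a oo b |a b. a \<in> D \<and> b \<in> D}"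
  proof -
    have "{(\<lambda>d\<in>D. d) a oo b |a b. a \<in> D \<and> b \<in> D} = {a oo b |a b. a \<in> D \<and> b \<in> D}" by force
    then show ?thesis using cstarD(8)[OF D] by simp
  qed
qed (use cstar_self_multipliers(1)[OF D] in auto)

lemma starhom_vimage:
  assumes A: "staralg A" and \<phi>: "starhom A \<phi>" and M: "csubspace M" "closed M"
    and S: "A = ccl S" "\<And>s. s \<in> S ==> \<phi> s \<in> M" and a: "a \<in> A"
  shows "\<phi> a \<in> M"
proof -
  have v: "csubspace {t \<in> A. \<phi> t \<in> M}" "closed {t \<in> A. \<phi> t \<in> M}"
    by (rule subspace_vimage[OF staralgD(3,4)[OF A] starhomD(2,3)[OF \<phi>] _ M, where K = 1];
        simp add: starhom_contractive[OF A \<phi>])+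
  have "ccl S \<subseteq> {t \<in> A. \<phi> t \<in> M}" using S by (intro ccl_minimal v) (auto intro: ccl_base)
  then show ?thesis using a S(1) by blast
qed

lemma bounded_eq_ccl:
  fixes f g :: "'a::complex_normed => 'b::complex_normed"
  assumes f: "\<And>s t. s \<in> ccl S ==> t \<in> ccl S ==> f (s + t) = f s + f t" "\<And>c t. t \<in> ccl S ==> f (c *c t) = c *c f t"
      "\<And>t. t \<in> ccl S ==> norm (f t) \<le> K * norm t"
    and g: "\<And>s t. s \<in> ccl S ==> t \<in> ccl S ==> g (s + t) = g s + g t" "\<And>c t. t \<in> ccl S ==> g (c *c t) = c *c g t"
      "\<And>t. t \<in> ccl S ==> norm (g t) \<le> L * norm t"
    and S: "\<And>s. s \<in> S ==> f s = g s" and x: "x \<in> ccl S"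
  shows "f x = g x"
proof -
  have 0: "csubspace {0 :: 'b}" "closed {0 :: 'b}" by (auto simp: complex_vector.subspace_single_0)
  have n: "norm (f t - g t) \<le> (K + L) * norm t" if "t \<in> ccl S" for t
    using norm_triangle_ineq4[of "f t" "g t"] f(3)[OF that] g(3)[OF that] by (simp add: distrib_right)
  have v: "csubspace {t \<in> ccl S. f t - g t \<in> {0}}" "closed {t \<in> ccl S. f t - g t \<in> {0}}"
    by (rule subspace_vimage[OF csubspace_ccl closed_ccl _ _ n 0]; simp add: f(1,2) g(1,2) scaleC.diff_right)+
  have "ccl S \<subseteq> {t \<in> ccl S. f t - g t \<in> {0}}" by (intro ccl_minimal v) (auto intro: ccl_base S)
  then show ?thesis using x by auto
qed

lemma starhom_eq:
  assumes A: "staralg A" and \<phi>: "starhom A \<phi>" and \<psi>: "starhom A \<psi>"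
    and S: "A = ccl S" "\<And>s. s \<in> S ==> \<phi> s = \<psi> s" and a: "a \<in> A"
  shows "\<phi> a = \<psi> a"
  by (rule bounded_eq_ccl[where K = 1 and L = 1 and S = S])
     (use S a starhomD(2,3)[OF \<phi>] starhomD(2,3)[OF \<psi>] starhom_contractive[OF A \<phi>] starhom_contractive[OF A \<psi>] in auto)

text \<open>This resolves the definite description: a star homomorphism with the right values on
  elementary tensors inherits nondegeneracy from \<phi> and \<psi>, and contractivity makes it
  unique.\<close>

lemma tensor_morphism_eqI:
  assumes A: "cstar A" and B: "cstar B" and C: "cstar C" and D: "cstar D"
    and \<phi>: "morphism A B \<phi>" and \<psi>: "morphism C D \<psi>"
    and \<Theta>: "starhom (A >< C) \<Theta>" "\<And>a c. a \<in> A ==> c \<in> C ==> \<Theta> (a ** c) = \<phi> a ** \<psi> c"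
  shows "morphism (A >< C) (B >< D) (restrict \<Theta> (A >< C))"
    "tensor_morphism A B \<phi> C D \<psi> = restrict \<Theta> (A >< C)"
proof -
  have AC: "cstar (A >< C)" and BD: "cstar (B >< D)" by (rule cstar_tensor[OF A C] cstar_tensor[OF B D])+
  have sAC: "staralg (A >< C)" and sM: "staralg (multipliers (B >< D))"
    by (intro cstar_staralg staralg_multipliers AC BD)+
  note \<phi>D = morphismD[OF A B \<phi>] and \<psi>D = morphismD[OF C D \<psi>]
  let ?\<Theta> = "restrict \<Theta> (A >< C)"
  have hom: "starhom (A >< C) ?\<Theta>"
    unfolding starhom_def using starhomD[OF \<Theta>(1)] cstarD(1,5,6)[OF AC] csubspaceD(2,3)[OF cstarD(3)[OF AC]] by auto
  show mor: "morphism (A >< C) (B >< D) ?\<Theta>"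
  proof (rule morphismI[OF BD hom])
    show "?\<Theta> t \<in> multipliers (B >< D)" if t: "t \<in> A >< C" for t
    proof -
      have "\<Theta> t \<in> multipliers (B >< D)"
        by (rule starhom_vimage[OF sAC \<Theta>(1) staralgD(3,4)[OF sM] tensor_alg_ccl _ t])
           (auto simp: \<Theta>(2) intro!: tensor_multipliers \<phi>D(3) \<psi>D(3) cstarD(2)[OF B] cstarD(2)[OF D])
      then show ?thesis using t by simp
    qed
    let ?M = "ccl {?\<Theta> a oo b |a b. a \<in> A >< C \<and> b \<in> B >< D}"
    have "b ** d \<in> ?M" if "b \<in> B" "d \<in> D" for b d
    proof (rule tensor_dense[of b "{\<phi> a oo b |a b. a \<in> A \<and> b \<in> B}" d "{\<psi> a oo b |a b. a \<in> C \<and> b \<in> D}"])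
      show "b \<in> ccl {\<phi> a oo b |a b. a \<in> A \<and> b \<in> B}" "d \<in> ccl {\<psi> a oo b |a b. a \<in> C \<and> b \<in> D}"
        unfolding \<phi>D(4) \<psi>D(4) by (rule that)+
      show "{\<phi> a oo b |a b. a \<in> A \<and> b \<in> B} \<subseteq> bop" "{\<psi> a oo b |a b. a \<in> C \<and> b \<in> D} \<subseteq> bop"
        using starhomD(1)[OF \<phi>D(1)] starhomD(1)[OF \<psi>D(1)] cstarD(1)[OF B] cstarD(1)[OF D] by auto
      fix s t assume "s \<in> {\<phi> a oo b |a b. a \<in> A \<and> b \<in> B}" "t \<in> {\<psi> a oo b |a b. a \<in> C \<and> b \<in> D}"
      then obtain a b c d where st: "s = \<phi> a oo b" "t = \<psi> c oo d" "a \<in> A" "b \<in> B" "c \<in> C" "d \<in> D" by blast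
      have "s ** t = ?\<Theta> (a ** c) oo (b ** d)"
        using st by (simp add: tensor_op_compose \<Theta>(2) tens_in_alg starhomD(1)[OF \<phi>D(1)] starhomD(1)[OF \<psi>D(1)]
            cstarD(1)[OF B] cstarD(1)[OF D])
      moreover have "a ** c \<in> A >< C" "b ** d \<in> B >< D" using st by (simp_all add: tens_in_alg)
      ultimately show "s ** t \<in> ?M" by (intro ccl_base) blast
    qed auto
    then show "B >< D \<subseteq> ?M" by (subst (1) tensor_alg_ccl) (rule ccl_minimal[OF _ csubspace_ccl closed_ccl], blast)
  qed simp
  show "tensor_morphism A B \<phi> C D \<psi> = ?\<Theta>"
    unfolding tensor_morphism_def
  proof (rule the_equality)
    show "morphism (A >< C) (B >< D) ?\<Theta> \<and> (\<forall>a\<in>A. \<forall>c\<in>C. ?\<Theta> (a ** c) = \<phi> a ** \<psi> c)"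
      using mor by (simp add: \<Theta>(2) tens_in_alg)
    fix \<Theta>' assume \<Theta>': "morphism (A >< C) (B >< D) \<Theta>' \<and> (\<forall>a\<in>A. \<forall>c\<in>C. \<Theta>' (a ** c) = \<phi> a ** \<psi> c)"
    note D' = morphismD[OF AC BD conjunct1[OF \<Theta>']]
    show "\<Theta>' = ?\<Theta>"
    proof (rule extensionalityI[OF D'(2)])
      show "\<Theta>' t = ?\<Theta> t" if t: "t \<in> A >< C" for t
        by (rule starhom_eq[OF sAC D'(1) hom tensor_alg_ccl _ t]) (use \<Theta>' \<Theta>(2) in \<open>auto simp: tens_in_alg\<close>)
    qed simp
  qed
qed

lemma compose_total_eq:
  fixes m n :: "'a::complex_hilbert -> 'b::complex_hilbert"
  assumes "ccl {blinfun_apply (\<phi> a) x |a x. a \<in> A} = UNIV" "m \<in> bop" "n \<in> bop" "\<And>a. a \<in> A ==> m oo \<phi> a = n oo \<phi> a"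
  shows "m = n"
proof (rule op_eq_total[OF assms(2,3) _ assms(1), of UNIV])
  fix r :: 'b and s assume "s \<in> {blinfun_apply (\<phi> a) x |a x. a \<in> A}"
  then obtain a x where s: "s = blinfun_apply (\<phi> a) x" "a \<in> A" by blast
  from arg_cong[OF assms(4)[OF s(2)], of "%T. blinfun_apply T x"] show "r \<bullet> blinfun_apply m s = r \<bullet> blinfun_apply n s"
    by (simp add: s(1))
qed (simp add: ccl_id)

text \<open>\<open>n\<close> is controlled only on the range of \<phi>; pairing with further
  elements \<phi> b carries the defining relation over to the adjoint.\<close>

lemma extension_adj:
  assumes A: "cstar A" and \<phi>: "starhom A \<phi>" "ccl {blinfun_apply (\<phi> a) x |a x. a \<in> A} = UNIV"
    and m: "m \<in> multipliers A" and n: "n \<in> bop" "\<And>a. a \<in> A ==> n oo \<phi> a = \<phi> (m oo a)" and a: "a \<in> A"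
  shows "adj n oo \<phi> a = \<phi> (adj m oo a)"
proof -
  have am: "adj m \<in> multipliers A" by (rule staralgD(6)[OF staralg_multipliers[OF cstar_staralg[OF A]] m])
  note mm = multipliersD[OF m] and amm = multipliersD[OF am]
  note ph = starhomD[OF \<phi>(1)] and AD = cstarD[OF A]
  have "adj (adj n oo \<phi> a) = adj (\<phi> (adj m oo a))"
  proof (rule compose_total_eq[OF \<phi>(2)])
    fix b assume b: "b \<in> A"
    have "adj (\<phi> a) oo (n oo \<phi> b) = \<phi> (adj a) oo \<phi> (m oo b)"
      using a b by (simp add: n ph(5))
    also have "\<dots> = \<phi> (adj a oo (m oo b))" by (rule ph(4)[symmetric]) (simp_all add: AD(6) a mm(2) b)
    also have "\<dots> = \<phi> (adj (adj m oo a) oo b)" using a mm(1) by (simp add: AD(1))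
    also have "\<dots> = adj (\<phi> (adj m oo a)) oo \<phi> b"
      using ph(4)[OF AD(6)[OF amm(2)[OF a]] b] ph(5)[OF amm(2)[OF a]] by simp
    finally show "adj (adj n oo \<phi> a) oo \<phi> b = adj (\<phi> (adj m oo a)) oo \<phi> b"
      using a n(1) by (simp add: ph(1))
  qed (use n(1) ph(1) a amm in simp_all)
  then have "adj (adj (adj n oo \<phi> a)) = adj (adj (\<phi> (adj m oo a)))" by (rule arg_cong)
  then show ?thesis using n(1) ph(1)[OF a] ph(1)[OF amm(2)[OF a]] by simp
qed

text \<open>To identify an extension it is enough to exhibit a bounded operator that acts correctly
  on each \<phi> a. Nondegeneracy makes it a left multiplier, and passing to adjoints makes it a
  right multiplier.\<close>

lemma extend_morphism_eqI:
  assumes A: "cstar A" and B: "cstar B" and \<phi>: "morphism A B \<phi>" and m: "m \<in> multipliers A"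
    and n: "n \<in> bop" "\<And>a. a \<in> A ==> n oo \<phi> a = \<phi> (m oo a)"
  shows "n \<in> multipliers B" "extend_morphism A B \<phi> m = n"
proof -
  note \<phi>D = morphismD[OF A B \<phi>]
  have am: "adj m \<in> multipliers A" by (rule staralgD(6)[OF staralg_multipliers[OF cstar_staralg[OF A]] m])
  have left: "n oo b \<in> B" if n: "n \<in> bop" "\<And>a. a \<in> A ==> n oo \<phi> a = \<phi> (m oo a)" and m: "m \<in> multipliers A" and b: "b \<in> B" for n m b
  proof (rule blin_ccl[of b "{\<phi> a oo b |a b. a \<in> A \<and> b \<in> B}" "%b. n oo b"])
    show "b \<in> ccl {\<phi> a oo b |a b. a \<in> A \<and> b \<in> B}" unfolding \<phi>D(4) by (rule b)
    show "{\<phi> a oo b |a b. a \<in> A \<and> b \<in> B} \<subseteq> bop" using starhomD(1)[OF \<phi>D(1)] cstarD(1)[OF B] by auto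
    fix s assume "s \<in> {\<phi> a oo b |a b. a \<in> A \<and> b \<in> B}"
    then obtain a b where s: "s = \<phi> a oo b" "a \<in> A" "b \<in> B" by blast
    have "n oo s = \<phi> (m oo a) oo b" using n(2)[OF s(2)] by (simp only: s(1) blinfun_compose_assoc[symmetric])
    then show "n oo s \<in> B" using multipliersD(2)[OF \<phi>D(3)[OF multipliersD(2)[OF m s(2)]] s(3)] by simp
  qed (auto intro: blin_compose_left n cstarD[OF B])
  have "b oo n \<in> B" if b: "b \<in> B" for b
  proof -
    have "adj n oo adj b \<in> B"
      by (rule left[OF _ extension_adj[OF A \<phi>D(1,5) m n] am]) (simp_all add: n(1) cstarD(6)[OF B b])
    from cstarD(6)[OF B this] show ?thesis using n(1) cstarD(1)[OF B b] by simp
  qed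
  then show nM: "n \<in> multipliers B" using n(1) left[OF n m] unfolding multipliers_def by blast
  show "extend_morphism A B \<phi> m = n"
    unfolding extend_morphism_def
  proof (rule the_equality)
    show "n \<in> multipliers B \<and> (\<forall>a\<in>A. \<forall>b\<in>B. n oo \<phi> a oo b = \<phi> (m oo a) oo b)"
      using nM n(2) by (simp del: blinfun_compose_assoc)
    fix n' assume n': "n' \<in> multipliers B \<and> (\<forall>a\<in>A. \<forall>b\<in>B. n' oo \<phi> a oo b = \<phi> (m oo a) oo b)"
    have "n' oo \<phi> a = n oo \<phi> a" if a: "a \<in> A" for a
      unfolding n(2)[OF a]
    proof (rule compose_total_eq[of "%b. b" B])
      show "ccl {blinfun_apply b x |b x. b \<in> B} = UNIV" by (rule cstarD(7)[OF B])
      show "n' oo \<phi> a \<in> bop" using n' starhomD(1)[OF \<phi>D(1) a] by (simp add: multipliers_def)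
      show "\<phi> (m oo a) \<in> bop" by (rule starhomD(1)[OF \<phi>D(1) multipliersD(2)[OF m a]])
      show "n' oo \<phi> a oo b = \<phi> (m oo a) oo b" if "b \<in> B" for b using n' a that by blast
    qed
    from compose_total_eq[OF \<phi>D(5) multipliersD(1)[OF conjunct1[OF n']] n(1) this] show "n' = n" .
  qed
qed

lemma extend_morphism:
  assumes A: "cstar A" and B: "cstar B" and \<phi>: "morphism A B \<phi>" and m: "m \<in> multipliers A"
  shows "extend_morphism A B \<phi> m \<in> multipliers B" "a \<in> A ==> extend_morphism A B \<phi> m oo \<phi> a = \<phi> (m oo a)"
proof -
  obtain n where n: "n \<in> bop" "\<forall>a\<in>A. n oo \<phi> a = \<phi> (m oo a)"
    using ex_extension[OF cstar_staralg[OF A] morphismD(1,5)[OF A B \<phi>] m] by blast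
  note e = extend_morphism_eqI[OF A B \<phi> m n(1)]
  show "extend_morphism A B \<phi> m \<in> multipliers B" "a \<in> A ==> extend_morphism A B \<phi> m oo \<phi> a = \<phi> (m oo a)"
    using e n(2) by simp_all
qed

lemma unitary_extend_morphism:
  assumes A: "cstar A" and B: "cstar B" and \<phi>: "morphism A B \<phi>" and m: "m \<in> multipliers A" "unitary m"
  shows "unitary (extend_morphism A B \<phi> m)"
proof -
  note \<phi>D = morphismD[OF A B \<phi>]
  define n where "n = extend_morphism A B \<phi> m"
  have n: "n \<in> bop" "\<And>a. a \<in> A ==> n oo \<phi> a = \<phi> (m oo a)"
    unfolding n_def by (rule multipliersD(1)[OF extend_morphism(1)[OF A B \<phi> m(1)]], rule extend_morphism(2)[OF A B \<phi> m(1)])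
  have am: "adj m \<in> multipliers A" by (rule staralgD(6)[OF staralg_multipliers[OF cstar_staralg[OF A]] m(1)])
  note an = extension_adj[OF A \<phi>D(1,5) m(1) n]
  have "adj n oo n = \<one>"
    by (rule compose_total_eq[OF \<phi>D(5)]) (use n an multipliersD(2)[OF m(1)] in \<open>auto simp: unitaryD(6)[OF m(2)]\<close>)
  moreover have "n oo adj n = \<one>"
    by (rule compose_total_eq[OF \<phi>D(5)]) (use n an multipliersD(2)[OF am] in \<open>auto simp: unitaryD(7)[OF m(2)]\<close>)
  ultimately show ?thesis unfolding unitary_def n_def[symmetric] using n(1) by simp
qed

section \<open>The morphism id tensor \<phi> and its slices\<close>

lemma (in star_hom) slrel_tens: "d \<in> bop ==> a \<in> A ==> slrel A \<phi> (d ** a) (d ** \<phi> a)"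
  using staralgD(1)[OF A] starhomD(1,3)[OF \<phi>]
  by (simp add: slrel_def lsl_tensor_op csubspaceD(3)[OF staralgD(3)[OF A]])

text \<open>Elementary tensors have partners, and the set of operators with a partner is closed: by
  \<open>slrel_norm\<close> the partners of a convergent sequence form a Cauchy sequence.\<close>

lemma (in star_hom) ex_slrel:
  assumes D: "D \<subseteq> bop" and t: "t \<in> D >< A"
  shows "\<exists>S. slrel A \<phi> t S"
proof -
  let ?M = "{t. \<exists>S. slrel A \<phi> t S}"
  have "D >< A \<subseteq> ?M"
    unfolding tensor_alg_ccl
  proof (rule ccl_minimal)
    show "{d ** a |d a. d \<in> D \<and> a \<in> A} \<subseteq> ?M" using D slrel_tens by blast
    have "slrel A \<phi> 0 0"
      by (simp add: slrel_def linear_0[OF bounded_linear.linear[OF bounded_linear_lsl(2)]] csubspaceD(1)[OF staralgD(3)[OF A]] starhom_0[OF A \<phi>])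
    then show "csubspace ?M"
      by (intro csubspaceI) (blast intro: slrel_add slrel_scale)+
    show "closed ?M"
      unfolding closed_sequential_limits
    proof (intro allI impI)
      fix t :: "nat => (_ -> _)" and l
      assume t: "(\<forall>n. t n \<in> ?M) \<and> t ----> l"
      then obtain S where S: "\<And>n. slrel A \<phi> (t n) (S n)" by (auto simp: choice_iff)
      from t have lim: "t ----> l" by blast
      have "Cauchy S"
        unfolding Cauchy_def
      proof (intro allI impI)
        fix e :: real assume "e > 0"
        then obtain N where N: "\<forall>m\<ge>N. \<forall>n\<ge>N. dist (t m) (t n) < e"
          using LIMSEQ_imp_Cauchy[OF lim] unfolding Cauchy_def by blast
        have "dist (S m) (S n) \<le> dist (t m) (t n)" for m n
          unfolding dist_norm by (rule slrel_norm[OF slrel_diff[OF S S]])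
        then show "\<exists>N. \<forall>m\<ge>N. \<forall>n\<ge>N. dist (S m) (S n) < e" using N by (meson le_less_trans)
      qed
      then obtain T where T: "S ----> T" by (meson Cauchy_convergent_iff convergent_def)
      have l: "l \<in> bop" by (rule closed_sequentially[OF closed_bop _ lim]) (rule slrelD(1)[OF S])
      have Tb: "T \<in> bop" by (rule closed_sequentially[OF closed_bop _ T]) (rule slrelD(2)[OF S])
      have "lsl p l q \<in> A \<and> lsl p T q = \<phi> (lsl p l q)" for p q
      proof -
        have 1: "(%n. lsl p (t n) q) ----> lsl p l q" by (rule bounded_linear.tendsto[OF bounded_linear_lsl(2) lim])
        have 2: "(%n. lsl p (S n) q) ----> lsl p T q" by (rule bounded_linear.tendsto[OF bounded_linear_lsl(2) T])
        have a: "lsl p l q \<in> A" by (rule closed_sequentially[OF staralgD(4)[OF A] _ 1]) (rule slrelD(3)[OF S])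
        have "(%n. \<phi> (lsl p (t n) q)) ----> \<phi> (lsl p l q)"
          by (rule starhom_tendsto[OF A \<phi> slrelD(3)[OF S] a 1])
        from LIMSEQ_unique[OF 2[unfolded slrelD(4)[OF S]] this] a show ?thesis by simp
      qed
      then show "l \<in> ?M" using l Tb unfolding slrel_def by blast
    qed
  qed
  then show ?thesis using t by blast
qed

text \<open>Linearity and adjoints follow from uniqueness of \<open>slrel\<close>. A slice of a
  product is in general not a finite sum of products of slices, so multiplicativity is instead
  extended by continuity from elementary tensors, one factor at a time.\<close>

lemma (in star_hom) ex_id_tensor:
  assumes D: "staralg D"
  shows "\<exists>\<Theta>. starhom (D >< A) \<Theta> \<and> (\<forall>t\<in>D >< A. slrel A \<phi> t (\<Theta> t))"
proof -
  note DD = staralgD[OF D] and AD = staralgD[OF A]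
  obtain \<Theta> where \<Theta>: "\<And>t. t \<in> D >< A ==> slrel A \<phi> t (\<Theta> t)"
    using ex_slrel[OF DD(2)] by metis
  let ?S = "{d ** a |d a. d \<in> D \<and> a \<in> A}"
  have Sb: "?S \<subseteq> bop" using DD(1) AD(1) by auto
  have c: "csubspace (D >< A)" "closed (D >< A)" by (simp_all add: tensor_alg_ccl)
  have comp: "x oo y \<in> D >< A" if "x \<in> D >< A" "y \<in> D >< A" for x y
    by (rule ccl_compose[OF that[unfolded tensor_alg_ccl] Sb Sb c])
       (auto simp: tensor_op_compose DD(1) AD(1) intro!: tens_in_alg DD(5) AD(5))
  have adj: "adj x \<in> D >< A" if "x \<in> D >< A" for x
    by (rule adj_ccl[OF that[unfolded tensor_alg_ccl] Sb _ c])
       (auto simp: DD(1) AD(1) intro!: tens_in_alg DD(6) AD(6))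
  have eq: "\<Theta> t = S" if "t \<in> D >< A" "slrel A \<phi> t S" for t S
    by (rule slrel_unique[OF \<Theta>[OF that(1)] that(2)])
  have add: "\<Theta> (s + t) = \<Theta> s + \<Theta> t" if "s \<in> D >< A" "t \<in> D >< A" for s t
    by (rule eq[OF csubspaceD(2)[OF c(1) that] slrel_add[OF \<Theta>[OF that(1)] \<Theta>[OF that(2)]]])
  have scale: "\<Theta> (a *c t) = a *c \<Theta> t" if "t \<in> D >< A" for a t
    by (rule eq[OF csubspaceD(3)[OF c(1) that] slrel_scale[OF \<Theta>[OF that]]])
  have norm: "norm (\<Theta> t) \<le> norm t" if "t \<in> D >< A" for t by (rule slrel_norm[OF \<Theta>[OF that]])
  have tens: "\<Theta> (d ** a) = d ** \<phi> a" if "d \<in> D" "a \<in> A" for d a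
    by (rule eq[OF tens_in_alg[OF that] slrel_tens[OF DD(1)[OF that(1)] that(2)]])
  have n2: "norm (\<Theta> (x oo y)) \<le> norm x * norm y" "norm (\<Theta> x oo \<Theta> y) \<le> norm x * norm y"
    if xy: "x \<in> D >< A" "y \<in> D >< A" for x y
    using order_trans[OF norm[OF comp[OF xy]] norm_blinfun_compose]
      order_trans[OF norm_blinfun_compose mult_mono[OF norm[OF xy(1)] norm[OF xy(2)]]] by auto
  have comp1: "\<Theta> (x oo y) = \<Theta> x oo \<Theta> y" if x: "x \<in> ?S" and y: "y \<in> D >< A" for x y
  proof -
    obtain d a where da: "x = d ** a" "d \<in> D" "a \<in> A" using x by blast
    have xD: "x \<in> D >< A" using da tens_in_alg by blast
    have xb: "x \<in> bop" "\<Theta> x \<in> bop" using slrelD(1,2)[OF \<Theta>[OF xD]] by auto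
    show ?thesis
    proof (rule bounded_eq_ccl[where K = "norm x" and L = "norm x" and S = ?S, of "%y. \<Theta> (x oo y)" "%y. \<Theta> x oo \<Theta> y" y, folded tensor_alg_ccl, OF _ _ n2(1)[OF xD] _ _ n2(2)[OF xD] _ y])
      fix s assume "s \<in> ?S"
      then obtain e b where s: "s = e ** b" "e \<in> D" "b \<in> A" by blast
      show "\<Theta> (x oo s) = \<Theta> x oo \<Theta> s"
        using da s by (simp add: tensor_op_compose DD(1,5) AD(1,5) tens starhomD(1,4)[OF \<phi>])
    qed (simp_all add: compose_add add scale comp xD xb)
  qed
  have comp2: "\<Theta> (x oo y) = \<Theta> x oo \<Theta> y" if x: "x \<in> D >< A" and y: "y \<in> D >< A" for x y
  proof (rule bounded_eq_ccl[where K = "norm y" and L = "norm y" and S = ?S, of "%x. \<Theta> (x oo y)" "%x. \<Theta> x oo \<Theta> y" x, folded tensor_alg_ccl, OF _ _ _ _ _ _ comp1[OF _ y] x])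
    have yb: "y \<in> bop" "\<Theta> y \<in> bop" using slrelD(1,2)[OF \<Theta>[OF y]] by auto
    show "norm (\<Theta> (x oo y)) \<le> norm y * norm x" "norm (\<Theta> x oo \<Theta> y) \<le> norm y * norm x" if "x \<in> D >< A" for x
      using n2[OF that y] by (simp_all add: mult.commute)
  qed (simp_all add: compose_add add scale comp y)
  have "starhom (D >< A) \<Theta>"
    unfolding starhom_def
  proof (intro conjI ballI allI)
    show "\<Theta> (adj t) = adj (\<Theta> t)" if "t \<in> D >< A" for t
      by (rule eq[OF adj[OF that] slrel_adj[OF \<Theta>[OF that]]])
  qed (use \<Theta> add scale comp2 in \<open>auto dest: slrelD(2)\<close>)
  then show ?thesis using \<Theta> by blast
qed

text \<open>A multiplier enters the tensor product after multiplication by \<open>d ** a\<close>.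
  This yields the slices at vectors of the form d q, and these are total by nondegeneracy of
  \<open>D\<close>.\<close>

lemma id_tensor_slices:
  fixes m :: "('d::complex_hilbert, 'a::complex_hilbert) htensor -> ('d, 'a) htensor"
    and \<phi> :: "('a -> 'a) => ('b::complex_hilbert -> 'b)"
  assumes D: "cstar D" and A: "cstar A" and B: "cstar B" and \<phi>: "morphism A B \<phi>"
    and m: "m \<in> multipliers (D >< A)"
  shows "id_tensor D A B \<phi> m \<in> multipliers (D >< B)" "unitary m ==> unitary (id_tensor D A B \<phi> m)"
    "(\<And>p q. lsl p m q \<in> A) ==> lsl p (id_tensor D A B \<phi> m) q = \<phi> (lsl p m q)"
proof -
  note \<phi>D = morphismD[OF A B \<phi>]
  interpret h: star_hom A \<phi> by unfold_locales (rule cstar_staralg[OF A], rule \<phi>D(1))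
  obtain \<Theta> where \<Theta>: "starhom (D >< A) \<Theta>" "\<And>t. t \<in> D >< A ==> slrel A \<phi> t (\<Theta> t)"
    using h.ex_id_tensor[OF cstar_staralg[OF D]] by blast
  have tens: "\<Theta> (d ** a) = (\<lambda>d\<in>D. d) d ** \<phi> a" if "d \<in> D" "a \<in> A" for d a
    using slrel_unique[OF \<Theta>(2)[OF tens_in_alg[OF that]] h.slrel_tens[OF cstarD(1)[OF D that(1)] that(2)]] that by simp
  have DA: "cstar (D >< A)" and DB: "cstar (D >< B)" by (rule cstar_tensor[OF D A] cstar_tensor[OF D B])+
  have tm: "morphism (D >< A) (D >< B) (restrict \<Theta> (D >< A))"
    "tensor_morphism D D (\<lambda>d\<in>D. d) A B \<phi> = restrict \<Theta> (D >< A)"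
    by (rule tensor_morphism_eqI[OF D D A B morphism_id[OF D] \<phi> \<Theta>(1)]; erule (1) tens)+
  define n where "n = id_tensor D A B \<phi> m"
  have n: "n = extend_morphism (D >< A) (D >< B) (restrict \<Theta> (D >< A)) m"
    by (simp add: n_def id_tensor_def tm(2))
  note ext = extend_morphism[OF DA DB tm(1) m, folded n]
  show "id_tensor D A B \<phi> m \<in> multipliers (D >< B)" using ext(1) by (simp add: n_def)
  show "unitary m ==> unitary (id_tensor D A B \<phi> m)"
    using unitary_extend_morphism[OF DA DB tm(1) m, folded n] by (simp add: n_def)
  assume sl: "\<And>p q. lsl p m q \<in> A"
  have mb: "m \<in> bop" and nb: "n \<in> bop" using multipliersD(1)[OF m] multipliersD(1)[OF ext(1)] .
  have 1: "lsl p n (blinfun_apply d q) = \<phi> (lsl p m (blinfun_apply d q))" if d: "d \<in> D" for p d q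
  proof (rule compose_total_eq[OF \<phi>D(5)])
    fix a assume a: "a \<in> A"
    note ab = cstarD(1)[OF A a] and db = cstarD(1)[OF D d] and pb = starhomD(1)[OF \<phi>D(1) a]
    have 2: "m oo (d ** a) \<in> D >< A" by (rule multipliersD(2)[OF m tens_in_alg[OF d a]])
    have "n oo (d ** \<phi> a) = \<Theta> (m oo (d ** a))"
      using ext(2)[OF tens_in_alg[OF d a]] 2 d by (simp add: tens_in_alg a tens)
    then have "lsl p (n oo (d ** \<phi> a)) q = \<phi> (lsl p (m oo (d ** a)) q)"
      using slrelD(4)[OF \<Theta>(2)[OF 2]] by simp
    then have "lsl p n (blinfun_apply d q) oo \<phi> a = \<phi> (lsl p m (blinfun_apply d q) oo a)"
      by (simp add: lsl_def tensor_op_left_ket ab db pb)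
    then show "lsl p n (blinfun_apply d q) oo \<phi> a = \<phi> (lsl p m (blinfun_apply d q)) oo \<phi> a"
      by (simp add: starhomD(4)[OF \<phi>D(1) sl a])
  qed (simp_all add: nb starhomD(1)[OF \<phi>D(1) sl])
  have "lsl p n q = \<phi> (lsl p m q)"
  proof (rule bounded_eq_ccl[where K = "norm p * norm n" and L = "norm p * norm m" and S = "{blinfun_apply d x |d x. d \<in> D}",
        of "%q. lsl p n q" "%q. \<phi> (lsl p m q)" q])
    show "norm (\<phi> (lsl p m t)) \<le> norm p * norm m * norm t" for t
      by (rule order_trans[OF starhom_contractive[OF cstar_staralg[OF A] \<phi>D(1) sl] norm_lsl_le])
    show "q \<in> ccl {blinfun_apply d x |d x. d \<in> D}" unfolding cstarD(7)[OF D] by simp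
    fix s assume "s \<in> {blinfun_apply d x |d x. d \<in> D}"
    then show "lsl p n s = \<phi> (lsl p m s)" using 1 by blast
  qed (simp_all add: norm_lsl_le lsl_linear(1,2) nb mb starhomD(2,3)[OF \<phi>D(1)] sl)
  then show "lsl p (id_tensor D A B \<phi> m) q = \<phi> (lsl p m q)" by (simp add: n_def)
qed

section \<open>Spatially implemented morphisms\<close>

lemma leg_tensor_op:
  assumes "S \<in> bop" "T \<in> bop"
  shows "leg12 (S ** T) = S ** (T ** \<one>)" "leg13 (S ** T) = S ** (\<one> ** T)"
  by (rule lsl_eqI; use assms in \<open>simp add: lsl_legs lsl_tensor_op tensor_op_linear\<close>)+

lemma blin_legs: "blin leg12" "blin leg13"
proof -
  show 12: "blin (leg12 :: (('p::complex_hilbert, 'q::complex_hilbert) htensor -> ('p, 'q) htensor)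
      => (('p, 'q, 'r::complex_hilbert) htensor3 -> ('p, 'q, 'r) htensor3))"
    unfolding leg12_def[abs_def] reassoc_def
    by (intro blin_comp[OF blin_tensor_left] blin_comp[OF blin_compose_left] blin_compose_right) auto
  show "blin leg13"
    unfolding leg13_def[abs_def]
    by (intro blin_comp[OF 12] blin_comp[OF blin_compose_left] blin_compose_right) auto
qed

text \<open>Conjugation is multiplicative on all bounded operators and has the right values on
  elementary tensors, so it computes the morphism and at the same time its extension to
  multipliers.\<close>

lemma id_tensor_spatial:
  fixes X :: "('k::complex_hilbert, 'l::complex_hilbert) htensor -> ('k, 'l) htensor"
    and m :: "('d::complex_hilbert, 'k) htensor -> ('d, 'k) htensor"
  assumes D: "cstar D" and A: "cstar A" and B: "cstar B" and \<phi>: "morphism A B \<phi>"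
    and X: "unitary X" "\<And>a. a \<in> A ==> \<phi> a = X oo (a ** \<one>) oo adj X"
    and m: "m \<in> multipliers (D >< A)"
  shows "id_tensor D A B \<phi> m = leg23 X oo leg12 m oo leg23 (adj X)"
proof -
  note [simp] = unitaryD(1)[OF X(1)]
  define \<Theta> :: "(('d, 'k) htensor -> ('d, 'k) htensor) => (('d, 'k, 'l) htensor3 -> _)"
    where "\<Theta> t = leg23 X oo leg12 t oo leg23 (adj X)" for t
  have DA: "cstar (D >< A)" and DB: "cstar (D >< B)" by (rule cstar_tensor[OF D A] cstar_tensor[OF D B])+
  have mult: "\<Theta> s oo \<Theta> t = \<Theta> (s oo t)" if "s \<in> bop" "t \<in> bop" for s t
    by (simp add: \<Theta>_def leg_compose2(3)[of "adj X" X] unitaryD(2)[OF X(1)] leg_compose2(1)[OF that])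
  have hom: "starhom (D >< A) \<Theta>"
    unfolding starhom_def using cstarD(1)[OF DA]
    by (auto simp: mult) (auto simp: \<Theta>_def blinD[OF blin_legs(1)] compose_add)
  have tens: "\<Theta> (d ** a) = (\<lambda>d\<in>D. d) d ** \<phi> a" if "d \<in> D" "a \<in> A" for d a
    using that cstarD(1)[OF D] cstarD(1)[OF A]
    by (simp add: \<Theta>_def leg_tensor_op leg23_def tensor_op_compose X(2))
  have tm: "morphism (D >< A) (D >< B) (restrict \<Theta> (D >< A))"
    "tensor_morphism D D (\<lambda>d\<in>D. d) A B \<phi> = restrict \<Theta> (D >< A)"
    by (rule tensor_morphism_eqI[OF D D A B morphism_id[OF D] \<phi> hom]; erule (1) tens)+
  have "\<Theta> m oo restrict \<Theta> (D >< A) t = restrict \<Theta> (D >< A) (m oo t)" if "t \<in> D >< A" for t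
    using that multipliersD[OF m] cstarD(1)[OF DA] by (simp add: mult)
  then have "extend_morphism (D >< A) (D >< B) (restrict \<Theta> (D >< A)) m = \<Theta> m"
    using multipliersD(1)[OF m] by (intro extend_morphism_eqI(2)[OF DA DB tm(1) m]) (simp add: \<Theta>_def, blast)
  then show ?thesis by (simp add: id_tensor_def tm(2) \<Theta>_def)
qed

text \<open>As for \<open>id_tensor_spatial\<close>, except that the conjugation is transported to
  the bracketing on the left, where the tensor product of \<open>B\<close> with \<open>D\<close>
  lives.\<close>

lemma tensor_id_spatial:
  fixes X :: "('k::complex_hilbert, 'l::complex_hilbert) htensor -> ('k, 'l) htensor"
    and m :: "('k, 'd::complex_hilbert) htensor -> ('k, 'd) htensor"
  assumes D: "cstar D" and A: "cstar A" and B: "cstar B" and \<phi>: "morphism A B \<phi>"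
    and X: "unitary X" "\<And>a. a \<in> A ==> \<phi> a = X oo (a ** \<one>) oo adj X"
    and m: "m \<in> multipliers (A >< D)"
  shows "reassoc (tensor_id A B \<phi> D m) = leg12 X oo leg13 m oo leg12 (adj X)"
proof -
  note [simp] = unitaryD(1)[OF X(1)]
  define \<Theta>' :: "(('k, 'd) htensor -> ('k, 'd) htensor) => (('k, 'l, 'd) htensor3 -> _)"
    where "\<Theta>' t = leg12 X oo leg13 t oo leg12 (adj X)" for t
  define \<Theta> where "\<Theta> t = adj assoc oo \<Theta>' t oo assoc" for t
  have DA: "cstar (A >< D)" and DB: "cstar (B >< D)" by (rule cstar_tensor[OF A D] cstar_tensor[OF B D])+
  have mult: "\<Theta> s oo \<Theta> t = \<Theta> (s oo t)" if "s \<in> bop" "t \<in> bop" for s t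
    by (simp add: \<Theta>_def \<Theta>'_def leg_compose2(1)[of "adj X" X] unitaryD(2)[OF X(1)] leg_compose2(2)[OF that])
  have hom: "starhom (A >< D) \<Theta>"
    unfolding starhom_def using cstarD(1)[OF DA]
    by (auto simp: mult) (auto simp: \<Theta>_def \<Theta>'_def blinD[OF blin_legs(2)] compose_add)
  have tens: "\<Theta> (a ** d) = \<phi> a ** (\<lambda>d\<in>D. d) d" if "a \<in> A" "d \<in> D" for d a
  proof -
    have b: "a \<in> bop" "d \<in> bop" using that cstarD(1)[OF D] cstarD(1)[OF A] by auto
    have "leg13 (a ** d) = assoc oo ((a ** (\<one> :: 'l -> 'l)) ** d) oo adj assoc"
      using b by (simp only: leg_tensor_op assoc_naturality bop_id blinfun_compose_assoc assoc_left_inverse blinfun_compose_id_right)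
    then have "\<Theta> (a ** d) = (X ** \<one>) oo (((a ** \<one>) ** d) oo (adj X ** \<one>))"
      by (simp add: \<Theta>_def \<Theta>'_def leg12_def reassoc_def)
    then show ?thesis using that b by (simp add: tensor_op_compose X(2))
  qed
  have tm: "morphism (A >< D) (B >< D) (restrict \<Theta> (A >< D))"
    "tensor_morphism A B \<phi> D D (\<lambda>d\<in>D. d) = restrict \<Theta> (A >< D)"
    by (rule tensor_morphism_eqI[OF A B D D \<phi> morphism_id[OF D] hom]; erule (1) tens)+
  have "\<Theta> m oo restrict \<Theta> (A >< D) t = restrict \<Theta> (A >< D) (m oo t)" if "t \<in> A >< D" for t
    using that multipliersD[OF m] cstarD(1)[OF DA] by (simp add: mult)
  then have "extend_morphism (A >< D) (B >< D) (restrict \<Theta> (A >< D)) m = \<Theta> m"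
    using multipliersD(1)[OF m] by (intro extend_morphism_eqI(2)[OF DA DB tm(1) m]) (simp add: \<Theta>_def \<Theta>'_def, blast)
  then have "tensor_id A B \<phi> D m = \<Theta> m" by (simp add: tensor_id_def tm(2))
  then show ?thesis by (simp add: \<Theta>_def \<Theta>'_def reassoc_def)
qed

lemma leg12_assoc_tensor: "X \<in> bop ==> T \<in> bop ==> a \<in> bop ==>
    leg12 X oo (assoc oo (T ** a)) = assoc oo ((X oo T) ** a)"
  by (simp add: leg12_def reassoc_def tensor_op_compose)

lemma assoc_kets:
  assumes "c \<in> bop" "a \<in> bop"
  shows "assoc oo ((left_ket z oo c) ** a) = left_ket z oo (c ** a)"
    "assoc oo ((right_ket z oo c) ** a) = c ** (left_ket z oo a)"
  by (rule blinfun_eq_tensI; use assms in simp)+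

lemma blin_hcol:
  assumes S: "S \<in> hcol A" and A: "A \<subseteq> bop" and f: "blin f" and M: "csubspace M" "closed M"
    and gen: "\<And>z a. a \<in> A ==> f (left_ket z oo a) \<in> M"
  shows "f S \<in> M"
  by (rule blin_ccl[OF S[unfolded hcol_def] f _ M]) (use A gen in auto)

lemma blin_hcol_tensor:
  assumes T: "T \<in> hcol (C >< A)" and C: "C \<subseteq> bop" and A: "A \<subseteq> bop" and X: "X \<in> bop"
    and gen: "\<And>z c a. c \<in> C ==> a \<in> A ==> X oo (left_ket z oo (c ** a)) \<in> hcol (C >< A)"
  shows "X oo T \<in> hcol (C >< A)"
proof (rule blin_hcol[OF T _ blin_compose_left[OF X]])
  have Sb: "{c ** a |c a. c \<in> C \<and> a \<in> A} \<subseteq> bop" using C A by (auto intro!: bop_tensor_op)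
  then show "C >< A \<subseteq> bop" unfolding tensor_alg_ccl by (rule ccl_bop)
  show "X oo (left_ket z oo t) \<in> hcol (C >< A)" if t: "t \<in> C >< A" for z t
    by (rule blin_ccl[OF t[unfolded tensor_alg_ccl], of "%t. X oo (left_ket z oo t)"])
       (use Sb gen X in \<open>auto intro!: blin_comp[OF blin_compose_left] blin_compose_left\<close>)
qed simp_all

lemma leg12_hcol:
  assumes X: "X \<in> bop" "\<And>S. S \<in> hcol C ==> X oo S \<in> hcol C" and C: "C \<subseteq> bop" and A: "A \<subseteq> bop"
    and T: "T \<in> hcol (C >< A)"
  shows "leg12 X oo T \<in> hcol (C >< A)"
proof (rule blin_hcol_tensor[OF T C A])
  fix z c a assume ca: "c \<in> C" "a \<in> A"
  then have b [simp]: "c \<in> bop" "a \<in> bop" using C A by auto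
  have "leg12 X oo (left_ket z oo (c ** a)) = assoc oo ((X oo (left_ket z oo c)) ** a)"
    unfolding assoc_kets(1)[OF b, symmetric] by (rule leg12_assoc_tensor) (simp_all add: X)
  also have "\<dots> \<in> hcol (C >< A)"
    by (rule blin_hcol[OF X(2)[OF hcol_base[OF ca(1)]] C, of "%T. assoc oo (T ** a)"])
       (use C ca in \<open>auto simp: assoc_kets subset_eq intro!: blin_comp[OF blin_tensor_left] blin_compose_left hcol_base tens_in_alg\<close>)
  finally show "leg12 X oo (left_ket z oo (c ** a)) \<in> hcol (C >< A)" .
qed (simp add: X)

lemma leg13_hcol:
  fixes C :: "('c::complex_hilbert -> 'c) set"
    and X :: "('b::complex_hilbert, 'd::complex_hilbert) htensor -> ('b, 'd) htensor"
  assumes X: "X \<in> bop" "\<And>S. S \<in> hcol A ==> X oo S \<in> hcol A" and C: "C \<subseteq> bop" and A: "A \<subseteq> bop"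
    and T: "T \<in> hcol (C >< A)"
  shows "leg13 X oo T \<in> hcol (C >< A)"
proof (rule blin_hcol_tensor[OF T C A])
  fix z c a assume ca: "c \<in> C" "a \<in> A"
  then have b [simp]: "c \<in> bop" "a \<in> bop" using C A by auto
  \<comment> \<open>\<open>?f\<close> turns a column on two legs into one on three legs with
    \<open>c\<close> inserted in the middle: the first flip exposes the leg on which the column
    acts, the last one restores the order.\<close>
  let ?f = "%T. (\<one> ** flip) oo (assoc oo ((T ** c) oo flip))"
  have f: "?f (left_ket z oo a) = left_ket z oo (c ** a)" if "a \<in> bop" for z a
    by (rule blinfun_eq_tensI) (use that in simp_all)
  have "leg13 X oo (left_ket z oo (c ** a)) = ?f (X oo (left_ket z oo a))"
  proof -
    have ff: "(\<one> ** flip) oo ((\<one> ** flip) oo S) = S"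
      for S :: "'x::real_normed_vector -> ('b, 'd, 'c) htensor3"
      by (simp add: tensor_op_compose flip: blinfun_compose_assoc)
    have la: "leg12 X oo (assoc oo ((T ** c) oo S)) = assoc oo (((X oo T) ** c) oo S)" if "T \<in> bop" for T S
      using leg12_assoc_tensor[OF X(1) that b(1)] by (simp flip: blinfun_compose_assoc)
    show ?thesis unfolding f[OF b(2), symmetric] leg13_def by (simp add: ff la)
  qed
  also have "\<dots> \<in> hcol (C >< A)"
    by (rule blin_hcol[OF X(2)[OF hcol_base[OF ca(2)]] A, of ?f])
       (use A ca in \<open>auto simp: f subset_eq simp del: blinfun_compose_assoc
         intro!: blin_comp[OF blin_tensor_left] blin_comp[OF blin_compose_left] blin_comp[OF blin_compose_right] blin_compose_left hcol_base tens_in_alg\<close>)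
  finally show "leg13 X oo (left_ket z oo (c ** a)) \<in> hcol (C >< A)" .
qed (simp add: X)

text \<open>At a vector d y, applying \<open>V\<close> to the column of \<open>a\<close> means
  applying \<open>V oo (d ** a)\<close> to the ket of y, and this operator lies in the tensor
  product again. Vectors d y are total.\<close>

lemma multiplier_hcol:
  assumes D: "cstar D" and A: "A \<subseteq> bop" and V: "V \<in> multipliers (D >< A)" and S: "S \<in> hcol A"
  shows "V oo S \<in> hcol A"
proof (rule blin_hcol[OF S A])
  note Vb = multipliersD(1)[OF V]
  show "blin (%S. V oo S)" by (rule blin_compose_left[OF Vb])
  fix z a assume a: "a \<in> A"
  have ab [simp]: "a \<in> bop" using a A by auto
  have 1: "V oo (left_ket (blinfun_apply d y) oo a) \<in> hcol A" if d: "d \<in> D" for d y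
  proof -
    have "t oo left_ket y \<in> hcol A" if t: "t \<in> D >< A" for t
      by (rule blin_ccl[OF t[unfolded tensor_alg_ccl], of "%t. t oo left_ket y"])
         (use A cstarD(1)[OF D] in \<open>auto simp: tensor_op_left_ket subset_eq intro!: blin_compose_right hcol_base\<close>)
    from this[OF multipliersD(2)[OF V tens_in_alg[OF d a]]] show ?thesis
      by (simp add: tensor_op_left_ket cstarD(1)[OF D d])
  qed
  show "V oo (left_ket z oo a) \<in> hcol A"
  proof (rule ccl_induct_map[of z "{blinfun_apply d y |d y. d \<in> D}" "%z. V oo (left_ket z oo a)"])
    show "z \<in> ccl {blinfun_apply d y |d y. d \<in> D}" unfolding cstarD(7)[OF D] by simp
    show "bounded_linear (%z. V oo (left_ket z oo a))"
      by (intro bounded_linear_compose[OF bounded_linear_compose_left] bounded_linear_compose[OF bounded_linear_compose_right] bounded_linear_left_ket)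
    show "\<exists>c'. V oo (left_ket (c *c x) oo a) = c' *c (V oo (left_ket x oo a))" for c x
      by (rule exI[of _ c]) (simp add: left_ket_scaleC Vb)
  qed (use 1 in auto)
qed simp_all

text \<open>The equation \<open>eq\<close> turns the conjugate of a slice of \<open>W\<close> into a
  slice of \<open>U\<close>. As \<open>U\<close> and its adjoint preserve the columns of the tensor
  product, the multiplier property and nondegeneracy follow by slicing, as in
  \<open>cstar_lalg\<close>. With \<open>V\<close> equal to \<open>W\<close> this is the
  comultiplication.\<close>

lemma spatial_morphism:
  fixes W :: "('c::complex_hilbert, 'c) htensor -> ('c, 'c) htensor" and V :: "('c, 'a::complex_hilbert) htensor -> ('c, 'a) htensor"
  assumes W: "modular_multiplicative_unitary W" and A: "cstar A" and V: "unitary V"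
    and hV: "\<And>S. S \<in> hcol A ==> V oo S \<in> hcol A" "\<And>S. S \<in> hcol A ==> adj V oo S \<in> hcol A"
    and eq: "leg23 V oo leg12 W = leg12 W oo leg13 V oo leg23 V"
  shows "morphism (lalg W) (lalg W >< A) (\<lambda>x\<in>lalg W. V oo (x ** \<one>) oo adj V)"
proof -
  let ?C = "lalg W"
  let ?CA = "?C >< A"
  have uW: "unitary W" using W by (simp add: modular_multiplicative_unitary_def)
  note [simp] = unitaryD(1)[OF V] unitaryD(1)[OF uW]
  note C = cstar_lalg(1)[OF W] and hW = cstar_lalg(2,3)[OF W]
  have CA: "cstar ?CA" by (rule cstar_tensor[OF C A])
  note CAD = cstarD[OF CA]
  define \<phi> where "\<phi> x = V oo (x ** (\<one> :: 'a -> 'a)) oo adj V" for x :: "'c -> 'c"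
  define U where "U = leg12 W oo leg13 V"
  have UU: "U oo (adj U oo S) = S" for S :: "'z::real_normed_vector -> ('c, 'c, 'a) htensor3"
    by (simp add: U_def leg_compose2(2)[of V "adj V"] leg_compose2(1)[of W "adj W"] unitaryD(3)[OF V] unitaryD(3)[OF uW])
  have hU: "U oo T \<in> hcol ?CA" "adj U oo T \<in> hcol ?CA" if "T \<in> hcol ?CA" for T
    using that by (auto simp: U_def intro!: leg12_hcol leg13_hcol hW hV cstarD(2)[OF C] cstarD(2)[OF A])
  have \<phi>_lsl: "\<phi> (lsl x W z) = lsl x U z" for x z
  proof -
    have "\<phi> (lsl x W z) = lsl x (leg23 V oo leg12 W oo leg23 (adj V)) z"
      by (simp add: \<phi>_def lsl_leg23_compose lsl_legs del: blinfun_compose_assoc)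
    also have "leg23 V oo leg12 W oo leg23 (adj V) = U"
      unfolding eq U_def by (simp add: leg_compose unitaryD(3)[OF V])
    finally show ?thesis .
  qed
  have blin_\<phi>: "blin \<phi>"
    unfolding \<phi>_def by (intro blin_comp[OF blin_tensor_left] blin_comp[OF blin_compose_left] blin_compose_right) simp_all
  have mult: "\<phi> s oo \<phi> t = \<phi> (s oo t)" if "s \<in> bop" "t \<in> bop" for s t
  proof -
    have "\<phi> s oo \<phi> t = V oo ((s ** \<one>) oo (t ** \<one>)) oo adj V"
      by (simp add: \<phi>_def unitaryD(6)[OF V])
    then show ?thesis using that by (simp only: tensor_op_compose \<phi>_def bop_id blinfun_compose_id_left)
  qed
  have adj: "adj (\<phi> s) = \<phi> (adj s)" if "s \<in> bop" for s using that by (simp add: \<phi>_def)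
  have hom: "starhom ?C \<phi>"
    unfolding starhom_def using cstarD(1)[OF C] by (auto simp: blinD[OF blin_\<phi>] mult adj)
  have left: "\<phi> s oo t \<in> ?CA" if s: "s \<in> ?C" and t: "t \<in> ?CA" for s t
  proof (rule blin_ccl[OF s[unfolded lalg_def], of "%s. \<phi> s oo t"])
    show "blin (%s. \<phi> s oo t)" by (rule blin_comp[OF blin_\<phi> blin_compose_right[OF CAD(1)[OF t]]])
    fix r assume "r \<in> {lsl x W z |x z. True}"
    then obtain x z where r: "r = lsl x W z" by blast
    show "\<phi> r oo t \<in> ?CA"
      unfolding r \<phi>_lsl using adj_left_ket_hcol[OF hU(1)[OF hcol_base[OF t, of z]] CAD(3,4), of x] by (simp add: lsl_def)
  qed (use CAD(3,4) in auto)
  have mul: "\<phi> s \<in> multipliers ?CA" if s: "s \<in> ?C" for s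
  proof -
    have "t oo \<phi> s \<in> ?CA" if t: "t \<in> ?CA" for t
      using CAD(6)[OF left[OF cstarD(6)[OF C s] CAD(6)[OF t]]] starhomD(1)[OF hom s] CAD(1)[OF t] cstarD(1)[OF C s]
      by (simp add: adj[symmetric])
    then show ?thesis using left[OF s] starhomD(1)[OF hom s] by (simp add: multipliers_def)
  qed
  let ?D = "ccl {\<phi> s oo t |s t. s \<in> ?C \<and> t \<in> ?CA}"
  have dense: "t \<in> ?D" if t: "t \<in> ?CA" for t
  proof (cases "\<exists>e::'c. e \<noteq> 0")
    case True
    then obtain e :: 'c where e: "e \<noteq> 0" by blast
    \<comment> \<open>Up to a scalar, t is a slice of U times \<open>adj U\<close> applied to the
      column of t. Expanding the inner part in columns leaves products of \<phi> s with elements of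
      the tensor product.\<close>
    have "adj (left_ket e) oo (U oo (adj U oo (left_ket e oo t))) \<in> ?D"
    proof (rule blin_hcol[OF hU(2)[OF hcol_base[OF t]] CAD(2), of "%S. adj (left_ket e) oo (U oo S)"])
      show "blin (%S. adj (left_ket e) oo (U oo S))"
        by (intro blin_comp[OF blin_compose_left] blin_compose_left) (simp_all add: U_def)
      fix z s assume s: "s \<in> ?CA"
      have "adj (left_ket e) oo (U oo (left_ket z oo s)) = \<phi> (lsl e W z) oo s"
        unfolding \<phi>_lsl by (simp add: lsl_def)
      then show "adj (left_ket e) oo (U oo (left_ket z oo s)) \<in> ?D"
        using s lsl_in_lalg[of e W z] by (intro ccl_base) auto
    qed simp_all
    moreover have "adj (left_ket e) oo (U oo (adj U oo (left_ket e oo t))) = of_real ((norm e)\<^sup>2) *c t"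
      unfolding UU by (simp add: blinfun_compose_assoc[symmetric] adj_left_ket_left_ket cinner_self del: blinfun_compose_assoc of_real_power)
    ultimately have "(1 / of_real ((norm e)\<^sup>2)) *c of_real ((norm e)\<^sup>2) *c t \<in> ?D"
      by (intro csubspaceD(3)[OF csubspace_ccl, of "of_real ((norm e)\<^sup>2) *c t"]) (simp only:)
    then show ?thesis using e by (simp add: scaleC_scaleC)
  next
    case False
    then have z: "e \<otimes> y = 0" for e :: 'c and y :: 'a by (metis tens.zero_left)
    have "t = 0" by (rule blinfun_eq_tensI) (simp_all add: CAD(1)[OF t] z blinfun.zero_right)
    then show ?thesis using csubspaceD(1)[OF csubspace_ccl] by simp
  qed
  have ccl_eq: "{(\<lambda>x\<in>?C. \<phi> x) s oo t |s t. s \<in> ?C \<and> t \<in> ?CA} = {\<phi> s oo t |s t. s \<in> ?C \<and> t \<in> ?CA}" by force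
  have "morphism ?C ?CA (\<lambda>x\<in>?C. \<phi> x)"
  proof (rule morphismI[OF CA])
    show "starhom ?C (\<lambda>x\<in>?C. \<phi> x)"
      unfolding starhom_def using starhomD[OF hom] cstarD(5,6)[OF C] csubspaceD(2,3)[OF cstarD(3)[OF C]] by auto
    show "?CA \<subseteq> ccl {(\<lambda>x\<in>?C. \<phi> x) s oo t |s t. s \<in> ?C \<and> t \<in> ?CA}" unfolding ccl_eq using dense by blast
  qed (simp_all add: mul)
  then show ?thesis by (simp add: \<phi>_def)
qed

section \<open>Multipliers placed in legs\<close>

lemma multipliersI_tensor:
  assumes D: "cstar D" and A: "cstar A" and m: "m \<in> bop"
    and 1: "\<And>d a. d \<in> D ==> a \<in> A ==> m oo (d ** a) \<in> D >< A"
    and 2: "\<And>d a. d \<in> D ==> a \<in> A ==> adj m oo (d ** a) \<in> D >< A"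
  shows "m \<in> multipliers (D >< A)"
  unfolding tensor_alg_ccl
proof (rule multipliersI_ccl)
  note b = cstarD(1)[OF D] cstarD(1)[OF A]
  show "{d ** a |d a. d \<in> D \<and> a \<in> A} \<subseteq> bop" using b by auto
  fix s assume "s \<in> {d ** a |d a. d \<in> D \<and> a \<in> A}"
  then obtain d a where s: "s = d ** a" "d \<in> D" "a \<in> A" by blast
  show "m oo s \<in> ccl {d ** a |d a. d \<in> D \<and> a \<in> A}"
    unfolding tensor_alg_ccl[symmetric] s(1) by (rule 1[OF s(2,3)])
  have "adj (adj m oo (adj d ** adj a)) \<in> D >< A"
    by (rule cstarD(6)[OF cstar_tensor[OF D A] 2[OF cstarD(6)[OF D s(2)] cstarD(6)[OF A s(3)]]])
  then show "s oo m \<in> ccl {d ** a |d a. d \<in> D \<and> a \<in> A}"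
    unfolding tensor_alg_ccl[symmetric] using s b m by simp
qed (rule m)

lemma leg12_multiplier:
  fixes m :: "('d::complex_hilbert, 'c::complex_hilbert) htensor -> ('d, 'c) htensor" and A :: "('a::complex_hilbert -> 'a) set"
  assumes D: "cstar D" and C: "cstar C" and A: "cstar A" and m: "m \<in> multipliers (D >< C)"
  shows "leg12 m \<in> multipliers (D >< (C >< A))"
proof (rule multipliersI_tensor[OF D cstar_tensor[OF C A]])
  have DC: "cstar (D >< C)" and CA: "cstar (C >< A)" and DCA: "cstar (D >< (C >< A))"
    by (intro cstar_tensor D C A)+
  note b = cstarD(1)[OF D] cstarD(1)[OF C] cstarD(1)[OF A]
  have am: "adj m \<in> multipliers (D >< C)" by (rule staralgD(6)[OF staralg_multipliers[OF cstar_staralg[OF DC]] m])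
  show mb: "leg12 m \<in> bop" using multipliersD(1)[OF m] by simp
  have *: "leg12 m oo (d ** t) \<in> D >< (C >< A)" if m: "m \<in> multipliers (D >< C)" and d: "d \<in> D" and t: "t \<in> C >< A" for m d t
  proof (rule blin_ccl[OF t[unfolded tensor_alg_ccl], of "%t. leg12 m oo (d ** t)"])
    show "blin (%t. leg12 m oo (d ** t))"
      using multipliersD(1)[OF m] b d by (intro blin_comp[OF blin_tensor_right] blin_compose_left) auto
    show "{c ** a |c a. c \<in> C \<and> a \<in> A} \<subseteq> bop" using b by auto
    fix s assume "s \<in> {c ** a |c a. c \<in> C \<and> a \<in> A}"
    then obtain c a where s: "s = c ** a" "c \<in> C" "a \<in> A" by blast
    have "leg12 m oo (d ** s) = assoc oo (m oo (d ** c)) ** a oo adj assoc"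
    proof -
      have "d ** s = assoc oo ((d ** c) ** a) oo adj assoc"
        using s d b by (simp add: adj_assoc_naturality)
      then show ?thesis using multipliersD(1)[OF m] s d b by (simp add: leg12_assoc_tensor[symmetric])
    qed
    also have "\<dots> \<in> D >< (C >< A)"
    proof (rule blin_ccl[OF multipliersD(2)[OF m tens_in_alg[OF d s(2)], unfolded tensor_alg_ccl], of "%T. assoc oo T ** a oo adj assoc"])
      show "blin (%T. assoc oo T ** a oo adj assoc)"
        using b s by (intro blin_comp[OF blin_comp[OF blin_tensor_left blin_compose_left] blin_compose_right]) auto
      show "{d ** c |d c. d \<in> D \<and> c \<in> C} \<subseteq> bop" using b by auto
      fix r assume "r \<in> {d ** c |d c. d \<in> D \<and> c \<in> C}"
      then obtain d c where r: "r = d ** c" "d \<in> D" "c \<in> C" by blast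
      have "assoc oo r ** a oo adj assoc = d ** (c ** a)"
        using r s b by (simp add: adj_assoc_naturality)
      then show "assoc oo r ** a oo adj assoc \<in> D >< (C >< A)"
        using r s by (simp only: tens_in_alg)
    qed (use cstarD(3,4)[OF DCA] in auto)
    finally show "leg12 m oo (d ** s) \<in> D >< (C >< A)" .
  qed (use cstarD(3,4)[OF DCA] in auto)
  show "leg12 m oo (d ** t) \<in> D >< (C >< A)" "adj (leg12 m) oo (d ** t) \<in> D >< (C >< A)" if "d \<in> D" "t \<in> C >< A" for d t
    using *[OF m that] *[OF am that] multipliersD(1)[OF m] by simp_all
qed

lemma leg13_slice:
  fixes X :: "('a::complex_hilbert, 'b::complex_hilbert) htensor -> ('a, 'b) htensor" and x z :: "'c::complex_hilbert"
  assumes "X \<in> bop"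
  shows "(\<one> ** adj (left_ket x)) oo (leg13 X oo (\<one> ** left_ket z)) = (x \<bullet> z) *c X"
proof -
  have "(\<one> ** adj (left_ket x)) oo (\<one> ** left_ket z) = (x \<bullet> z) *c (\<one> :: ('a, 'b) htensor -> _)"
    by (simp add: tensor_op_compose adj_left_ket_left_ket tensor_op_linear)
  then show ?thesis
    using assms by (simp only: leg13_id_left_ket(2)[OF assms, of x, THEN compose_reassoc] scaleC_compose_left scaleC_compose_right assms blinfun_compose_id_right)
qed

text \<open>Covers a zero first factor, where no unit vector is available for slicing.\<close>

lemma trivial_htensor:
  fixes S T :: "('c::complex_hilbert, 'a::complex_hilbert) htensor -> 'k::complex_hilbert"
  assumes "\<And>e::'c. e = 0" "S \<in> bop" "T \<in> bop"
  shows "S = T"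
proof (rule blinfun_eq_tensI[OF assms(2,3)])
  fix x :: 'c and y :: 'a
  have "x \<otimes> y = 0" using assms(1)[of x] by (simp add: tens.zero_left)
  then show "S (x \<otimes> y) = T (x \<otimes> y)" by (simp add: blinfun.zero_right)
qed

lemma leg13_inject:
  fixes X Y :: "('c::complex_hilbert, 'a::complex_hilbert) htensor -> ('c, 'a) htensor"
  assumes X: "X \<in> bop" and Y: "Y \<in> bop"
    and eq: "(leg13 X :: ('c, 'c, 'a) htensor3 -> _) = leg13 Y"
  shows "X = Y"
proof (cases "\<exists>e::'c. e \<noteq> 0")
  case True
  then obtain e :: 'c where e: "e \<noteq> 0" by blast
  have "(e \<bullet> e) *c X = (e \<bullet> e) *c Y"
    unfolding leg13_slice[OF X, symmetric] leg13_slice[OF Y, symmetric] eq ..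
  then have "inverse (e \<bullet> e) *c (e \<bullet> e) *c X = inverse (e \<bullet> e) *c (e \<bullet> e) *c Y" by (rule arg_cong)
  then show ?thesis using e by (simp add: scaleC_scaleC cinner_self)
qed (auto intro: trivial_htensor X Y)

text \<open>Feed \<open>d ** (c ** a)\<close> into \<open>leg13 V\<close> and contract the middle
  leg with e = c g: up to the nonzero scalar \<open>e \<bullet> e\<close> the result is
  \<open>V oo (d ** a)\<close>.\<close>

lemma leg13_multiplier_slice:
  fixes V :: "('c::complex_hilbert, 'a::complex_hilbert) htensor -> ('c, 'a) htensor" and C :: "('c -> 'c) set"
  assumes D: "cstar D" and C: "cstar C" and A: "cstar A" and V: "V \<in> bop"
    and m: "leg13 V \<in> multipliers (D >< (C >< A))"
  shows "V \<in> multipliers (D >< A)"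
proof (rule multipliersI_tensor[OF D A V])
  have DA: "cstar (D >< A)" and CA: "cstar (C >< A)" and DCA: "cstar (D >< (C >< A))"
    by (intro cstar_tensor D C A)+
  note b [simp] = cstarD(1)[OF D] cstarD(1)[OF C] cstarD(1)[OF A]
  have sl: "(\<one> ** adj (left_ket e)) oo (T oo (\<one> ** left_ket g)) \<in> D >< A"
    if T: "T \<in> D >< (C >< A)" for T and e g :: 'c
  proof (rule blin_ccl[OF T[unfolded tensor_alg_ccl[of D]], of "%T. (\<one> ** adj (left_ket e)) oo (T oo (\<one> ** left_ket g))"])
    show "blin (%T. (\<one> ** adj (left_ket e)) oo (T oo (\<one> ** left_ket g)))"
      by (intro blin_comp[OF blin_compose_right] blin_compose_left) simp_all
    show "{d ** t |d t. d \<in> D \<and> t \<in> C >< A} \<subseteq> bop" using cstarD(1)[OF CA] by auto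
    fix s assume "s \<in> {d ** t |d t. d \<in> D \<and> t \<in> C >< A}"
    then obtain d t where s: "s = d ** t" "d \<in> D" "t \<in> C >< A" by blast
    have "lsl e t g \<in> A"
      by (rule blin_ccl[OF s(3)[unfolded tensor_alg_ccl] blin_lsl])
         (auto simp: lsl_tensor_op intro!: csubspaceD(3)[OF cstarD(3)[OF A]] cstarD(3,4)[OF A])
    then show "(\<one> ** adj (left_ket e)) oo (s oo (\<one> ** left_ket g)) \<in> D >< A"
      using s cstarD(1)[OF CA s(3)] by (simp add: tensor_op_compose lsl_def[symmetric] tens_in_alg) (simp add: lsl_def tens_in_alg)
  qed (use cstarD(3,4)[OF DA] in auto)
  have *: "V oo (d ** a) \<in> D >< A"
    if V: "V \<in> bop" and m: "leg13 V \<in> multipliers (D >< (C >< A))" and da: "d \<in> D" "a \<in> A" for V :: "('c, 'a) htensor -> ('c, 'a) htensor" and d a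
  proof (cases "\<exists>c\<in>C. \<exists>g. blinfun_apply c g \<noteq> 0")
    case True
    then obtain c g where c: "c \<in> C" "blinfun_apply c g \<noteq> 0" by blast
    define e where "e = blinfun_apply c g"
    have "(\<one> ** adj (left_ket e)) oo ((leg13 V oo (d ** (c ** a))) oo (\<one> ** left_ket g)) \<in> D >< A"
      by (intro sl multipliersD(2)[OF m] tens_in_alg da c)
    also have "(\<one> ** adj (left_ket e)) oo ((leg13 V oo (d ** (c ** a))) oo (\<one> ** left_ket g))
        = (\<one> ** adj (left_ket e)) oo (leg13 V oo (\<one> ** left_ket e)) oo (d ** a)"
      using da c by (simp add: tensor_op_compose tensor_op_left_ket e_def)
    also have "\<dots> = (e \<bullet> e) *c (V oo (d ** a))" unfolding leg13_slice[OF V] by simp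
    finally have "inverse (e \<bullet> e) *c (e \<bullet> e) *c (V oo (d ** a)) \<in> D >< A" by (rule csubspaceD(3)[OF cstarD(3)[OF DA]])
    then show ?thesis using c by (simp add: scaleC_scaleC cinner_self e_def)
  next
    case False
    then have "{blinfun_apply c x |c x. c \<in> C} \<subseteq> {0}" by auto
    then have "ccl {blinfun_apply c x |c x. c \<in> C} \<subseteq> {0 :: 'c}"
      by (rule ccl_minimal) (auto simp: complex_vector.subspace_single_0)
    then have "e = 0" for e :: 'c unfolding cstarD(7)[OF C] by blast
    then have "V oo (d ** a) = 0" by (rule trivial_htensor) (simp_all add: V da)
    then show ?thesis using csubspaceD(1)[OF cstarD(3)[OF DA]] by simp
  qed
  have am: "leg13 (adj V) \<in> multipliers (D >< (C >< A))"
    using staralgD(6)[OF staralg_multipliers[OF cstar_staralg[OF DCA]] m] V by simp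
  show "V oo (d ** a) \<in> D >< A" "adj V oo (d ** a) \<in> D >< A" if "d \<in> D" "a \<in> A" for d a
    using *[OF V m that] *[OF _ am that] V by simp_all
qed

text \<open>The pentagon equation writes \<open>leg13 W\<close> as a product of \<open>W\<close> and
  its adjoint in legs 12 and 23. All factors preserve \<open>Z\<close>, which has the dual algebra
  in leg 1, a free vector in leg 2 and the algebra in leg 3: legs 12 act on columns of the dual,
  legs 23 on columns of \<open>lalg W\<close>. Contracting leg 2 gives the claim.\<close>

lemma reduced_bicharacter_multiplier:
  fixes W :: "('c::complex_hilbert, 'c) htensor -> ('c, 'c) htensor"
  assumes W: "modular_multiplicative_unitary W"
  shows "W \<in> multipliers (lalg (dualu W) >< lalg W)"
proof -
  let ?C = "lalg W" and ?D = "lalg (dualu W)"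
  have uW: "unitary W" and mW: "multiplicative W" using W by (auto simp: modular_multiplicative_unitary_def)
  note [simp] = unitaryD(1)[OF uW]
  note W' = modular_multiplicative_unitary_dualu[OF W]
  note C = cstar_lalg[OF W] and D = cstar_lalg[OF W']
  note b [simp] = cstarD(1)[OF C(1)] cstarD(1)[OF D(1)]
  have DC: "cstar (?D >< ?C)" by (rule cstar_tensor[OF D(1) C(1)])
  define Z where "Z = ccl {d ** (left_ket f oo c) |d (f::'c) c. d \<in> ?D \<and> c \<in> ?C}"
  have Z: "d ** (left_ket f oo c) \<in> Z" if "d \<in> ?D" "c \<in> ?C" for d c f
    unfolding Z_def using that by (intro ccl_base) blast
  have Zc: "csubspace Z" "closed Z" by (simp_all add: Z_def)
  have Zg: "X oo T \<in> Z" if X: "X \<in> bop" "\<And>d f c. d \<in> ?D ==> c \<in> ?C ==> X oo (d ** (left_ket f oo c)) \<in> Z" and T: "T \<in> Z"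
    for X :: "('c, 'c, 'c) htensor3 -> ('c, 'c, 'c) htensor3" and T
    by (rule blin_ccl[OF T[unfolded Z_def] blin_compose_left[OF X(1)] _ Zc]) (auto intro!: X(2))
  have Z12: "leg12 X oo T \<in> Z"
    if X: "X \<in> bop" "\<And>S. S \<in> hcol ?D ==> (flip oo X oo flip) oo S \<in> hcol ?D" and T: "T \<in> Z" for X T
  proof (rule Zg[OF _ _ T])
    fix d f c assume dc: "d \<in> ?D" "c \<in> ?C"
    have "leg12 X oo (d ** (left_ket f oo c)) = assoc oo ((X oo (right_ket f oo d)) ** c)"
      using dc X(1) by (simp add: assoc_kets(2)[symmetric] leg12_assoc_tensor)
    \<comment> \<open>A flip of legs 1 and 2 makes this a column of the dual algebra, on which the
      dual unitary or its adjoint acts.\<close>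
    also have "X oo (right_ket f oo d) = flip oo ((flip oo X oo flip) oo (left_ket f oo d))" by simp
    also have "assoc oo ((flip oo ((flip oo X oo flip) oo (left_ket f oo d))) ** c) \<in> Z"
      by (rule blin_hcol[OF X(2)[OF hcol_base[OF dc(1)]] cstarD(2)[OF D(1)] _ Zc, of "%S. assoc oo ((flip oo S) ** c)"])
         (use dc in \<open>auto simp: assoc_kets(2) Z intro!: blin_comp[OF blin_compose_left] blin_comp[OF blin_tensor_left] blin_compose_left\<close>)
    finally show "leg12 X oo (d ** (left_ket f oo c)) \<in> Z" .
  qed (simp add: X)
  have Z23: "leg23 X oo T \<in> Z"
    if X: "X \<in> bop" "\<And>S. S \<in> hcol ?C ==> X oo S \<in> hcol ?C" and T: "T \<in> Z" for X T
  proof (rule Zg[OF _ _ T])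
    fix d f c assume dc: "d \<in> ?D" "c \<in> ?C"
    have "leg23 X oo (d ** (left_ket f oo c)) = d ** (X oo (left_ket f oo c))"
      using dc X(1) by (simp add: leg23_def tensor_op_compose)
    also have "\<dots> \<in> Z"
      by (rule blin_hcol[OF X(2)[OF hcol_base[OF dc(2)]] cstarD(2)[OF C(1)] _ Zc, of "%S. d ** S"])
         (use dc in \<open>auto simp: Z intro!: blin_tensor_right\<close>)
    finally show "leg23 X oo (d ** (left_ket f oo c)) \<in> Z" .
  qed (simp add: X)
  have flipW: "flip oo adj W oo flip = dualu W" "flip oo W oo flip = adj (dualu W)"
    by (simp_all add: dualu_def)
  note W12 = Z12[of W, unfolded flipW, OF _ D(3)] Z12[of "adj W", unfolded flipW, OF _ D(2)]
  note W23 = Z23[OF _ C(2)] Z23[OF _ C(3)]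
  have p: "leg12 W oo (leg13 W oo leg23 W) = leg23 W oo leg12 W" using mW by (simp add: multiplicative_def)
  have "leg12 (adj W) oo (leg12 W oo (leg13 W oo leg23 W)) oo leg23 (adj W) = leg13 W"
    by (simp add: leg_compose leg_compose2(1)[of "adj W" W] unitaryD(2,3)[OF uW])
  then have W13: "leg13 W = leg12 (adj W) oo (leg23 W oo (leg12 W oo leg23 (adj W)))"
    unfolding p by simp
  then have "adj (leg13 W) = adj (leg12 (adj W) oo (leg23 W oo (leg12 W oo leg23 (adj W))))" by simp
  then have W13': "leg13 (adj W) = leg23 W oo (leg12 (adj W) oo (leg23 (adj W) oo leg12 W))" by simp
  have sl: "(\<one> ** adj (left_ket e)) oo T \<in> ?D >< ?C" if T: "T \<in> Z" for T and e :: 'c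
  proof (rule blin_ccl[OF T[unfolded Z_def] blin_compose_left])
    fix s assume "s \<in> {d ** (left_ket f oo c) |d (f::'c) c. d \<in> ?D \<and> c \<in> ?C}"
    then obtain d f c where s: "s = d ** (left_ket f oo c)" "d \<in> ?D" "c \<in> ?C" by blast
    have "(\<one> ** adj (left_ket e)) oo s = (e \<bullet> f) *c (d ** c)"
      using s by (simp add: tensor_op_compose adj_left_ket_left_ket tensor_op_linear flip: blinfun_compose_assoc)
    then show "(\<one> ** adj (left_ket e)) oo s \<in> ?D >< ?C"
      using s by (simp add: csubspaceD(3)[OF cstarD(3)[OF DC]] tens_in_alg)
  qed (use cstarD(3,4)[OF DC] in auto)
  have *: "X oo (d ** c) \<in> ?D >< ?C"
    if X: "X \<in> bop" "\<And>T. T \<in> Z ==> leg13 X oo T \<in> Z" and dc: "d \<in> ?D" "c \<in> ?C" for X d c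
  proof (cases "\<exists>e::'c. e \<noteq> 0")
    case True
    then obtain e :: 'c where e: "e \<noteq> 0" by blast
    have "(\<one> ** adj (left_ket e)) oo (leg13 X oo (d ** (left_ket e oo c))) \<in> ?D >< ?C"
      by (intro sl X(2) Z dc)
    also have "(\<one> ** adj (left_ket e)) oo (leg13 X oo (d ** (left_ket e oo c)))
        = (\<one> ** adj (left_ket e)) oo (leg13 X oo (\<one> ** left_ket e)) oo (d ** c)"
      using dc by (simp add: tensor_op_compose)
    also have "\<dots> = (e \<bullet> e) *c (X oo (d ** c))" unfolding leg13_slice[OF X(1)] by simp
    finally have "inverse (e \<bullet> e) *c (e \<bullet> e) *c (X oo (d ** c)) \<in> ?D >< ?C" by (rule csubspaceD(3)[OF cstarD(3)[OF DC]])
    then show ?thesis using e by (simp add: scaleC_scaleC cinner_self)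
  next
    case False
    then have "X oo (d ** c) = 0" by (intro trivial_htensor) (simp_all add: X dc)
    then show ?thesis using csubspaceD(1)[OF cstarD(3)[OF DC]] by simp
  qed
  show ?thesis
  proof (rule multipliersI_tensor[OF D(1) C(1)])
    show "W oo (d ** c) \<in> ?D >< ?C" if "d \<in> ?D" "c \<in> ?C" for d c
      by (rule *[OF _ _ that]) (simp_all add: W13 W12 W23)
    show "adj W oo (d ** c) \<in> ?D >< ?C" if "d \<in> ?D" "c \<in> ?C" for d c
      by (rule *[OF _ _ that]) (simp_all add: W13' W12 W23)
  qed simp
qed

section \<open>Bicharacters and right quantum group homomorphisms\<close>

lemma lsl_leg23: "X \<in> bop ==> lsl x (leg23 X) z = (x \<bullet> z) *c X"
  by (simp add: leg23_def lsl_tensor_op)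

lemma lsl_conj_tensor_id:
  assumes U: "U \<in> bop" "U' \<in> bop"
  shows "lsl x ((U ** \<one>) oo (T oo (U' ** \<one>))) z = lsl (adj U x) T (U' z)"
proof -
  have "lsl x ((U ** \<one>) oo (T oo (U' ** \<one>))) z
      = (adj (left_ket x) oo (U ** \<one>)) oo T oo ((U' ** \<one>) oo left_ket z)" by (simp add: lsl_def)
  then show ?thesis by (simp add: U tensor_op_left_ket adj_left_ket_tensor_op lsl_def)
qed

lemma leg12_commute:
  fixes Y :: "('b::complex_hilbert, 'c::complex_hilbert) htensor -> ('b, 'c) htensor" and a :: "'d::complex_hilbert -> 'd"
  assumes Y: "Y \<in> bop" and a: "a \<in> bop"
  shows "(\<one> ** (\<one> ** a)) oo leg12 Y = leg12 Y oo (\<one> ** (\<one> ** a))"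
proof -
  have e: "(\<one> :: 'b -> 'b) ** ((\<one> :: 'c -> 'c) ** a) = assoc oo (((\<one> :: ('b, 'c) htensor -> _) ** a) oo adj assoc)"
    using adj_assoc_naturality[of "\<one> :: 'b -> 'b" "\<one> :: 'c -> 'c" a] a by simp
  have c: "((\<one> :: ('b, 'c) htensor -> _) ** a) oo (Y ** \<one>) = (Y ** \<one>) oo (\<one> ** a)"
    by (simp add: tensor_op_compose Y a)
  show ?thesis unfolding e by (simp add: leg12_def reassoc_def compose_reassoc[OF c])
qed

lemma lsl_id_tensor:
  "A \<in> bop ==> B \<in> bop ==> lsl x ((\<one> ** A) oo (T oo (\<one> ** B))) z = A oo (lsl x T z oo B)"
  by (simp add: lsl_def tensor_op_left_ket) (simp add: adj_left_ket_tensor_op flip: blinfun_compose_assoc)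

text \<open>With four legs, \<open>leg123\<close> and \<open>leg124\<close> place an operator on
  three legs, while nested uses of \<open>leg13\<close> and \<open>leg23\<close> cover the remaining
  positions. Slicing the first leg brings everything back to three legs
  (\<open>lsl_leg4\<close>).\<close>

definition leg123 :: "(('p::complex_hilbert, 'q::complex_hilbert, 'r::complex_hilbert) htensor3 -> ('p, 'q, 'r) htensor3) =>
    (('p, ('q, 'r, 's::complex_hilbert) htensor3) htensor -> ('p, ('q, 'r, 's) htensor3) htensor)" where
  "leg123 T = (\<one> ** assoc) oo (leg12 T oo (\<one> ** adj assoc))"

definition leg124 :: "(('p::complex_hilbert, 'q::complex_hilbert, 'r::complex_hilbert) htensor3 -> ('p, 'q, 'r) htensor3) =>
    (('p, ('q, 's::complex_hilbert, 'r) htensor3) htensor -> ('p, ('q, 's, 'r) htensor3) htensor)" where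
  "leg124 T = (\<one> ** (\<one> ** flip)) oo (leg123 T oo (\<one> ** (\<one> ** flip)))"

lemma bop_leg4 [simp]: "T \<in> bop ==> leg123 T \<in> bop" "T \<in> bop ==> leg124 T \<in> bop"
  by (simp_all add: leg123_def leg124_def)

lemma lsl_leg4:
  assumes "T \<in> bop"
  shows "lsl x (leg123 T) z = leg12 (lsl x T z)" "lsl x (leg124 T) z = leg13 (lsl x T z)"
proof -
  show 1: "lsl x (leg123 T) z = leg12 (lsl x T z)" for x z
    unfolding leg123_def using assms by (simp add: lsl_id_tensor lsl_legs) (simp add: leg12_def reassoc_def)
  show "lsl x (leg124 T) z = leg13 (lsl x T z)"
    unfolding leg124_def by (simp add: lsl_id_tensor 1 leg13_def)
qed

lemma leg4_compose:
  assumes "S \<in> bop" "T \<in> bop"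
  shows "leg123 (S oo T) = leg123 S oo leg123 T" "leg124 (S oo T) = leg124 S oo leg124 T"
proof -
  have 1: "(\<one> ** adj assoc) oo ((\<one> ** assoc) oo R) = R"
    for R :: "'z::real_normed_vector -> ('x::complex_hilbert, (('u::complex_hilbert, 'v::complex_hilbert) htensor, 'w::complex_hilbert) htensor) htensor"
    by (simp add: tensor_op_compose flip: blinfun_compose_assoc)
  show 2: "leg123 (S oo T) = leg123 S oo leg123 T"
    by (simp add: leg123_def 1 leg_compose2(1)[OF assms])
  have 3: "(\<one> ** (\<one> ** flip)) oo ((\<one> ** (\<one> ** flip)) oo R) = R"
    for R :: "'z::real_normed_vector -> ('x::complex_hilbert, ('u::complex_hilbert, 'v::complex_hilbert, 'w::complex_hilbert) htensor3) htensor"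
    by (simp add: tensor_op_compose flip: blinfun_compose_assoc)
  show "leg124 (S oo T) = leg124 S oo leg124 T"
    by (simp add: leg124_def 3 2)
qed

lemma leg4_legs:
  assumes X: "X \<in> bop"
  shows "leg123 (leg12 X) = leg12 X" "leg124 (leg12 X) = leg12 X" "leg123 (leg13 X) = leg13 (leg12 X)" "leg124 (leg13 X) = leg13 (leg13 X)"
    "leg123 (leg23 X) = leg23 (leg12 X)" "leg124 (leg23 X) = leg23 (leg13 X)" "leg13 (leg23 X) = leg23 (leg23 X)"
proof -
  have l: "leg12 (c *c X) = c *c leg12 X" "leg13 (c *c X) = c *c leg13 X" "c *c \<one> ** Y = \<one> ** c *c Y" if "Y \<in> bop" for c Y
    using X that by (simp_all add: blinD(3)[OF blin_legs(1)] blinD(3)[OF blin_legs(2)] tensor_op_linear)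
  note s = lsl_leg4 lsl_legs(1,2) lsl_leg23 leg_tensor_op tensor_op_linear l(1,2)[OF bop_id] X
  show "leg123 (leg12 X) = leg12 X" by (rule lsl_eqI) (simp_all add: s)
  show "leg124 (leg12 X) = leg12 X" by (rule lsl_eqI) (simp_all add: s)
  show "leg123 (leg13 X) = leg13 (leg12 X)" by (rule lsl_eqI) (simp_all add: s)
  show "leg124 (leg13 X) = leg13 (leg13 X)" by (rule lsl_eqI) (simp_all add: s)
  show "leg123 (leg23 X) = leg23 (leg12 X)" by (rule lsl_eqI) (simp_all add: s)
  show "leg124 (leg23 X) = leg23 (leg13 X)" by (rule lsl_eqI) (simp_all add: s)
  show "leg13 (leg23 X) = leg23 (leg23 X)" by (rule lsl_eqI) (simp_all add: s, simp add: leg23_def tensor_op_linear X)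
qed

lemma leg4_commute:
  assumes "X \<in> bop" "Y \<in> bop"
  shows "leg13 (leg13 X) oo leg23 (leg12 Y) = leg23 (leg12 Y) oo leg13 (leg13 X)"
    "leg12 X oo leg23 (leg23 Y) = leg23 (leg23 Y) oo leg12 X"
proof -
  show "leg13 (leg13 X) oo leg23 (leg12 Y) = leg23 (leg12 Y) oo leg13 (leg13 X)"
    by (rule lsl_eqI) (use assms in \<open>simp_all add: lsl_leg23_compose lsl_legs leg12_commute\<close>)
  show "leg12 X oo leg23 (leg23 Y) = leg23 (leg23 Y) oo leg12 X"
  proof (rule lsl_eqI)
    fix x z
    have "(lsl x X z ** \<one>) oo leg23 Y = leg23 Y oo (lsl x X z ** \<one>)"
      using assms by (simp add: leg23_def tensor_op_compose)
    then show "lsl x (leg12 X oo leg23 (leg23 Y)) z = lsl x (leg23 (leg23 Y) oo leg12 X) z"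
      using assms by (simp add: lsl_leg23_compose lsl_legs(1))
  qed (use assms in simp_all)
qed

text \<open>Slicing leg 2 affects only \<open>X\<close> and leaves \<open>rsl p X q\<close> on leg
  1, which moves onto the vector \<open>p'\<close>. A double slice thus becomes a single slice of
  \<open>Y\<close>; for \<open>X\<close> and \<open>Y\<close> equal to \<open>W\<close> this
  computes slices of the comultiplication.\<close>

lemma lsl_lsl_legs:
  assumes X: "X \<in> bop" and Y: "Y \<in> bop"
  shows "lsl p (lsl p' (leg12 X oo leg13 Y) q') q = lsl (adj (rsl p X q) p') Y q'"
proof -
  have k: "left_ket p' oo left_ket p = (\<one> ** left_ket p) oo left_ket p'" for p p'
    by (simp add: tensor_op_left_ket)
  have r: "(\<one> ** adj (left_ket p)) oo (leg12 X oo (\<one> ** left_ket q)) = rsl p X q ** \<one>"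
  proof (rule lsl_eqI)
    fix x z
    have "lsl x ((\<one> ** adj (left_ket p)) oo (leg12 X oo (\<one> ** left_ket q))) z = lsl p (lsl x X z ** \<one>) q"
      using X by (simp add: lsl_id_tensor lsl_legs) (simp add: lsl_def)
    then show "lsl x ((\<one> ** adj (left_ket p)) oo (leg12 X oo (\<one> ** left_ket q))) z = lsl x (rsl p X q ** \<one>) z"
      using X by (simp add: lsl_tensor_op cinner_lsl cinner_rsl)
  qed (use X in simp_all)
  have "lsl p (lsl p' (leg12 X oo leg13 Y) q') q = (adj (left_ket p) oo adj (left_ket p')) oo (leg12 X oo leg13 Y) oo (left_ket q' oo left_ket q)"
    by (simp add: lsl_def)
  also have "adj (left_ket p) oo adj (left_ket p') = adj (left_ket p') oo (\<one> ** adj (left_ket p))"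
    by (simp add: adj_left_ket_tensor_op)
  also have "left_ket q' oo left_ket q = (\<one> ** left_ket q) oo left_ket q'" by (rule k)
  also have "(adj (left_ket p') oo (\<one> ** adj (left_ket p))) oo (leg12 X oo leg13 Y) oo ((\<one> ** left_ket q) oo left_ket q')
      = (adj (left_ket p') oo ((\<one> ** adj (left_ket p)) oo (leg12 X oo (\<one> ** left_ket q)))) oo (Y oo left_ket q')"
    by (simp add: leg13_id_left_ket(1)[OF Y, of q, THEN compose_reassoc])
  also have "\<dots> = lsl (adj (rsl p X q) p') Y q'"
  proof -
    have "rsl p X q \<in> bop" using X by (simp add: rsl_def)
    then show ?thesis unfolding r by (simp add: adj_left_ket_tensor_op lsl_def del: blinfun_compose_assoc) (simp add: lsl_def)
  qed
  finally show ?thesis .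
qed

lemma rsl_leg13:
  assumes "X \<in> bop"
  shows "(\<one> ** adj (right_ket l)) oo (leg13 X oo (\<one> ** right_ket k)) = rsl l X k ** \<one>"
proof (rule lsl_eqI)
  fix x z
  have "adj (right_ket l) oo ((\<one> ** lsl x X z) oo right_ket k) = (l \<bullet> lsl x X z k) *c \<one>"
    by (rule op_eqI) (use assms in \<open>simp add: cinner_adj_right scaleC_blinfun_apply mult.commute\<close>)
  then show "lsl x ((\<one> ** adj (right_ket l)) oo (leg13 X oo (\<one> ** right_ket k))) z = lsl x (rsl l X k ** \<one>) z"
    using assms by (simp add: lsl_id_tensor lsl_legs lsl_tensor_op cinner_lsl cinner_rsl)
qed (use assms in \<open>simp_all add: rsl_def\<close>)

text \<open>Legs 1 and 2 are merged into one so that \<open>slrel\<close> covers operators on three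
  legs. Slices at elementary tensors determine all others by density and contractivity.\<close>

lemma (in star_hom) slrelI_tens:
  fixes t :: "('p::complex_hilbert, 'q::complex_hilbert, 'a) htensor3 -> _" and S :: "('p, 'q, 'b) htensor3 -> _"
  assumes t: "t \<in> bop" and S: "S \<in> bop"
    and 1: "\<And>p q r s. lsl r (lsl p t q) s \<in> A" "\<And>p q r s. lsl r (lsl p S q) s = \<phi> (lsl r (lsl p t q) s)"
  shows "slrel A \<phi> (adj assoc oo t oo assoc) (adj assoc oo S oo assoc)"
proof -
  let ?E = "range (%(x, y). x \<otimes> y) :: ('p, 'q) htensor set"
  have E: "\<xi> \<in> ccl ?E" for \<xi> by (simp add: ccl_tens)
  have k: "assoc oo left_ket (x \<otimes> y) = left_ket x oo left_ket y" for x :: 'p and y :: 'q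
    by (rule blinfun_eqI) simp
  have ak: "adj (left_ket (x \<otimes> y)) oo adj assoc = adj (left_ket y) oo adj (left_ket x)" for x :: 'p and y :: 'q
    using arg_cong[OF k[of x y], of adj] by simp
  have el: "lsl (p \<otimes> r) (adj assoc oo (T oo assoc)) (q \<otimes> s) = lsl r (lsl p T q) s"
    for p q r s and T :: "('p, 'q, 'z::complex_hilbert) htensor3 -> ('p, 'q, 'z) htensor3"
  proof -
    have "lsl (p \<otimes> r) (adj assoc oo (T oo assoc)) (q \<otimes> s) = (adj (left_ket (p \<otimes> r)) oo adj assoc) oo T oo (assoc oo left_ket (q \<otimes> s))"
      by (simp add: lsl_def)
    then show ?thesis unfolding k ak by (simp add: lsl_def)
  qed
  define t' where "t' = adj assoc oo t oo assoc"
  define S' where "S' = adj assoc oo S oo assoc"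
  have b [simp]: "t' \<in> bop" "S' \<in> bop" using t S by (simp_all add: t'_def S'_def)
  have in1: "lsl \<xi> t' \<eta> \<in> A" if \<eta>: "\<eta> \<in> ?E" for \<xi> \<eta>
    by (rule ccl_induct_map[OF E, of "%\<xi>. lsl \<xi> t' \<eta>" A \<xi>])
       (use \<eta> in \<open>auto simp: t'_def el 1 lsl_linear staralgD(3,4)[OF A] intro!: bounded_linear_lsl(1)\<close>)
  have in2: "lsl \<xi> t' \<eta> \<in> A" for \<xi> \<eta>
    by (rule ccl_induct_map[OF E, of "%\<eta>. lsl \<xi> t' \<eta>" A \<eta>])
       (auto simp: lsl_linear staralgD(3,4)[OF A] intro!: bounded_linear_lsl(3) in1)
  have bl: "bounded_linear (%\<xi>. \<phi> (lsl \<xi> t' \<eta>))" "bounded_linear (%\<eta>. \<phi> (lsl \<xi> t' \<eta>))" for \<xi> \<eta>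
  proof -
    have n: "norm (\<phi> (lsl \<xi> t' \<eta>)) \<le> norm \<xi> * norm t' * norm \<eta>" for \<xi> \<eta>
      by (rule order_trans[OF starhom_contractive[OF A \<phi> in2] norm_lsl_le])
    show "bounded_linear (%\<xi>. \<phi> (lsl \<xi> t' \<eta>))"
    proof (rule bounded_linear_intro[where K = "norm t' * norm \<eta>"])
      show "norm (\<phi> (lsl x t' \<eta>)) \<le> norm x * (norm t' * norm \<eta>)" for x using n[of x \<eta>] by (simp add: mult.assoc)
    qed (simp_all add: lsl_linear scaleR_scaleC starhomD(2,3)[OF \<phi>] in2)
    show "bounded_linear (%\<eta>. \<phi> (lsl \<xi> t' \<eta>))"
    proof (rule bounded_linear_intro[where K = "norm \<xi> * norm t'"])
      show "norm (\<phi> (lsl \<xi> t' x)) \<le> norm x * (norm \<xi> * norm t')" for x using n[of \<xi> x] by (simp add: mult.commute)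
    qed (simp_all add: lsl_linear scaleR_scaleC starhomD(2,3)[OF \<phi>] in2)
  qed
  have e1: "lsl \<xi> S' \<eta> = \<phi> (lsl \<xi> t' \<eta>)" if \<eta>: "\<eta> \<in> ?E" for \<xi> \<eta>
    by (rule ccl_eq_map_anti[OF E, of "%\<xi>. lsl \<xi> S' \<eta>" "%\<xi>. \<phi> (lsl \<xi> t' \<eta>)" \<xi>, OF bounded_linear_lsl(1) _ bl(1)])
       (use \<eta> in \<open>auto simp: lsl_linear starhomD(3)[OF \<phi>] in2, auto simp: t'_def S'_def el 1\<close>)
  have "lsl \<xi> S' \<eta> = \<phi> (lsl \<xi> t' \<eta>)" for \<xi> \<eta>
    by (rule ccl_eq_map[OF E, of "%\<eta>. lsl \<xi> S' \<eta>" "%\<eta>. \<phi> (lsl \<xi> t' \<eta>)" \<eta>, OF bounded_linear_lsl(3)[OF b(2)] _ bl(2)])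
       (auto simp: lsl_linear starhomD(3)[OF \<phi>] in2 e1)
  then show ?thesis unfolding t'_def[symmetric] S'_def[symmetric] slrel_def using in2 by simp
qed

lemma slrel_conj:
  assumes r: "slrel A \<phi> t S" and U: "U \<in> bop" "U' \<in> bop"
  shows "slrel A \<phi> ((U ** \<one>) oo t oo (U' ** \<one>)) ((U ** \<one>) oo S oo (U' ** \<one>))"
  using r U unfolding slrel_def by (simp add: lsl_conj_tensor_id)

text \<open>Apply \<phi> to the last leg of the pentagon equation
  \<open>leg13 W oo leg23 W = leg12 (adj W) oo leg23 W oo leg12 W\<close>. Operators in legs 1 and 2
  pass through (\<open>slrel_conj\<close>), multiplicativity of \<phi> handles the left side, and
  \<open>slrel\<close> determines the result.\<close>

lemma (in star_hom) hom_multiplicative: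
  fixes W :: "('a, 'a) htensor -> ('a, 'a) htensor" and Y :: "('a, 'b) htensor -> ('a, 'b) htensor"
  assumes W: "unitary W" "multiplicative W" and r: "slrel A \<phi> W Y"
  shows "leg13 Y oo leg23 Y = leg12 (adj W) oo leg23 Y oo leg12 W"
proof -
  note [simp] = unitaryD(1)[OF W(1)]
  have Yb [simp]: "Y \<in> bop" by (rule slrelD(2)[OF r])
  have lsl2: "lsl s (lsl p (leg13 T oo leg23 T) q) u = lsl p T q oo lsl s T u" "lsl s (lsl p (leg23 T) q) u = (p \<bullet> q) *c lsl s T u"
    if "T \<in> bop" for s p q u and T :: "('a, 'z::complex_hilbert) htensor -> ('a, 'z) htensor"
    using that by (simp_all add: lsl_leg23_compose lsl_legs lsl_linear) (simp add: lsl_def adj_left_ket_tensor_op flip: blinfun_compose_assoc)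
  have 1: "slrel A \<phi> (adj assoc oo (leg13 W oo leg23 W) oo assoc) (adj assoc oo (leg13 Y oo leg23 Y) oo assoc)"
    by (rule slrelI_tens) (simp_all add: lsl2 slrelD(3,4)[OF r] staralgD(5)[OF A] starhomD(4)[OF \<phi>] del: blinfun_compose_assoc)
  have "slrel A \<phi> (adj assoc oo (leg23 W :: ('a, 'a, 'a) htensor3 -> _) oo assoc)
      (adj assoc oo (leg23 Y :: ('a, 'a, 'b) htensor3 -> _) oo assoc)"
    by (rule slrelI_tens) (simp_all add: lsl2 slrelD(3,4)[OF r] csubspaceD(3)[OF staralgD(3)[OF A]] starhomD(3)[OF \<phi>])
  from slrel_conj[OF this, of "adj W" W]
  have 2: "slrel A \<phi> (adj assoc oo (leg12 (adj W) oo leg23 W oo leg12 W) oo assoc) (adj assoc oo (leg12 (adj W) oo leg23 Y oo leg12 W) oo assoc)"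
    by (simp add: leg12_def reassoc_def)
  have "leg12 (adj W) oo leg23 W oo leg12 W = leg13 W oo leg23 W"
    using W(2) by (simp add: multiplicative_def leg_compose2(1)[of "adj W" W] unitaryD(2)[OF W(1)])
  with 2 have "slrel A \<phi> (adj assoc oo (leg13 W oo leg23 W) oo assoc) (adj assoc oo (leg12 (adj W) oo leg23 Y oo leg12 W) oo assoc)"
    by (simp only:)
  from slrel_unique[OF 1 this]
  have "assoc oo (adj assoc oo (leg13 Y oo leg23 Y) oo assoc) oo adj assoc
      = assoc oo (adj assoc oo (leg12 (adj W) oo leg23 Y oo leg12 W) oo assoc) oo adj assoc" by (simp only:)
  then show ?thesis by simp
qed

text \<open>Flipping legs 1 and 2 turns conjugation by the dual unitary into conjugation by the
  adjoint of \<open>leg12 W\<close>, so the character condition in the first leg is a pentagon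
  equation for \<open>W\<close> and \<open>V\<close>.\<close>

lemma pentagon_dualu:
  fixes W :: "('c::complex_hilbert, 'c) htensor -> ('c, 'c) htensor" and V :: "('c, 'a::complex_hilbert) htensor -> ('c, 'a) htensor"
  assumes W: "unitary W" and V: "V \<in> bop"
  shows "leg12 (dualu W) oo leg13 V oo leg12 (adj (dualu W)) = leg23 V oo leg13 V \<longleftrightarrow>
    leg23 V oo leg12 W = leg12 W oo leg13 V oo leg23 V"
proof -
  note [simp] = unitaryD(1)[OF W] V
  define F :: "('c, 'c, 'a) htensor3 -> _" where "F = leg12 flip"
  have FF: "F oo F = \<one>" "F oo (F oo S) = S" for S :: "'z::real_normed_vector -> ('c, 'c, 'a) htensor3"
    by (simp_all add: F_def leg_compose leg_compose2)
  have Fc: "(x \<otimes> (y \<otimes> w)) \<bullet> F v = (y \<otimes> (x \<otimes> w)) \<bullet> v" for x y w v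
    using cinner_adj[of F "x \<otimes> (y \<otimes> w)" v] by (simp add: F_def leg12_tens)
  have Fa: "F (x \<otimes> (y \<otimes> w)) = y \<otimes> (x \<otimes> w)" and [simp]: "F \<in> bop" for x y w
    by (simp_all add: F_def leg12_tens)
  have F3: "F oo leg13 V = leg23 V oo F" "F oo leg23 V = leg13 V oo F"
    by (rule op_eqI3; simp add: Fc Fa cinner_legs)+
  have d: "leg12 (dualu W) = F oo leg12 (adj W) oo F" "leg12 (adj (dualu W)) = F oo leg12 W oo F"
    by (simp_all add: dualu_def F_def leg_compose leg_compose2)
  have "leg12 (dualu W) oo leg13 V oo leg12 (adj (dualu W)) = F oo (leg12 (adj W) oo leg23 V oo leg12 W) oo F"
    unfolding d by (simp add: FF F3[THEN compose_reassoc])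
  moreover have "leg23 V oo leg13 V = F oo (leg13 V oo leg23 V) oo F"
    by (simp add: FF F3 F3[THEN compose_reassoc])
  moreover have "F oo S oo F = F oo T oo F \<longleftrightarrow> S = T" for S T
  proof
    assume "F oo S oo F = F oo T oo F"
    then have "F oo (F oo S oo F) oo F = F oo (F oo T oo F) oo F" by (simp only:)
    then show "S = T" by (simp add: FF)
  qed simp
  ultimately have "leg12 (dualu W) oo leg13 V oo leg12 (adj (dualu W)) = leg23 V oo leg13 V \<longleftrightarrow>
      leg12 (adj W) oo leg23 V oo leg12 W = leg13 V oo leg23 V" by (simp only:)
  also have "\<dots> \<longleftrightarrow> leg23 V oo leg12 W = leg12 W oo leg13 V oo leg23 V"
  proof
    assume "leg12 (adj W) oo leg23 V oo leg12 W = leg13 V oo leg23 V"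
    then have "leg12 W oo (leg12 (adj W) oo leg23 V oo leg12 W) = leg12 W oo (leg13 V oo leg23 V)" by (simp only:)
    then show "leg23 V oo leg12 W = leg12 W oo leg13 V oo leg23 V"
      by (simp add: leg_compose2(1)[of W "adj W"] unitaryD(3)[OF W])
  qed (simp add: leg_compose2(1)[of "adj W" W] unitaryD(2)[OF W])
  finally show ?thesis .
qed

section \<open>Bicharacters as pentagon equations\<close>

locale quantum_group_pair =
  fixes W :: "('c::complex_hilbert, 'c) htensor -> ('c, 'c) htensor" and W' :: "('a::complex_hilbert, 'a) htensor -> ('a, 'a) htensor"
  assumes W: "modular_multiplicative_unitary W" and W': "modular_multiplicative_unitary W'"
begin

abbreviation C where "C \<equiv> lalg W"
abbreviation D where "D \<equiv> lalg (dualu W)"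
abbreviation A where "A \<equiv> lalg W'"

definition DC where "DC = (\<lambda>x\<in>C. W oo (x ** \<one>) oo adj W)"
definition DD where "DD = (\<lambda>x\<in>D. dualu W oo (x ** \<one>) oo adj (dualu W))"
definition DA where "DA = (\<lambda>x\<in>A. W' oo (x ** \<one>) oo adj W')"

lemma uW: "unitary W" "unitary W'" and mW: "multiplicative W" "multiplicative W'"
  using W W' by (auto simp: modular_multiplicative_unitary_def)

lemmas bW [simp] = unitaryD(1)[OF uW(1)] unitaryD(1)[OF uW(2)]

lemmas mdual = modular_multiplicative_unitary_dualu[OF W]
lemmas cs = cstar_lalg(1)[OF W] cstar_lalg(1)[OF mdual] cstar_lalg(1)[OF W']
lemmas cCA = cstar_tensor[OF cs(1) cs(3)] and cAA = cstar_tensor[OF cs(3) cs(3)] and cCC = cstar_tensor[OF cs(1) cs(1)]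
  and cDD = cstar_tensor[OF cs(2) cs(2)] and cDC = cstar_tensor[OF cs(2) cs(1)] and cDA = cstar_tensor[OF cs(2) cs(3)]
  and cDCA = cstar_tensor[OF cs(2) cstar_tensor[OF cs(1) cs(3)]]

lemma morphism_comult: "modular_multiplicative_unitary U ==> morphism (lalg U) (lalg U >< lalg U) (\<lambda>x\<in>lalg U. U oo (x ** \<one>) oo adj U)"
  by (rule spatial_morphism; simp add: cstar_lalg modular_multiplicative_unitary_def multiplicative_def)

lemmas mor = morphism_comult[OF W, folded DC_def] morphism_comult[OF mdual, folded DD_def] morphism_comult[OF W', folded DA_def]

text \<open>\<open>pent\<close> encodes the character condition in the first leg and
  \<open>pent'\<close> the one in the second (\<open>bicharacter_iff\<close>).\<close>

definition pent :: "(('c, 'a) htensor -> ('c, 'a) htensor) => bool" where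
  "pent V \<longleftrightarrow> leg23 V oo leg12 W = leg12 W oo leg13 V oo leg23 V"

definition pent' :: "(('c, 'a) htensor -> ('c, 'a) htensor) => bool" where
  "pent' V \<longleftrightarrow> leg23 W' oo leg12 V = leg12 V oo leg13 V oo leg23 W'"

lemma dual_eq: "dual_algebra W = D" "dual_comult W = DD"
proof -
  show d: "dual_algebra W = D" by (rule dual_algebra_eq) simp
  show "dual_comult W = DD"
  proof
    fix y
    show "dual_comult W y = DD y"
    proof (cases "y \<in> D")
      case True
      then show ?thesis using dual_comult_eq[OF uW(1), of y] by (simp add: d DD_def)
    qed (simp add: dual_comult_def DD_def d)
  qed
qed

lemma unitary_multipliersD:
  assumes "V \<in> unitary_multipliers (D >< A)"
  shows "unitary V" "V \<in> bop" "V \<in> multipliers (D >< A)" "S \<in> hcol A ==> V oo S \<in> hcol A" "S \<in> hcol A ==> adj V oo S \<in> hcol A"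
proof -
  show u: "unitary V" and m: "V \<in> multipliers (D >< A)" using assms by (auto simp: unitary_multipliers_def)
  then show "V \<in> bop" by (simp add: unitaryD)
  show "S \<in> hcol A ==> V oo S \<in> hcol A" by (rule multiplier_hcol[OF cs(2) cstarD(2)[OF cs(3)] m])
  have "adj V \<in> multipliers (D >< A)" by (rule staralgD(6)[OF staralg_multipliers[OF cstar_staralg[OF cDA]] m])
  then show "S \<in> hcol A ==> adj V oo S \<in> hcol A" by (rule multiplier_hcol[OF cs(2) cstarD(2)[OF cs(3)]])
qed

lemma bicharacter_iff:
  assumes V: "V \<in> unitary_multipliers (D >< A)"
  shows "bicharacter W A DA V \<longleftrightarrow> pent V \<and> pent' V"
proof -
  note VD = unitary_multipliersD[OF V]
  note [simp] = VD(2)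
  have 1: "reassoc (tensor_id D (D >< D) DD A V) = leg12 (dualu W) oo leg13 V oo leg12 (adj (dualu W))"
    by (rule tensor_id_spatial[OF cs(3,2) cDD mor(2) unitary_dualu[OF uW(1)] _ VD(3)]) (simp add: DD_def)
  have 2: "id_tensor D A (A >< A) DA V = leg23 W' oo leg12 V oo leg23 (adj W')"
    by (rule id_tensor_spatial[OF cs(2,3) cAA mor(3) uW(2) _ VD(3)]) (simp add: DA_def)
  have 3: "leg23 W' oo leg12 V oo leg23 (adj W') = leg12 V oo leg13 V \<longleftrightarrow> pent' V"
  proof
    assume "leg23 W' oo leg12 V oo leg23 (adj W') = leg12 V oo leg13 V"
    then have "leg23 W' oo leg12 V oo leg23 (adj W') oo leg23 W' = leg12 V oo leg13 V oo leg23 W'" by (simp only:)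
    then show "pent' V" by (simp add: pent'_def leg_compose unitaryD(2)[OF uW(2)])
  next
    assume "pent' V"
    then have "leg23 W' oo leg12 V oo leg23 (adj W') = leg12 V oo leg13 V oo leg23 W' oo leg23 (adj W')" by (simp only: pent'_def)
    then show "leg23 W' oo leg12 V oo leg23 (adj W') = leg12 V oo leg13 V" by (simp add: leg_compose unitaryD(3)[OF uW(2)])
  qed
  show ?thesis
    unfolding bicharacter_def Let_def dual_eq 1 2 pentagon_dualu[OF uW(1) VD(2)] 3 pent_def[symmetric] using V by blast
qed

lemma pent_conj:
  assumes "pent V" "unitary V"
  shows "leg23 V oo (leg12 W oo leg23 (adj V)) = leg12 W oo leg13 V"
proof -
  note [simp] = unitaryD(1)[OF assms(2)]
  have "leg23 V oo leg12 W oo leg23 (adj V) = leg12 W oo leg13 V oo leg23 V oo leg23 (adj V)"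
    using assms(1) by (simp only: pent_def)
  then show ?thesis by (simp add: leg_compose unitaryD(3)[OF assms(2)])
qed

lemma morphism_of_pent:
  assumes V: "V \<in> unitary_multipliers (D >< A)" and p: "pent V"
  shows "morphism C (C >< A) (\<lambda>x\<in>C. V oo (x ** \<one>) oo adj V)"
  by (rule spatial_morphism[OF W cs(3) unitary_multipliersD(1,4,5)[OF V] p[unfolded pent_def]])

lemma id_tensor_of_pent:
  assumes V: "V \<in> unitary_multipliers (D >< A)" and p: "pent V"
  shows "id_tensor D C (C >< A) (\<lambda>x\<in>C. V oo (x ** \<one>) oo adj V) W = leg12 W oo leg13 V"
  unfolding pent_conj[OF p unitary_multipliersD(1)[OF V], symmetric]
  by (subst id_tensor_spatial[OF cs(2,1) cCA morphism_of_pent[OF V p] unitary_multipliersD(1)[OF V] _ reduced_bicharacter_multiplier[OF W]]) simp_all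

lemma hom_of_pents:
  assumes V: "V \<in> unitary_multipliers (D >< A)" and p: "pent V" "pent' V"
  shows "right_qg_hom C DC A DA (\<lambda>x\<in>C. V oo (x ** \<one>) oo adj V)"
proof -
  let ?\<phi> = "\<lambda>x\<in>C. V oo (x ** \<one>) oo adj V"
  note VD = unitary_multipliersD[OF V]
  note [simp] = VD(2)
  note \<phi> = morphism_of_pent[OF V p(1)]
  note \<phi>M = morphismD(3)[OF cs(1) cCA \<phi>] and DM = morphismD(3)[OF cs(1) cCC mor(1)]
  have e\<phi>: "?\<phi> x = V oo (x ** \<one>) oo adj V" if "x \<in> C" for x using that by simp
  have eD: "DC x = W oo (x ** \<one>) oo adj W" if "x \<in> C" for x using that by (simp add: DC_def)
  have eA: "DA x = W' oo (x ** \<one>) oo adj W'" if "x \<in> A" for x using that by (simp add: DA_def)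
  \<comment> \<open>Both sides of each condition conjugate x tensor 1 tensor 1; by the pentagon
    equations the implementing unitaries differ by a right factor that commutes with it.\<close>
  have adj_eq: "U oo (X oo adj U) = U' oo (X oo adj U')" if "U = U' oo R" "R oo X = X oo R" "unitary R" "U' \<in> bop" for U U' R X :: "'z::complex_hilbert -> 'z"
  proof -
    have "R oo (X oo S) = X oo (R oo S)" for S :: "'z -> 'z" by (rule compose_reassoc[OF that(2)])
    then show ?thesis using that(3,4) by (simp add: that(1) unitaryD)
  qed
  have 1: "reassoc (tensor_id C (C >< C) DC A (?\<phi> x)) = id_tensor C C (C >< A) ?\<phi> (DC x)" if x: "x \<in> C" for x
  proof -
    have xb [simp]: "x \<in> bop" by (rule cstarD(1)[OF cs(1) x])
    let ?X = "x ** (\<one> ** \<one>) :: ('c, 'c, 'a) htensor3 -> _"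
    have X: "leg12 (x ** \<one>) = ?X" "leg13 (x ** \<one>) = ?X" by (simp_all add: leg_tensor_op)
    have "reassoc (tensor_id C (C >< C) DC A (?\<phi> x)) = leg12 W oo leg13 (?\<phi> x) oo leg12 (adj W)"
      by (rule tensor_id_spatial[OF cs(3,1) cCC mor(1) uW(1) eD \<phi>M[OF x]])
    also have "\<dots> = (leg12 W oo leg13 V) oo (?X oo adj (leg12 W oo leg13 V))"
      using x by (simp add: leg_compose(2)[symmetric] X del: tensor_op_id)
    also have "\<dots> = (leg23 V oo leg12 W) oo (?X oo adj (leg23 V oo leg12 W))"
      by (rule adj_eq[symmetric, of _ _ "leg23 V"]) (use p VD(1) in \<open>simp_all add: pent_def leg23_def tensor_op_compose\<close>)
    also have "\<dots> = leg23 V oo leg12 (DC x) oo leg23 (adj V)"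
      using x by (simp add: eD leg_compose(1)[symmetric] X del: tensor_op_id)
    also have "\<dots> = id_tensor C C (C >< A) ?\<phi> (DC x)"
      by (rule id_tensor_spatial[OF cs(1,1) cCA \<phi> VD(1) e\<phi> DM[OF x], symmetric])
    finally show ?thesis .
  qed
  have 2: "id_tensor C A (A >< A) DA (?\<phi> x) = reassoc (tensor_id C (C >< A) ?\<phi> A (?\<phi> x))" if x: "x \<in> C" for x
  proof -
    have xb [simp]: "x \<in> bop" by (rule cstarD(1)[OF cs(1) x])
    let ?X = "x ** (\<one> ** \<one>) :: ('c, 'a, 'a) htensor3 -> _"
    have X: "leg12 (x ** \<one>) = ?X" "leg13 (x ** \<one>) = ?X" by (simp_all add: leg_tensor_op)
    have "id_tensor C A (A >< A) DA (?\<phi> x) = leg23 W' oo leg12 (?\<phi> x) oo leg23 (adj W')"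
      by (rule id_tensor_spatial[OF cs(1,3) cAA mor(3) uW(2) eA \<phi>M[OF x]])
    also have "\<dots> = (leg23 W' oo leg12 V) oo (?X oo adj (leg23 W' oo leg12 V))"
      using x by (simp add: leg_compose(1)[symmetric] X del: tensor_op_id)
    also have "\<dots> = (leg12 V oo leg13 V) oo (?X oo adj (leg12 V oo leg13 V))"
      by (rule adj_eq[of _ _ "leg23 W'"]) (use p VD(1) uW(2) in \<open>simp_all add: pent'_def leg23_def tensor_op_compose\<close>)
    also have "\<dots> = leg12 V oo leg13 (?\<phi> x) oo leg12 (adj V)"
      using x by (simp add: leg_compose(2)[symmetric] X del: tensor_op_id)
    also have "\<dots> = reassoc (tensor_id C (C >< A) ?\<phi> A (?\<phi> x))"
      by (rule tensor_id_spatial[OF cs(3,1) cCA \<phi> VD(1) e\<phi> \<phi>M[OF x], symmetric])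
    finally show ?thesis .
  qed
  show ?thesis unfolding right_qg_hom_def using \<phi> 1 2 by blast
qed

section \<open>From homomorphisms to bicharacters\<close>

lemma hom_slices:
  assumes \<phi>: "morphism C (C >< A) \<phi>"
  defines "Y \<equiv> id_tensor D C (C >< A) \<phi> W"
  shows "Y \<in> multipliers (D >< (C >< A))" "unitary Y" "lsl p Y q = \<phi> (lsl p W q)" "slrel C \<phi> W Y"
proof -
  note s = id_tensor_slices[OF cs(2,1) cCA \<phi> reduced_bicharacter_multiplier[OF W], folded Y_def]
  show "Y \<in> multipliers (D >< (C >< A))" by (rule s(1))
  show "unitary Y" by (rule s(2)[OF uW(1)])
  then show "slrel C \<phi> W Y" unfolding slrel_def by (simp add: lsl_in_lalg s(3) unitaryD(1))
  show "lsl p Y q = \<phi> (lsl p W q)" by (rule s(3)) (rule lsl_in_lalg)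
qed

text \<open>Both pentagon equations first appear on four legs with one leg untouched: leg 3 when
  multiplicativity of \<phi> is exploited, leg 2 for the second homomorphism condition.
  \<open>leg13_inject\<close> strips off the spare leg.\<close>

lemma hom_spatial:
  assumes hom: "right_qg_hom C DC A DA \<phi>" and V: "V \<in> unitary_multipliers (D >< A)"
    and Y: "id_tensor D C (C >< A) \<phi> W = leg12 W oo leg13 V"
  shows "pent V" "pent' V" "\<phi> = (\<lambda>x\<in>C. V oo (x ** \<one>) oo adj V)"
proof -
  have \<phi>: "morphism C (C >< A) \<phi>" using hom by (simp add: right_qg_hom_def)
  note \<phi>D = morphismD[OF cs(1) cCA \<phi>]
  note VD = unitary_multipliersD[OF V]
  note [simp] = VD(2)
  note sl = hom_slices[OF \<phi>, unfolded Y]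
  interpret h: star_hom C \<phi> by unfold_locales (rule cstar_staralg[OF cs(1)], rule \<phi>D(1))
  \<comment> \<open>In leg numbers a = W_13, b = V_14, c = W_23, d = V_24 and w = W_12. The pentagon
    equation for \<open>W\<close> moves w past c, and b commutes with c; cancelling a and c leaves
    V_14 V_24 as the conjugate of V_24 by the adjoint of w.\<close>
  define a where "a = (leg13 (leg12 W) :: ('c, ('c, 'c, 'a) htensor3) htensor -> _)"
  define b where "b = (leg13 (leg13 V) :: ('c, ('c, 'c, 'a) htensor3) htensor -> _)"
  define c where "c = (leg23 (leg12 W) :: ('c, ('c, 'c, 'a) htensor3) htensor -> _)"
  define d where "d = (leg23 (leg13 V) :: ('c, ('c, 'c, 'a) htensor3) htensor -> _)"
  define w where "w = (leg12 W :: ('c, ('c, 'c, 'a) htensor3) htensor -> _)"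
  have w: "unitary w" "unitary a" "unitary c" by (simp_all add: w_def a_def c_def uW)
  have "(a oo b) oo (c oo d) = adj w oo (c oo d) oo w"
    using h.hom_multiplicative[OF uW(1) mW(1) sl(4)] by (simp only: a_def b_def c_def d_def w_def leg_compose bop_legs bW VD(2) leg_adj)
  then have 1: "a oo (b oo (c oo d)) = adj w oo (c oo (d oo w))" by simp
  have bc: "b oo c = c oo b" by (simp add: b_def c_def leg4_commute)
  have "leg123 (leg23 W oo leg12 W) = leg123 (leg12 W oo leg13 W oo leg23 W)" using mW(1) by (simp only: multiplicative_def)
  then have ac: "c oo w = w oo (a oo c)"
    by (simp add: a_def c_def w_def leg4_compose leg4_legs)
  have "adj w oo (c oo (d oo w)) = a oo (c oo (adj w oo (d oo w)))"
  proof -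
    have "adj w oo (c oo (d oo w)) = adj w oo ((c oo w) oo (adj w oo (d oo w)))" by (simp add: unitaryD(7)[OF w(1)])
    also have "\<dots> = a oo (c oo (adj w oo (d oo w)))" unfolding ac by (simp add: unitaryD(6)[OF w(1)])
    finally show ?thesis .
  qed
  with 1 have "a oo (c oo (b oo d)) = a oo (c oo (adj w oo (d oo w)))"
    using compose_reassoc[OF bc, of d] by simp
  then have "adj c oo (adj a oo (a oo (c oo (b oo d)))) = adj c oo (adj a oo (a oo (c oo (adj w oo (d oo w)))))" by (simp only:)
  then have bd: "b oo d = adj w oo (d oo w)" by (simp add: unitaryD(6)[OF w(2)] unitaryD(6)[OF w(3)])
  have "(leg124 (leg13 V oo leg23 V) :: ('c, ('c, 'c, 'a) htensor3) htensor -> _) = leg124 (leg12 (adj W) oo (leg23 V oo leg12 W))"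
    using bd by (simp add: b_def d_def w_def leg4_compose leg4_legs)
  then have "(leg13 (lsl x (leg13 V oo leg23 V) z) :: ('c, 'c, 'a) htensor3 -> _) = leg13 (lsl x (leg12 (adj W) oo (leg23 V oo leg12 W)) z)" for x z
    by (simp add: lsl_leg4(2)[symmetric])
  then have "leg13 V oo leg23 V = leg12 (adj W) oo (leg23 V oo leg12 W)"
    by (intro lsl_eqI leg13_inject) simp_all
  then have "leg12 W oo (leg13 V oo leg23 V) = leg12 W oo (leg12 (adj W) oo (leg23 V oo leg12 W))" by (simp only:)
  then show p: "pent V" by (simp add: pent_def leg_compose2(1)[of W "adj W"] unitaryD(3)[OF uW(1)])
  let ?\<psi> = "\<lambda>x\<in>C. V oo (x ** \<one>) oo adj V"
  note \<psi>D = morphismD[OF cs(1) cCA morphism_of_pent[OF V p]]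
  show eq: "\<phi> = ?\<psi>"
  proof (rule extensionalityI[OF \<phi>D(2) \<psi>D(2)])
    fix x assume x: "x \<in> C"
    show "\<phi> x = ?\<psi> x"
    proof (rule starhom_eq[OF cstar_staralg[OF cs(1)] \<phi>D(1) \<psi>D(1) lalg_def _ x])
      fix s assume "s \<in> {lsl x W z |x z. True}"
      then obtain p q where s: "s = lsl p W q" by blast
      have "?\<psi> s = V oo (lsl p (leg12 W) q oo adj V)" by (simp add: s lsl_in_lalg lsl_legs)
      also have "\<dots> = lsl p (leg23 V oo (leg12 W oo leg23 (adj V))) q" by (simp add: lsl_leg23_compose)
      also have "\<dots> = \<phi> s" unfolding pent_conj[OF p VD(1)] s by (rule sl(3))
      finally show "\<phi> s = ?\<psi> s" by simp
    qed
  qed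
  have e\<phi>: "\<phi> x = V oo (x ** \<one>) oo adj V" if "x \<in> C" for x using that by (simp add: eq)
  have eA: "DA x = W' oo (x ** \<one>) oo adj W'" if "x \<in> A" for x using that by (simp add: DA_def)
  define Y' where "Y' = leg12 W oo leg13 V"
  have [simp]: "Y' \<in> bop" by (simp add: Y'_def)
  \<comment> \<open>Here t is W' in legs 3 and 4, the three u are \<open>V\<close> in the legs they
    name, and w' is \<open>W\<close> in legs 1 and 2. The second condition on \<phi>, tested on
    slices of \<open>W\<close>, becomes a single equation between these.\<close>
  define t where "t = (leg23 (leg23 W') :: ('c, ('c, 'a, 'a) htensor3) htensor -> _)"
  define u13 where "u13 = (leg13 (leg12 V) :: ('c, ('c, 'a, 'a) htensor3) htensor -> _)"
  define u14 where "u14 = (leg13 (leg13 V) :: ('c, ('c, 'a, 'a) htensor3) htensor -> _)"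
  define u23 where "u23 = (leg23 (leg12 V) :: ('c, ('c, 'a, 'a) htensor3) htensor -> _)"
  define w' where "w' = (leg12 W :: ('c, ('c, 'a, 'a) htensor3) htensor -> _)"
  have u: "unitary t" "unitary w'" "unitary u23" by (simp_all add: t_def w'_def u23_def uW VD(1))
  have "t oo leg123 Y' oo adj t = u23 oo leg124 Y' oo adj u23"
  proof (rule lsl_eqI)
    fix p q
    let ?x = "lsl p W q"
    have x: "?x \<in> C" by (rule lsl_in_lalg)
    have \<phi>x: "\<phi> ?x = lsl p Y' q" unfolding Y'_def by (rule sl(3)[symmetric])
    note m = \<phi>D(3)[OF x]
    have "leg23 W' oo leg12 (\<phi> ?x) oo leg23 (adj W') = id_tensor C A (A >< A) DA (\<phi> ?x)"
      by (rule id_tensor_spatial[OF cs(1,3) cAA mor(3) uW(2) eA m, symmetric])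
    also have "\<dots> = reassoc (tensor_id C (C >< A) \<phi> A (\<phi> ?x))" using hom x unfolding right_qg_hom_def by blast
    also have "\<dots> = leg12 V oo leg13 (\<phi> ?x) oo leg12 (adj V)"
      by (rule tensor_id_spatial[OF cs(3,1) cCA \<phi> VD(1) e\<phi> m])
    finally show "lsl p (t oo leg123 Y' oo adj t) q = lsl p (u23 oo leg124 Y' oo adj u23) q"
      unfolding \<phi>x by (simp add: t_def u23_def lsl_leg23_compose lsl_leg4)
  qed (simp_all add: t_def u23_def)
  then have "t oo ((w' oo u13) oo adj t) = u23 oo ((w' oo u14) oo adj u23)"
    by (simp add: Y'_def leg4_compose leg4_legs w'_def u13_def u14_def)
  moreover have tw: "t oo (w' oo S) = w' oo (t oo S)" for S :: "('c, ('c, 'a, 'a) htensor3) htensor -> ('c, ('c, 'a, 'a) htensor3) htensor"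
    by (rule compose_reassoc) (simp add: t_def w'_def leg4_commute)
  moreover have uw: "u23 oo (w' oo S) = (w' oo (u13 oo u23)) oo S" for S :: "('c, ('c, 'a, 'a) htensor3) htensor -> ('c, ('c, 'a, 'a) htensor3) htensor"
  proof -
    have "leg123 (leg23 V oo leg12 W) = leg123 (leg12 W oo leg13 V oo leg23 V)" using p by (simp only: pent_def)
    then have "u23 oo w' = w' oo (u13 oo u23)" by (simp add: u23_def u13_def w'_def leg4_compose leg4_legs)
    then show ?thesis by (simp only: blinfun_compose_assoc[symmetric])
  qed
  moreover have "u23 oo (u14 oo S) = u14 oo (u23 oo S)" for S :: "('c, ('c, 'a, 'a) htensor3) htensor -> ('c, ('c, 'a, 'a) htensor3) htensor"
    by (rule compose_reassoc) (simp add: u23_def u14_def leg4_commute)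
  ultimately have "w' oo (t oo (u13 oo adj t)) = w' oo (u13 oo u14)"
    by (simp add: unitaryD(3)[OF u(3)])
  then have "adj w' oo (w' oo (t oo (u13 oo adj t))) oo t = adj w' oo (w' oo (u13 oo u14)) oo t" by (simp only:)
  then have "t oo u13 = u13 oo (u14 oo t)" by (simp add: unitaryD(6)[OF u(2)] unitaryD(2)[OF u(1)])
  then have "(leg13 (leg23 W' oo leg12 V) :: ('c, ('c, 'a, 'a) htensor3) htensor -> _) = leg13 (leg12 V oo leg13 V oo leg23 W')"
    by (simp add: t_def u13_def u14_def leg_compose(2)[symmetric] leg4_legs(7))
  from leg13_inject[OF _ _ this] show "pent' V" by (simp add: pent'_def)
qed

lemma intertwiner_scalar:
  assumes "a \<in> bop" "b \<in> bop" "W oo (a ** \<one>) = (\<one> ** b) oo W"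
  shows "\<exists>c. a = c *c \<one>"
proof -
  obtain Q' E' q' Q E q V where md: "modular_data W Q' E' q' Q E q V" using ex_modular_data[OF W] by blast
  show ?thesis by (rule modular_data.intertwiner_scalar[OF md assms])
qed

lemma ex_bichar:
  assumes hom: "right_qg_hom C DC A DA \<phi>"
  shows "\<exists>V\<in>unitary_multipliers (D >< A). id_tensor D C (C >< A) \<phi> W = leg12 W oo leg13 V"
proof -
  have \<phi>: "morphism C (C >< A) \<phi>" using hom by (simp add: right_qg_hom_def)
  note \<phi>D = morphismD[OF cs(1) cCA \<phi>]
  define Y where "Y = id_tensor D C (C >< A) \<phi> W"
  note sl = hom_slices[OF \<phi>, folded Y_def]
  note [simp] = unitaryD(1)[OF sl(2)]
  have eD: "DC x = W oo (x ** \<one>) oo adj W" if "x \<in> C" for x using that by (simp add: DC_def)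
  have DC_lsl: "DC (lsl p W q) = lsl p (leg12 W oo leg13 W) q" for p q
  proof -
    have "DC (lsl p W q) = lsl p (leg23 W oo leg12 W oo leg23 (adj W)) q"
      by (simp add: eD lsl_in_lalg lsl_leg23_compose lsl_legs)
    also have "leg23 W oo leg12 W oo leg23 (adj W) = leg12 W oo leg13 W"
      unfolding mW(1)[unfolded multiplicative_def] by (simp add: leg_compose unitaryD(3)[OF uW(1)])
    finally show ?thesis .
  qed
  \<comment> \<open>The first homomorphism condition after slicing. A slice of the comultiplication
    of a slice of \<open>W\<close> is again a slice of \<open>W\<close>, so both sides are expressed
    through \<open>Y\<close>.\<close>
  have cond: "lsl p (leg12 W oo (leg13 (lsl p' Y q') oo leg12 (adj W))) q = lsl (adj (rsl p W q) p') Y q'" for p q p' q'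
  proof -
    let ?x = "lsl p' W q'"
    have x: "?x \<in> C" by (rule lsl_in_lalg)
    have m: "DC ?x \<in> multipliers (C >< C)" by (rule morphismD(3)[OF cs(1) cCC mor(1) x])
    have s: "lsl p (DC ?x) q = lsl (adj (rsl p W q) p') W q'" for p q
      unfolding DC_lsl by (rule lsl_lsl_legs) simp_all
    have "leg12 W oo leg13 (\<phi> ?x) oo leg12 (adj W) = reassoc (tensor_id C (C >< C) DC A (\<phi> ?x))"
      by (rule tensor_id_spatial[OF cs(3,1) cCC mor(1) uW(1) eD \<phi>D(3)[OF x], symmetric])
    also have "\<dots> = id_tensor C C (C >< A) \<phi> (DC ?x)" using hom x unfolding right_qg_hom_def by blast
    finally have "lsl p (leg12 W oo leg13 (\<phi> ?x) oo leg12 (adj W)) q = \<phi> (lsl p (DC ?x) q)"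
      using id_tensor_slices(3)[OF cs(1,1) cCA \<phi> m] by (simp add: s lsl_in_lalg)
    then show ?thesis by (simp add: s sl(3))
  qed
  define X where "X = leg12 (adj W) oo Y"
  have uX: "unitary X"
    unfolding unitary_def by (simp add: X_def leg_compose2(1)[of W "adj W"] leg_compose(1) unitaryD[OF uW(1)] unitaryD[OF sl(2)])
  have r12: "(\<one> ** adj (right_ket l)) oo leg12 T = T oo (\<one> ** adj (right_ket l))"
    if "T \<in> bop" for T :: "('c, 'c) htensor -> ('c, 'c) htensor" and l :: 'a
    using arg_cong[OF leg12_id_right_ket[of "adj T" l], of adj] that by simp
  have scalar: "\<exists>k. \<forall>y u. (x \<otimes> (y \<otimes> l)) \<bullet> X (z \<otimes> (u \<otimes> l')) = k * (y \<bullet> u)" for x z l l'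
  proof -
    \<comment> \<open>A slice of \<open>Y\<close> in its last leg lives on the same space as
      \<open>W\<close>. The relation \<open>E\<close> for it has the shape of the pentagon for
      \<open>W\<close>, so dividing by \<open>W\<close> from the left leaves an intertwiner.\<close>
    define y where "y = (\<one> ** adj (right_ket l)) oo (Y oo (\<one> ** right_ket l'))"
    have yb [simp]: "y \<in> bop" by (simp add: y_def)
    have sy: "lsl p y q = adj (right_ket l) oo (lsl p Y q oo right_ket l')" for p q
      unfolding y_def by (rule lsl_id_tensor) simp_all
    have "W oo ((lsl p' y q' ** \<one>) oo adj W) = lsl p' (leg12 W oo leg13 y) q'" for p' q'
    proof (rule lsl_eqI)
      fix p q
      let ?Z = "lsl p' Y q'"
      have "W oo ((lsl p' y q' ** \<one>) oo adj W) = W oo ((rsl l ?Z l' ** \<one>) oo adj W)"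
        by (simp add: sy rsl_def)
      also have "\<dots> = (\<one> ** adj (right_ket l)) oo ((leg12 W oo (leg13 ?Z oo leg12 (adj W))) oo (\<one> ** right_ket l'))"
        by (simp add: rsl_leg13[symmetric] leg12_id_right_ket r12[THEN compose_reassoc])
      finally have "lsl p (W oo ((lsl p' y q' ** \<one>) oo adj W)) q
          = adj (right_ket l) oo (lsl p (leg12 W oo (leg13 ?Z oo leg12 (adj W))) q oo right_ket l')"
        by (simp only: lsl_id_tensor bop_adj bop_right_ket)
      also have "\<dots> = lsl p (lsl p' (leg12 W oo leg13 y) q') q"
        unfolding cond by (simp add: sy[symmetric] lsl_lsl_legs)
      finally show "lsl p (W oo ((lsl p' y q' ** \<one>) oo adj W)) q = lsl p (lsl p' (leg12 W oo leg13 y) q') q" .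
    qed simp_all
    then have "lsl p' (leg23 W oo (leg12 y oo leg23 (adj W))) q' = lsl p' (leg12 W oo leg13 y) q'" for p' q'
      by (simp add: lsl_leg23_compose lsl_legs)
    then have E: "leg23 W oo (leg12 y oo leg23 (adj W)) = leg12 W oo leg13 y" by (intro lsl_eqI) simp_all
    define v where "v = adj W oo y"
    have vb [simp]: "v \<in> bop" and Wv: "y = W oo v" by (simp_all add: v_def unitaryD(7)[OF uW(1)])
    have "leg23 W oo (leg12 W oo (leg12 v oo leg23 (adj W))) = leg12 W oo (leg13 W oo leg13 v)"
      using E unfolding Wv by (simp add: leg_compose(1)[symmetric] leg_compose(2)[symmetric])
    moreover have "leg23 W oo (leg12 W oo S) = leg12 W oo (leg13 W oo (leg23 W oo S))" for S :: "('c, 'c, 'c) htensor3 -> ('c, 'c, 'c) htensor3"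
      using mW(1) unfolding multiplicative_def by (simp flip: blinfun_compose_assoc)
    ultimately have "leg13 (adj W) oo (leg12 (adj W) oo (leg12 W oo (leg13 W oo (leg23 W oo (leg12 v oo leg23 (adj W)))))) oo leg23 W
        = leg13 (adj W) oo (leg12 (adj W) oo (leg12 W oo (leg13 W oo leg13 v))) oo leg23 W" by (simp only:)
    then have "leg23 W oo leg12 v = leg13 v oo leg23 W"
      by (simp add: leg_compose2(1)[of "adj W" W] leg_compose2(2)[of "adj W" W] leg_compose(3) unitaryD(2)[OF uW(1)])
    then have "lsl x (leg23 W oo leg12 v) z = lsl x (leg13 v oo leg23 W) z" by (simp only:)
    \<comment> \<open>Slicing the first leg gives the form of \<open>intertwiner_scalar\<close> with
      equal operators on both sides.\<close>
    then have "W oo (lsl x v z ** \<one>) = (\<one> ** lsl x v z) oo W"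
      by (simp add: lsl_leg23_compose lsl_legs)
    from intertwiner_scalar[OF _ _ this] obtain k where k: "lsl x v z = k *c \<one>" by auto
    have vX: "v = (\<one> ** adj (right_ket l)) oo (X oo (\<one> ** right_ket l'))"
      by (simp add: v_def y_def X_def r12[THEN compose_reassoc])
    have "adj (right_ket l) oo (lsl x X z oo right_ket l') = k *c \<one>"
      unfolding k[symmetric] vX by (rule lsl_id_tensor[symmetric]) simp_all
    then have "y \<bullet> (adj (right_ket l) oo (lsl x X z oo right_ket l')) u = k * (y \<bullet> u)" for y u
      by (simp add: scaleC_blinfun_apply)
    then show ?thesis by (intro exI[of _ k] allI) (simp add: cinner_adj_right cinner_lsl)
  qed
  have "\<exists>V. V \<in> unitary_multipliers (D >< A) \<and> X = leg13 V"
  proof (cases "\<exists>e::'c. e \<noteq> 0")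
    case True
    then obtain e0 :: 'c where e0: "e0 \<noteq> 0" by blast
    \<comment> \<open>A unit vector for the middle leg; as X is trivial there, the choice does not
      affect V.\<close>
    define e where "e = sgn e0"
    have e: "e \<bullet> e = 1" using e0 by (simp add: cinner_self e_def norm_sgn)
    define V where "V = (\<one> ** adj (left_ket e)) oo (X oo (\<one> ** left_ket e))"
    note [simp] = unitaryD(1)[OF uX]
    have Vb [simp]: "V \<in> bop" by (simp add: V_def)
    have cV: "(x \<otimes> l) \<bullet> V (z \<otimes> l') = (x \<otimes> (e \<otimes> l)) \<bullet> X (z \<otimes> (e \<otimes> l'))" for x z l l'
      using cinner_adj_right[of "\<one> ** left_ket e" "x \<otimes> l" "X (z \<otimes> (e \<otimes> l'))"] by (simp add: V_def)
    have XV: "X = leg13 V"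
    proof (rule op_eqI3)
      fix x y l z u l'
      obtain k where "\<And>y u. (x \<otimes> (y \<otimes> l)) \<bullet> X (z \<otimes> (u \<otimes> l')) = k * (y \<bullet> u)" using scalar by blast
      then show "(x \<otimes> (y \<otimes> l)) \<bullet> X (z \<otimes> (u \<otimes> l')) = (x \<otimes> (y \<otimes> l)) \<bullet> leg13 V (z \<otimes> (u \<otimes> l'))"
        by (simp add: cinner_legs cV e)
    qed simp_all
    have "(leg13 (adj V oo V) :: ('c, 'c, 'a) htensor3 -> _) = leg13 \<one>"
      "(leg13 (V oo adj V) :: ('c, 'c, 'a) htensor3 -> _) = leg13 \<one>"
      using unitaryD(2,3)[OF uX] by (simp_all add: XV leg_compose(2)[symmetric])
    from this[THEN leg13_inject[rotated 2]] have uV: "unitary V" by (simp add: unitary_def)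
    \<comment> \<open>\<open>leg13 V\<close> is a product of two multipliers of the threefold tensor
      product; contracting its middle leg exhibits V as a multiplier.\<close>
    have "leg12 (adj W) \<in> multipliers (D >< (C >< A))"
      by (intro leg12_multiplier cs staralgD(6)[OF staralg_multipliers[OF cstar_staralg[OF cDC]]] reduced_bicharacter_multiplier W)
    then have "leg13 V \<in> multipliers (D >< (C >< A))"
      unfolding XV[symmetric] X_def by (rule staralgD(5)[OF staralg_multipliers[OF cstar_staralg[OF cDCA]] _ sl(1)])
    then have "V \<in> multipliers (D >< A)" by (rule leg13_multiplier_slice[OF cs(2,1,3) Vb])
    then show ?thesis using uV XV by (auto simp: unitary_multipliers_def)
  next
    case False
    then have "X = leg13 \<one>" by (intro trivial_htensor) (simp_all add: unitaryD(1)[OF uX])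
    then show ?thesis
      by (intro exI[of _ \<one>]) (simp add: unitary_multipliers_def cstar_self_multipliers(2) unitary_def)
  qed
  then obtain V where V: "V \<in> unitary_multipliers (D >< A)" "X = leg13 V" by blast
  have "Y = leg12 W oo leg13 V"
    unfolding V(2)[symmetric] by (simp add: X_def leg_compose2(1)[of W "adj W"] unitaryD(3)[OF uW(1)])
  then show ?thesis using V(1) unfolding Y_def by blast
qed

lemma bichar_unique:
  assumes V: "V \<in> unitary_multipliers (D >< A)" "U \<in> unitary_multipliers (D >< A)"
    and eq: "(leg12 W oo leg13 V :: ('c, 'c, 'a) htensor3 -> _) = leg12 W oo leg13 U"
  shows "V = U"
proof -
  have "leg12 (adj W) oo (leg12 W oo leg13 V) = leg12 (adj W) oo (leg12 W oo leg13 U)" by (simp only: eq)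
  then have "(leg13 V :: ('c, 'c, 'a) htensor3 -> _) = leg13 U" by (simp add: leg_compose2(1)[of "adj W" W] unitaryD(2)[OF uW(1)])
  from leg13_inject[OF unitary_multipliersD(2)[OF V(1)] unitary_multipliersD(2)[OF V(2)] this] show ?thesis .
qed

lemma bichar_of_hom_eqI:
  assumes "V \<in> unitary_multipliers (D >< A)" "id_tensor D C (C >< A) \<phi> W = leg12 W oo leg13 V"
  shows "bichar_of_hom W C A \<phi> = V"
  unfolding bichar_of_hom_def dual_eq
  by (rule the_equality) (use assms bichar_unique in auto)

end

theorem theorem5p3:
  fixes W\<^sub>C :: "('c::complex_hilbert, 'c) htensor \<Rightarrow>\<^sub>L ('c, 'c) htensor"
    and W\<^sub>A :: "('a::complex_hilbert, 'a) htensor \<Rightarrow>\<^sub>L ('a, 'a) htensor"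
    and C :: "('c \<Rightarrow>\<^sub>L 'c) set"
    and \<Delta>\<^sub>C :: "('c \<Rightarrow>\<^sub>L 'c) \<Rightarrow> (('c, 'c) htensor \<Rightarrow>\<^sub>L ('c, 'c) htensor)"
    and A :: "('a \<Rightarrow>\<^sub>L 'a) set"
    and \<Delta>\<^sub>A :: "('a \<Rightarrow>\<^sub>L 'a) \<Rightarrow> (('a, 'a) htensor \<Rightarrow>\<^sub>L ('a, 'a) htensor)"
  assumes "quantum_group W\<^sub>C C \<Delta>\<^sub>C"
    and "quantum_group W\<^sub>A A \<Delta>\<^sub>A"
  shows
    "(\<forall>\<Delta>\<^sub>R. right_qg_hom C \<Delta>\<^sub>C A \<Delta>\<^sub>A \<Delta>\<^sub>R \<longrightarrow>
        (\<exists>!V. V \<in> unitary_multipliers (dual_algebra W\<^sub>C \<otimes>\<^sub>a A) \<and>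
          id_tensor (dual_algebra W\<^sub>C) C (C \<otimes>\<^sub>a A) \<Delta>\<^sub>R W\<^sub>C = leg12 W\<^sub>C o\<^sub>L leg13 V) \<and>
        (\<forall>V. V \<in> unitary_multipliers (dual_algebra W\<^sub>C \<otimes>\<^sub>a A) \<and>
          id_tensor (dual_algebra W\<^sub>C) C (C \<otimes>\<^sub>a A) \<Delta>\<^sub>R W\<^sub>C = leg12 W\<^sub>C o\<^sub>L leg13 V \<longrightarrow>
          bicharacter W\<^sub>C A \<Delta>\<^sub>A V)) \<and>
     (\<forall>V. bicharacter W\<^sub>C A \<Delta>\<^sub>A V \<longrightarrow>
        right_qg_hom C \<Delta>\<^sub>C A \<Delta>\<^sub>A (\<lambda>x\<in>C. V o\<^sub>L (x \<otimes>\<^sub>o id_blinfun) o\<^sub>L adj V)) \<and>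
     (\<forall>\<Delta>\<^sub>R. right_qg_hom C \<Delta>\<^sub>C A \<Delta>\<^sub>A \<Delta>\<^sub>R \<longrightarrow>
        hom_of_bichar C (bichar_of_hom W\<^sub>C C A \<Delta>\<^sub>R) = \<Delta>\<^sub>R) \<and>
     (\<forall>V. bicharacter W\<^sub>C A \<Delta>\<^sub>A V \<longrightarrow>
        bichar_of_hom W\<^sub>C C A (hom_of_bichar C V) = V)"
proof -
  note c = quantum_groupD[OF assms(1)] and a = quantum_groupD[OF assms(2)]
  interpret quantum_group_pair W\<^sub>C W\<^sub>A by unfold_locales (rule c(1), rule a(1))
  have \<Delta>: "\<Delta>\<^sub>C = DC" "\<Delta>\<^sub>A = DA" using c(5) a(5) unfolding DC_def DA_def c(4) a(4) by auto
  have bi: "V \<in> unitary_multipliers (lalg (dualu W\<^sub>C) >< lalg W\<^sub>A) \<and> pent V \<and> pent' V" if "bicharacter W\<^sub>C (lalg W\<^sub>A) DA V" for V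
  proof -
    have "V \<in> unitary_multipliers (lalg (dualu W\<^sub>C) >< lalg W\<^sub>A)" using that by (simp add: bicharacter_def Let_def dual_eq)
    then show ?thesis using bicharacter_iff that by blast
  qed
  show ?thesis
    unfolding \<Delta> c(4) a(4) dual_eq
  proof (intro conjI allI impI)
    fix \<phi> assume hom: "right_qg_hom (lalg W\<^sub>C) DC (lalg W\<^sub>A) DA \<phi>"
    obtain V where V: "V \<in> unitary_multipliers (lalg (dualu W\<^sub>C) >< lalg W\<^sub>A)"
        "id_tensor (lalg (dualu W\<^sub>C)) (lalg W\<^sub>C) (lalg W\<^sub>C >< lalg W\<^sub>A) \<phi> W\<^sub>C = leg12 W\<^sub>C oo leg13 V"
      using ex_bichar[OF hom] by blast
    show "\<exists>!V. V \<in> unitary_multipliers (lalg (dualu W\<^sub>C) >< lalg W\<^sub>A) \<and>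
        id_tensor (lalg (dualu W\<^sub>C)) (lalg W\<^sub>C) (lalg W\<^sub>C >< lalg W\<^sub>A) \<phi> W\<^sub>C = leg12 W\<^sub>C oo leg13 V"
      using V bichar_unique by (intro ex1I[of _ V]) auto
    show "hom_of_bichar (lalg W\<^sub>C) (bichar_of_hom W\<^sub>C (lalg W\<^sub>C) (lalg W\<^sub>A) \<phi>) = \<phi>"
      unfolding bichar_of_hom_eqI[OF V] hom_of_bichar_def by (rule hom_spatial(3)[OF hom V, symmetric])
  next
    fix \<phi> V assume hom: "right_qg_hom (lalg W\<^sub>C) DC (lalg W\<^sub>A) DA \<phi>"
      and "V \<in> unitary_multipliers (lalg (dualu W\<^sub>C) >< lalg W\<^sub>A) \<and>
        id_tensor (lalg (dualu W\<^sub>C)) (lalg W\<^sub>C) (lalg W\<^sub>C >< lalg W\<^sub>A) \<phi> W\<^sub>C = leg12 W\<^sub>C oo leg13 V"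
    then show "bicharacter W\<^sub>C (lalg W\<^sub>A) DA V"
      using bicharacter_iff hom_spatial(1,2)[OF hom] by blast
  next
    fix V assume "bicharacter W\<^sub>C (lalg W\<^sub>A) DA V"
    from bi[OF this] have V: "V \<in> unitary_multipliers (lalg (dualu W\<^sub>C) >< lalg W\<^sub>A)" "pent V" "pent' V" by auto
    show "right_qg_hom (lalg W\<^sub>C) DC (lalg W\<^sub>A) DA (\<lambda>x\<in>lalg W\<^sub>C. V oo (x ** \<one>) oo adj V)"
      by (rule hom_of_pents[OF V])
    show "bichar_of_hom W\<^sub>C (lalg W\<^sub>C) (lalg W\<^sub>A) (hom_of_bichar (lalg W\<^sub>C) V) = V"
      unfolding hom_of_bichar_def by (rule bichar_of_hom_eqI[OF V(1) id_tensor_of_pent[OF V(1,2)]])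
  qed
qed

end
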